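(* Let $(R,\mathfrak m)$ and $(S,\mathfrak n)$ be complete Noetherian regular local rings, each containing a field, and assume that $k:=R/\mathfrak m\cong S/\mathfrak n$. Let $I\subseteq R$ and $J\subseteq S$ be ideals such that $R/I$ and $S/J$ carry $k$-algebra structures for which there is an isomorphism of $k$-algebras $R/I\cong S/J$. Then $\mathrm{rt}_R(I)=\mathrm{rt}_S(J)$.
   Context: Relation type of a standard graded algebra: Let $R$ be a commutative ring and let $A=\bigoplus_{n\ge 0}A_n$ be a standard graded $R$-algebra, i.e. a commutative graded algebra with $A_0=R$ generated as an $R$-algebra by finitely many elements $f_1,\ldots,f_m$ of degree $1$. Let $\varphi: R[T_1,\ldots,T_m]\to A$ be the graded surjection $T_i\mapsto f_i$, with kernel $\mathcal Q=\bigoplus_{\ell\ge1}\mathcal Q_\ell$, and let $\mathcal Q\langle \ell\rangle$ be the ideal generated by the elements of $\mathcal Q$ of degree at most $\ell$. The relation type $\mathrm{rt}_R(A)$ is the least integer $\ell\ge 1$ with $\mathcal Q\langle\ell\rangle=\mathcal Q$; it does not depend on the chosen generators. Relation type of an ideal: for an ideal $I$ of a Noetherian ring $R$, $\mathrm{rt}_R(I):=\mathrm{rt}_R(\mathcal R_R(I))$, where $\mathcal R_R(I)=\bigoplus_{n\ge0}I^nt^n=R[It]\subseteq R[t]$ is the Rees algebra of $I$. *)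

theory Defs
  imports "HOL-Library.Extended_Nat" "HOL-Algebra.Algebra"
begin

section \<open>Complete regular local rings\<close>

text \<open>Powers \<open>I\<^sup>n\<close> are taken in the multiplicative monoid of all ideals, so that \<open>I\<^sup>0\<close> is the
  whole ring.\<close>

definition ideal_power :: "('a, 'm) ring_scheme \<Rightarrow> 'a set \<Rightarrow> nat \<Rightarrow> 'a set"
  where "ideal_power R I n = I [^]\<^bsub>ideals_set R\<^esub> n"

definition krull_dim :: "('a, 'm) ring_scheme \<Rightarrow> enat"
  where "krull_dim R =
    Sup {enat n | n. \<exists>P. (\<forall>i\<le>n. primeideal (P i) R) \<and> (\<forall>i<n. P i \<subset> P (Suc i))}"

locale local_ring = cring R + maximalideal \<mm> R for \<mm> and R (structure) +
  assumes maximal_unique: "maximalideal M R \<Longrightarrow> M = \<mm>"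

locale noetherian_local_ring = local_ring \<mm> R + noetherian_ring R for \<mm> and R (structure)

locale regular_local_ring = noetherian_local_ring +
  assumes regular: "\<exists>A \<subseteq> carrier R. finite A \<and> \<mm> = Idl A \<and> enat (card A) = krull_dim R"

text \<open>The two axioms are injectivity and surjectivity of the canonical map from \<open>R\<close> to the inverse
  limit of the rings \<open>R/\<mm>\<^sup>n\<close>, compatible families being represented by representatives
  \<open>x n\<close> of their components.\<close>

locale complete_regular_local_ring = regular_local_ring +
  assumes separated: "(\<Inter>n. ideal_power R \<mm> n) = {\<zero>}"
    and complete: "\<lbrakk> \<And>n. x n \<in> carrier R; \<And>n. x (Suc n) \<ominus> x n \<in> ideal_power R \<mm> n \<rbrakk>
      \<Longrightarrow> \<exists>y \<in> carrier R. \<forall>n. y \<ominus> x n \<in> ideal_power R \<mm> n"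


section \<open>Algebra structures on a ring\<close>

definition with_smult :: "('b, 'm) ring_scheme \<Rightarrow> ('c \<Rightarrow> 'b \<Rightarrow> 'b) \<Rightarrow> ('c, 'b) module"
  where "with_smult A s = \<lparr> carrier = carrier A, monoid.mult = monoid.mult A, one = one A,
    ring.zero = ring.zero A, add = add A, smult = s \<rparr>"

definition algebra_iso ::
  "('c, 'n) ring_scheme \<Rightarrow> ('c, 'a, 'p) module_scheme \<Rightarrow> ('c, 'b, 'q) module_scheme \<Rightarrow> ('a \<Rightarrow> 'b) set"
  where "algebra_iso K A B = {h \<in> ring_iso A B.
    \<forall>c \<in> carrier K. \<forall>x \<in> carrier A. h (c \<odot>\<^bsub>A\<^esub> x) = c \<odot>\<^bsub>B\<^esub> h x}"


section \<open>Polynomial rings in finitely many variables\<close>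

text \<open>The ring \<open>R[T\<^sub>0, \<dots>, T\<^sub>m\<^sub>-\<^sub>1]\<close>, on the library's carrier: a monomial is the multiset of its
  variables, and a polynomial is the function giving its coefficients. The library provides
  no product of two such polynomials, hence the convolution.\<close>

definition mpoly_ring :: "('a, 'm) ring_scheme \<Rightarrow> nat \<Rightarrow> (nat multiset \<Rightarrow> 'a) ring"
  where "mpoly_ring R m = \<lparr>
    carrier = ring.indexed_pset R {..<m} (carrier R),
    monoid.mult = (\<lambda>P Q M. \<Oplus>\<^bsub>R\<^esub>N \<in> {N. N \<subseteq># M}. P N \<otimes>\<^bsub>R\<^esub> Q (M - N)),
    one = ring.indexed_const R \<one>\<^bsub>R\<^esub>,
    ring.zero = ring.indexed_const R \<zero>\<^bsub>R\<^esub>,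
    add = ring.indexed_padd R \<rparr>"

definition mpoly_eval ::
  "('a, 'm) ring_scheme \<Rightarrow> ('a, 'b, 'n) module_scheme \<Rightarrow> nat \<Rightarrow> (nat \<Rightarrow> 'b) \<Rightarrow> (nat multiset \<Rightarrow> 'a) \<Rightarrow> 'b"
  where "mpoly_eval R A m f P =
    (\<Oplus>\<^bsub>A\<^esub>M \<in> {M. P M \<noteq> \<zero>\<^bsub>R\<^esub>}. P M \<odot>\<^bsub>A\<^esub> (\<Otimes>\<^bsub>A\<^esub>i \<in> {..<m}. f i [^]\<^bsub>A\<^esub> count M i))"


section \<open>The relation type\<close>

text \<open>Below, \<open>G n\<close> stands for the homogeneous component of degree \<open>n\<close> of the \<open>R\<close>-algebra \<open>A\<close>.\<close>

definition standard_generators ::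
  "('a, 'm) ring_scheme \<Rightarrow> ('a, 'b, 'n) module_scheme \<Rightarrow> (nat \<Rightarrow> 'b set) \<Rightarrow> nat \<Rightarrow> (nat \<Rightarrow> 'b) \<Rightarrow> bool"
  where "standard_generators R A G m f \<longleftrightarrow> f ` {..<m} \<subseteq> G 1 \<and>
    generate_ring A ((\<lambda>a. a \<odot>\<^bsub>A\<^esub> \<one>\<^bsub>A\<^esub>) ` carrier R \<union> f ` {..<m}) = carrier A"

definition relations ::
  "('a, 'm) ring_scheme \<Rightarrow> ('a, 'b, 'n) module_scheme \<Rightarrow> nat \<Rightarrow> (nat \<Rightarrow> 'b) \<Rightarrow> (nat multiset \<Rightarrow> 'a) set"
  where "relations R A m f = {P \<in> carrier (mpoly_ring R m). mpoly_eval R A m f P = \<zero>\<^bsub>A\<^esub>}"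

definition relations_upto ::
  "('a, 'm) ring_scheme \<Rightarrow> ('a, 'b, 'n) module_scheme \<Rightarrow> nat \<Rightarrow> (nat \<Rightarrow> 'b) \<Rightarrow> nat
    \<Rightarrow> (nat multiset \<Rightarrow> 'a) set"
  where "relations_upto R A m f l = genideal (mpoly_ring R m)
    {P \<in> relations R A m f. \<forall>M. P M \<noteq> \<zero>\<^bsub>R\<^esub> \<longrightarrow> size M \<le> l}"

definition relation_type_wrt ::
  "('a, 'm) ring_scheme \<Rightarrow> ('a, 'b, 'n) module_scheme \<Rightarrow> nat \<Rightarrow> (nat \<Rightarrow> 'b) \<Rightarrow> nat"
  where "relation_type_wrt R A m f =
    (LEAST l. 1 \<le> l \<and> relations_upto R A m f l = relations R A m f)"

text \<open>The description is proper because the value is the same for all systems of generators; it is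
  meaningful only if \<open>A\<close> is a standard graded algebra and the kernel of the presentation is
  generated in bounded degree (automatic over a Noetherian ring).\<close>

definition relation_type ::
  "('a, 'm) ring_scheme \<Rightarrow> ('a, 'b, 'n) module_scheme \<Rightarrow> (nat \<Rightarrow> 'b set) \<Rightarrow> nat"
  where "relation_type R A G =
    (THE r. \<exists>m f. standard_generators R A G m f \<and> r = relation_type_wrt R A m f)"

definition rees_algebra :: "('a, 'm) ring_scheme \<Rightarrow> 'a set \<Rightarrow> ('a, nat \<Rightarrow> 'a) up_ring"
  where "rees_algebra R I = (UP R) \<lparr> carrier :=
    {p \<in> carrier (UP R). \<forall>n. coeff (UP R) p n \<in> ideal_power R I n} \<rparr>"

definition rees_component :: "('a, 'm) ring_scheme \<Rightarrow> 'a set \<Rightarrow> nat \<Rightarrow> (nat \<Rightarrow> 'a) set"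
  where "rees_component R I n = (\<lambda>a. monom (UP R) a n) ` ideal_power R I n"

definition ideal_relation_type :: "('a, 'm) ring_scheme \<Rightarrow> 'a set \<Rightarrow> nat"
  where "ideal_relation_type R I = relation_type R (rees_algebra R I) (rees_component R I)"

end

theory Submission
  imports Defs "HOL-Library.Multiset_Order"
begin

text \<open>The relation type of an ideal \<open>I\<close> is determined by the ring \<open>R/I\<close> as soon as \<open>R\<close> is a
  complete regular local ring containing a field. Such a ring is a power series ring over a field,
  and two presentations of one ring as a quotient of power series rings are related by adding
  variables and passing to retracts; neither operation raises the relation type. The two rings
  play symmetric roles, so one inequality is enough.

  Let \<open>C\<close> be a commutative ring, \<open>\<phi> : R \<rightarrow> C\<close> a homomorphism and \<open>\<kappa> : I \<rightarrow> C\<close> a \<open>\<phi>\<close>-linear map. The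
  only candidate for an extension of \<open>\<kappa>\<close> to the component of degree \<open>n\<close> of the Rees algebra sends
  \<open>r a\<^sub>1\<cdots>a\<^sub>n\<close> to \<open>\<phi> r \<kappa> a\<^sub>1\<cdots>\<kappa> a\<^sub>n\<close>, and the question is whether this is single-valued. The
  relation type of \<open>I\<close> is at most \<open>l\<close> if and only if single-valuedness in degrees up to \<open>l\<close>
  implies single-valuedness in every degree, for all \<open>C\<close>, \<open>\<phi>\<close>, \<open>\<kappa>\<close>. This is the predicate
  \<open>type_le\<close>; the equivalence is \<open>relation_type_wrt_cond\<close>, and it shows at once that the choice of
  generators does not matter. In this form it is easy to see that the bound passes to retracts
  (\<open>type_le_retract\<close>) and from \<open>(R, I)\<close> to \<open>(R\<lbrakk>Z\<rbrakk>, (I, Z))\<close>: the only new relations are \<open>Z a = a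
  Z\<close>, and \<open>\<kappa>\<close> respects them because it is linear (\<open>type_le_extend\<close>, \<open>type_le_ps_vars\<close>).

  Let \<open>B\<close> be the common quotient of \<open>R\<close> and \<open>S\<close>, with surjections \<open>p : R \<rightarrow> B\<close> and \<open>q : S \<rightarrow> B\<close>. Let
  \<open>y\<^sub>1,\<dots>,y\<^sub>e\<close> be a regular system of parameters of \<open>S\<close>. Coefficient fields of \<open>R\<close> and \<open>S\<close> can be
  chosen so that they agree in \<open>B\<close>. A homomorphism \<open>\<alpha> : R \<rightarrow> S\<close> with \<open>q \<alpha> = p\<close> is found by lifting
  the images of the parameters of \<open>R\<close>, and elements \<open>b\<^sub>j\<close> of \<open>R\<close> with \<open>p b\<^sub>j = q y\<^sub>j\<close> exist
  because \<open>p\<close> is surjective. Let \<open>V = R\<lbrakk>Y\<^sub>1,\<dots>,Y\<^sub>e\<rbrakk>\<close>, let \<open>\<sigma> : S \<rightarrow> V\<close> send \<open>y\<^sub>j\<close> to \<open>Y\<^sub>j + b\<^sub>j\<close>,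
  and let \<open>\<tau> : V \<rightarrow> S\<close> extend \<open>\<alpha>\<close> and send \<open>Y\<^sub>j\<close> to \<open>y\<^sub>j - \<alpha> b\<^sub>j\<close>. Then \<open>\<tau> \<sigma>\<close> fixes the coefficient
  field and the \<open>y\<^sub>j\<close>, so it is the identity, while \<open>\<sigma>\<close> and \<open>\<tau>\<close> are compatible with the maps of
  \<open>S\<close> and \<open>V\<close> to \<open>B\<close>. Hence \<open>J\<close> is a retract of the ideal of series with constant term in \<open>I\<close>, and
  the relation type of \<open>J\<close> is at most that of \<open>I\<close> (\<open>relation_bound_transfer\<close>).

  Homomorphisms out of a complete regular local ring are prescribed freely on a coefficient field
  and on regular parameters (\<open>regular_hom_exists\<close>). This needs that regular parameters satisfy no
  form with a unit coefficient modulo the next power of the maximal ideal (\<open>regular_independent\<close>).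
  The proof compares two growth rates: a chain of primes of length \<open>d\<close> provides, by the Artin-Rees
  lemma, \<open>t\<^sup>d\<close> elements that are independent over the coefficient field modulo a power of exponent
  linear in \<open>t\<close>, whereas a nontrivial form would allow all residues to be generated by a number of
  monomials of order \<open>t\<^sup>d\<^sup>-\<^sup>1\<close>. Coefficient fields come from lifting homomorphisms of a field
  along the quotients \<open>R/J\<^sup>n\<^sup>+\<^sup>1 \<rightarrow> R/J\<^sup>n\<close> (\<open>field_lift\<close>, \<open>field_lift_complete\<close>). Identities
  between the maps are checked modulo all powers of the maximal ideal, which suffices by Krull's
  intersection theorem (\<open>ideal_closed\<close>).\<close>

section \<open>Polynomials and power series in several variables\<close>

text \<open>All coefficient functions in the variables indexed by \<open>nat\<close>. A monomial has only finitely
  many submultisets, so the convolution is defined without a finiteness condition; polynomial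
  rings and power series rings in finitely many variables are subrings.\<close>

definition power_series_ring :: "('a, 'm) ring_scheme \<Rightarrow> (nat multiset \<Rightarrow> 'a) ring"
  where "power_series_ring R = \<lparr>
    carrier = {P. \<forall>M. P M \<in> carrier R},
    monoid.mult = (\<lambda>P Q M. \<Oplus>\<^bsub>R\<^esub>N \<in> {N. N \<subseteq># M}. P N \<otimes>\<^bsub>R\<^esub> Q (M - N)),
    one = ring.indexed_const R \<one>\<^bsub>R\<^esub>,
    ring.zero = ring.indexed_const R \<zero>\<^bsub>R\<^esub>,
    add = ring.indexed_padd R \<rparr>"

lemma mpoly_ring_eq:
  "mpoly_ring R m = (power_series_ring R)\<lparr>carrier := ring.indexed_pset R {..<m} (carrier R)\<rparr>"
  by (simp add: mpoly_ring_def power_series_ring_def)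

lemma finite_submultisets: "finite {N. N \<subseteq># (M :: 'x multiset)}"
proof (induction M)
  case (add x M)
  have "{N. N \<subseteq># add_mset x M} \<subseteq> {N. N \<subseteq># M} \<union> add_mset x ` {N. N \<subseteq># M}"
  proof
    fix N assume "N \<in> {N. N \<subseteq># add_mset x M}"
    then have N: "N \<subseteq># add_mset x M" by simp
    show "N \<in> {N. N \<subseteq># M} \<union> add_mset x ` {N. N \<subseteq># M}"
    proof (cases "x \<in># N")
      case True
      then obtain N' where "N = add_mset x N'" by (metis insert_DiffM)
      then show ?thesis using N by auto
    next
      case False
      then have "N \<subseteq># M" using N
        by (metis diff_single_trivial diff_union_single_conv add_mset_remove_trivial subset_eq_diff_conv union_single_eq_member add_mset_add_single mset_subset_eq_add_mset_cancel)
      then show ?thesis by simp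
    qed
  qed
  then show ?case using add finite_subset by blast
qed simp

lemma (in abelian_monoid) finsum_Sigma:
  assumes "finite A" "\<And>a. a \<in> A \<Longrightarrow> finite (B a)"
    "\<And>a b. a \<in> A \<Longrightarrow> b \<in> B a \<Longrightarrow> f a b \<in> carrier G"
  shows "(\<Oplus>a\<in>A. \<Oplus>b\<in>B a. f a b) = (\<Oplus>p\<in>Sigma A B. f (fst p) (snd p))"
proof -
  have 1: "(\<Oplus>p\<in>Sigma A B. f (fst p) (snd p)) = (\<Oplus>p\<in>(\<Union>a\<in>A. Pair a ` B a). f (fst p) (snd p))"
    by (rule arg_cong[where f="finsum G (\<lambda>p. f (fst p) (snd p))"]) auto
  also have "\<dots> = (\<Oplus>a\<in>A. \<Oplus>p\<in>Pair a ` B a. f (fst p) (snd p))"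
    using assms by (intro add.finprod_UN_disjoint) (auto simp: disjnt_def pairwise_def)
  also have "\<dots> = (\<Oplus>a\<in>A. \<Oplus>b\<in>B a. f a b)"
  proof (rule finsum_cong')
    fix a assume a: "a \<in> A"
    have "(\<Oplus>p\<in>Pair a ` B a. f (fst p) (snd p)) = (\<Oplus>b\<in>B a. f (fst (Pair a b)) (snd (Pair a b)))"
      using a assms by (intro finsum_reindex) (auto simp: inj_on_def)
    then show "(\<Oplus>p\<in>Pair a ` B a. f (fst p) (snd p)) = (\<Oplus>b\<in>B a. f a b)" by simp
  qed (use assms in \<open>auto intro!: finsum_closed\<close>)
  finally show ?thesis by simp
qed

context cring
begin

lemma ps_simps [simp]:
  "carrier (power_series_ring R) = {P. \<forall>M. P M \<in> carrier R}"
  "P \<oplus>\<^bsub>power_series_ring R\<^esub> Q = (\<lambda>M. P M \<oplus> Q M)"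
  "\<zero>\<^bsub>power_series_ring R\<^esub> = (\<lambda>M. \<zero>)"
  "\<one>\<^bsub>power_series_ring R\<^esub> = (\<lambda>M. if M = {#} then \<one> else \<zero>)"
  by (auto simp: power_series_ring_def indexed_padd_def indexed_const_def)

lemma ps_mult:
  "(P \<otimes>\<^bsub>power_series_ring R\<^esub> Q) M = (\<Oplus>N \<in> {N. N \<subseteq># M}. P N \<otimes> Q (M - N))"
  by (simp add: power_series_ring_def)

lemma ps_mult_closed:
  assumes "P \<in> carrier (power_series_ring R)" "Q \<in> carrier (power_series_ring R)"
  shows "P \<otimes>\<^bsub>power_series_ring R\<^esub> Q \<in> carrier (power_series_ring R)"
  using assms by (auto simp: ps_mult intro!: finsum_closed)

text \<open>Both sides sum over the decompositions of \<open>M\<close> into three parts; they differ only in which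
  two of the parts are grouped together.\<close>

lemma ps_mult_assoc:
  assumes P: "\<And>M. P M \<in> carrier R" and Q: "\<And>M. Q M \<in> carrier R" and T: "\<And>M. T M \<in> carrier R"
  shows "(\<Oplus>N \<in> {N. N \<subseteq># M}. (\<Oplus>L \<in> {L. L \<subseteq># N}. P L \<otimes> Q (N - L)) \<otimes> T (M - N))
    = (\<Oplus>L \<in> {L. L \<subseteq># M}. P L \<otimes> (\<Oplus>K \<in> {K. K \<subseteq># M - L}. Q K \<otimes> T (M - L - K)))"
proof -
  let ?A = "Sigma {N. N \<subseteq># M} (\<lambda>N. {L. L \<subseteq># N})"
  let ?B = "Sigma {L. L \<subseteq># M} (\<lambda>L. {K. K \<subseteq># M - L})"
  let ?g = "\<lambda>p. (fst p + snd p, fst p)"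
  note fin = finite_submultisets
  have "(\<Oplus>N \<in> {N. N \<subseteq># M}. (\<Oplus>L \<in> {L. L \<subseteq># N}. P L \<otimes> Q (N - L)) \<otimes> T (M - N))
      = (\<Oplus>N \<in> {N. N \<subseteq># M}. (\<Oplus>L \<in> {L. L \<subseteq># N}. P L \<otimes> Q (N - L) \<otimes> T (M - N)))"
    using assms by (intro finsum_cong' finsum_ldistr fin) (auto intro!: finsum_closed)
  also have "\<dots> = (\<Oplus>p\<in>?A. P (snd p) \<otimes> Q (fst p - snd p) \<otimes> T (M - fst p))"
    using assms by (intro finsum_Sigma fin) auto
  also have "?A = ?g ` ?B"
  proof
    show "?A \<subseteq> ?g ` ?B"
    proof
      fix p assume p: "p \<in> ?A"
      then have "snd p \<subseteq># fst p" "fst p \<subseteq># M" by auto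
      then have "p = ?g (snd p, fst p - snd p)" "(snd p, fst p - snd p) \<in> ?B"
        by (auto simp: prod_eq_iff) (metis subset_mset.diff_add_assoc2 subset_mset.le_diff_conv2 subset_mset.add_diff_inverse subset_mset.order_trans mset_subset_eq_mono_add_right_cancel subset_mset.diff_add)
      then show "p \<in> ?g ` ?B" by blast
    qed
    show "?g ` ?B \<subseteq> ?A"
      by (auto simp: subset_mset.le_diff_conv2 add.commute)
  qed
  also have "(\<Oplus>p\<in>?g ` ?B. P (snd p) \<otimes> Q (fst p - snd p) \<otimes> T (M - fst p))
      = (\<Oplus>p\<in>?B. P (snd (?g p)) \<otimes> Q (fst (?g p) - snd (?g p)) \<otimes> T (M - fst (?g p)))"
    using assms by (intro finsum_reindex) (auto simp: inj_on_def)
  also have "\<dots> = (\<Oplus>p\<in>?B. P (fst p) \<otimes> (Q (snd p) \<otimes> T (M - fst p - snd p)))"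
    using assms by (intro finsum_cong') (auto simp: m_assoc)
  also have "\<dots> = (\<Oplus>L \<in> {L. L \<subseteq># M}. (\<Oplus>K \<in> {K. K \<subseteq># M - L}. P L \<otimes> (Q K \<otimes> T (M - L - K))))"
    using assms by (intro finsum_Sigma[symmetric] fin) auto
  also have "\<dots> = (\<Oplus>L \<in> {L. L \<subseteq># M}. P L \<otimes> (\<Oplus>K \<in> {K. K \<subseteq># M - L}. Q K \<otimes> T (M - L - K)))"
    using assms by (intro finsum_cong' finsum_rdistr[symmetric] fin) (auto intro!: finsum_closed)
  finally show ?thesis .
qed

lemma ps_mult_comm:
  assumes P: "\<And>M. P M \<in> carrier R" and Q: "\<And>M. Q M \<in> carrier R"
  shows "(\<Oplus>N \<in> {N. N \<subseteq># M}. P N \<otimes> Q (M - N)) = (\<Oplus>N \<in> {N. N \<subseteq># M}. Q N \<otimes> P (M - N))"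
proof -
  let ?A = "{N. N \<subseteq># M}"
  have im: "(\<lambda>N. M - N) ` ?A = ?A"
  proof
    show "?A \<subseteq> (\<lambda>N. M - N) ` ?A"
    proof
      fix N assume "N \<in> ?A"
      then have "N = M - (M - N)" "M - N \<in> ?A"
        by (auto simp: subset_mset.diff_diff_right)
      then show "N \<in> (\<lambda>N. M - N) ` ?A" by blast
    qed
  qed auto
  have inj: "inj_on (\<lambda>N. M - N) ?A"
    by (auto simp: inj_on_def) (metis subset_mset.diff_add_assoc subset_mset.add_diff_inverse add_left_imp_eq add_right_imp_eq subset_mset.diff_add)
  have "(\<Oplus>N \<in> ?A. P N \<otimes> Q (M - N)) = (\<Oplus>N \<in> (\<lambda>N. M - N) ` ?A. P N \<otimes> Q (M - N))" by (simp add: im)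
  also have "\<dots> = (\<Oplus>N \<in> ?A. P (M - N) \<otimes> Q (M - (M - N)))"
    using assms inj by (intro finsum_reindex) auto
  also have "\<dots> = (\<Oplus>N \<in> ?A. Q N \<otimes> P (M - N))"
    using assms by (intro finsum_cong') (auto simp: m_comm subset_mset.diff_diff_right)
  finally show ?thesis .
qed

lemma ps_mult_const:
  assumes P: "\<And>M. P M \<in> carrier R" and k: "k \<in> carrier R"
  shows "(\<Oplus>N \<in> {N. N \<subseteq># M}. indexed_const k N \<otimes> P (M - N)) = k \<otimes> P M"
proof -
  have "(\<Oplus>N \<in> {N. N \<subseteq># M}. indexed_const k N \<otimes> P (M - N))
     = (\<Oplus>N \<in> {N. N \<subseteq># M}. if {#} = N then k \<otimes> P (M - N) else \<zero>)"
    using assms by (intro finsum_cong') (auto simp: indexed_const_def)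
  also have "\<dots> = k \<otimes> P M"
    using assms finite_submultisets by (subst add.finprod_singleton) auto
  finally show ?thesis .
qed

lemma power_series_cring: "cring (power_series_ring R)"
proof (rule cringI)
  show "abelian_group (power_series_ring R)"
  proof (rule abelian_groupI)
    fix P assume "P \<in> carrier (power_series_ring R)"
    then have "(\<lambda>M. \<ominus> P M) \<in> carrier (power_series_ring R)"
      "(\<lambda>M. \<ominus> P M) \<oplus>\<^bsub>power_series_ring R\<^esub> P = \<zero>\<^bsub>power_series_ring R\<^esub>"
      by (auto simp: l_neg)
    then show "\<exists>Q\<in>carrier (power_series_ring R). Q \<oplus>\<^bsub>power_series_ring R\<^esub> P = \<zero>\<^bsub>power_series_ring R\<^esub>"
      by blast
  qed (auto simp: a_ac)
  show "comm_monoid (power_series_ring R)"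
  proof (rule comm_monoidI)
    fix P Q T assume PQT: "P \<in> carrier (power_series_ring R)" "Q \<in> carrier (power_series_ring R)"
      "T \<in> carrier (power_series_ring R)"
    show "P \<otimes>\<^bsub>power_series_ring R\<^esub> Q \<otimes>\<^bsub>power_series_ring R\<^esub> T =
      P \<otimes>\<^bsub>power_series_ring R\<^esub> (Q \<otimes>\<^bsub>power_series_ring R\<^esub> T)"
      using PQT ps_mult_assoc[of P Q T] by (auto simp: ps_mult)
  next
    fix P Q assume PQ: "P \<in> carrier (power_series_ring R)" "Q \<in> carrier (power_series_ring R)"
    show "P \<otimes>\<^bsub>power_series_ring R\<^esub> Q = Q \<otimes>\<^bsub>power_series_ring R\<^esub> P"
      using PQ ps_mult_comm[of P Q] by (auto simp: ps_mult)
  next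
    fix P assume P: "P \<in> carrier (power_series_ring R)"
    show "\<one>\<^bsub>power_series_ring R\<^esub> \<otimes>\<^bsub>power_series_ring R\<^esub> P = P"
      using P ps_mult_const[of P \<one>] by (auto simp: ps_mult indexed_const_def fun_eq_iff)
  qed (rule ps_mult_closed, auto)
next
  fix P Q T assume PQT: "P \<in> carrier (power_series_ring R)" "Q \<in> carrier (power_series_ring R)"
    "T \<in> carrier (power_series_ring R)"
  show "(P \<oplus>\<^bsub>power_series_ring R\<^esub> Q) \<otimes>\<^bsub>power_series_ring R\<^esub> T =
    P \<otimes>\<^bsub>power_series_ring R\<^esub> T \<oplus>\<^bsub>power_series_ring R\<^esub> Q \<otimes>\<^bsub>power_series_ring R\<^esub> T"
    using PQT by (auto simp: ps_mult l_distr fun_eq_iff intro!: finsum_addf[symmetric] trans[OF finsum_cong'[OF refl] finsum_addf])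
qed

lemma ps_mult_var:
  assumes P: "\<And>M. P M \<in> carrier R"
  shows "P \<otimes>\<^bsub>power_series_ring R\<^esub> indexed_var i = indexed_pmult P i"
proof
  fix M
  have "(\<Oplus>N \<in> {N. N \<subseteq># M}. indexed_var i N \<otimes> P (M - N))
     = (\<Oplus>N \<in> {N. N \<subseteq># M}. if {#i#} = N then P (M - N) else \<zero>)"
    using assms by (intro finsum_cong') (auto simp: indexed_var_def indexed_const_def indexed_pmult_def
      dest!: multi_member_split)
  also have "\<dots> = indexed_pmult P i M"
  proof (cases "i \<in># M")
    case True
    then show ?thesis using assms finite_submultisets
      by (subst add.finprod_singleton) (auto simp: indexed_pmult_def)
  next
    case False
    then show ?thesis using assms
      by (auto simp: indexed_pmult_def intro!: add.finprod_one_eqI)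
  qed
  finally show "(P \<otimes>\<^bsub>power_series_ring R\<^esub> indexed_var i) M = indexed_pmult P i M"
    using ps_mult_comm[of P "indexed_var i" M] assms
    by (auto simp: ps_mult indexed_var_def indexed_const_def indexed_pmult_def)
qed

end

definition monomial :: "('a, 'm) ring_scheme \<Rightarrow> 'a \<Rightarrow> nat multiset \<Rightarrow> nat multiset \<Rightarrow> 'a"
  where "monomial R k M = (\<lambda>N. if N = M then k else \<zero>\<^bsub>R\<^esub>)"

definition homogeneous :: "('a, 'm) ring_scheme \<Rightarrow> nat \<Rightarrow> (nat multiset \<Rightarrow> 'a) \<Rightarrow> bool"
  where "homogeneous R n P \<longleftrightarrow> (\<forall>M. P M \<noteq> \<zero>\<^bsub>R\<^esub> \<longrightarrow> size M = n)"

definition hcomp :: "('a, 'm) ring_scheme \<Rightarrow> nat \<Rightarrow> (nat multiset \<Rightarrow> 'a) \<Rightarrow> (nat multiset \<Rightarrow> 'a)"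
  where "hcomp R n P = (\<lambda>M. if size M = n then P M else \<zero>\<^bsub>R\<^esub>)"

text \<open>Evaluation along an arbitrary homomorphism \<open>h\<close> of the coefficients; \<open>mpoly_eval\<close> is the case
  of the structure map of an algebra.\<close>

definition poly_ev where
  "poly_ev R S h m c P = (\<Oplus>\<^bsub>S\<^esub>M \<in> {M. P M \<noteq> \<zero>\<^bsub>R\<^esub>}. h (P M) \<otimes>\<^bsub>S\<^esub> (\<Otimes>\<^bsub>S\<^esub>i \<in> {..<m}. c i [^]\<^bsub>S\<^esub> count M i))"

context cring
begin

lemma minus_eq_zero_iff: "a \<in> carrier R \<Longrightarrow> \<ominus> a = \<zero> \<longleftrightarrow> a = \<zero>"
  by (metis minus_minus minus_zero)

lemma monomial_add_mset: "monomial R k (add_mset i M) = indexed_pmult (monomial R k M) i"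
  by (auto simp: monomial_def indexed_pmult_def fun_eq_iff)

lemma monomial_empty: "monomial R k {#} = indexed_const k"
  by (auto simp: monomial_def indexed_const_def fun_eq_iff)

lemma monomial_in_pset:
  assumes "k \<in> carrier R" "set_mset M \<subseteq> I"
  shows "monomial R k M \<in> indexed_pset I (carrier R)"
  using assms(2)
proof (induction M)
  case empty
  then show ?case using assms by (simp add: monomial_empty indexed_pset.indexed_const)
next
  case (add i M)
  then show ?case by (simp add: monomial_add_mset indexed_pset.indexed_pmult)
qed

text \<open>Every polynomial is the sum of its terms. As an induction rule, this avoids finite sums in
  the ring of polynomials.\<close>

lemma support_induct:
  assumes "finite {M. P M \<noteq> \<zero>}" "\<And>M. P M \<in> carrier R"
    and z: "W (\<lambda>M. \<zero>)"
    and m: "\<And>M. P M \<noteq> \<zero> \<Longrightarrow> W (monomial R (P M) M)"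
    and a: "\<And>A B. W A \<Longrightarrow> W B \<Longrightarrow> W (\<lambda>M. A M \<oplus> B M)"
  shows "W P"
proof -
  have "W (\<lambda>M. if M \<in> F then P M else \<zero>)" if "finite F" for F
    using that
  proof (induction F)
    case empty then show ?case using z by simp
  next
    case (insert M F)
    have "W (\<lambda>N. monomial R (P M) M N \<oplus> (if N \<in> F then P N else \<zero>))"
      using insert a m z by (cases "P M = \<zero>") (auto simp: monomial_def)
    also have "(\<lambda>N. monomial R (P M) M N \<oplus> (if N \<in> F then P N else \<zero>)) = (\<lambda>N. if N \<in> insert M F then P N else \<zero>)"
      using insert assms(2) by (auto simp: monomial_def fun_eq_iff)
    finally show ?case .
  qed
  from this[OF assms(1)] show ?thesis by (rule subst[where P=W, rotated]) (auto simp: fun_eq_iff)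
qed

text \<open>The inductive definition of the carrier goes through multiplications by single variables.
  The coefficientwise description is the one that can be checked for a convolution product.\<close>

lemma pset_iff:
  fixes P :: "nat multiset \<Rightarrow> 'a" and I :: "nat set"
  shows "P \<in> indexed_pset I (carrier R) \<longleftrightarrow>
    (\<forall>M. P M \<in> carrier R) \<and> finite {M. P M \<noteq> \<zero>} \<and> (\<forall>M. P M \<noteq> \<zero> \<longrightarrow> set_mset M \<subseteq> I)"
proof
  assume "P \<in> indexed_pset I (carrier R)"
  then show "(\<forall>M. P M \<in> carrier R) \<and> finite {M. P M \<noteq> \<zero>} \<and> (\<forall>M. P M \<noteq> \<zero> \<longrightarrow> set_mset M \<subseteq> I)"
  proof induction
    case (indexed_const k)
    have "{M. ring.indexed_const R k M \<noteq> \<zero>} \<subseteq> {{#}}" by (auto simp: indexed_const_def)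
    then show ?case using indexed_const finite_subset by (auto simp: indexed_const_def)
  next
    case (indexed_padd P Q)
    have "{M. (indexed_padd P Q) M \<noteq> \<zero>} \<subseteq> {M. P M \<noteq> \<zero>} \<union> {M. Q M \<noteq> \<zero>}"
      by (auto simp: indexed_padd_def)
    then have "finite {M. (indexed_padd P Q) M \<noteq> \<zero>}" using indexed_padd finite_subset by blast
    moreover have "\<forall>M. (indexed_padd P Q) M \<noteq> \<zero> \<longrightarrow> set_mset M \<subseteq> I"
    proof (intro allI impI)
      fix M assume "(indexed_padd P Q) M \<noteq> \<zero>"
      then have "P M \<noteq> \<zero> \<or> Q M \<noteq> \<zero>" by (auto simp: indexed_padd_def)
      then show "set_mset M \<subseteq> I" using indexed_padd by blast
    qed
    ultimately show ?case using indexed_padd by (auto simp: indexed_padd_def)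
  next
    case (indexed_pmult P i)
    have "{M. (indexed_pmult P i) M \<noteq> \<zero>} \<subseteq> add_mset i ` {M. P M \<noteq> \<zero>}"
      by (auto simp: indexed_pmult_def split: if_splits dest!: multi_member_split)
    then have "finite {M. (indexed_pmult P i) M \<noteq> \<zero>}" using indexed_pmult finite_subset by blast
    moreover have "\<forall>M. (indexed_pmult P i) M \<noteq> \<zero> \<longrightarrow> set_mset M \<subseteq> I"
    proof (intro allI impI)
      fix M assume "(indexed_pmult P i) M \<noteq> \<zero>"
      then obtain N where "M = add_mset i N" "P N \<noteq> \<zero>"
        by (auto simp: indexed_pmult_def split: if_splits dest!: multi_member_split)
      then show "set_mset M \<subseteq> I" using indexed_pmult by auto
    qed
    ultimately show ?case using indexed_pmult by (auto simp: indexed_pmult_def)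
  qed
next
  assume P: "(\<forall>M. P M \<in> carrier R) \<and> finite {M. P M \<noteq> \<zero>} \<and> (\<forall>M. P M \<noteq> \<zero> \<longrightarrow> set_mset M \<subseteq> I)"
  have z: "(\<lambda>M. \<zero>) \<in> indexed_pset I (carrier R)"
    using indexed_pset.indexed_const[of \<zero> "carrier R" I] by (simp add: indexed_zero_def)
  show "P \<in> indexed_pset I (carrier R)"
    using P z by (intro support_induct[of P "\<lambda>P. P \<in> indexed_pset I (carrier R)"])
      (auto intro!: monomial_in_pset dest: indexed_pset.indexed_padd simp: indexed_padd_def)
qed

lemma mpoly_simps [simp]:
  "P \<oplus>\<^bsub>mpoly_ring R m\<^esub> Q = (\<lambda>M. P M \<oplus> Q M)"
  "\<zero>\<^bsub>mpoly_ring R m\<^esub> = (\<lambda>M. \<zero>)"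
  "\<one>\<^bsub>mpoly_ring R m\<^esub> = indexed_const \<one>"
  "(\<otimes>\<^bsub>mpoly_ring R m\<^esub>) = (\<otimes>\<^bsub>power_series_ring R\<^esub>)"
  by (simp_all add: mpoly_ring_eq power_series_ring_def indexed_padd_def indexed_const_def fun_eq_iff)

lemma mpoly_carrier_iff: "P \<in> carrier (mpoly_ring R m) \<longleftrightarrow>
    (\<forall>M. P M \<in> carrier R) \<and> finite {M. P M \<noteq> \<zero>} \<and> (\<forall>M. P M \<noteq> \<zero> \<longrightarrow> set_mset M \<subseteq> {..<m})"
  using pset_iff[of P "{..<m}"] by (simp add: mpoly_ring_def)

lemma ps_mult_nonzero:
  assumes "\<And>M. P M \<in> carrier R" "\<And>M. Q M \<in> carrier R" "(P \<otimes>\<^bsub>power_series_ring R\<^esub> Q) M \<noteq> \<zero>"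
  obtains N L where "M = N + L" "P N \<noteq> \<zero>" "Q L \<noteq> \<zero>"
proof -
  have "\<exists>N. N \<subseteq># M \<and> P N \<otimes> Q (M - N) \<noteq> \<zero>"
    using assms(3) unfolding ps_mult by (metis (mono_tags, lifting) add.finprod_one_eqI mem_Collect_eq)
  then obtain N where N: "N \<subseteq># M" "P N \<otimes> Q (M - N) \<noteq> \<zero>" by blast
  show ?thesis
    by (rule that[of N "M - N"]) (use N assms in \<open>auto\<close>)
qed

lemma mpoly_mult_closed:
  assumes "P \<in> carrier (mpoly_ring R m)" "Q \<in> carrier (mpoly_ring R m)"
  shows "P \<otimes>\<^bsub>power_series_ring R\<^esub> Q \<in> carrier (mpoly_ring R m)"
proof -
  note P = assms(1)[unfolded mpoly_carrier_iff] and Q = assms(2)[unfolded mpoly_carrier_iff]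
  let ?PQ = "P \<otimes>\<^bsub>power_series_ring R\<^esub> Q"
  have sub: "\<exists>N L. M = N + L \<and> P N \<noteq> \<zero> \<and> Q L \<noteq> \<zero>" if "?PQ M \<noteq> \<zero>" for M
    using that P Q by (meson ps_mult_nonzero)
  have "{M. ?PQ M \<noteq> \<zero>} \<subseteq> (\<lambda>(N,L). N + L) ` ({N. P N \<noteq> \<zero>} \<times> {L. Q L \<noteq> \<zero>})"
    using sub by force
  then have "finite {M. ?PQ M \<noteq> \<zero>}" using P Q by (meson finite_SigmaI finite_imageI finite_subset)
  moreover have "\<forall>M. ?PQ M \<in> carrier R" using ps_mult_closed[of P Q] P Q by simp
  moreover have "\<forall>M. ?PQ M \<noteq> \<zero> \<longrightarrow> set_mset M \<subseteq> {..<m}"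
  proof (intro allI impI)
    fix M assume "?PQ M \<noteq> \<zero>"
    then obtain N L where "M = N + L" "P N \<noteq> \<zero>" "Q L \<noteq> \<zero>" using sub by blast
    then show "set_mset M \<subseteq> {..<m}" using P Q by auto
  qed
  ultimately show ?thesis unfolding mpoly_carrier_iff by blast
qed

lemma mpoly_const_closed [intro, simp]: "k \<in> carrier R \<Longrightarrow> indexed_const k \<in> carrier (mpoly_ring R m)"
  by (simp add: mpoly_ring_def indexed_pset.indexed_const)

lemma mpoly_zero_closed [intro, simp]: "(\<lambda>M. \<zero>) \<in> carrier (mpoly_ring R m)"
  using mpoly_const_closed[of \<zero> m] by (simp add: indexed_zero_def)

lemma mpoly_add_closed [intro]: "P \<in> carrier (mpoly_ring R m) \<Longrightarrow> Q \<in> carrier (mpoly_ring R m) \<Longrightarrow>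
  (\<lambda>M. P M \<oplus> Q M) \<in> carrier (mpoly_ring R m)"
  using indexed_pset.indexed_padd[of P "{..<m}" "carrier R" Q] by (simp add: mpoly_ring_def indexed_padd_def)

lemma mpoly_pmult_closed [intro]: "P \<in> carrier (mpoly_ring R m) \<Longrightarrow> i < m \<Longrightarrow>
  indexed_pmult P i \<in> carrier (mpoly_ring R m)"
  using indexed_pset.indexed_pmult[of P "{..<m}" "carrier R" i] by (simp add: mpoly_ring_def)

lemma mpoly_var_closed [intro]: "i < m \<Longrightarrow> indexed_var i \<in> carrier (mpoly_ring R m)"
  unfolding indexed_var_def by auto

lemma mpoly_monomial_closed [intro]:
  "k \<in> carrier R \<Longrightarrow> set_mset M \<subseteq> {..<m} \<Longrightarrow> monomial R k M \<in> carrier (mpoly_ring R m)"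
  using monomial_in_pset[of k M "{..<m}"] by (simp add: mpoly_ring_def)

lemma mpoly_coeff: "P \<in> carrier (mpoly_ring R m) \<Longrightarrow> P M \<in> carrier R"
  by (simp add: mpoly_carrier_iff)

lemma ps_uminus: "P \<in> carrier (power_series_ring R) \<Longrightarrow> \<ominus>\<^bsub>power_series_ring R\<^esub> P = (\<lambda>M. \<ominus> P M)"
proof -
  interpret PS: cring "power_series_ring R" by (rule power_series_cring)
  assume "P \<in> carrier (power_series_ring R)"
  then show ?thesis
    by (intro PS.minus_equality) (auto simp: l_neg)
qed

lemma mpoly_subcring: "subcring (carrier (mpoly_ring R m)) (power_series_ring R)"
proof -
  interpret PS: cring "power_series_ring R" by (rule power_series_cring)
  show ?thesis
  proof (rule PS.subcringI')
    show "subring (carrier (mpoly_ring R m)) (power_series_ring R)"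
    proof (rule PS.subringI)
      fix P assume P: "P \<in> carrier (mpoly_ring R m)"
      then have "(\<lambda>M. \<ominus> P M) \<in> carrier (mpoly_ring R m)"
        unfolding mpoly_carrier_iff by (auto simp: minus_eq_zero_iff)
      then show "\<ominus>\<^bsub>power_series_ring R\<^esub> P \<in> carrier (mpoly_ring R m)"
        using P by (subst ps_uminus) (auto simp: mpoly_carrier_iff)
    next
      show "\<one>\<^bsub>power_series_ring R\<^esub> \<in> carrier (mpoly_ring R m)"
        using mpoly_const_closed[of \<one> m] by (simp add: indexed_const_def)
    qed (use mpoly_mult_closed mpoly_add_closed in \<open>auto simp: mpoly_coeff\<close>)
  qed
qed

lemma mpoly_cring: "cring (mpoly_ring R m)"
proof -
  interpret PS: cring "power_series_ring R" by (rule power_series_cring)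
  have "carrier (mpoly_ring R m) = indexed_pset {..<m} (carrier R)" by (simp add: mpoly_ring_def)
  moreover have "carrier (mpoly_ring R m) \<subseteq> carrier (power_series_ring R)"
    by (auto simp: mpoly_coeff)
  ultimately show ?thesis
    using PS.subcring_iff[of "carrier (mpoly_ring R m)"] mpoly_subcring[of m]
    by (simp add: mpoly_ring_eq)
qed

lemma mpoly_uminus: "P \<in> carrier (mpoly_ring R m) \<Longrightarrow> \<ominus>\<^bsub>mpoly_ring R m\<^esub> P = (\<lambda>M. \<ominus> P M)"
proof -
  interpret MP: cring "mpoly_ring R m" by (rule mpoly_cring)
  assume P: "P \<in> carrier (mpoly_ring R m)"
  then have "(\<lambda>M. \<ominus> P M) \<in> carrier (mpoly_ring R m)"
    unfolding mpoly_carrier_iff by (auto simp: minus_eq_zero_iff)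
  then show ?thesis using P
    by (intro MP.minus_equality) (auto simp: l_neg mpoly_coeff)
qed

lemma mpoly_minus: "P \<in> carrier (mpoly_ring R m) \<Longrightarrow> Q \<in> carrier (mpoly_ring R m) \<Longrightarrow>
  P \<ominus>\<^bsub>mpoly_ring R m\<^esub> Q = (\<lambda>M. P M \<ominus> Q M)"
  by (simp add: a_minus_def mpoly_uminus)

lemma mpoly_mult_var: "P \<in> carrier (mpoly_ring R m) \<Longrightarrow>
   P \<otimes>\<^bsub>power_series_ring R\<^esub> indexed_var i = indexed_pmult P i"
  by (rule ps_mult_var) (rule mpoly_coeff)

lemma mpoly_const_mult: "k \<in> carrier R \<Longrightarrow> P \<in> carrier (mpoly_ring R m) \<Longrightarrow>
   indexed_const k \<otimes>\<^bsub>power_series_ring R\<^esub> P = (\<lambda>M. k \<otimes> P M)"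
  by (rule ext) (simp add: ps_mult ps_mult_const mpoly_coeff)

lemma mpoly_restrict_closed:
  assumes "P \<in> carrier (mpoly_ring R m)"
  shows "(\<lambda>M. if p M then P M else \<zero>) \<in> carrier (mpoly_ring R m)"
proof -
  have "finite {M. (if p M then P M else \<zero>) \<noteq> \<zero>}"
    by (rule rev_finite_subset[of "{M. P M \<noteq> \<zero>}"]) (use assms in \<open>auto simp: mpoly_carrier_iff\<close>)
  then show ?thesis using assms by (auto simp: mpoly_carrier_iff)
qed

lemma hcomp_closed [intro]: "P \<in> carrier (mpoly_ring R m) \<Longrightarrow> hcomp R n P \<in> carrier (mpoly_ring R m)"
  unfolding hcomp_def by (rule mpoly_restrict_closed)

lemma homogeneous_hcomp: "homogeneous R n (hcomp R n P)"
  by (auto simp: homogeneous_def hcomp_def)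

lemma homogeneous_mult:
  assumes "P \<in> carrier (mpoly_ring R m)" "Q \<in> carrier (mpoly_ring R m)"
    "homogeneous R a P" "homogeneous R b Q"
  shows "homogeneous R (a + b) (P \<otimes>\<^bsub>power_series_ring R\<^esub> Q)"
  unfolding homogeneous_def
proof (intro allI impI)
  fix M assume "(P \<otimes>\<^bsub>power_series_ring R\<^esub> Q) M \<noteq> \<zero>"
  then obtain N L where "M = N + L" "P N \<noteq> \<zero>" "Q L \<noteq> \<zero>"
    using assms by (meson ps_mult_nonzero mpoly_coeff)
  then show "size M = a + b" using assms by (auto simp: homogeneous_def)
qed

end

locale evaluation = ring_hom_cring R S h for R (structure) and S (structure) and h +
  fixes m :: nat and c :: "nat \<Rightarrow> 'c"
  assumes c_closed: "i < m \<Longrightarrow> c i \<in> carrier S"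
begin

abbreviation "ev \<equiv> poly_ev R S h m c"

abbreviation "mval M \<equiv> (\<Otimes>\<^bsub>S\<^esub>i \<in> {..<m}. c i [^]\<^bsub>S\<^esub> count M i)"

lemma mval_closed [simp, intro]: "mval M \<in> carrier S"
  using c_closed by (intro S.finprod_closed) auto

lemma ev_superset:
  assumes "finite A" "{M. P M \<noteq> \<zero>} \<subseteq> A" "\<And>M. P M \<in> carrier R"
  shows "ev P = (\<Oplus>\<^bsub>S\<^esub>M \<in> A. h (P M) \<otimes>\<^bsub>S\<^esub> mval M)"
  unfolding poly_ev_def using assms
  by (intro S.add.finprod_mono_neutral_cong_left) auto

lemma ev_closed [simp, intro]: "P \<in> carrier (mpoly_ring R m) \<Longrightarrow> ev P \<in> carrier S"
  unfolding poly_ev_def by (intro S.finsum_closed) (auto simp: R.mpoly_coeff)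

lemma mval_empty: "mval {#} = \<one>\<^bsub>S\<^esub>"
  by (intro S.finprod_one_eqI) auto

lemma mval_add_mset:
  assumes "i < m"
  shows "mval (add_mset i M) = mval M \<otimes>\<^bsub>S\<^esub> c i"
proof -
  have "mval (add_mset i M) = (\<Otimes>\<^bsub>S\<^esub>j \<in> {..<m}. (c j [^]\<^bsub>S\<^esub> count M j) \<otimes>\<^bsub>S\<^esub> (if i = j then c j else \<one>\<^bsub>S\<^esub>))"
    using c_closed by (intro S.finprod_cong') auto
  also have "\<dots> = mval M \<otimes>\<^bsub>S\<^esub> (\<Otimes>\<^bsub>S\<^esub>j \<in> {..<m}. (if i = j then c j else \<one>\<^bsub>S\<^esub>))"
    using c_closed by (intro S.finprod_multf) auto
  also have "(\<Otimes>\<^bsub>S\<^esub>j \<in> {..<m}. (if i = j then c j else \<one>\<^bsub>S\<^esub>)) = c i"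
    using c_closed assms by (intro S.finprod_singleton) auto
  finally show ?thesis .
qed

lemma ev_monomial: "k \<in> carrier R \<Longrightarrow> ev (monomial R k M) = h k \<otimes>\<^bsub>S\<^esub> mval M"
  by (subst ev_superset[of "{M}"]) (auto simp: monomial_def)

lemma ev_const [simp]: "k \<in> carrier R \<Longrightarrow> ev (R.indexed_const k) = h k"
  using ev_monomial[of k "{#}"] by (simp add: R.monomial_empty mval_empty)

lemma ev_zero [simp]: "ev (\<lambda>M. \<zero>) = \<zero>\<^bsub>S\<^esub>"
  by (simp add: poly_ev_def)

lemma ev_add:
  assumes "P \<in> carrier (mpoly_ring R m)" "Q \<in> carrier (mpoly_ring R m)"
  shows "ev (\<lambda>M. P M \<oplus> Q M) = ev P \<oplus>\<^bsub>S\<^esub> ev Q"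
proof -
  let ?A = "{M. P M \<noteq> \<zero>} \<union> {M. Q M \<noteq> \<zero>}"
  have fin: "finite ?A" using assms by (simp add: R.mpoly_carrier_iff)
  have co: "\<And>M. P M \<in> carrier R" "\<And>M. Q M \<in> carrier R" using assms by (auto simp: R.mpoly_coeff)
  have "ev (\<lambda>M. P M \<oplus> Q M) = (\<Oplus>\<^bsub>S\<^esub>M \<in> ?A. h (P M \<oplus> Q M) \<otimes>\<^bsub>S\<^esub> mval M)"
    using fin co by (intro ev_superset) auto
  also have "\<dots> = (\<Oplus>\<^bsub>S\<^esub>M \<in> ?A. h (P M) \<otimes>\<^bsub>S\<^esub> mval M \<oplus>\<^bsub>S\<^esub> h (Q M) \<otimes>\<^bsub>S\<^esub> mval M)"
    using co by (intro S.finsum_cong') (auto simp: S.l_distr)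
  also have "\<dots> = (\<Oplus>\<^bsub>S\<^esub>M \<in> ?A. h (P M) \<otimes>\<^bsub>S\<^esub> mval M) \<oplus>\<^bsub>S\<^esub> (\<Oplus>\<^bsub>S\<^esub>M \<in> ?A. h (Q M) \<otimes>\<^bsub>S\<^esub> mval M)"
    using co by (intro S.finsum_addf) auto
  also have "\<dots> = ev P \<oplus>\<^bsub>S\<^esub> ev Q"
    using fin co by (subst (1 2) ev_superset[of ?A]) auto
  finally show ?thesis .
qed

lemma ev_pmult:
  assumes P: "P \<in> carrier (mpoly_ring R m)" and i: "i < m"
  shows "ev (R.indexed_pmult P i) = ev P \<otimes>\<^bsub>S\<^esub> c i"
proof -
  let ?A = "{M. P M \<noteq> \<zero>}"
  have fin: "finite ?A" using P by (simp add: R.mpoly_carrier_iff)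
  have co: "\<And>M. P M \<in> carrier R" using P by (auto simp: R.mpoly_coeff)
  have "ev (R.indexed_pmult P i) = (\<Oplus>\<^bsub>S\<^esub>M \<in> add_mset i ` ?A. h (R.indexed_pmult P i M) \<otimes>\<^bsub>S\<^esub> mval M)"
    using fin co by (intro ev_superset)
      (auto simp: R.indexed_pmult_def split: if_splits dest!: multi_member_split)
  also have "\<dots> = (\<Oplus>\<^bsub>S\<^esub>M \<in> ?A. h (R.indexed_pmult P i (add_mset i M)) \<otimes>\<^bsub>S\<^esub> mval (add_mset i M))"
    using co by (intro S.finsum_reindex) (auto simp: R.indexed_pmult_def inj_on_def)
  also have "\<dots> = (\<Oplus>\<^bsub>S\<^esub>M \<in> ?A. h (P M) \<otimes>\<^bsub>S\<^esub> mval M \<otimes>\<^bsub>S\<^esub> c i)"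
    using co i c_closed by (intro S.finsum_cong') (auto simp: R.indexed_pmult_def mval_add_mset S.m_assoc simp del: count_add_mset)
  also have "\<dots> = ev P \<otimes>\<^bsub>S\<^esub> c i"
    unfolding poly_ev_def using co c_closed i fin by (intro S.finsum_ldistr[symmetric]) auto
  finally show ?thesis .
qed

lemma ev_var: "i < m \<Longrightarrow> ev (R.indexed_var i) = c i"
  unfolding R.indexed_var_def using c_closed by (subst ev_pmult) auto

text \<open>Induction on the first factor through constants, sums and multiplication by a variable; only
  the first case touches the sum that defines the evaluation.\<close>

lemma ev_mult:
  assumes P: "P \<in> carrier (mpoly_ring R m)" and Q: "Q \<in> carrier (mpoly_ring R m)"
  shows "ev (P \<otimes>\<^bsub>power_series_ring R\<^esub> Q) = ev P \<otimes>\<^bsub>S\<^esub> ev Q"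
proof -
  interpret MP: cring "mpoly_ring R m" by (rule R.mpoly_cring)
  have "P \<in> R.indexed_pset {..<m} (carrier R)" using P by (simp add: mpoly_ring_def)
  then show ?thesis
  proof induction
    case (indexed_const k)
    let ?A = "{M. Q M \<noteq> \<zero>}"
    have fin: "finite ?A" using Q by (simp add: R.mpoly_carrier_iff)
    have co: "\<And>M. Q M \<in> carrier R" using Q by (auto simp: R.mpoly_coeff)
    have "ev (\<lambda>M. k \<otimes> Q M) = (\<Oplus>\<^bsub>S\<^esub>M \<in> ?A. h (k \<otimes> Q M) \<otimes>\<^bsub>S\<^esub> mval M)"
      using fin co indexed_const by (intro ev_superset) auto
    also have "\<dots> = (\<Oplus>\<^bsub>S\<^esub>M \<in> ?A. h k \<otimes>\<^bsub>S\<^esub> (h (Q M) \<otimes>\<^bsub>S\<^esub> mval M))"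
      using co indexed_const by (intro S.finsum_cong') (auto simp: S.m_assoc)
    also have "\<dots> = h k \<otimes>\<^bsub>S\<^esub> ev Q"
      unfolding poly_ev_def using co indexed_const fin by (intro S.finsum_rdistr[symmetric]) auto
    finally show ?case using indexed_const Q by (simp add: R.mpoly_const_mult)
  next
    case (indexed_padd P1 P2)
    then have c: "P1 \<in> carrier (mpoly_ring R m)" "P2 \<in> carrier (mpoly_ring R m)"
      by (simp_all add: mpoly_ring_def)
    have "R.indexed_padd P1 P2 \<otimes>\<^bsub>power_series_ring R\<^esub> Q =
      (\<lambda>M. (P1 \<otimes>\<^bsub>power_series_ring R\<^esub> Q) M \<oplus> (P2 \<otimes>\<^bsub>power_series_ring R\<^esub> Q) M)"
      using MP.l_distr[OF c Q] by (simp add: R.indexed_padd_def)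
    then show ?case using c Q indexed_padd.IH
      by (simp add: ev_add R.mpoly_mult_closed R.indexed_padd_def S.l_distr)
  next
    case (indexed_pmult P i)
    then have c: "P \<in> carrier (mpoly_ring R m)" "i < m" by (simp_all add: mpoly_ring_def)
    note v = R.mpoly_var_closed[OF c(2)]
    have "R.indexed_pmult P i \<otimes>\<^bsub>power_series_ring R\<^esub> Q = (P \<otimes>\<^bsub>mpoly_ring R m\<^esub> R.indexed_var i) \<otimes>\<^bsub>mpoly_ring R m\<^esub> Q"
      using c by (simp add: R.mpoly_mult_var)
    also have "\<dots> = (P \<otimes>\<^bsub>mpoly_ring R m\<^esub> Q) \<otimes>\<^bsub>mpoly_ring R m\<^esub> R.indexed_var i"
      using c Q v by (simp only: MP.m_assoc MP.m_comm[of Q])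
    also have "\<dots> = R.indexed_pmult (P \<otimes>\<^bsub>power_series_ring R\<^esub> Q) i"
      using R.mpoly_mult_var[OF R.mpoly_mult_closed[OF c(1) Q]] by simp
    finally show ?case using c Q c_closed indexed_pmult.IH
      by (simp add: ev_pmult R.mpoly_mult_closed S.m_ac)
  qed
qed

lemma ev_ring_hom: "ev \<in> ring_hom (mpoly_ring R m) S"
  by (rule ring_hom_memI) (auto simp: ev_mult ev_add)

lemma ev_ring_hom_cring: "ring_hom_cring (mpoly_ring R m) S ev"
proof -
  interpret MP: cring "mpoly_ring R m" by (rule R.mpoly_cring)
  show ?thesis by unfold_locales (rule ev_ring_hom)
qed

lemma ev_minus:
  assumes "P \<in> carrier (mpoly_ring R m)" "Q \<in> carrier (mpoly_ring R m)"
  shows "ev (\<lambda>M. P M \<ominus> Q M) = ev P \<ominus>\<^bsub>S\<^esub> ev Q"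
proof -
  interpret E: ring_hom_cring "mpoly_ring R m" S ev by (rule ev_ring_hom_cring)
  have "(\<lambda>M. P M \<ominus> Q M) = P \<ominus>\<^bsub>mpoly_ring R m\<^esub> Q" using assms by (simp add: R.mpoly_minus)
  then show ?thesis using assms E.hom_add E.hom_a_inv by (simp add: a_minus_def del: R.mpoly_simps)
qed

lemma ev_homogeneous_zero:
  assumes P: "P \<in> carrier (mpoly_ring R m)"
    and "\<And>M. P M \<noteq> \<zero> \<Longrightarrow> size M \<le> l" "\<And>n. n \<le> l \<Longrightarrow> ev (hcomp R n P) = \<zero>\<^bsub>S\<^esub>"
  shows "ev P = \<zero>\<^bsub>S\<^esub>"
  using assms
proof (induction l arbitrary: P)
  case 0
  then have "hcomp R 0 P = P" by (force simp: hcomp_def fun_eq_iff)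
  then show ?case using "0.prems"(3)[of 0] by simp
next
  case (Suc l)
  define Q where "Q = (\<lambda>M. if size M \<le> l then P M else \<zero>)"
  have Qc: "Q \<in> carrier (mpoly_ring R m)"
    unfolding Q_def using Suc.prems(1) by (rule R.mpoly_restrict_closed)
  have PQ: "P = (\<lambda>M. Q M \<oplus> hcomp R (Suc l) P M)"
  proof
    fix M
    show "P M = Q M \<oplus> hcomp R (Suc l) P M"
      using Suc.prems(2)[of M] R.mpoly_coeff[OF Suc.prems(1), of M]
      by (cases "P M = \<zero>") (auto simp: Q_def hcomp_def le_Suc_eq)
  qed
  have "ev Q = \<zero>\<^bsub>S\<^esub>"
  proof (rule Suc.IH[OF Qc])
    fix M assume "Q M \<noteq> \<zero>"
    then show "size M \<le> l" by (auto simp: Q_def split: if_splits)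
  next
    fix n assume n: "n \<le> l"
    then have "hcomp R n Q = hcomp R n P" by (auto simp: Q_def hcomp_def fun_eq_iff)
    then show "ev (hcomp R n Q) = \<zero>\<^bsub>S\<^esub>" using Suc.prems(3)[of n] n by simp
  qed
  moreover have "ev P = ev Q \<oplus>\<^bsub>S\<^esub> ev (hcomp R (Suc l) P)"
    using ev_add[OF Qc R.hcomp_closed[OF Suc.prems(1), of "Suc l"]] PQ by simp
  ultimately show ?case using Suc.prems(3)[of "Suc l"] by simp
qed

end

section \<open>Relation type through extension of linear maps\<close>

text \<open>In degree \<open>n\<close>, the additive span of the pairs \<open>(r a\<^sub>1\<cdots>a\<^sub>n, \<phi> r \<kappa> a\<^sub>1\<cdots>\<kappa> a\<^sub>n)\<close> with all \<open>a\<^sub>i\<close>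
  in \<open>I\<close>. It is a relation and not a function since the point is to decide whether \<open>\<kappa>\<close> extends to
  the component of degree \<open>n\<close> of the Rees algebra; if it does, this is the graph of the
  extension.\<close>

inductive rees_graph for R :: "('a, 'm) ring_scheme" and I :: "'a set" and C :: "('c, 'n) ring_scheme"
    and \<phi> \<kappa> :: "'a \<Rightarrow> 'c" where
  scalar: "r \<in> carrier R \<Longrightarrow> rees_graph R I C \<phi> \<kappa> 0 r (\<phi> r)"
| times: "a \<in> I \<Longrightarrow> rees_graph R I C \<phi> \<kappa> n u w \<Longrightarrow> rees_graph R I C \<phi> \<kappa> (Suc n) (a \<otimes>\<^bsub>R\<^esub> u) (\<kappa> a \<otimes>\<^bsub>C\<^esub> w)"
| plus: "rees_graph R I C \<phi> \<kappa> n u w \<Longrightarrow> rees_graph R I C \<phi> \<kappa> n u' w' \<Longrightarrow>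
    rees_graph R I C \<phi> \<kappa> n (u \<oplus>\<^bsub>R\<^esub> u') (w \<oplus>\<^bsub>C\<^esub> w')"

definition semilinear where
  "semilinear R I C \<phi> \<kappa> \<longleftrightarrow> (\<forall>a\<in>I. \<kappa> a \<in> carrier C) \<and> (\<forall>a\<in>I. \<forall>b\<in>I. \<kappa> (a \<oplus>\<^bsub>R\<^esub> b) = \<kappa> a \<oplus>\<^bsub>C\<^esub> \<kappa> b) \<and>
    (\<forall>r\<in>carrier R. \<forall>a\<in>I. \<kappa> (r \<otimes>\<^bsub>R\<^esub> a) = \<phi> r \<otimes>\<^bsub>C\<^esub> \<kappa> a)"

text \<open>The graph is an additive subgroup, so it is single-valued as soon as it is so at zero.\<close>

definition single_valued_at where
  "single_valued_at R I C \<phi> \<kappa> n \<longleftrightarrow> (\<forall>w. rees_graph R I C \<phi> \<kappa> n \<zero>\<^bsub>R\<^esub> w \<longrightarrow> w = \<zero>\<^bsub>C\<^esub>)"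

text \<open>The type of the test ring is a parameter because types cannot be quantified over inside a
  formula. A quotient of a polynomial ring over \<open>R\<close> decides the matter, so that the single type of
  its cosets already determines the relation type.\<close>

definition type_le :: "'c itself \<Rightarrow> nat \<Rightarrow> ('a, 'm) ring_scheme \<Rightarrow> 'a set \<Rightarrow> bool" where
  "type_le T l R I \<longleftrightarrow> (\<forall>(C :: 'c ring) \<phi> \<kappa>. cring C \<longrightarrow> \<phi> \<in> ring_hom R C \<longrightarrow> semilinear R I C \<phi> \<kappa> \<longrightarrow>
    (\<forall>n\<le>l. single_valued_at R I C \<phi> \<kappa> n) \<longrightarrow> (\<forall>n. single_valued_at R I C \<phi> \<kappa> n))"

locale rees_map = ring_hom_cring R C \<phi> + I?: ideal I R
  for R (structure) and C (structure) and I and \<phi> +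
  fixes \<kappa>
  assumes semilin: "semilinear R I C \<phi> \<kappa>"
begin

abbreviation "G \<equiv> rees_graph R I C \<phi> \<kappa>"

lemma I_closed: "a \<in> I \<Longrightarrow> a \<in> carrier R" by (rule I.Icarr)

lemma kappa_closed [simp]: "a \<in> I \<Longrightarrow> \<kappa> a \<in> carrier C"
  and kappa_add: "a \<in> I \<Longrightarrow> b \<in> I \<Longrightarrow> \<kappa> (a \<oplus> b) = \<kappa> a \<oplus>\<^bsub>C\<^esub> \<kappa> b"
  and kappa_mult: "r \<in> carrier R \<Longrightarrow> a \<in> I \<Longrightarrow> \<kappa> (r \<otimes> a) = \<phi> r \<otimes>\<^bsub>C\<^esub> \<kappa> a"
  using semilin by (auto simp: semilinear_def)

lemma kappa_zero: "\<kappa> \<zero> = \<zero>\<^bsub>C\<^esub>"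
  using kappa_mult[of \<zero> \<zero>] by simp

lemma G_closed: "G n u w \<Longrightarrow> u \<in> carrier R \<and> w \<in> carrier C"
  by (induction rule: rees_graph.induct) (auto simp: I_closed)

lemma G_scale:
  assumes "r \<in> carrier R" "G n u w"
  shows "G n (r \<otimes> u) (\<phi> r \<otimes>\<^bsub>C\<^esub> w)"
  using assms(2)
proof (induction rule: rees_graph.induct)
  case (scalar s)
  then show ?case using rees_graph.scalar[of "r \<otimes> s" R] assms(1) by (metis hom_mult R.m_closed)
next
  case (times a n u w)
  have "G (Suc n) (a \<otimes> (r \<otimes> u)) (\<kappa> a \<otimes>\<^bsub>C\<^esub> (\<phi> r \<otimes>\<^bsub>C\<^esub> w))"
    using times by (intro rees_graph.times)
  then show ?case using G_closed[OF times(2)] times(1) assms(1)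
    by (simp add: R.m_lcomm S.m_lcomm I_closed)
next
  case (plus n u w u' w')
  have "G n (r \<otimes> u \<oplus> r \<otimes> u') (\<phi> r \<otimes>\<^bsub>C\<^esub> w \<oplus>\<^bsub>C\<^esub> \<phi> r \<otimes>\<^bsub>C\<^esub> w')"
    using plus by (intro rees_graph.plus)
  then show ?case using G_closed[OF plus(1)] G_closed[OF plus(2)] assms(1)
    by (simp add: R.r_distr S.r_distr)
qed

lemma G_zero: "G n \<zero> \<zero>\<^bsub>C\<^esub>"
proof (induction n)
  case 0 then show ?case using rees_graph.scalar[of \<zero> R I C \<phi> \<kappa>] by simp
next
  case (Suc n)
  then show ?case using rees_graph.times[of \<zero> I R C \<phi> \<kappa> n \<zero> "\<zero>\<^bsub>C\<^esub>"] by simp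
qed

end

lemma rees_map_intro:
  assumes "cring R" "cring C" "ideal I R" "\<phi> \<in> ring_hom R C" "semilinear R I C \<phi> \<kappa>"
  shows "rees_map R C I \<phi> \<kappa>"
  using assms by (simp add: rees_map_def rees_map_axioms_def ring_hom_cring_def ring_hom_cring_axioms_def)

text \<open>A test map \<open>\<kappa>\<close> on \<open>J\<close> gives the test map \<open>\<kappa> \<circ> \<tau>\<close> on \<open>L\<close>. The homomorphism \<open>\<tau>\<close> carries the
  graph of the latter into that of the former, and \<open>\<sigma>\<close> the other way round: the first transports
  single-valuedness in low degrees to \<open>L\<close>, the second brings it back to \<open>J\<close> in all degrees.\<close>

lemma type_le_retract:
  assumes "cring S" "cring V" and \<sigma>: "\<sigma> \<in> ring_hom S V" and \<tau>: "\<tau> \<in> ring_hom V S"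
    and inv: "\<And>s. s \<in> carrier S \<Longrightarrow> \<tau> (\<sigma> s) = s"
    and J: "ideal J S" and L: "ideal L V" and \<sigma>J: "\<sigma> ` J \<subseteq> L" and \<tau>L: "\<tau> ` L \<subseteq> J"
    and le: "type_le TYPE('c) l V L"
  shows "type_le TYPE('c) l S J"
  unfolding type_le_def
proof (intro allI impI)
  fix C :: "'c ring" and \<phi> \<kappa> n
  assume C: "cring C" and \<phi>: "\<phi> \<in> ring_hom S C" and sl: "semilinear S J C \<phi> \<kappa>"
    and sv: "\<forall>n\<le>l. single_valued_at S J C \<phi> \<kappa> n"
  interpret S: cring S by fact
  interpret V: cring V by fact
  interpret C: cring C by fact
  interpret J: ideal J S by fact
  interpret L: ideal L V by fact
  have \<sigma>c: "\<sigma> s \<in> carrier V" if "s \<in> carrier S" for s using \<sigma> that by (rule ring_hom_closed)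
  have \<tau>c: "\<tau> s \<in> carrier S" if "s \<in> carrier V" for s using \<tau> that by (rule ring_hom_closed)
  let ?\<phi> = "\<phi> \<circ> \<tau>" and ?\<kappa> = "\<kappa> \<circ> \<tau>"
  have \<phi>': "?\<phi> \<in> ring_hom V C" using \<tau> \<phi> by (rule ring_hom_trans)
  have Lc: "\<tau> a \<in> J" if "a \<in> L" for a using that \<tau>L by blast
  have sl': "semilinear V L C ?\<phi> ?\<kappa>"
    using sl Lc L.Icarr unfolding semilinear_def
    by (auto simp: ring_hom_add[OF \<tau>] ring_hom_mult[OF \<tau>] \<tau>c)
  interpret GV: rees_map V C L ?\<phi> ?\<kappa> using assms C \<phi>' sl' by (intro rees_map_intro)
  interpret GS: rees_map S C J \<phi> \<kappa> using assms C \<phi> sl by (intro rees_map_intro)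
  have down: "GS.G n (\<tau> v) w" if "GV.G n v w" for n v w
    using that
  proof (induction rule: rees_graph.induct)
    case (scalar r)
    then show ?case using rees_graph.scalar[of "\<tau> r" S J C \<phi> \<kappa>] by (simp add: \<tau>c)
  next
    case (times a n u w)
    then show ?case using rees_graph.times[of "\<tau> a" J S C \<phi> \<kappa> n "\<tau> u" w] GV.G_closed[OF times(2)]
      by (simp add: Lc ring_hom_mult[OF \<tau>] L.Icarr)
  next
    case (plus n u w u' w')
    then show ?case using rees_graph.plus[of S J C \<phi> \<kappa> n "\<tau> u" w "\<tau> u'" w'] GV.G_closed[OF plus(1)]
      GV.G_closed[OF plus(2)] by (simp add: ring_hom_add[OF \<tau>])
  qed
  have up: "GV.G n (\<sigma> v) w" if "GS.G n v w" for n v w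
    using that
  proof (induction rule: rees_graph.induct)
    case (scalar r)
    then show ?case using rees_graph.scalar[of "\<sigma> r" V L C ?\<phi> ?\<kappa>] by (simp add: \<sigma>c inv comp_def)
  next
    case (times a n u w)
    then show ?case using rees_graph.times[of "\<sigma> a" L V C ?\<phi> ?\<kappa> n "\<sigma> u" w] GS.G_closed[OF times(2)]
      \<sigma>J by (simp add: inv ring_hom_mult[OF \<sigma>] J.Icarr image_subset_iff comp_def)
  next
    case (plus n u w u' w')
    then show ?case using rees_graph.plus[of V L C ?\<phi> ?\<kappa> n "\<sigma> u" w "\<sigma> u'" w'] GS.G_closed[OF plus(1)]
      GS.G_closed[OF plus(2)] by (simp add: ring_hom_add[OF \<sigma>] comp_def)
  qed
  have z\<tau>: "\<tau> \<zero>\<^bsub>V\<^esub> = \<zero>\<^bsub>S\<^esub>" and z\<sigma>: "\<sigma> \<zero>\<^bsub>S\<^esub> = \<zero>\<^bsub>V\<^esub>"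
    using ring_hom_zero[OF \<tau>] ring_hom_zero[OF \<sigma>] S.ring_axioms V.ring_axioms by auto
  have "single_valued_at V L C ?\<phi> ?\<kappa> n" if "n \<le> l" for n
    using sv that down[of n "\<zero>\<^bsub>V\<^esub>"] unfolding single_valued_at_def z\<tau> by blast
  then have "single_valued_at V L C ?\<phi> ?\<kappa> n"
    using le C \<phi>' sl' unfolding type_le_def by blast
  then show "single_valued_at S J C \<phi> \<kappa> n"
    using up[of n "\<zero>\<^bsub>S\<^esub>"] unfolding single_valued_at_def z\<sigma> by blast
qed

text \<open>Linearity forces \<open>\<kappa> a = \<phi> a \<kappa> 1\<close>, so in degree \<open>n\<close> the graph is that of the function \<open>u \<mapsto> \<phi>
  u (\<kappa> 1)\<^sup>n\<close>.\<close>

lemma type_le_unit_ideal: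
  assumes "cring R"
  shows "type_le TYPE('c) l R (carrier R)"
  unfolding type_le_def
proof (intro allI impI)
  fix C :: "'c ring" and \<phi> \<kappa> n
  assume C: "cring C" and \<phi>: "\<phi> \<in> ring_hom R C" and sl: "semilinear R (carrier R) C \<phi> \<kappa>"
  interpret R: cring R by fact
  interpret G: rees_map R C "carrier R" \<phi> \<kappa> using assms C \<phi> sl R.oneideal by (intro rees_map_intro)
  let ?e = "\<kappa> \<one>\<^bsub>R\<^esub>"
  have k: "\<kappa> a = \<phi> a \<otimes>\<^bsub>C\<^esub> ?e" if "a \<in> carrier R" for a
    using G.kappa_mult[of a "\<one>\<^bsub>R\<^esub>"] that by simp
  have "w = \<phi> u \<otimes>\<^bsub>C\<^esub> ?e [^]\<^bsub>C\<^esub> n" if "G.G n u w" for n u w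
    using that
  proof (induction rule: rees_graph.induct)
    case (times a n u w)
    then have "u \<in> carrier R" using G.G_closed by blast
    have "\<phi> a \<otimes>\<^bsub>C\<^esub> ?e \<otimes>\<^bsub>C\<^esub> (\<phi> u \<otimes>\<^bsub>C\<^esub> ?e [^]\<^bsub>C\<^esub> n) =
      \<phi> a \<otimes>\<^bsub>C\<^esub> \<phi> u \<otimes>\<^bsub>C\<^esub> (?e [^]\<^bsub>C\<^esub> n \<otimes>\<^bsub>C\<^esub> ?e)"
      using times \<open>u \<in> carrier R\<close> by (simp add: G.S.m_ac)
    then show ?case using times \<open>u \<in> carrier R\<close> by (simp add: k[OF times(1)])
  next
    case (plus n u w u' w')
    then show ?case using G.G_closed[OF plus(1)] G.G_closed[OF plus(2)] by (simp add: G.S.l_distr)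
  qed simp
  then show "single_valued_at R (carrier R) C \<phi> \<kappa> n"
    unfolding single_valued_at_def by (metis G.hom_zero G.S.l_null G.S.nat_pow_closed G.kappa_closed R.one_closed)
qed

text \<open>If \<open>V = R + z V\<close> and \<open>L = I V + z V\<close>, then \<open>L\<^sup>n\<^sup>+\<^sup>1 = I\<^sup>n\<^sup>+\<^sup>1 + z L\<^sup>n\<close>. The graph over \<open>V\<close>
  is described here along this decomposition, which is unique when \<open>z\<close> is not a zero divisor and
  \<open>R\<close> meets \<open>z V\<close> only in zero; single-valuedness can then be tested on the two parts.\<close>

inductive split_graph for R :: "('a, 'm) ring_scheme" and I :: "'a set" and V :: "('v, 'k) ring_scheme"
    and C :: "('c, 'n) ring_scheme" and \<iota> :: "'a \<Rightarrow> 'v" and z :: 'v and \<phi> \<kappa> :: "'v \<Rightarrow> 'c" where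
  base: "v \<in> carrier V \<Longrightarrow> split_graph R I V C \<iota> z \<phi> \<kappa> 0 v (\<phi> v)"
| step: "rees_graph R I C (\<phi> \<circ> \<iota>) (\<kappa> \<circ> \<iota>) (Suc n) u w \<Longrightarrow> split_graph R I V C \<iota> z \<phi> \<kappa> n v y \<Longrightarrow>
   split_graph R I V C \<iota> z \<phi> \<kappa> (Suc n) (\<iota> u \<oplus>\<^bsub>V\<^esub> z \<otimes>\<^bsub>V\<^esub> v) (w \<oplus>\<^bsub>C\<^esub> \<kappa> z \<otimes>\<^bsub>C\<^esub> y)"

inductive_cases split_graph_0E: "split_graph R I V C \<iota> z \<phi> \<kappa> 0 v y"
inductive_cases split_graph_SucE: "split_graph R I V C \<iota> z \<phi> \<kappa> (Suc n) v y"

text \<open>The model is a power series ring \<open>V\<close> over \<open>R\<close> in one variable \<open>z\<close>, with \<open>\<rho>\<close> setting \<open>z\<close> to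
  zero.\<close>

locale one_variable_extension = R: cring R + V: cring V + C: cring C + I: ideal I R
  for R :: "('a, 'm) ring_scheme" and V :: "('v, 'k) ring_scheme" and C :: "('c, 'n) ring_scheme" and I +
  fixes \<iota> \<rho> z \<phi> \<kappa> L
  assumes \<iota>: "\<iota> \<in> ring_hom R V" and \<rho>: "\<rho> \<in> ring_hom V R"
    and \<rho>\<iota>: "r \<in> carrier R \<Longrightarrow> \<rho> (\<iota> r) = r"
    and z: "z \<in> carrier V" and \<rho>z: "\<rho> z = \<zero>\<^bsub>R\<^esub>"
    and expand: "v \<in> carrier V \<Longrightarrow> \<exists>v'\<in>carrier V. v = \<iota> (\<rho> v) \<oplus>\<^bsub>V\<^esub> z \<otimes>\<^bsub>V\<^esub> v'"
    and regular: "v \<in> carrier V \<Longrightarrow> z \<otimes>\<^bsub>V\<^esub> v = \<zero>\<^bsub>V\<^esub> \<Longrightarrow> v = \<zero>\<^bsub>V\<^esub>"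
    and L_def: "L = {v \<in> carrier V. \<rho> v \<in> I}"
    and \<phi>: "\<phi> \<in> ring_hom V C" and sl: "semilinear V L C \<phi> \<kappa>"
begin

sublocale io: ring_hom_cring R V \<iota> by unfold_locales (rule \<iota>)
sublocale rh: ring_hom_cring V R \<rho> by unfold_locales (rule \<rho>)
sublocale ph: ring_hom_cring V C \<phi> by unfold_locales (rule \<phi>)

lemma L_D: "b \<in> L \<Longrightarrow> b \<in> carrier V" "b \<in> L \<Longrightarrow> \<rho> b \<in> I"
  by (simp_all add: L_def)

lemma L_ideal: "ideal L V"
proof (rule idealI[OF V.ring_axioms])
  show "subgroup L (add_monoid V)"
    by (rule V.add.subgroupI) (auto simp: L_def I.a_closed I.a_inv_closed a_inv_def[symmetric])
qed (auto simp: L_def I.I_l_closed I.I_r_closed)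

sublocale GV: rees_map V C L \<phi> \<kappa>
  using V.is_cring C.is_cring L_ideal \<phi> sl by (intro rees_map_intro)

lemma \<iota>I: assumes "a \<in> I" shows "\<iota> a \<in> L"
proof -
  have a: "a \<in> carrier R" by (rule I.Icarr[OF assms])
  have "\<rho> (\<iota> a) \<in> I" unfolding \<rho>\<iota>[OF a] by (rule assms)
  then show ?thesis unfolding L_def using io.hom_closed[OF a] by (intro CollectI conjI)
qed

lemma zL: "z \<in> L" 
  unfolding L_def using z \<rho>z additive_subgroup.zero_closed[OF I.is_additive_subgroup] by (intro CollectI conjI) auto

lemma sl0: "semilinear R I C (\<phi> \<circ> \<iota>) (\<kappa> \<circ> \<iota>)"
  unfolding semilinear_def using \<iota>I I.Icarr by (simp add: GV.kappa_add GV.kappa_mult)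

sublocale GR: rees_map R C I "\<phi> \<circ> \<iota>" "\<kappa> \<circ> \<iota>"
  using R.is_cring C.is_cring I.is_ideal ring_hom_trans[OF \<iota> \<phi>] sl0 by (intro rees_map_intro)

abbreviation "H \<equiv> split_graph R I V C \<iota> z \<phi> \<kappa>"

lemma kz [simp]: "\<kappa> z \<in> carrier C" using zL by simp

lemma H_closed: "H n v y \<Longrightarrow> v \<in> carrier V \<and> y \<in> carrier C"
  by (induction rule: split_graph.induct) (use GR.G_closed z in \<open>auto simp del: comp_apply\<close>)

text \<open>Both sides are the value of \<open>\<kappa>\<close> at \<open>z a = a z\<close>.\<close>

lemma koszul: "a \<in> I \<Longrightarrow> \<phi> z \<otimes>\<^bsub>C\<^esub> \<kappa> (\<iota> a) = \<phi> (\<iota> a) \<otimes>\<^bsub>C\<^esub> \<kappa> z"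
proof -
  assume a: "a \<in> I"
  have "\<phi> z \<otimes>\<^bsub>C\<^esub> \<kappa> (\<iota> a) = \<kappa> (z \<otimes>\<^bsub>V\<^esub> \<iota> a)" using a \<iota>I z by (simp add: GV.kappa_mult)
  also have "z \<otimes>\<^bsub>V\<^esub> \<iota> a = \<iota> a \<otimes>\<^bsub>V\<^esub> z" using z a I.Icarr by (simp add: V.m_comm)
  also have "\<kappa> (\<iota> a \<otimes>\<^bsub>V\<^esub> z) = \<phi> (\<iota> a) \<otimes>\<^bsub>C\<^esub> \<kappa> z" using a I.Icarr zL by (simp add: GV.kappa_mult)
  finally show ?thesis .
qed

lemma H_add: "H n v y \<Longrightarrow> H n v' y' \<Longrightarrow> H n (v \<oplus>\<^bsub>V\<^esub> v') (y \<oplus>\<^bsub>C\<^esub> y')"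
proof (induction n arbitrary: v y v' y')
  case 0
  then show ?case using split_graph.base[of "v \<oplus>\<^bsub>V\<^esub> v'" V R I C \<iota> z \<phi> \<kappa>]
    by (elim split_graph_0E) simp
next
  case (Suc n)
  from Suc.prems(1) obtain u w x t where 1: "GR.G (Suc n) u w" "H n x t"
    "v = \<iota> u \<oplus>\<^bsub>V\<^esub> z \<otimes>\<^bsub>V\<^esub> x" "y = w \<oplus>\<^bsub>C\<^esub> \<kappa> z \<otimes>\<^bsub>C\<^esub> t" by (auto elim: split_graph_SucE)
  from Suc.prems(2) obtain u' w' x' t' where 2: "GR.G (Suc n) u' w'" "H n x' t'"
    "v' = \<iota> u' \<oplus>\<^bsub>V\<^esub> z \<otimes>\<^bsub>V\<^esub> x'" "y' = w' \<oplus>\<^bsub>C\<^esub> \<kappa> z \<otimes>\<^bsub>C\<^esub> t'" by (auto elim: split_graph_SucE)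
  note c = GR.G_closed[OF 1(1)] GR.G_closed[OF 2(1)] H_closed[OF 1(2)] H_closed[OF 2(2)] z
  have "H (Suc n) (\<iota> (u \<oplus>\<^bsub>R\<^esub> u') \<oplus>\<^bsub>V\<^esub> z \<otimes>\<^bsub>V\<^esub> (x \<oplus>\<^bsub>V\<^esub> x')) (w \<oplus>\<^bsub>C\<^esub> w' \<oplus>\<^bsub>C\<^esub> \<kappa> z \<otimes>\<^bsub>C\<^esub> (t \<oplus>\<^bsub>C\<^esub> t'))"
    using Suc.IH[OF 1(2) 2(2)] rees_graph.plus[OF 1(1) 2(1)] by (intro split_graph.step)
  then show ?case using c unfolding 1(3,4) 2(3,4) by (simp add: V.r_distr C.r_distr V.a_ac C.a_ac)
qed

lemma H_zero: "H n \<zero>\<^bsub>V\<^esub> \<zero>\<^bsub>C\<^esub>"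
proof (induction n)
  case 0
  then show ?case using split_graph.base[of "\<zero>\<^bsub>V\<^esub>" V R I C \<iota> z \<phi> \<kappa>] by simp
next
  case (Suc n)
  then show ?case using split_graph.step[OF GR.G_zero[of "Suc n"] Suc] z by simp
qed

lemma H_z:
  assumes "H n v y"
  shows "H (Suc n) (z \<otimes>\<^bsub>V\<^esub> v) (\<kappa> z \<otimes>\<^bsub>C\<^esub> y)"
  using split_graph.step[OF GR.G_zero[of "Suc n"] assms] z H_closed[OF assms] by simp

lemma G_into_H: "GR.G n u w \<Longrightarrow> H n (\<iota> u) w"
proof (cases n)
  case 0
  assume "GR.G n u w"
  then have "GR.G n u w" by simp
  then have "w = \<phi> (\<iota> u) \<and> u \<in> carrier R" using 0
    by (induction rule: rees_graph.induct) auto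
  then show ?thesis using 0 split_graph.base[of "\<iota> u" V R I C \<iota> z \<phi> \<kappa>] by simp
next
  case (Suc k)
  assume G: "GR.G n u w"
  then show ?thesis using split_graph.step[OF G[unfolded Suc] H_zero[of k]] GR.G_closed[OF G] z Suc by simp
qed

text \<open>The relation \<open>\<phi> z \<kappa> a = \<phi> a \<kappa> z\<close> exchanges one of the factors \<open>\<kappa> a\<close> of \<open>w\<close> for \<open>\<kappa> z\<close>. A
  multiple of \<open>z\<close> in degree \<open>n + 1\<close> thereby turns into \<open>\<kappa> z\<close> times an element of degree \<open>n\<close>, which
  is the shape that \<open>split_graph\<close> requires.\<close>

lemma absorb:
  assumes "GR.G (Suc n) u w"
  shows "\<exists>v y. H n v y \<and> z \<otimes>\<^bsub>V\<^esub> \<iota> u = z \<otimes>\<^bsub>V\<^esub> v \<and> \<phi> z \<otimes>\<^bsub>C\<^esub> w = \<kappa> z \<otimes>\<^bsub>C\<^esub> y"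
  using assms
proof (induction "Suc n" u w rule: rees_graph.induct)
  case (times a u w)
  have "H n (\<iota> (a \<otimes>\<^bsub>R\<^esub> u)) ((\<phi> \<circ> \<iota>) a \<otimes>\<^bsub>C\<^esub> w)"
    using times by (intro G_into_H GR.G_scale I.Icarr)
  moreover have "\<phi> z \<otimes>\<^bsub>C\<^esub> ((\<kappa> \<circ> \<iota>) a \<otimes>\<^bsub>C\<^esub> w) = \<kappa> z \<otimes>\<^bsub>C\<^esub> ((\<phi> \<circ> \<iota>) a \<otimes>\<^bsub>C\<^esub> w)"
  proof -
    have c: "w \<in> carrier C" "\<kappa> (\<iota> a) \<in> carrier C" "\<phi> (\<iota> a) \<in> carrier C" "\<phi> z \<in> carrier C"
      using times GR.G_closed \<iota>I I.Icarr z by auto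
    have "\<phi> z \<otimes>\<^bsub>C\<^esub> (\<kappa> (\<iota> a) \<otimes>\<^bsub>C\<^esub> w) = \<phi> z \<otimes>\<^bsub>C\<^esub> \<kappa> (\<iota> a) \<otimes>\<^bsub>C\<^esub> w" using c by (simp add: C.m_assoc)
    also have "\<dots> = \<phi> (\<iota> a) \<otimes>\<^bsub>C\<^esub> \<kappa> z \<otimes>\<^bsub>C\<^esub> w" using koszul times by simp
    also have "\<dots> = \<kappa> z \<otimes>\<^bsub>C\<^esub> (\<phi> (\<iota> a) \<otimes>\<^bsub>C\<^esub> w)" using c by (simp add: C.m_ac)
    finally show ?thesis by simp
  qed
  ultimately show ?case by blast
next
  case (plus u w u' w')
  then obtain v y v' y' where H: "H n v y" "z \<otimes>\<^bsub>V\<^esub> \<iota> u = z \<otimes>\<^bsub>V\<^esub> v" "\<phi> z \<otimes>\<^bsub>C\<^esub> w = \<kappa> z \<otimes>\<^bsub>C\<^esub> y"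
    "H n v' y'" "z \<otimes>\<^bsub>V\<^esub> \<iota> u' = z \<otimes>\<^bsub>V\<^esub> v'" "\<phi> z \<otimes>\<^bsub>C\<^esub> w' = \<kappa> z \<otimes>\<^bsub>C\<^esub> y'" by blast
  have "H n (v \<oplus>\<^bsub>V\<^esub> v') (y \<oplus>\<^bsub>C\<^esub> y')" using H by (intro H_add)
  moreover have "z \<otimes>\<^bsub>V\<^esub> \<iota> (u \<oplus>\<^bsub>R\<^esub> u') = z \<otimes>\<^bsub>V\<^esub> (v \<oplus>\<^bsub>V\<^esub> v')" "\<phi> z \<otimes>\<^bsub>C\<^esub> (w \<oplus>\<^bsub>C\<^esub> w') = \<kappa> z \<otimes>\<^bsub>C\<^esub> (y \<oplus>\<^bsub>C\<^esub> y')"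
    using H H_closed[OF H(1)] H_closed[OF H(4)] GR.G_closed[OF plus(1)] GR.G_closed[OF plus(3)] z
    by (simp_all add: V.r_distr C.r_distr)
  ultimately show ?case by blast
qed

text \<open>For \<open>b = r + z b'\<close> the part \<open>z b'\<close> is not of the shape allowed in the component over \<open>R\<close>;
  \<open>absorb\<close> moves it to the component divisible by \<open>z\<close>.\<close>

lemma H_scale: "b \<in> carrier V \<Longrightarrow> H n v y \<Longrightarrow> H n (b \<otimes>\<^bsub>V\<^esub> v) (\<phi> b \<otimes>\<^bsub>C\<^esub> y)"
proof (induction n arbitrary: v y b)
  case 0
  then show ?case using split_graph.base[of "b \<otimes>\<^bsub>V\<^esub> v" V R I C \<iota> z \<phi> \<kappa>]
    by (elim split_graph_0E) simp
next
  case (Suc n)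
  from Suc.prems(2) obtain u w x t where 1: "GR.G (Suc n) u w" "H n x t"
    "v = \<iota> u \<oplus>\<^bsub>V\<^esub> z \<otimes>\<^bsub>V\<^esub> x" "y = w \<oplus>\<^bsub>C\<^esub> \<kappa> z \<otimes>\<^bsub>C\<^esub> t" by (auto elim: split_graph_SucE)
  obtain b' where b': "b' \<in> carrier V" "b = \<iota> (\<rho> b) \<oplus>\<^bsub>V\<^esub> z \<otimes>\<^bsub>V\<^esub> b'" using expand Suc.prems by blast
  define r where "r = \<rho> b"
  have r: "r \<in> carrier R" "b = \<iota> r \<oplus>\<^bsub>V\<^esub> z \<otimes>\<^bsub>V\<^esub> b'" using Suc.prems b' by (auto simp: r_def)
  obtain x1 t1 where 2: "H n x1 t1" "z \<otimes>\<^bsub>V\<^esub> \<iota> u = z \<otimes>\<^bsub>V\<^esub> x1" "\<phi> z \<otimes>\<^bsub>C\<^esub> w = \<kappa> z \<otimes>\<^bsub>C\<^esub> t1"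
    using absorb[OF 1(1)] by blast
  note c = GR.G_closed[OF 1(1)] H_closed[OF 1(2)] H_closed[OF 2(1)] z r(1) b'(1) Suc.prems(1)
  have H': "H (Suc n) (\<iota> (r \<otimes>\<^bsub>R\<^esub> u) \<oplus>\<^bsub>V\<^esub> z \<otimes>\<^bsub>V\<^esub> (b' \<otimes>\<^bsub>V\<^esub> x1 \<oplus>\<^bsub>V\<^esub> b \<otimes>\<^bsub>V\<^esub> x))
     (((\<phi> \<circ> \<iota>) r \<otimes>\<^bsub>C\<^esub> w) \<oplus>\<^bsub>C\<^esub> \<kappa> z \<otimes>\<^bsub>C\<^esub> (\<phi> b' \<otimes>\<^bsub>C\<^esub> t1 \<oplus>\<^bsub>C\<^esub> \<phi> b \<otimes>\<^bsub>C\<^esub> t))"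
    using Suc.IH[OF b'(1) 2(1)] Suc.IH[OF Suc.prems(1) 1(2)] GR.G_scale[OF r(1) 1(1)]
    by (intro split_graph.step H_add)
  have "b \<otimes>\<^bsub>V\<^esub> v = b \<otimes>\<^bsub>V\<^esub> \<iota> u \<oplus>\<^bsub>V\<^esub> z \<otimes>\<^bsub>V\<^esub> (b \<otimes>\<^bsub>V\<^esub> x)"
    using c by (simp add: 1 V.r_distr V.m_lcomm)
  also have "b \<otimes>\<^bsub>V\<^esub> \<iota> u = \<iota> (r \<otimes>\<^bsub>R\<^esub> u) \<oplus>\<^bsub>V\<^esub> b' \<otimes>\<^bsub>V\<^esub> (z \<otimes>\<^bsub>V\<^esub> \<iota> u)"
    by (subst r(2)) (use c in \<open>simp add: V.l_distr V.r_distr V.m_ac\<close>)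
  also have "\<dots> = \<iota> (r \<otimes>\<^bsub>R\<^esub> u) \<oplus>\<^bsub>V\<^esub> z \<otimes>\<^bsub>V\<^esub> (b' \<otimes>\<^bsub>V\<^esub> x1)" using c by (simp add: 2(2) V.m_lcomm)
  finally have e1: "b \<otimes>\<^bsub>V\<^esub> v = \<iota> (r \<otimes>\<^bsub>R\<^esub> u) \<oplus>\<^bsub>V\<^esub> z \<otimes>\<^bsub>V\<^esub> (b' \<otimes>\<^bsub>V\<^esub> x1 \<oplus>\<^bsub>V\<^esub> b \<otimes>\<^bsub>V\<^esub> x)"
    using c by (simp add: V.r_distr V.a_assoc)
  have "\<phi> b \<otimes>\<^bsub>C\<^esub> y = \<phi> b \<otimes>\<^bsub>C\<^esub> w \<oplus>\<^bsub>C\<^esub> \<kappa> z \<otimes>\<^bsub>C\<^esub> (\<phi> b \<otimes>\<^bsub>C\<^esub> t)"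
    using c by (simp add: 1 C.r_distr C.m_lcomm)
  also have "\<phi> b \<otimes>\<^bsub>C\<^esub> w = \<phi> (\<iota> r) \<otimes>\<^bsub>C\<^esub> w \<oplus>\<^bsub>C\<^esub> \<phi> b' \<otimes>\<^bsub>C\<^esub> (\<phi> z \<otimes>\<^bsub>C\<^esub> w)"
    by (subst r(2)) (use c in \<open>simp add: C.l_distr C.r_distr C.m_ac\<close>)
  also have "\<dots> = \<phi> (\<iota> r) \<otimes>\<^bsub>C\<^esub> w \<oplus>\<^bsub>C\<^esub> \<kappa> z \<otimes>\<^bsub>C\<^esub> (\<phi> b' \<otimes>\<^bsub>C\<^esub> t1)" using c by (simp add: 2(3) C.m_lcomm)
  finally have e2: "\<phi> b \<otimes>\<^bsub>C\<^esub> y = (\<phi> \<circ> \<iota>) r \<otimes>\<^bsub>C\<^esub> w \<oplus>\<^bsub>C\<^esub> \<kappa> z \<otimes>\<^bsub>C\<^esub> (\<phi> b' \<otimes>\<^bsub>C\<^esub> t1 \<oplus>\<^bsub>C\<^esub> \<phi> b \<otimes>\<^bsub>C\<^esub> t)"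
    using c by (simp add: C.r_distr C.a_assoc)
  show ?case using H' unfolding e1 e2 .
qed

lemma H_times_I: "a \<in> I \<Longrightarrow> H n v y \<Longrightarrow> H (Suc n) (\<iota> a \<otimes>\<^bsub>V\<^esub> v) (\<kappa> (\<iota> a) \<otimes>\<^bsub>C\<^esub> y)"
proof (induction n arbitrary: v y)
  case 0
  then have v: "v \<in> carrier V" "y = \<phi> v" by (auto elim: split_graph_0E)
  obtain v' where v': "v' \<in> carrier V" "v = \<iota> (\<rho> v) \<oplus>\<^bsub>V\<^esub> z \<otimes>\<^bsub>V\<^esub> v'" using expand v by blast
  define r where "r = \<rho> v"
  have r: "r \<in> carrier R" "v = \<iota> r \<oplus>\<^bsub>V\<^esub> z \<otimes>\<^bsub>V\<^esub> v'" using v v' by (auto simp: r_def)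
  have a: "a \<in> carrier R" "\<kappa> (\<iota> a) \<in> carrier C" using 0 I.Icarr \<iota>I by auto
  have H': "H (Suc 0) (\<iota> (a \<otimes>\<^bsub>R\<^esub> r) \<oplus>\<^bsub>V\<^esub> z \<otimes>\<^bsub>V\<^esub> (\<iota> a \<otimes>\<^bsub>V\<^esub> v'))
    ((\<kappa> \<circ> \<iota>) a \<otimes>\<^bsub>C\<^esub> (\<phi> \<circ> \<iota>) r \<oplus>\<^bsub>C\<^esub> \<kappa> z \<otimes>\<^bsub>C\<^esub> \<phi> (\<iota> a \<otimes>\<^bsub>V\<^esub> v'))"
    using 0 r v' a by (intro split_graph.step split_graph.base rees_graph.times rees_graph.scalar) auto
  have e1: "\<iota> a \<otimes>\<^bsub>V\<^esub> v = \<iota> (a \<otimes>\<^bsub>R\<^esub> r) \<oplus>\<^bsub>V\<^esub> z \<otimes>\<^bsub>V\<^esub> (\<iota> a \<otimes>\<^bsub>V\<^esub> v')"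
    by (subst r(2)) (use r(1) v'(1) z a in \<open>simp add: V.r_distr V.m_lcomm\<close>)
  have "\<kappa> (\<iota> a) \<otimes>\<^bsub>C\<^esub> y = \<kappa> (\<iota> a) \<otimes>\<^bsub>C\<^esub> \<phi> (\<iota> r) \<oplus>\<^bsub>C\<^esub> (\<phi> z \<otimes>\<^bsub>C\<^esub> \<kappa> (\<iota> a)) \<otimes>\<^bsub>C\<^esub> \<phi> v'"
    unfolding v(2) by (subst r(2)) (use r(1) v'(1) z a in \<open>simp add: C.r_distr C.m_ac\<close>)
  also have "\<dots> = (\<kappa> \<circ> \<iota>) a \<otimes>\<^bsub>C\<^esub> (\<phi> \<circ> \<iota>) r \<oplus>\<^bsub>C\<^esub> \<kappa> z \<otimes>\<^bsub>C\<^esub> \<phi> (\<iota> a \<otimes>\<^bsub>V\<^esub> v')"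
    using koszul[OF 0(1)] r(1) v'(1) z a by (simp add: C.m_ac)
  finally show ?case using H' e1 by simp
next
  case (Suc n)
  from Suc.prems(2) obtain u w x t where 1: "GR.G (Suc n) u w" "H n x t"
    "v = \<iota> u \<oplus>\<^bsub>V\<^esub> z \<otimes>\<^bsub>V\<^esub> x" "y = w \<oplus>\<^bsub>C\<^esub> \<kappa> z \<otimes>\<^bsub>C\<^esub> t" by (auto elim: split_graph_SucE)
  have a: "a \<in> carrier R" "\<kappa> (\<iota> a) \<in> carrier C" using Suc.prems I.Icarr \<iota>I by auto
  note c = GR.G_closed[OF 1(1)] H_closed[OF 1(2)] z a
  have H': "H (Suc (Suc n)) (\<iota> (a \<otimes>\<^bsub>R\<^esub> u) \<oplus>\<^bsub>V\<^esub> z \<otimes>\<^bsub>V\<^esub> (\<iota> a \<otimes>\<^bsub>V\<^esub> x))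
    ((\<kappa> \<circ> \<iota>) a \<otimes>\<^bsub>C\<^esub> w \<oplus>\<^bsub>C\<^esub> \<kappa> z \<otimes>\<^bsub>C\<^esub> (\<kappa> (\<iota> a) \<otimes>\<^bsub>C\<^esub> t))"
    using Suc.IH[OF Suc.prems(1) 1(2)] rees_graph.times[OF Suc.prems(1) 1(1)]
    by (intro split_graph.step)
  then show ?case using c unfolding 1(3,4) by (simp add: V.r_distr C.r_distr V.m_lcomm C.m_lcomm)
qed

text \<open>The split relation is closed under multiplication by elements of \<open>I\<close>, by \<open>z\<close> and by scalars,
  and these generate the multiplication by elements of \<open>L\<close>.\<close>

lemma G_sub_H: "GV.G n v y \<Longrightarrow> H n v y"
proof (induction rule: rees_graph.induct)
  case (scalar r) then show ?case by (rule split_graph.base)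
next
  case (times b n v y)
  have bc: "b \<in> carrier V" "\<rho> b \<in> I" using L_D[OF times(1)] by blast+
  obtain b' where b': "b' \<in> carrier V" "b = \<iota> (\<rho> b) \<oplus>\<^bsub>V\<^esub> z \<otimes>\<^bsub>V\<^esub> b'" using expand bc by blast
  define a where "a = \<rho> b"
  have a: "a \<in> I" "a \<in> carrier R" "b = \<iota> a \<oplus>\<^bsub>V\<^esub> b' \<otimes>\<^bsub>V\<^esub> z"
    using bc b' z by (auto simp: a_def V.m_comm)
  have bz: "b' \<otimes>\<^bsub>V\<^esub> z \<in> L" using zL b' L_ideal ideal.I_l_closed by metis
  note c = H_closed[OF times(3)] z b'(1) a(2)
  have "\<kappa> b = \<kappa> (\<iota> a) \<oplus>\<^bsub>C\<^esub> \<phi> b' \<otimes>\<^bsub>C\<^esub> \<kappa> z"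
    by (subst a(3)) (use \<iota>I[OF a(1)] bz zL b'(1) in \<open>simp add: GV.kappa_add GV.kappa_mult\<close>)
  then have e2: "\<kappa> b \<otimes>\<^bsub>C\<^esub> y = \<kappa> (\<iota> a) \<otimes>\<^bsub>C\<^esub> y \<oplus>\<^bsub>C\<^esub> \<kappa> z \<otimes>\<^bsub>C\<^esub> (\<phi> b' \<otimes>\<^bsub>C\<^esub> y)"
    using c \<iota>I[OF a(1)] by (simp add: C.l_distr C.r_distr C.m_ac)
  have e1: "b \<otimes>\<^bsub>V\<^esub> v = \<iota> a \<otimes>\<^bsub>V\<^esub> v \<oplus>\<^bsub>V\<^esub> z \<otimes>\<^bsub>V\<^esub> (b' \<otimes>\<^bsub>V\<^esub> v)"
    by (subst a(3)) (use c in \<open>simp add: V.l_distr V.r_distr V.m_ac\<close>)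
  show ?case unfolding e1 e2
    using times(3) a(1) b'(1) by (intro H_add H_times_I H_z H_scale)
next
  case (plus n u w u' w') then show ?case by (intro H_add)
qed

text \<open>Applying \<open>\<rho>\<close> to a decomposition of zero kills the component divisible by \<open>z\<close>, so the
  component over \<open>R\<close> vanishes; then \<open>z\<close> can be cancelled.\<close>

lemma H_single_valued:
  assumes sv: "\<And>n. single_valued_at R I C (\<phi> \<circ> \<iota>) (\<kappa> \<circ> \<iota>) n"
  shows "H n \<zero>\<^bsub>V\<^esub> y \<Longrightarrow> y = \<zero>\<^bsub>C\<^esub>"
proof (induction n arbitrary: y)
  case 0 then show ?case by (auto elim: split_graph_0E)
next
  case (Suc n)
  then obtain u w x t where 1: "GR.G (Suc n) u w" "H n x t"
    "\<zero>\<^bsub>V\<^esub> = \<iota> u \<oplus>\<^bsub>V\<^esub> z \<otimes>\<^bsub>V\<^esub> x" "y = w \<oplus>\<^bsub>C\<^esub> \<kappa> z \<otimes>\<^bsub>C\<^esub> t" by (auto elim: split_graph_SucE)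
  note c = GR.G_closed[OF 1(1)] H_closed[OF 1(2)] z
  have "\<zero>\<^bsub>R\<^esub> = \<rho> (\<iota> u \<oplus>\<^bsub>V\<^esub> z \<otimes>\<^bsub>V\<^esub> x)" using 1(3)[symmetric] by simp
  also have "\<dots> = u" using c by (simp add: \<rho>\<iota> \<rho>z)
  finally have u: "u = \<zero>\<^bsub>R\<^esub>" by simp
  then have w: "w = \<zero>\<^bsub>C\<^esub>" using sv 1(1) unfolding single_valued_at_def by blast
  have "z \<otimes>\<^bsub>V\<^esub> x = \<zero>\<^bsub>V\<^esub>" using 1(3) u c by simp
  then have "x = \<zero>\<^bsub>V\<^esub>" using regular c by blast
  then have "t = \<zero>\<^bsub>C\<^esub>" using Suc.IH 1(2) by blast
  then show ?case using 1(4) w by simp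
qed

lemma G_up: "GR.G n u w \<Longrightarrow> GV.G n (\<iota> u) w"
proof (induction rule: rees_graph.induct)
  case (scalar r)
  then show ?case using rees_graph.scalar[of "\<iota> r" V L C \<phi> \<kappa>] by simp
next
  case (times a n u w)
  then show ?case using rees_graph.times[of "\<iota> a" L V C \<phi> \<kappa> n "\<iota> u" w] GR.G_closed[OF times(2)]
    by (simp add: \<iota>I I.Icarr)
next
  case (plus n u w u' w')
  then show ?case using rees_graph.plus[of V L C \<phi> \<kappa> n "\<iota> u" w "\<iota> u'" w'] GR.G_closed[OF plus(1)]
      GR.G_closed[OF plus(2)] by simp
qed

end

text \<open>Adjoining \<open>z\<close> to the ring and to the ideal adds only the relations \<open>z a = a z\<close>, which hold
  in every test ring by linearity. Hence single-valuedness over \<open>V\<close> reduces, in every degree, to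
  single-valuedness over \<open>R\<close>.\<close>

lemma type_le_extend:
  assumes "cring R" "cring V" "ideal I R" and \<iota>: "\<iota> \<in> ring_hom R V" and \<rho>: "\<rho> \<in> ring_hom V R"
    and \<rho>\<iota>: "\<And>r. r \<in> carrier R \<Longrightarrow> \<rho> (\<iota> r) = r"
    and z: "z \<in> carrier V" and \<rho>z: "\<rho> z = \<zero>\<^bsub>R\<^esub>"
    and expand: "\<And>v. v \<in> carrier V \<Longrightarrow> \<exists>v'\<in>carrier V. v = \<iota> (\<rho> v) \<oplus>\<^bsub>V\<^esub> z \<otimes>\<^bsub>V\<^esub> v'"
    and regular: "\<And>v. v \<in> carrier V \<Longrightarrow> z \<otimes>\<^bsub>V\<^esub> v = \<zero>\<^bsub>V\<^esub> \<Longrightarrow> v = \<zero>\<^bsub>V\<^esub>"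
    and le: "type_le TYPE('c) l R I"
  shows "type_le TYPE('c) l V {v \<in> carrier V. \<rho> v \<in> I}"
  unfolding type_le_def
proof (intro allI impI)
  fix C :: "'c ring" and \<phi> \<kappa> n
  let ?L = "{v \<in> carrier V. \<rho> v \<in> I}"
  assume C: "cring C" and \<phi>: "\<phi> \<in> ring_hom V C" and sl: "semilinear V ?L C \<phi> \<kappa>"
    and sv: "\<forall>n\<le>l. single_valued_at V ?L C \<phi> \<kappa> n"
  interpret E: one_variable_extension R V C I \<iota> \<rho> z \<phi> \<kappa> ?L
    using assms C \<phi> sl by (simp add: one_variable_extension_def one_variable_extension_axioms_def)
  have "single_valued_at R I C (\<phi> \<circ> \<iota>) (\<kappa> \<circ> \<iota>) n" if "n \<le> l" for n
    using sv that E.G_up[of n "\<zero>\<^bsub>R\<^esub>"] unfolding single_valued_at_def E.io.hom_zero by blast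
  then have "single_valued_at R I C (\<phi> \<circ> \<iota>) (\<kappa> \<circ> \<iota>) n" for n
    using le C ring_hom_trans[OF \<iota> \<phi>] E.sl0 unfolding type_le_def by blast
  then show "single_valued_at V ?L C \<phi> \<kappa> n"
    unfolding single_valued_at_def using E.G_sub_H E.H_single_valued
    by (metis (no_types, lifting) single_valued_at_def)
qed

section \<open>Presentations of the Rees algebra\<close>

text \<open>A constant of its own instead of \<open>\<lambda>x. x\<close>: with the latter, the laws of a homomorphism loop
  as rewrite rules.\<close>

definition identity :: "'a \<Rightarrow> 'a" where identity_apply: "identity x = x"

lemma (in cring) identity_hom: "identity \<in> ring_hom R R"
  by (rule ring_hom_memI) (simp_all add: identity_apply)

locale self_evaluation = R: cring R for R (structure) + fixes m :: nat and a
  assumes a_closed: "i < m \<Longrightarrow> a i \<in> carrier R"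
begin

sublocale evaluation R R identity m a
  by unfold_locales (use a_closed R.identity_hom in auto)

lemma self_ev_const [simp]: "k \<in> carrier R \<Longrightarrow> ev (R.indexed_const k) = k"
  by (rule trans[OF ev_const identity_apply])

declare ev_const [simp del]

end

lemma (in ring) genideal_induct:
  assumes "b \<in> genideal R A" "A \<subseteq> carrier R"
    and gen: "\<And>a. a \<in> A \<Longrightarrow> Q a"
    and add: "\<And>x y. x \<in> genideal R A \<Longrightarrow> y \<in> genideal R A \<Longrightarrow> Q x \<Longrightarrow> Q y \<Longrightarrow> Q (x \<oplus> y)"
    and l: "\<And>r x. r \<in> carrier R \<Longrightarrow> x \<in> genideal R A \<Longrightarrow> Q x \<Longrightarrow> Q (r \<otimes> x)"
    and r: "\<And>r x. r \<in> carrier R \<Longrightarrow> x \<in> genideal R A \<Longrightarrow> Q x \<Longrightarrow> Q (x \<otimes> r)"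
    and z: "Q \<zero>"
  shows "Q b"
proof -
  interpret I: ideal "genideal R A" R by (rule genideal_ideal) fact
  let ?K = "{x \<in> genideal R A. Q x}"
  have K0: "?K \<noteq> {}" using z I.zero_closed by blast
  have "ideal ?K R"
  proof (rule idealI[OF ring_axioms])
    show "subgroup ?K (add_monoid R)"
    proof (rule add.subgroupI)
      fix x assume x: "x \<in> ?K"
      then have "\<ominus> \<one> \<otimes> x = \<ominus> x" using I.Icarr by (simp add: l_minus)
      moreover have "Q (\<ominus> \<one> \<otimes> x)" using x l by simp
      ultimately show "\<ominus> x \<in> ?K" using x I.a_inv_closed by (simp add: a_inv_def)
    qed (use K0 z add I.Icarr in auto)
  qed (use l r in \<open>auto intro: I.I_l_closed I.I_r_closed\<close>)
  moreover have "A \<subseteq> ?K" using gen genideal_self[OF assms(2)] by auto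
  ultimately have "genideal R A \<subseteq> ?K" by (rule genideal_minimal)
  then show ?thesis using assms(1) by blast
qed

locale presentation = rees_map R C I \<phi> \<kappa>
  for R (structure) and C (structure) and I and \<phi> \<kappa> +
  fixes m :: nat and a
  assumes a_I: "i < m \<Longrightarrow> a i \<in> I" and gen: "I = genideal R (a ` {..<m})"
begin

sublocale A: self_evaluation R m a
  by unfold_locales (use a_I I_closed in auto)

sublocale B: evaluation R C \<phi> m "\<lambda>i. \<kappa> (a i)"
  by unfold_locales (use a_I in auto)

lemma G_monomial:
  assumes "k \<in> carrier R" "set_mset M \<subseteq> {..<m}"
  shows "G (size M) (A.ev (monomial R k M)) (B.ev (monomial R k M))"
  using assms(2)
proof (induction M)
  case empty
  then show ?case using assms rees_graph.scalar[of k R I C \<phi> \<kappa>] by (simp add: R.monomial_empty)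
next
  case (add i M)
  then have i: "i < m" and c: "monomial R k M \<in> carrier (mpoly_ring R m)"
    using assms by (auto intro!: R.mpoly_monomial_closed)
  have "G (Suc (size M)) (a i \<otimes> A.ev (monomial R k M)) (\<kappa> (a i) \<otimes>\<^bsub>C\<^esub> B.ev (monomial R k M))"
    using add i a_I by (intro rees_graph.times) auto
  then show ?case
    using i c a_I I_closed by (simp add: R.monomial_add_mset A.ev_pmult B.ev_pmult R.m_comm S.m_comm)
qed

text \<open>Together with \<open>G_form\<close>: the graph in degree \<open>n\<close> consists of the pairs \<open>(F(a), F(\<kappa> a))\<close> for
  the forms \<open>F\<close> of degree \<open>n\<close>. Single-valuedness says that the forms vanishing at \<open>a\<close> vanish at \<open>\<kappa>
  a\<close>.\<close>

lemma form_in_G: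
  assumes P: "P \<in> carrier (mpoly_ring R m)" and h: "homogeneous R n P"
  shows "G n (A.ev P) (B.ev P)"
proof -
  let ?W = "\<lambda>P. P \<in> carrier (mpoly_ring R m) \<and> G n (A.ev P) (B.ev P)"
  note Pc = P[unfolded R.mpoly_carrier_iff]
  have "?W P"
  proof (rule R.support_induct[of P ?W])
    show "?W (\<lambda>M. \<zero>)" using G_zero by simp
  next
    fix M assume M: "P M \<noteq> \<zero>"
    then show "?W (monomial R (P M) M)"
      using G_monomial[of "P M" M] h Pc by (auto simp: homogeneous_def intro!: R.mpoly_monomial_closed)
  next
    fix P1 P2 assume "?W P1" "?W P2"
    then show "?W (\<lambda>M. P1 M \<oplus> P2 M)"
      using rees_graph.plus[of R I C \<phi> \<kappa> n "A.ev P1" "B.ev P1" "A.ev P2" "B.ev P2"]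
      by (simp add: A.ev_add B.ev_add R.mpoly_add_closed)
  qed (use Pc in auto)
  then show ?thesis by blast
qed

lemma homogeneous_add: "homogeneous R n P \<Longrightarrow> homogeneous R n Q \<Longrightarrow> homogeneous R n (\<lambda>M. P M \<oplus> Q M)"
  by (auto simp: homogeneous_def) (metis R.l_zero R.zero_closed)

lemma homogeneous_const: "k \<in> carrier R \<Longrightarrow> homogeneous R 0 (R.indexed_const k)"
  by (auto simp: homogeneous_def R.indexed_const_def)

lemma homogeneous_var: "homogeneous R 1 (R.indexed_var i)"
  by (auto simp: homogeneous_def R.indexed_var_def R.indexed_const_def R.indexed_pmult_def
    split: if_splits dest!: multi_member_split)

lemma linear_form:
  assumes "b \<in> I"
  shows "\<exists>P\<in>carrier (mpoly_ring R m). homogeneous R 1 P \<and> A.ev P = b \<and> B.ev P = \<kappa> b"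
proof -
  let ?Q = "\<lambda>b. \<exists>P\<in>carrier (mpoly_ring R m). homogeneous R 1 P \<and> A.ev P = b \<and> B.ev P = \<kappa> b"
  have scale: "?Q (r \<otimes> x)" if r: "r \<in> carrier R" and x: "x \<in> genideal R (a ` {..<m})" "?Q x" for r x
  proof -
    obtain P where P: "P \<in> carrier (mpoly_ring R m)" "homogeneous R 1 P" "A.ev P = x" "B.ev P = \<kappa> x"
      using x by blast
    let ?P = "R.indexed_const r \<otimes>\<^bsub>power_series_ring R\<^esub> P"
    have "?P \<in> carrier (mpoly_ring R m)" using r P by (simp add: R.mpoly_mult_closed)
    moreover have "homogeneous R 1 ?P"
      using R.homogeneous_mult[of "R.indexed_const r" m P 0 1] r P by (simp add: homogeneous_const)
    moreover have "A.ev ?P = r \<otimes> x" "B.ev ?P = \<kappa> (r \<otimes> x)"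
      using r P x gen by (simp_all add: A.ev_mult B.ev_mult kappa_mult)
    ultimately show ?thesis by blast
  qed
  have bb: "b \<in> genideal R (a ` {..<m})" using assms gen by simp
  show ?thesis
  proof (rule R.genideal_induct[OF bb, of ?Q])
    show "a ` {..<m} \<subseteq> carrier R" using a_I I_closed by auto
  next
    fix x assume "x \<in> a ` {..<m}"
    then obtain i where i: "i < m" "x = a i" by auto
    then show "?Q x"
      by (intro bexI[of _ "R.indexed_var i"]) (use homogeneous_var in \<open>auto simp: A.ev_var B.ev_var R.mpoly_var_closed\<close>)
  next
    fix x y assume xy: "x \<in> genideal R (a ` {..<m})" "y \<in> genideal R (a ` {..<m})" "?Q x" "?Q y"
    then obtain P Q where "P \<in> carrier (mpoly_ring R m)" "homogeneous R 1 P" "A.ev P = x" "B.ev P = \<kappa> x"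
      "Q \<in> carrier (mpoly_ring R m)" "homogeneous R 1 Q" "A.ev Q = y" "B.ev Q = \<kappa> y" by blast
    then show "?Q (x \<oplus> y)" using xy(1,2) gen
      by (intro bexI[of _ "\<lambda>M. P M \<oplus> Q M"]) (auto simp: A.ev_add B.ev_add homogeneous_add kappa_add)
  next
    fix r x assume rx: "r \<in> carrier R" "x \<in> genideal R (a ` {..<m})" "?Q x"
    then have "x \<otimes> r = r \<otimes> x" using gen I_closed by (metis R.m_comm)
    then show "?Q (x \<otimes> r)" using scale[OF rx] by simp
  next
    show "?Q \<zero>" by (intro bexI[of _ "\<lambda>M. \<zero>"]) (auto simp: homogeneous_def kappa_zero)
  qed (rule scale)
qed

lemma G_form:
  assumes "G n u w"
  shows "\<exists>P\<in>carrier (mpoly_ring R m). homogeneous R n P \<and> A.ev P = u \<and> B.ev P = w"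
  using assms
proof (induction rule: rees_graph.induct)
  case (scalar r)
  then show ?case by (intro bexI[of _ "R.indexed_const r"]) (auto simp: homogeneous_const)
next
  case (times b n u w)
  then obtain P Q where P: "P \<in> carrier (mpoly_ring R m)" "homogeneous R n P" "A.ev P = u" "B.ev P = w"
    and Q: "Q \<in> carrier (mpoly_ring R m)" "homogeneous R 1 Q" "A.ev Q = b" "B.ev Q = \<kappa> b"
    using linear_form by blast
  have "homogeneous R (1 + n) (Q \<otimes>\<^bsub>power_series_ring R\<^esub> P)"
    using P Q by (intro R.homogeneous_mult)
  then show ?case using P Q
    by (intro bexI[of _ "Q \<otimes>\<^bsub>power_series_ring R\<^esub> P"]) (auto simp: A.ev_mult B.ev_mult R.mpoly_mult_closed)
next
  case (plus n u w u' w')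
  then obtain P Q where P: "P \<in> carrier (mpoly_ring R m)" "homogeneous R n P" "A.ev P = u" "B.ev P = w"
    and Q: "Q \<in> carrier (mpoly_ring R m)" "homogeneous R n Q" "A.ev Q = u'" "B.ev Q = w'" by blast
  then show ?case
    by (intro bexI[of _ "\<lambda>M. P M \<oplus> Q M"]) (auto simp: A.ev_add B.ev_add homogeneous_add)
qed

end

text \<open>The kernel of \<open>T\<^sub>i \<mapsto> a\<^sub>i t\<close> on polynomials, without reference to the Rees algebra: \<open>F(a t)\<close>
  is the sum of the \<open>F\<^sub>n(a) t\<^sup>n\<close> over the homogeneous components \<open>F\<^sub>n\<close> of \<open>F\<close>.\<close>

definition form_relations where
  "form_relations R m a = {P \<in> carrier (mpoly_ring R m). \<forall>n. poly_ev R R identity m a (hcomp R n P) = \<zero>\<^bsub>R\<^esub>}"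

definition form_relations_upto where
  "form_relations_upto R m a l = genideal (mpoly_ring R m)
    {P \<in> form_relations R m a. \<forall>M. P M \<noteq> \<zero>\<^bsub>R\<^esub> \<longrightarrow> size M \<le> l}"

lemma (in cring) hcomp_of_homogeneous:
  assumes "homogeneous R n P" shows "hcomp R k P = (if k = n then P else (\<lambda>M. \<zero>))"
  using assms by (force simp: homogeneous_def hcomp_def fun_eq_iff)

lemma (in presentation) single_valued_imp_vanish:
  assumes sv: "\<And>n. n \<le> l \<Longrightarrow> single_valued_at R I C \<phi> \<kappa> n"
    and P: "P \<in> form_relations R m a" "\<And>M. P M \<noteq> \<zero> \<Longrightarrow> size M \<le> l"
  shows "B.ev P = \<zero>\<^bsub>C\<^esub>"
proof (rule B.ev_homogeneous_zero)
  show Pc: "P \<in> carrier (mpoly_ring R m)" using P by (simp add: form_relations_def)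
  show "\<And>M. P M \<noteq> \<zero> \<Longrightarrow> size M \<le> l" by fact
  fix n assume n: "n \<le> l"
  have "G n (A.ev (hcomp R n P)) (B.ev (hcomp R n P))"
    by (rule form_in_G) (use Pc R.homogeneous_hcomp in auto)
  moreover have "A.ev (hcomp R n P) = \<zero>" using P by (simp add: form_relations_def)
  ultimately show "B.ev (hcomp R n P) = \<zero>\<^bsub>C\<^esub>"
    using sv[OF n] by (simp add: single_valued_at_def)
qed

lemma (in presentation) G_zero_form:
  assumes "G n \<zero> w"
  shows "\<exists>P\<in>form_relations R m a. homogeneous R n P \<and> B.ev P = w"
proof -
  obtain P where P: "P \<in> carrier (mpoly_ring R m)" "homogeneous R n P" "A.ev P = \<zero>" "B.ev P = w"
    using G_form[OF assms] by blast
  then have "P \<in> form_relations R m a"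
    by (auto simp: form_relations_def R.hcomp_of_homogeneous)
  then show ?thesis using P by blast
qed

text \<open>Evaluation at the \<open>\<kappa> a\<^sub>i\<close> is a homomorphism. If it kills the relations of degree at most
  \<open>l\<close>, then it kills the ideal that they generate.\<close>

lemma relations_imp_type_le:
  assumes R: "cring R" and a: "\<And>i. i < m \<Longrightarrow> a i \<in> carrier R" and I: "I = genideal R (a ` {..<m})"
    and eq: "form_relations_upto R m a l = form_relations R m a"
  shows "type_le TYPE('c) l R I"
  unfolding type_le_def
proof (intro allI impI)
  fix C :: "'c ring" and \<phi> \<kappa> n
  assume C: "cring C" and \<phi>: "\<phi> \<in> ring_hom R C" and sl: "semilinear R I C \<phi> \<kappa>"
    and sv: "\<forall>n\<le>l. single_valued_at R I C \<phi> \<kappa> n"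
  interpret R: cring R by fact
  have sub: "a ` {..<m} \<subseteq> carrier R" using a by auto
  have "ideal I R" unfolding I by (rule R.genideal_ideal[OF sub])
  then interpret G: rees_map R C I \<phi> \<kappa> using R C \<phi> sl by (intro rees_map_intro)
  interpret G: presentation R C I \<phi> \<kappa> m a
    by unfold_locales (use I R.genideal_self[OF sub] in auto)
  interpret MP: cring "mpoly_ring R m" by (rule R.mpoly_cring)
  interpret E: ring_hom_cring "mpoly_ring R m" C G.B.ev by (rule G.B.ev_ring_hom_cring)
  have K: "ideal (a_kernel (mpoly_ring R m) C G.B.ev) (mpoly_ring R m)"
    by (rule ring_hom_ring.kernel_is_ideal)
      (rule ring_hom_ringI2[OF MP.ring_axioms G.S.ring_axioms G.B.ev_ring_hom])
  have "{P \<in> form_relations R m a. \<forall>M. P M \<noteq> \<zero>\<^bsub>R\<^esub> \<longrightarrow> size M \<le> l} \<subseteq> a_kernel (mpoly_ring R m) C G.B.ev"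
  proof
    fix P assume P: "P \<in> {P \<in> form_relations R m a. \<forall>M. P M \<noteq> \<zero>\<^bsub>R\<^esub> \<longrightarrow> size M \<le> l}"
    then have "G.B.ev P = \<zero>\<^bsub>C\<^esub>" using sv by (intro G.single_valued_imp_vanish[of l]) auto
    moreover have "P \<in> carrier (mpoly_ring R m)" using P unfolding form_relations_def by blast
    ultimately show "P \<in> a_kernel (mpoly_ring R m) C G.B.ev" unfolding a_kernel_def' by blast
  qed
  from MP.genideal_minimal[OF K this]
  have "form_relations R m a \<subseteq> a_kernel (mpoly_ring R m) C G.B.ev"
    using eq by (simp add: form_relations_upto_def)
  then show "single_valued_at R I C \<phi> \<kappa> n"
    unfolding single_valued_at_def a_kernel_def' using G.G_zero_form by blast
qed

text \<open>The universal test ring is the polynomial ring modulo the relations of degree at most \<open>l\<close>,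
  with \<open>\<kappa> b\<close> the class of any linear form with value \<open>b\<close>; two such forms differ by a linear
  relation, which is where \<open>1 \<le> l\<close> enters. In degrees up to \<open>l\<close> the graph is single-valued by
  construction, and single-valuedness in all degrees says that every relation is zero in this
  quotient.\<close>

lemma type_le_imp_relations:
  fixes R :: "('a, 'm) ring_scheme"
  assumes R: "cring R" and a: "\<And>i. i < m \<Longrightarrow> a i \<in> carrier R" and I: "I = genideal R (a ` {..<m})"
    and id: "ideal (form_relations R m a) (mpoly_ring R m)" and l: "1 \<le> l"
    and le: "type_le TYPE((nat multiset \<Rightarrow> 'a) set) l R I"
  shows "form_relations_upto R m a l = form_relations R m a"
proof
  interpret R: cring R by fact
  interpret MP: cring "mpoly_ring R m" by (rule R.mpoly_cring)
  have sub: "a ` {..<m} \<subseteq> carrier R" using a by auto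
  interpret I: ideal I R unfolding I by (rule R.genideal_ideal[OF sub])
  let ?S = "{P \<in> form_relations R m a. \<forall>M. P M \<noteq> \<zero>\<^bsub>R\<^esub> \<longrightarrow> size M \<le> l}"
  let ?Q = "form_relations_upto R m a l"
  have Sc: "?S \<subseteq> carrier (mpoly_ring R m)" by (auto simp: form_relations_def)
  show "?Q \<subseteq> form_relations R m a"
    unfolding form_relations_upto_def by (rule MP.genideal_minimal[OF id]) auto
  interpret Q: ideal ?Q "mpoly_ring R m"
    unfolding form_relations_upto_def by (rule MP.genideal_ideal[OF Sc])
  let ?C = "mpoly_ring R m Quot ?Q"
  let ?cls = "\<lambda>P. ?Q +>\<^bsub>mpoly_ring R m\<^esub> P"
  interpret C: cring ?C by (rule Q.quotient_is_cring[OF MP.is_cring])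
  have cls: "?cls \<in> ring_hom (mpoly_ring R m) ?C" by (rule Q.rcos_ring_hom)
  interpret cls: ring_hom_cring "mpoly_ring R m" ?C ?cls by unfold_locales (rule cls)
  have cls0: "?cls P = \<zero>\<^bsub>?C\<^esub> \<longleftrightarrow> P \<in> ?Q" if "P \<in> carrier (mpoly_ring R m)" for P
    using that Q.a_rcos_const Q.a_rcos_self by (auto simp: FactRing_def)
  let ?\<phi> = "\<lambda>r. ?cls (R.indexed_const r)"
  have \<phi>: "?\<phi> \<in> ring_hom R ?C"
  proof -
    have "R.indexed_const \<in> ring_hom R (mpoly_ring R m)"
    proof (rule ring_hom_memI)
      fix x y assume xy: "x \<in> carrier R" "y \<in> carrier R"
      show "R.indexed_const (x \<otimes>\<^bsub>R\<^esub> y) = R.indexed_const x \<otimes>\<^bsub>mpoly_ring R m\<^esub> (R.indexed_const y :: nat multiset \<Rightarrow> 'a)"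
        using xy R.mpoly_const_mult[of x "R.indexed_const y" m] R.mpoly_const_closed[OF xy(2), of m]
        by (simp only: R.mpoly_simps) (auto simp: R.indexed_const_def fun_eq_iff)
    next
      fix x assume "x \<in> carrier R"
      then show "(R.indexed_const x :: nat multiset \<Rightarrow> 'a) \<in> carrier (mpoly_ring R m)" by (rule R.mpoly_const_closed)
    qed (auto simp: R.indexed_const_def fun_eq_iff)
    from ring_hom_trans[OF this cls] show ?thesis by (simp add: comp_def)
  qed
  interpret \<phi>: ring_hom_cring R ?C ?\<phi> by unfold_locales (rule \<phi>)
  interpret A: self_evaluation R m a
    by unfold_locales (use a in auto)
  have lin: "\<exists>P\<in>carrier (mpoly_ring R m). homogeneous R 1 P \<and> A.ev P = b" if "b \<in> I" for b
  proof -
    have z: "semilinear R I R identity identity"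
      by (auto simp: semilinear_def identity_apply)
    interpret Z: rees_map R R I identity identity
      using R I.is_ideal z A.homh by (intro rees_map_intro)
    interpret Z: presentation R R I identity identity m a
      by unfold_locales (use I R.genideal_self[OF sub] in auto)
    show ?thesis using Z.linear_form[OF that] by blast
  qed
  define B where "B b = (SOME P. P \<in> carrier (mpoly_ring R m) \<and> homogeneous R 1 P \<and> A.ev P = b)" for b
  have B: "B b \<in> carrier (mpoly_ring R m)" "homogeneous R 1 (B b)" "A.ev (B b) = b" if "b \<in> I" for b
    using someI_ex[of "\<lambda>P. P \<in> carrier (mpoly_ring R m) \<and> homogeneous R 1 P \<and> A.ev P = b"] lin[OF that]
    unfolding B_def by blast+
  have rel: "P \<in> ?S" if "P \<in> carrier (mpoly_ring R m)" "homogeneous R n P" "A.ev P = \<zero>\<^bsub>R\<^esub>" "n \<le> l" for P n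
  proof -
    have "P \<in> form_relations R m a"
      using that by (auto simp: form_relations_def R.hcomp_of_homogeneous)
    then show ?thesis using that by (auto simp: homogeneous_def)
  qed
  have S_Q: "?S \<subseteq> ?Q" unfolding form_relations_upto_def by (rule MP.genideal_self[OF Sc])
  have lin_eq: "?cls P = ?cls P'" if "P \<in> carrier (mpoly_ring R m)" "homogeneous R 1 P"
    "P' \<in> carrier (mpoly_ring R m)" "homogeneous R 1 P'" "A.ev P = A.ev P'" for P P'
  proof -
    have c: "(\<lambda>M. P M \<ominus>\<^bsub>R\<^esub> P' M) = P \<ominus>\<^bsub>mpoly_ring R m\<^esub> P'" using that by (simp add: R.mpoly_minus)
    have "(\<lambda>M. P M \<ominus>\<^bsub>R\<^esub> P' M) \<in> ?S"
    proof (rule rel[of _ 1])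
      show "(\<lambda>M. P M \<ominus>\<^bsub>R\<^esub> P' M) \<in> carrier (mpoly_ring R m)" unfolding c using that by (intro MP.minus_closed)
      show "homogeneous R 1 (\<lambda>M. P M \<ominus>\<^bsub>R\<^esub> P' M)"
        using that(2,4) unfolding homogeneous_def by (metis R.r_right_minus_eq R.zero_closed)
      show "A.ev (\<lambda>M. P M \<ominus>\<^bsub>R\<^esub> P' M) = \<zero>\<^bsub>R\<^esub>"
        using that by (subst A.ev_minus) (auto simp: R.minus_eq R.r_neg)
    qed (rule l)
    then have "P \<ominus>\<^bsub>mpoly_ring R m\<^esub> P' \<in> ?Q" using S_Q c by auto
    then have "?cls (P \<ominus>\<^bsub>mpoly_ring R m\<^esub> P') = \<zero>\<^bsub>?C\<^esub>" using cls0 that by (meson MP.minus_closed)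
    then have "?cls P \<ominus>\<^bsub>?C\<^esub> ?cls P' = \<zero>\<^bsub>?C\<^esub>"
      using that by (simp add: a_minus_def del: R.mpoly_simps)
    then show ?thesis using that by (simp add: C.r_right_minus_eq)
  qed
  define \<kappa> where "\<kappa> b = ?cls (B b)" for b
  have sl: "semilinear R I ?C ?\<phi> \<kappa>"
    unfolding semilinear_def
  proof (intro conjI ballI)
    fix b assume "b \<in> I" then show "\<kappa> b \<in> carrier ?C" using B by (simp add: \<kappa>_def)
  next
    fix b c assume bc: "b \<in> I" "c \<in> I"
    have "?cls (B (b \<oplus>\<^bsub>R\<^esub> c)) = ?cls (B b \<oplus>\<^bsub>mpoly_ring R m\<^esub> B c)"
    proof (rule lin_eq)
      show "homogeneous R 1 (B b \<oplus>\<^bsub>mpoly_ring R m\<^esub> B c)"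
        using B(2)[OF bc(1)] B(2)[OF bc(2)] by (auto simp: homogeneous_def) (metis R.l_zero R.zero_closed)
      show "A.ev (B (b \<oplus>\<^bsub>R\<^esub> c)) = A.ev (B b \<oplus>\<^bsub>mpoly_ring R m\<^esub> B c)"
        using B bc I.a_closed by (simp add: A.ev_add)
    qed (use B bc I.a_closed MP.a_closed in auto)
    then show "\<kappa> (b \<oplus>\<^bsub>R\<^esub> c) = \<kappa> b \<oplus>\<^bsub>?C\<^esub> \<kappa> c"
      using B bc by (simp add: \<kappa>_def del: R.mpoly_simps)
  next
    fix r b assume rb: "r \<in> carrier R" "b \<in> I"
    have rbI: "r \<otimes>\<^bsub>R\<^esub> b \<in> I" using rb by (intro I.I_l_closed)
    have "?cls (B (r \<otimes>\<^bsub>R\<^esub> b)) = ?cls (R.indexed_const r \<otimes>\<^bsub>mpoly_ring R m\<^esub> B b)"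
    proof (rule lin_eq)
      have "homogeneous R 0 (R.indexed_const r :: nat multiset \<Rightarrow> 'a)"
        by (auto simp: homogeneous_def R.indexed_const_def)
      then show "homogeneous R 1 (R.indexed_const r \<otimes>\<^bsub>mpoly_ring R m\<^esub> B b)"
        using R.homogeneous_mult[of "R.indexed_const r" m "B b" 0 1] B rb by simp
      show "A.ev (B (r \<otimes>\<^bsub>R\<^esub> b)) = A.ev (R.indexed_const r \<otimes>\<^bsub>mpoly_ring R m\<^esub> B b)"
        using B rb rbI by (simp add: A.ev_mult)
      show "R.indexed_const r \<otimes>\<^bsub>mpoly_ring R m\<^esub> B b \<in> carrier (mpoly_ring R m)"
        using B rb by (intro MP.m_closed) auto
    qed (use B rbI in auto)
    then show "\<kappa> (r \<otimes>\<^bsub>R\<^esub> b) = ?\<phi> r \<otimes>\<^bsub>?C\<^esub> \<kappa> b"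
      using B rb by (simp add: \<kappa>_def del: R.mpoly_simps)
  qed
  interpret G: rees_map R ?C I ?\<phi> \<kappa>
    using R C.is_cring I.is_ideal \<phi> sl by (intro rees_map_intro)
  interpret G: presentation R ?C I ?\<phi> \<kappa> m a
    by unfold_locales (use I R.genideal_self[OF sub] in auto)
  have ev_cls: "G.B.ev P = ?cls P" if "P \<in> carrier (mpoly_ring R m)" for P
  proof -
    have "P \<in> R.indexed_pset {..<m} (carrier R)" using that by (simp add: mpoly_ring_def)
    then show ?thesis
    proof induction
      case (indexed_const k)
      then show ?case by simp
    next
      case (indexed_padd P Q)
      then have c: "P \<in> carrier (mpoly_ring R m)" "Q \<in> carrier (mpoly_ring R m)"
        by (simp_all add: mpoly_ring_def)
      have "R.indexed_padd P Q = P \<oplus>\<^bsub>mpoly_ring R m\<^esub> Q" by (simp add: R.indexed_padd_def)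
      then show ?case using indexed_padd.IH c G.B.ev_add[OF c] cls.hom_add[OF c] by (simp only: R.mpoly_simps)
    next
      case (indexed_pmult P i)
      then have c: "P \<in> carrier (mpoly_ring R m)" "i < m" by (simp_all add: mpoly_ring_def)
      have v: "R.indexed_var i \<in> carrier (mpoly_ring R m)" using c by (intro R.mpoly_var_closed)
      have aI: "a i \<in> I" using c I R.genideal_self[OF sub] by auto
      have e: "R.indexed_pmult P i = P \<otimes>\<^bsub>mpoly_ring R m\<^esub> R.indexed_var i"
        using c by (simp add: R.mpoly_mult_var)
      have k: "\<kappa> (a i) = ?cls (R.indexed_var i)"
        unfolding \<kappa>_def using B[OF aI] v c G.homogeneous_var[of i] A.ev_var[of i] by (intro lin_eq) auto
      have "G.B.ev (R.indexed_pmult P i) = ?cls P \<otimes>\<^bsub>?C\<^esub> ?cls (R.indexed_var i)"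
        using c indexed_pmult.IH by (simp add: G.B.ev_pmult k)
      also have "\<dots> = ?cls (P \<otimes>\<^bsub>mpoly_ring R m\<^esub> R.indexed_var i)"
        using cls.hom_mult[OF c(1) v] by simp
      finally show ?case unfolding e .
    qed
  qed
  have "single_valued_at R I ?C ?\<phi> \<kappa> n" if n: "n \<le> l" for n
    unfolding single_valued_at_def
  proof (intro allI impI)
    fix w assume "rees_graph R I ?C ?\<phi> \<kappa> n \<zero>\<^bsub>R\<^esub> w"
    from G.G_form[OF this] obtain P where P: "P \<in> carrier (mpoly_ring R m)" "homogeneous R n P"
      "A.ev P = \<zero>\<^bsub>R\<^esub>" "G.B.ev P = w" by blast
    then have "P \<in> ?Q" using rel[OF P(1-3) n] S_Q by blast
    then show "w = \<zero>\<^bsub>?C\<^esub>" using P(4) ev_cls[OF P(1)] cls0[OF P(1)] by metis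
  qed
  then have sv: "single_valued_at R I ?C ?\<phi> \<kappa> n" for n
    using le C.is_cring \<phi> sl unfolding type_le_def by blast
  show "form_relations R m a \<subseteq> ?Q"
  proof
    fix P assume P: "P \<in> form_relations R m a"
    then have Pc: "P \<in> carrier (mpoly_ring R m)" by (simp add: form_relations_def)
    then have "finite (size ` {M. P M \<noteq> \<zero>\<^bsub>R\<^esub>})" by (simp add: R.mpoly_carrier_iff)
    then obtain d where "\<And>M. P M \<noteq> \<zero>\<^bsub>R\<^esub> \<Longrightarrow> size M \<le> d"
      unfolding finite_nat_set_iff_bounded_le by blast
    then have "G.B.ev P = \<zero>\<^bsub>?C\<^esub>" using sv P by (intro G.single_valued_imp_vanish)
    then show "P \<in> ?Q" using ev_cls[OF Pc] cls0[OF Pc] by metis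
  qed
qed

context cring
begin

lemma ideal_power_0 [simp]: "ideal_power R I 0 = carrier R"
  by (simp add: ideal_power_def ideals_set_def)

lemma ideal_power_Suc: "ideal_power R I (Suc n) = ideal_prod R (ideal_power R I n) I"
  by (simp add: ideal_power_def ideals_set_def)

lemma ideal_power_ideal: "ideal I R \<Longrightarrow> ideal (ideal_power R I n) R"
  by (induction n) (auto simp: ideal_power_Suc oneideal ideal_prod_is_ideal)

lemma ideal_power_1: "ideal I R \<Longrightarrow> ideal_power R I (Suc 0) = I"
  using ideal_prod_one[of I] ideal_prod_commute[of I "carrier R"] oneideal by (simp add: ideal_power_Suc)

lemma ideal_power_add:
  assumes "ideal I R"
  shows "ideal_power R I (i + j) = ideal_prod R (ideal_power R I i) (ideal_power R I j)"
proof -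
  interpret IS: comm_monoid "ideals_set R" by (rule ideals_set_is_comm_monoid)
  show ?thesis using IS.nat_pow_mult[of I i j] assms by (simp add: ideal_power_def) (simp add: ideals_set_def)
qed

lemma ideal_power_mult:
  assumes "ideal I R" "a \<in> ideal_power R I i" "b \<in> ideal_power R I j"
  shows "a \<otimes> b \<in> ideal_power R I (i + j)"
  unfolding ideal_power_add[OF assms(1)] using assms by (intro ideal_prod.prod)

lemma ideal_power_closed: "ideal I R \<Longrightarrow> a \<in> ideal_power R I n \<Longrightarrow> a \<in> carrier R"
  using ideal_power_ideal ideal.Icarr by metis

lemma ideal_power_zero: "ideal I R \<Longrightarrow> \<zero> \<in> ideal_power R I n"
  using ideal_power_ideal additive_subgroup.zero_closed ideal.axioms(1) by metis

lemma ideal_power_plus: "ideal I R \<Longrightarrow> a \<in> ideal_power R I n \<Longrightarrow> b \<in> ideal_power R I n \<Longrightarrow>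
  a \<oplus> b \<in> ideal_power R I n"
  using ideal_power_ideal additive_subgroup.a_closed ideal.axioms(1) by metis

lemma ideal_power_uminus: "ideal I R \<Longrightarrow> a \<in> ideal_power R I n \<Longrightarrow> \<ominus> a \<in> ideal_power R I n"
  using ideal_power_ideal additive_subgroup.a_inv_closed ideal.axioms(1) by metis

lemma ideal_finsum_closed:
  assumes "ideal I R" "\<And>i. i \<in> A \<Longrightarrow> f i \<in> I"
  shows "finsum R f A \<in> I"
proof (cases "finite A")
  case True
  then show ?thesis using assms(2)
  proof (induction A)
    case empty
    then show ?case using assms(1) additive_subgroup.zero_closed ideal.axioms(1) by fastforce
  next
    case (insert x F)
    then have "finsum R f (insert x F) = f x \<oplus> finsum R f F"
      using insert ideal.Icarr[OF assms(1)] by (intro finsum_insert) auto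
    then show ?case using insert assms(1) additive_subgroup.a_closed ideal.axioms(1) by fastforce
  qed
next
  case False
  then show ?thesis using assms(1) additive_subgroup.zero_closed ideal.axioms(1) by fastforce
qed

end

locale rees = R?: cring R + I?: ideal I R for R (structure) and I
begin

abbreviation "U \<equiv> UP R"
abbreviation "A \<equiv> rees_algebra R I"

sublocale UP_cring R U
  by unfold_locales simp_all

lemma carrier_A: "carrier A = {p \<in> carrier U. \<forall>n. up_ring.coeff U p n \<in> ideal_power R I n}"
  by (simp add: rees_algebra_def)

lemma A_simps [simp]: "monoid.mult A = monoid.mult U" "ring.add A = ring.add U" "monoid.one A = monoid.one U" "ring.zero A = ring.zero U" "module.smult A = module.smult U"
  by (simp_all add: rees_algebra_def)

lemma A_subcring: "subcring (carrier A) U"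
proof (rule P.subcringI', rule P.subringI)
  note I = I.is_ideal
  show "carrier A \<subseteq> carrier U" by (auto simp: carrier_A)
  show "\<one>\<^bsub>U\<^esub> \<in> carrier A" using R.ideal_power_zero[OF I] by (auto simp: carrier_A)
  fix p assume p: "p \<in> carrier A"
  then show "\<ominus>\<^bsub>U\<^esub> p \<in> carrier A" using R.ideal_power_uminus[OF I] by (auto simp: carrier_A)
  fix q assume q: "q \<in> carrier A"
  show "p \<oplus>\<^bsub>U\<^esub> q \<in> carrier A" using p q R.ideal_power_plus[OF I] by (auto simp: carrier_A)
  have "(\<Oplus>i\<in>{..n}. up_ring.coeff U p i \<otimes> up_ring.coeff U q (n - i)) \<in> ideal_power R I n" for n
  proof (rule R.ideal_finsum_closed[OF R.ideal_power_ideal[OF I]])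
    fix i assume "i \<in> {..n}"
    then show "up_ring.coeff U p i \<otimes> up_ring.coeff U q (n - i) \<in> ideal_power R I n"
      using p q R.ideal_power_mult[OF I, of "up_ring.coeff U p i" i "up_ring.coeff U q (n - i)" "n - i"] by (simp add: carrier_A)
  qed
  then show "p \<otimes>\<^bsub>U\<^esub> q \<in> carrier A" using p q by (auto simp: carrier_A)
qed

lemma A_cring: "cring A"
proof -
  have "cring (U \<lparr>carrier := carrier A\<rparr>)"
    using P.subcring_iff[of "carrier A"] A_subcring by (auto simp: carrier_A)
  moreover have "U \<lparr>carrier := carrier A\<rparr> = A" unfolding carrier_A by (simp add: rees_algebra_def)
  ultimately show ?thesis by simp
qed

lemma A_carrier_U: "p \<in> carrier A \<Longrightarrow> p \<in> carrier U" by (simp add: carrier_A)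

definition "const r = up_ring.monom U r 0"

lemma const_hom: "const \<in> ring_hom R A"
proof (rule ring_hom_memI)
  fix x y assume xy: "x \<in> carrier R" "y \<in> carrier R"
  show "const x \<in> carrier A" using xy R.ideal_power_zero[OF I.is_ideal] by (auto simp: const_def carrier_A)
  show "const (x \<otimes> y) = const x \<otimes>\<^bsub>A\<^esub> const y" using monom_mult[of x y 0 0] xy by (simp add: const_def)
qed (simp_all add: const_def monom_one)

lemma monom_in_A: "a \<in> ideal_power R I n \<Longrightarrow> up_ring.monom U a n \<in> carrier A"
  using R.ideal_power_closed[OF I.is_ideal] R.ideal_power_zero[OF I.is_ideal] by (auto simp: carrier_A)

end

locale rees_generators = rees R I for R (structure) and I +
  fixes m :: nat and a f
  assumes a_I: "i < m \<Longrightarrow> a i \<in> I" and f_eq: "i < m \<Longrightarrow> f i = up_ring.monom (UP R) (a i) 1"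
begin

sublocale AC: cring A by (rule A_cring)

sublocale F: evaluation R A const m f
proof (unfold_locales)
  fix i assume "i < m"
  then show "f i \<in> carrier A" using f_eq a_I monom_in_A[of "a i" 1] R.ideal_power_1[OF I.is_ideal] by simp
qed (rule const_hom)

sublocale E: self_evaluation R m a
  by unfold_locales (use a_I I.Icarr in auto)

lemma mpoly_eval_eq:
  assumes P: "P \<in> carrier (mpoly_ring R m)"
  shows "mpoly_eval R A m f P = F.ev P"
  unfolding mpoly_eval_def poly_ev_def
proof (rule AC.finsum_cong')
  fix M
  have k: "P M \<in> carrier R" using P by (rule R.mpoly_coeff)
  have "const (P M) \<otimes>\<^bsub>A\<^esub> F.mval M = P M \<odot>\<^bsub>A\<^esub> F.mval M"
    using monom_mult_is_smult[OF k A_carrier_U[OF F.mval_closed]] by (simp add: const_def)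
  then show "P M \<odot>\<^bsub>A\<^esub> F.mval M = const (P M) \<otimes>\<^bsub>A\<^esub> F.mval M" by simp
next
  show "(\<lambda>M. const (P M) \<otimes>\<^bsub>A\<^esub> F.mval M) \<in> {M. P M \<noteq> \<zero>} \<rightarrow> carrier A"
    using R.mpoly_coeff[OF P] ring_hom_closed[OF const_hom] by (intro Pi_I AC.m_closed F.mval_closed) auto
qed simp

text \<open>Substituting \<open>T\<^sub>i \<mapsto> a\<^sub>i t\<close> multiplies a monomial of degree \<open>n\<close> by \<open>t\<^sup>n\<close>, so the powers of
  \<open>t\<close> separate the homogeneous components.\<close>

lemma coeff_ev:
  assumes "P \<in> carrier (mpoly_ring R m)"
  shows "up_ring.coeff U (F.ev P) n = E.ev (hcomp R n P)"
proof -
  have "P \<in> R.indexed_pset {..<m} (carrier R)" using assms by (simp add: mpoly_ring_def)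
  then show ?thesis
  proof (induction arbitrary: n)
    case (indexed_const k)
    have "hcomp R n (R.indexed_const k) = (if n = 0 then R.indexed_const k else (\<lambda>M. \<zero>))"
      by (auto simp: hcomp_def R.indexed_const_def fun_eq_iff)
    moreover have "F.ev (R.indexed_const k) = up_ring.monom U k 0"
      using F.ev_const[OF indexed_const] unfolding const_def .
    ultimately show ?case using indexed_const by simp
  next
    case (indexed_padd P Q)
    then have c: "P \<in> carrier (mpoly_ring R m)" "Q \<in> carrier (mpoly_ring R m)"
      by (simp_all add: mpoly_ring_def)
    have "hcomp R n (R.indexed_padd P Q) = (\<lambda>M. hcomp R n P M \<oplus> hcomp R n Q M)"
      by (auto simp: hcomp_def R.indexed_padd_def fun_eq_iff)
    then have 1: "E.ev (hcomp R n (R.indexed_padd P Q)) = E.ev (hcomp R n P) \<oplus> E.ev (hcomp R n Q)"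
      using E.ev_add[OF R.hcomp_closed[OF c(1)] R.hcomp_closed[OF c(2)]] by simp
    have "F.ev (R.indexed_padd P Q) = F.ev P \<oplus>\<^bsub>U\<^esub> F.ev Q"
      using F.ev_add[OF c] by (simp add: R.indexed_padd_def)
    then show ?case using 1 indexed_padd.IH A_carrier_U[OF F.ev_closed[OF c(1)]] A_carrier_U[OF F.ev_closed[OF c(2)]]
      by simp
  next
    case (indexed_pmult P i)
    then have c: "P \<in> carrier (mpoly_ring R m)" "i < m" by (simp_all add: mpoly_ring_def)
    have ai: "a i \<in> carrier R" using a_I c I.Icarr by blast
    note FU = A_carrier_U[OF F.ev_closed[OF c(1)]]
    have "up_ring.coeff U (F.ev (R.indexed_pmult P i)) n = up_ring.coeff U (up_ring.monom U (a i) 1 \<otimes>\<^bsub>U\<^esub> F.ev P) n"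
      using F.ev_pmult[OF c] f_eq[OF c(2)] FU ai by (simp add: P.m_comm)
    also have "\<dots> = E.ev (hcomp R n (R.indexed_pmult P i))"
    proof (cases n)
      case 0
      have "hcomp R n (R.indexed_pmult P i) = (\<lambda>M. \<zero>)"
        using 0 by (auto simp: hcomp_def R.indexed_pmult_def fun_eq_iff)
      then show ?thesis using 0 ai FU by simp
    next
      case (Suc k)
      have "hcomp R n (R.indexed_pmult P i) = R.indexed_pmult (hcomp R k P) i"
        using Suc by (auto simp: hcomp_def R.indexed_pmult_def fun_eq_iff dest!: multi_member_split)
      then have "E.ev (hcomp R n (R.indexed_pmult P i)) = E.ev (hcomp R k P) \<otimes> a i"
        using E.ev_pmult[OF R.hcomp_closed[OF c(1)] c(2)] by simp
      moreover have "up_ring.coeff U (up_ring.monom U (a i) 1 \<otimes>\<^bsub>U\<^esub> F.ev P) n = a i \<otimes> up_ring.coeff U (F.ev P) k"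
        using coeff_monom_mult[OF ai FU, of 1 k] Suc by simp
      ultimately show ?thesis using indexed_pmult.IH[of k] ai R.hcomp_closed[OF c(1)] by (simp add: R.m_comm)
    qed
    finally show ?case .
  qed
qed

lemma relations_eq: "relations R A m f = form_relations R m a"
proof -
  have "F.ev P = \<zero>\<^bsub>U\<^esub> \<longleftrightarrow> (\<forall>n. E.ev (hcomp R n P) = \<zero>)" if P: "P \<in> carrier (mpoly_ring R m)" for P
    using up_eqI[OF _ A_carrier_U[OF F.ev_closed[OF P]] UP_zero_closed] coeff_ev[OF P] by (metis coeff_zero)
  then show ?thesis
    unfolding relations_def form_relations_def by (auto simp: mpoly_eval_eq)
qed

lemma relations_ideal: "ideal (form_relations R m a) (mpoly_ring R m)"
proof -
  interpret MP: cring "mpoly_ring R m" by (rule R.mpoly_cring)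
  have "ideal (a_kernel (mpoly_ring R m) A F.ev) (mpoly_ring R m)"
    by (rule ring_hom_ring.kernel_is_ideal)
      (rule ring_hom_ringI2[OF MP.ring_axioms AC.ring_axioms F.ev_ring_hom])
  also have "a_kernel (mpoly_ring R m) A F.ev = relations R A m f"
    unfolding a_kernel_def' relations_def by (auto simp: mpoly_eval_eq)
  finally show ?thesis by (simp add: relations_eq)
qed

lemma relations_upto_eq: "relations_upto R A m f l = form_relations_upto R m a l"
  by (simp add: relations_upto_def form_relations_upto_def relations_eq)

end

context rees
begin

lemma smult_one: "r \<in> carrier R \<Longrightarrow> r \<odot>\<^bsub>A\<^esub> \<one>\<^bsub>A\<^esub> = const r"
  using monom_mult_is_smult[of r "\<one>\<^bsub>U\<^esub>"] by (simp add: const_def)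

text \<open>Generators of degree one have the form \<open>a\<^sub>i t\<close>. The elements whose coefficient at \<open>t\<close> lies
  in the ideal generated by the \<open>a\<^sub>i\<close> form a subring, so that ideal contains the coefficient at
  \<open>t\<close> of every element of the Rees algebra, and these are all of \<open>I\<close>.\<close>

lemma standard_generators_obtain:
  assumes "standard_generators R A (rees_component R I) m f"
  obtains a where "rees_generators R I m a f" "I = genideal R (a ` {..<m})"
proof -
  interpret AC: cring A by (rule A_cring)
  have "\<forall>i<m. \<exists>b. b \<in> I \<and> f i = up_ring.monom U b 1"
    using assms R.ideal_power_1[OF I.is_ideal] by (auto simp: standard_generators_def rees_component_def)
  then obtain a where a: "\<And>i. i < m \<Longrightarrow> a i \<in> I" "\<And>i. i < m \<Longrightarrow> f i = up_ring.monom U (a i) 1" by metis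
  have rg: "rees_generators R I m a f" by unfold_locales (use a in auto)
  have sub: "a ` {..<m} \<subseteq> carrier R" using a I.Icarr by auto
  interpret J: ideal "genideal R (a ` {..<m})" R by (rule R.genideal_ideal[OF sub])
  let ?H = "(\<lambda>r. r \<odot>\<^bsub>A\<^esub> \<one>\<^bsub>A\<^esub>) ` carrier R \<union> f ` {..<m}"
  have "p \<in> carrier U \<and> up_ring.coeff U p 1 \<in> genideal R (a ` {..<m})" if "p \<in> generate_ring A ?H" for p
    using that
  proof (induction rule: generate_ring.induct)
    case one
    then show ?case by simp
  next
    case (incl h)
    then show ?case
    proof
      assume "h \<in> (\<lambda>r. r \<odot>\<^bsub>A\<^esub> \<one>\<^bsub>A\<^esub>) ` carrier R"
      then show ?thesis by (auto simp: smult_one const_def simp del: A_simps)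
    next
      assume "h \<in> f ` {..<m}"
      then obtain i where i: "i < m" "h = up_ring.monom U (a i) 1" using a by auto
      then show ?thesis using R.genideal_self[OF sub] sub by auto
    qed
  next
    case (a_inv h)
    have "h \<in> generate_ring A ?H" by fact
    then have "h \<in> carrier A" using assms by (simp add: standard_generators_def)
    then have "\<ominus>\<^bsub>A\<^esub> h = \<ominus>\<^bsub>U\<^esub> h"
    proof -
      assume h: "h \<in> carrier A"
      then have "\<ominus>\<^bsub>U\<^esub> h \<in> carrier A" using subringE(5)[OF subcring.axioms(1)[OF A_subcring]] by blast
      then show ?thesis using h a_inv by (intro AC.minus_equality) (auto simp: P.l_neg)
    qed
    then show ?case using a_inv by (simp add: J.a_inv_closed)
  next
    case (eng_add p q)
    then show ?case by (simp add: J.a_closed)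
  next
    case (eng_mult p q)
    then have "up_ring.coeff U (p \<otimes>\<^bsub>U\<^esub> q) 1 = up_ring.coeff U p 0 \<otimes> up_ring.coeff U q 1 \<oplus> up_ring.coeff U p 1 \<otimes> up_ring.coeff U q 0"
      by (simp add: coeff_mult atMost_Suc Pi_def R.a_comm)
    then show ?case using eng_mult by (simp add: J.a_closed J.I_l_closed J.I_r_closed)
  qed
  then have "up_ring.coeff U p 1 \<in> genideal R (a ` {..<m})" if "p \<in> carrier A" for p
    using that assms by (auto simp: standard_generators_def)
  then have "I \<subseteq> genideal R (a ` {..<m})"
    using monom_in_A[of _ 1] R.ideal_power_1[OF I.is_ideal] I.Icarr
    by (metis One_nat_def coeff_monom subsetI)
  moreover have "genideal R (a ` {..<m}) \<subseteq> I" using a by (intro R.genideal_minimal I.is_ideal) auto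
  ultimately show ?thesis using that rg by blast
qed

lemma standard_generators_exist:
  assumes "finite B" "I = genideal R B" "B \<subseteq> carrier R"
  shows "\<exists>m f. standard_generators R A (rees_component R I) m f"
proof -
  interpret AC: cring A by (rule A_cring)
  obtain m and a :: "nat \<Rightarrow> 'a" where B: "B = a ` {..<m}"
    using assms(1) by (metis finite_imp_nat_seg_image_inj_on lessThan_def)
  define f where "f i = up_ring.monom U (a i) 1" for i
  let ?H = "(\<lambda>r. r \<odot>\<^bsub>A\<^esub> \<one>\<^bsub>A\<^esub>) ` carrier R \<union> f ` {..<m}"
  let ?gen = "generate_ring A ?H"
  have aI: "a i \<in> I" if "i < m" for i using that R.genideal_self[OF assms(3)] B assms(2) by auto
  have fA: "f i \<in> carrier A" if "i < m" for i
    using monom_in_A[of "a i" 1] aI[OF that] R.ideal_power_1[OF I.is_ideal] by (simp add: f_def)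
  have constA: "const r \<in> carrier A" if "r \<in> carrier R" for r using const_hom that by (rule ring_hom_closed)
  have H: "?H \<subseteq> carrier A" using fA constA by (auto simp: smult_one simp del: A_simps)
  have Hc: "const r \<in> ?gen" if "r \<in> carrier R" for r
    using that by (intro generate_ring.incl UnI1 image_eqI[of _ _ r]) (auto simp: smult_one simp del: A_simps)
  have lin: "up_ring.monom U b 1 \<in> ?gen" if "b \<in> I" for b
  proof -
    have b: "b \<in> genideal R B" using that assms by simp
    note cl = subsetD[OF equalityD1[OF assms(2)[symmetric]], THEN I.Icarr]
    have sc: "up_ring.monom U (r \<otimes> x) 1 \<in> ?gen" if "r \<in> carrier R" "x \<in> genideal R B" "up_ring.monom U x 1 \<in> ?gen" for r x
    proof -
      have "const r \<otimes>\<^bsub>A\<^esub> up_ring.monom U x 1 \<in> ?gen" using that Hc by (intro generate_ring.eng_mult)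
      moreover have "const r \<otimes>\<^bsub>A\<^esub> up_ring.monom U x 1 = up_ring.monom U (r \<otimes> x) 1"
        using monom_mult[of r x 0 1] that cl by (simp add: const_def)
      ultimately show ?thesis by simp
    qed
    show ?thesis
    proof (rule R.genideal_induct[OF b assms(3), of "\<lambda>b. up_ring.monom U b 1 \<in> ?gen"])
      fix x assume "x \<in> B"
      then obtain i where "i < m" "x = a i" using B by auto
      then show "up_ring.monom U x 1 \<in> ?gen" by (auto simp: f_def intro!: generate_ring.incl)
    next
      fix x y assume xy: "x \<in> genideal R B" "y \<in> genideal R B" "up_ring.monom U x 1 \<in> ?gen" "up_ring.monom U y 1 \<in> ?gen"
      then have "up_ring.monom U x 1 \<oplus>\<^bsub>A\<^esub> up_ring.monom U y 1 \<in> ?gen" by (intro generate_ring.eng_add)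
      then show "up_ring.monom U (x \<oplus> y) 1 \<in> ?gen" using xy cl by simp
    next
      fix r x assume "r \<in> carrier R" "x \<in> genideal R B" "up_ring.monom U x 1 \<in> ?gen"
      then show "up_ring.monom U (x \<otimes> r) 1 \<in> ?gen" using sc cl by (metis R.m_comm)
    next
      have "const \<zero> \<in> ?gen" using Hc by simp
      then show "up_ring.monom U \<zero> 1 \<in> ?gen" by (simp add: const_def)
    qed (rule sc)
  qed
  have powers: "up_ring.monom U b n \<in> ?gen" if "b \<in> ideal_power R I n" for b n
    using that
  proof (induction n arbitrary: b)
    case 0
    then show ?case using Hc by (simp add: const_def)
  next
    case (Suc n)
    then have "b \<in> ideal_prod R (ideal_power R I n) I" by (simp add: R.ideal_power_Suc)
    then have "b \<in> carrier R \<and> up_ring.monom U b (Suc n) \<in> ?gen"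
    proof induction
      case (prod i j)
      have c: "i \<in> carrier R" "j \<in> carrier R" using prod R.ideal_power_closed[OF I.is_ideal] I.Icarr by auto
      have "up_ring.monom U i n \<otimes>\<^bsub>A\<^esub> up_ring.monom U j 1 \<in> ?gen" using prod Suc.IH lin by (intro generate_ring.eng_mult)
      then show ?case using monom_mult[OF c, of n 1] c by simp
    next
      case (sum s1 s2)
      then have "up_ring.monom U s1 (Suc n) \<oplus>\<^bsub>A\<^esub> up_ring.monom U s2 (Suc n) \<in> ?gen" by (intro generate_ring.eng_add) auto
      then show ?case using sum by simp
    qed
    then show ?case by blast
  qed
  have "p \<in> ?gen" if p: "p \<in> carrier A" for p
  proof -
    have pU: "p \<in> carrier U" using p by (rule A_carrier_U)
    have "(\<Oplus>\<^bsub>U\<^esub>i\<in>{..n}. up_ring.monom U (up_ring.coeff U p i) i) \<in> ?gen" for n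
    proof (induction n)
      case 0
      then show ?case using p pU powers[of "up_ring.coeff U p 0" 0] by (simp add: carrier_A)
    next
      case (Suc n)
      have "up_ring.monom U (up_ring.coeff U p (Suc n)) (Suc n) \<oplus>\<^bsub>A\<^esub> (\<Oplus>\<^bsub>U\<^esub>i\<in>{..n}. up_ring.monom U (up_ring.coeff U p i) i) \<in> ?gen"
        using p Suc powers[of "up_ring.coeff U p (Suc n)" "Suc n"] by (intro generate_ring.eng_add) (auto simp: carrier_A)
      then show ?case using pU by (simp add: Pi_def)
    qed
    from this[of "deg R p"] show ?thesis unfolding up_repr[OF pU] .
  qed
  then have "?gen = carrier A" using AC.generate_ring_incl[OF H] by blast
  moreover have "f ` {..<m} \<subseteq> rees_component R I 1"
    using aI R.ideal_power_1[OF I.is_ideal] by (auto simp: rees_component_def f_def)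
  ultimately have "standard_generators R A (rees_component R I) m f"
    by (simp add: standard_generators_def)
  then show ?thesis by blast
qed

end

text \<open>The condition on \<open>l\<close> that defines the relation type, free of generators. The first direction
  holds for every test ring, and the second needs the test rings of one type only.\<close>

lemma relation_type_wrt_cond:
  fixes R :: "('a, 'm) ring_scheme"
  assumes "cring R" "ideal I R" "standard_generators R (rees_algebra R I) (rees_component R I) m f" "1 \<le> l"
  shows "relations_upto R (rees_algebra R I) m f l = relations R (rees_algebra R I) m f \<Longrightarrow> type_le TYPE('c) l R I"
    and "type_le TYPE((nat multiset \<Rightarrow> 'a) set) l R I \<Longrightarrow>
      relations_upto R (rees_algebra R I) m f l = relations R (rees_algebra R I) m f"
proof -
  interpret R: rees R I using assms by (simp add: rees_def)
  obtain a where a: "rees_generators R I m a f" "I = genideal R (a ` {..<m})"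
    using R.standard_generators_obtain[OF assms(3)] by blast
  interpret a: rees_generators R I m a f by fact
  note eq = a.relations_upto_eq a.relations_eq
  show "type_le TYPE('c) l R I"
    if "relations_upto R (rees_algebra R I) m f l = relations R (rees_algebra R I) m f"
    by (rule relations_imp_type_le[OF assms(1) a.E.a_closed a(2)]) (use that in \<open>simp_all add: eq\<close>)
  show "relations_upto R (rees_algebra R I) m f l = relations R (rees_algebra R I) m f"
    if "type_le TYPE((nat multiset \<Rightarrow> 'a) set) l R I"
    unfolding eq
    by (rule type_le_imp_relations[OF assms(1) a.E.a_closed a(2) a.relations_ideal assms(4) that])
qed

text \<open>All systems of generators on either side give the same set of bounds \<open>l\<close>, hence the same
  least one. Each implication is required for test rings of the type that belongs to the ring in
  its conclusion.\<close>

lemma ideal_relation_type_eqI: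
  fixes R :: "('a, 'm) ring_scheme" and S :: "('b, 'n) ring_scheme"
  assumes R: "cring R" "noetherian_ring R" "ideal I R" and S: "cring S" "noetherian_ring S" "ideal J S"
    and RS: "\<And>l. type_le TYPE((nat multiset \<Rightarrow> 'b) set) l R I \<Longrightarrow> type_le TYPE((nat multiset \<Rightarrow> 'b) set) l S J"
    and SR: "\<And>l. type_le TYPE((nat multiset \<Rightarrow> 'a) set) l S J \<Longrightarrow> type_le TYPE((nat multiset \<Rightarrow> 'a) set) l R I"
  shows "ideal_relation_type R I = ideal_relation_type S J"
proof -
  interpret R: rees R I using R by (simp add: rees_def)
  interpret S: rees S J using S by (simp add: rees_def)
  let ?A = "\<lambda>m f. standard_generators R (rees_algebra R I) (rees_component R I) m f"
  let ?B = "\<lambda>m f. standard_generators S (rees_algebra S J) (rees_component S J) m f"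
  obtain B where X: "finite B" "I = genideal R B" "B \<subseteq> carrier R"
    using noetherian_ring.finetely_gen[OF R(2,3)] by blast
  obtain Y where Y: "finite Y" "J = genideal S Y" "Y \<subseteq> carrier S"
    using noetherian_ring.finetely_gen[OF S(2,3)] by blast
  obtain m0 f0 where 1: "?A m0 f0" using R.standard_generators_exist[OF X] by blast
  obtain n0 g0 where 2: "?B n0 g0" using S.standard_generators_exist[OF Y] by blast
  have eq: "relation_type_wrt R (rees_algebra R I) m f = relation_type_wrt S (rees_algebra S J) n g"
    if "?A m f" "?B n g" for m f n g
    unfolding relation_type_wrt_def
  proof (rule arg_cong[where f = Least], rule ext, rule conj_cong[OF refl])
    fix l :: nat assume l: "1 \<le> l"
    note 1 = relation_type_wrt_cond[OF R(1,3) that(1) l] and 2 = relation_type_wrt_cond[OF S(1,3) that(2) l]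
    show "(relations_upto R (rees_algebra R I) m f l = relations R (rees_algebra R I) m f) =
      (relations_upto S (rees_algebra S J) n g l = relations S (rees_algebra S J) n g)"
      by (rule iffI) (erule 2(2)[OF RS[OF 1(1)]], erule 1(2)[OF SR[OF 2(1)]])
  qed
  have "(\<exists>m f. ?A m f \<and> r = relation_type_wrt R (rees_algebra R I) m f) \<longleftrightarrow>
    (\<exists>m f. ?B m f \<and> r = relation_type_wrt S (rees_algebra S J) m f)" for r
    using 1 2 eq by metis
  then show ?thesis unfolding ideal_relation_type_def relation_type_def by simp
qed

section \<open>The Artin-Rees lemma\<close>

lemma nat_monotone_subsequence:
  fixes f :: "nat \<Rightarrow> nat"
  shows "\<exists>r :: nat \<Rightarrow> nat. strict_mono r \<and> mono (\<lambda>n. f (r n))"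
proof -
  obtain s :: "nat \<Rightarrow> nat" where s: "strict_mono s" "monoseq (\<lambda>n. f (s n))" using seq_monosub by blast
  show ?thesis
  proof (cases "incseq (\<lambda>n. f (s n))")
    case True
    then show ?thesis using s(1) by (intro exI[of _ s] conjI)
  next
    case False
    then have dec: "\<And>i j. i \<le> j \<Longrightarrow> f (s j) \<le> f (s i)" using s(2) by (auto simp: monoseq_def incseq_def)
    define v where "v = (LEAST v. \<exists>i. v = f (s i))"
    have "\<exists>i. v = f (s i)" unfolding v_def by (rule LeastI_ex) blast
    then obtain i0 where i0: "v = f (s i0)" by blast
    have "f (s (i + i0)) = v" for i
    proof (rule antisym)
      show "f (s (i + i0)) \<le> v" using dec[of i0 "i + i0"] i0 by simp
      show "v \<le> f (s (i + i0))" unfolding v_def by (rule Least_le) blast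
    qed
    moreover have "strict_mono (\<lambda>i. s (i + i0))" using s(1) by (simp add: strict_mono_def)
    ultimately show ?thesis by (intro exI[of _ "\<lambda>i. s (i + i0)"]) (simp add: mono_def)
  qed
qed

text \<open>Pass to a subsequence for one exponent after the other.\<close>

lemma dickson:
  fixes N :: "nat \<Rightarrow> nat multiset"
  assumes "\<And>i. set_mset (N i) \<subseteq> {..<d}"
  shows "\<exists>r :: nat \<Rightarrow> nat. strict_mono r \<and> (\<forall>i j. i \<le> j \<longrightarrow> N (r i) \<subseteq># N (r j))"
proof -
  have "\<exists>r :: nat \<Rightarrow> nat. strict_mono r \<and> (\<forall>k<e. mono (\<lambda>i. count (N (r i)) k))" for e
  proof (induction e)
    case 0
    show ?case by (rule exI[of _ "\<lambda>i. i"]) (simp add: strict_mono_def)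
  next
    case (Suc e)
    then obtain r :: "nat \<Rightarrow> nat" where r: "strict_mono r" "\<forall>k<e. mono (\<lambda>i. count (N (r i)) k)" by blast
    obtain s :: "nat \<Rightarrow> nat" where s: "strict_mono s" "mono (\<lambda>i. count (N (r (s i))) e)"
      using nat_monotone_subsequence[of "\<lambda>i. count (N (r i)) e"] by blast
    have "mono (\<lambda>i. count (N (r (s i))) k)" if "k < Suc e" for k
    proof (cases "k = e")
      case False
      then have "mono (\<lambda>i. count (N (r i)) k)" using r that by simp
      then show ?thesis using strict_mono_mono[OF s(1)] by (auto simp: mono_def)
    qed (use s in simp)
    moreover have "strict_mono (\<lambda>i. r (s i))" using r(1) s(1) by (simp add: strict_mono_def)
    ultimately show ?case by blast
  qed
  from this[of d] obtain r :: "nat \<Rightarrow> nat" where r: "strict_mono r" "\<And>k. k < d \<Longrightarrow> mono (\<lambda>i. count (N (r i)) k)" by blast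
  have "N (r i) \<subseteq># N (r j)" if "i \<le> j" for i j
  proof (rule mset_subset_eqI)
    fix k
    show "count (N (r i)) k \<le> count (N (r j)) k"
    proof (cases "k < d")
      case True then show ?thesis using r(2) that by (simp add: mono_def)
    next
      case False
      then have "k \<notin># N (r i)" using assms[of "r i"] by auto
      then show ?thesis by (simp add: not_in_iff)
    qed
  qed
  then show ?thesis using r(1) by blast
qed

text \<open>Otherwise each bound \<open>c\<close> has a monomial whose ideal is not that of any of its divisors of
  degree at most \<open>c\<close>. Iterating this along the degrees and passing to a divisibility chain by
  Dickson's lemma gives a strictly increasing sequence of ideals.\<close>

lemma (in noetherian_ring) dickson_ideals:
  fixes LC :: "nat multiset \<Rightarrow> 'a set"
  assumes ideal: "\<And>M. set_mset M \<subseteq> {..<d} \<Longrightarrow> ideal (LC M) R"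
    and mono: "\<And>M N. set_mset N \<subseteq> {..<d} \<Longrightarrow> M \<subseteq># N \<Longrightarrow> LC M \<subseteq> LC N"
  shows "\<exists>c. \<forall>M. set_mset M \<subseteq> {..<d} \<longrightarrow> (\<exists>M'. M' \<subseteq># M \<and> size M' \<le> c \<and> LC M \<subseteq> LC M')"
proof (rule ccontr)
  assume "\<not> ?thesis"
  then have "\<forall>c. \<exists>M. set_mset M \<subseteq> {..<d} \<and> (\<forall>M'. M' \<subseteq># M \<longrightarrow> size M' \<le> c \<longrightarrow> \<not> LC M \<subseteq> LC M')"
    by blast
  then obtain bad where bad: "\<And>c. set_mset (bad c) \<subseteq> {..<d}"
    "\<And>c M'. M' \<subseteq># bad c \<Longrightarrow> size M' \<le> c \<Longrightarrow> \<not> LC (bad c) \<subseteq> LC M'" by metis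
  define N where "N = rec_nat (bad 0) (\<lambda>_ M. bad (size M))"
  have N: "\<exists>c. N k = bad c" for k by (cases k) (auto simp: N_def)
  have NSuc: "N (Suc k) = bad (size (N k))" for k by (simp add: N_def)
  have size_less: "size (N k) < size (N (Suc k))" for k
  proof (rule ccontr)
    assume "\<not> size (N k) < size (N (Suc k))"
    then have "\<not> LC (bad (size (N k))) \<subseteq> LC (N (Suc k))"
      unfolding NSuc[symmetric] using bad(2)[of "N (Suc k)" "size (N k)"] NSuc[of k] by simp
    then show False using NSuc[of k] by simp
  qed
  then have sm: "strict_mono (\<lambda>k. size (N k))" by (simp add: strict_mono_Suc_iff)
  have Nd: "set_mset (N k) \<subseteq> {..<d}" for k using N bad(1) by metis
  obtain r :: "nat \<Rightarrow> nat" where r0: "strict_mono r \<and> (\<forall>i j. i \<le> j \<longrightarrow> N (r i) \<subseteq># N (r j))"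
    using dickson[OF Nd] by (rule exE)
  then have r: "strict_mono r" "\<And>i j. i \<le> j \<Longrightarrow> N (r i) \<subseteq># N (r j)" by simp_all
  have LCm: "LC (N (r i)) \<subseteq> LC (N (r j))" if "i \<le> j" for i j
    by (rule mono[OF Nd r(2)[OF that]])
  let ?C = "range (\<lambda>i. LC (N (r i)))"
  have "subset.chain {I. ideal I R} ?C"
    unfolding subset_chain_def
  proof (intro conjI ballI)
    show "?C \<subseteq> {I. ideal I R}" using ideal Nd by blast
    fix U V assume "U \<in> ?C" "V \<in> ?C"
    then obtain i j where "U = LC (N (r i))" "V = LC (N (r j))" by blast
    then show "U \<subseteq> V \<or> V \<subseteq> U" using LCm[of i j] LCm[of j i] nat_le_linear[of i j] by auto
  qed
  then have "\<Union>?C \<in> ?C" by (intro ideal_chain_is_trivial) auto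
  then obtain i where i: "\<Union>?C = LC (N (r i))" by blast
  have less: "r i < r (Suc i)" using r(1) by (simp add: strict_mono_def)
  then obtain k where k: "r (Suc i) = Suc k" "r i \<le> k" by (cases "r (Suc i)") auto
  have "size (N (r i)) \<le> size (N k)" using strict_mono_mono[OF sm] k(2) by (simp add: mono_def)
  then have "\<not> LC (N (r (Suc i))) \<subseteq> LC (N (r i))"
    using bad(2)[of "N (r i)" "size (N k)"] r(2)[of i "Suc i"] k(1) NSuc[of k] by simp
  then show False using i by blast
qed

context cring
begin

lemma ps_monomial_mult:
  assumes P: "\<And>M. P M \<in> carrier R" and k: "k \<in> carrier R"
  shows "(monomial R k L \<otimes>\<^bsub>power_series_ring R\<^esub> P) M = (if L \<subseteq># M then k \<otimes> P (M - L) else \<zero>)"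
proof -
  have "(\<Oplus>N \<in> {N. N \<subseteq># M}. monomial R k L N \<otimes> P (M - N))
     = (\<Oplus>N \<in> {N. N \<subseteq># M}. if L = N then k \<otimes> P (M - N) else \<zero>)"
    using assms by (intro finsum_cong') (auto simp: monomial_def)
  also have "\<dots> = (if L \<subseteq># M then k \<otimes> P (M - L) else \<zero>)"
  proof (cases "L \<subseteq># M")
    case True
    then show ?thesis using assms finite_submultisets by (subst add.finprod_singleton) auto
  next
    case False
    then show ?thesis using assms by (auto intro!: add.finprod_one_eqI)
  qed
  finally show ?thesis by (simp add: ps_mult)
qed

lemma homogeneous_monomial: "homogeneous R (size M) (monomial R k M)"
  by (auto simp: homogeneous_def monomial_def)

lemma ideal_power_antimono:
  assumes "ideal I R" "j \<le> n"
  shows "ideal_power R I n \<subseteq> ideal_power R I j"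
proof -
  have "ideal_power R I (j + (n - j)) \<subseteq> ideal_power R I j \<inter> ideal_power R I (n - j)"
    unfolding ideal_power_add[OF assms(1)] using assms by (intro ideal_prod_inter ideal_power_ideal)
  then show ?thesis using assms by simp
qed

end

context presentation
begin

lemma monomial_in_power:
  assumes "set_mset M \<subseteq> {..<m}"
  shows "A.mval M \<in> ideal_power R I (size M)"
  using assms
proof (induction M)
  case empty then show ?case by (simp add: A.mval_empty)
next
  case (add i M)
  then have "A.mval M \<otimes> a i \<in> ideal_power R I (size M + 1)"
    using a_I R.ideal_power_1[OF I.is_ideal] by (intro R.ideal_power_mult I.is_ideal) auto
  then show ?case using add A.mval_add_mset[of i M] by simp
qed

lemma power_form:
  assumes "b \<in> ideal_power R I n"
  shows "\<exists>P\<in>carrier (mpoly_ring R m). homogeneous R n P \<and> A.ev P = b"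
  using assms
proof (induction n arbitrary: b)
  case 0
  then show ?case by (intro bexI[of _ "R.indexed_const b"]) (auto simp: homogeneous_const)
next
  case (Suc n)
  then have "b \<in> ideal_prod R (ideal_power R I n) I" by (simp add: R.ideal_power_Suc)
  then show ?case
  proof induction
    case (prod b j)
    obtain P where P: "P \<in> carrier (mpoly_ring R m)" "homogeneous R n P" "A.ev P = b"
      using Suc.IH prod by blast
    obtain Q where Q: "Q \<in> carrier (mpoly_ring R m)" "homogeneous R 1 Q" "A.ev Q = j"
      using linear_form prod by blast
    show ?case using P Q R.homogeneous_mult[OF P(1) Q(1) P(2) Q(2)]
      by (intro bexI[of _ "P \<otimes>\<^bsub>power_series_ring R\<^esub> Q"]) (auto simp: A.ev_mult R.mpoly_mult_closed)
  next
    case (sum s1 s2)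
    then obtain P Q where P: "P \<in> carrier (mpoly_ring R m)" "homogeneous R (Suc n) P" "A.ev P = s1"
      and Q: "Q \<in> carrier (mpoly_ring R m)" "homogeneous R (Suc n) Q" "A.ev Q = s2" by blast
    then show ?case
      by (intro bexI[of _ "\<lambda>M. P M \<oplus> Q M"]) (auto simp: A.ev_add homogeneous_add)
  qed
qed

end

lemma (in cring) trivial_presentation:
  assumes "\<And>i. i < m \<Longrightarrow> a i \<in> carrier R" "I = genideal R (a ` {..<m})"
  shows "presentation R R I identity identity m a"
proof -
  have sub: "a ` {..<m} \<subseteq> carrier R" using assms by auto
  interpret I: ideal I R unfolding assms(2) by (rule genideal_ideal[OF sub])
  have z: "semilinear R I R identity identity"
    by (auto simp: semilinear_def identity_apply)
  interpret Z: rees_map R R I identity identity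
    using is_cring I.is_ideal z identity_hom by (intro rees_map_intro)
  show ?thesis
    by unfold_locales (use assms genideal_self[OF sub] in auto)
qed

text \<open>For a monomial \<open>M\<close> let \<open>LC M\<close> be the ideal of the coefficients at \<open>M\<close> of forms with leading
  monomial at most \<open>M\<close> whose values, at generators of \<open>I\<close>, lie in \<open>W\<close>. These ideals increase with
  \<open>M\<close>, so they all come from monomials of degree at most some \<open>c\<close>. A form of degree \<open>n\<close> with value
  in \<open>W\<close> can then be reduced to zero by subtracting multiples of forms of degree at most \<open>c\<close>, and
  each multiple has its value in \<open>I\<^sup>n\<^sup>-\<^sup>c W\<close>.\<close>

theorem artin_rees:
  assumes R: "cring R" "noetherian_ring R" and I: "ideal I R" and W: "ideal W R"
  shows "\<exists>c. \<forall>n. ideal_power R I n \<inter> W \<subseteq> ideal_prod R (ideal_power R I (n - c)) W"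
proof -
  interpret R: cring R by fact
  interpret N: noetherian_ring R by fact
  interpret W: ideal W R by fact
  obtain B where B: "B \<subseteq> carrier R" "finite B" "I = genideal R B" using N.finetely_gen[OF I] by blast
  obtain d and a :: "nat \<Rightarrow> _" where Ba: "B = a ` {..<d}"
    using B(2) by (metis finite_imp_nat_seg_image_inj_on lessThan_def)
  interpret presentation R R I identity identity d a
    using B Ba by (intro R.trivial_presentation) auto
  let ?MP = "mpoly_ring R d"
  interpret MP: cring ?MP by (rule R.mpoly_cring)
  \<comment> \<open>The monomials are ordered by the multiset order, a well-founded total order that is
    compatible with multiplication. The leading coefficient may be zero, so that the coefficients
    form an ideal.\<close>
  define lead where "lead P M \<longleftrightarrow> P \<in> carrier ?MP \<and> homogeneous R (size M) P \<and> (\<forall>M'. P M' \<noteq> \<zero>\<^bsub>R\<^esub> \<longrightarrow> M' \<le> M) \<and> A.ev P \<in> W"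
    for P :: "nat multiset \<Rightarrow> _" and M
  define LC where "LC M = {P M | P. lead P M}" for M
  have LC_I: "y \<in> LC M" if "lead P M" "P M = y" for P M y using that unfolding LC_def by blast
  have lead_add: "lead (\<lambda>M. P M \<oplus>\<^bsub>R\<^esub> Q M) M" if "lead P M" "lead Q M" for P Q M
    using that unfolding lead_def
    by (auto simp: A.ev_add homogeneous_add W.a_closed) (metis R.l_zero R.zero_closed)
  have shift: "lead (monomial R k L \<otimes>\<^bsub>power_series_ring R\<^esub> P) (M + L)"
    "(monomial R k L \<otimes>\<^bsub>power_series_ring R\<^esub> P) (M + L) = k \<otimes>\<^bsub>R\<^esub> P M"
    if P: "lead P M" and L: "set_mset L \<subseteq> {..<d}" and k: "k \<in> carrier R" for P M L k
  proof -
    have Pc: "P \<in> carrier ?MP" "\<And>M. P M \<in> carrier R" using P R.mpoly_coeff by (auto simp: lead_def)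
    have mc: "monomial R k L \<in> carrier ?MP" using L k by (intro R.mpoly_monomial_closed)
    note f = R.ps_monomial_mult[of P k L, OF Pc(2) k]
    show "(monomial R k L \<otimes>\<^bsub>power_series_ring R\<^esub> P) (M + L) = k \<otimes>\<^bsub>R\<^esub> P M" by (simp add: f)
    have "M' \<le> M + L" if "(monomial R k L \<otimes>\<^bsub>power_series_ring R\<^esub> P) M' \<noteq> \<zero>\<^bsub>R\<^esub>" for M'
    proof -
      have "L \<subseteq># M'" "P (M' - L) \<noteq> \<zero>\<^bsub>R\<^esub>" using that k by (auto simp: f split: if_splits)
      then have "M' - L \<le> M" using P by (auto simp: lead_def)
      then have "M' - L + L \<le> M + L" by (rule add_right_mono)
      then show ?thesis using \<open>L \<subseteq># M'\<close> by simp
    qed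
    moreover have "homogeneous R (size (M + L)) (monomial R k L \<otimes>\<^bsub>power_series_ring R\<^esub> P)"
      using R.homogeneous_mult[OF mc Pc(1) R.homogeneous_monomial, of "size M"] P by (simp add: lead_def add.commute)
    moreover have "A.ev (monomial R k L \<otimes>\<^bsub>power_series_ring R\<^esub> P) \<in> W"
      using A.ev_mult[OF mc Pc(1)] P A.ev_closed[OF mc] by (simp add: lead_def W.I_l_closed)
    ultimately show "lead (monomial R k L \<otimes>\<^bsub>power_series_ring R\<^esub> P) (M + L)"
      using mc Pc by (simp add: lead_def R.mpoly_mult_closed)
  qed
  have zero_lead: "lead (\<lambda>M. \<zero>\<^bsub>R\<^esub>) M" for M by (simp add: lead_def homogeneous_def)
  have LC_ideal: "ideal (LC M) R" for M
  proof (rule idealI[OF R.ring_axioms])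
    have scale: "k \<otimes>\<^bsub>R\<^esub> x \<in> LC M" if x: "x \<in> LC M" and k: "k \<in> carrier R" for x k
    proof -
      obtain P where P: "x = P M" "lead P M" using x unfolding LC_def by blast
      have s: "lead (monomial R k {#} \<otimes>\<^bsub>power_series_ring R\<^esub> P) M"
        "(monomial R k {#} \<otimes>\<^bsub>power_series_ring R\<^esub> P) M = k \<otimes>\<^bsub>R\<^esub> x"
        using shift[OF P(2), of "{#}" k] k P by simp_all
      show ?thesis by (rule LC_I[OF s])
    qed
    have sub: "LC M \<subseteq> carrier R" using R.mpoly_coeff by (auto simp: LC_def lead_def)
    show "subgroup (LC M) (add_monoid R)"
    proof (rule R.add.subgroupI)
      show "LC M \<noteq> {}" using zero_lead by (auto simp: LC_def)
      fix x y assume x: "x \<in> LC M"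
      have "\<ominus>\<^bsub>R\<^esub> \<one>\<^bsub>R\<^esub> \<otimes>\<^bsub>R\<^esub> x = \<ominus>\<^bsub>R\<^esub> x" using x sub by (simp add: R.l_minus subsetD)
      then show "\<ominus>\<^bsub>R\<^esub> x \<in> LC M" using scale[OF x, of "\<ominus>\<^bsub>R\<^esub> \<one>\<^bsub>R\<^esub>"] by simp
      assume y: "y \<in> LC M"
      obtain P Q where "x = P M" "lead P M" "y = Q M" "lead Q M" using x y by (auto simp: LC_def)
      then show "x \<oplus>\<^bsub>R\<^esub> y \<in> LC M" by (intro LC_I[OF lead_add]) auto
    qed (use sub in simp)
    fix x k assume x: "x \<in> LC M" "k \<in> carrier R"
    show "k \<otimes>\<^bsub>R\<^esub> x \<in> LC M" by (rule scale[OF x])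
    then show "x \<otimes>\<^bsub>R\<^esub> k \<in> LC M" using x sub by (simp add: R.m_comm subsetD)
  qed
  have LC_mono: "LC M \<subseteq> LC N" if N: "set_mset N \<subseteq> {..<d}" "M \<subseteq># N" for M N
  proof
    fix x assume "x \<in> LC M"
    then obtain P where P: "x = P M" "lead P M" by (auto simp: LC_def)
    have L: "set_mset (N - M) \<subseteq> {..<d}" using N by (meson in_diffD subset_iff)
    have x: "x \<in> carrier R" using P R.mpoly_coeff by (auto simp: lead_def)
    have s: "lead (monomial R \<one>\<^bsub>R\<^esub> (N - M) \<otimes>\<^bsub>power_series_ring R\<^esub> P) N"
      "(monomial R \<one>\<^bsub>R\<^esub> (N - M) \<otimes>\<^bsub>power_series_ring R\<^esub> P) N = x"
      using shift[OF P(2) L R.one_closed] N(2) P(1) x by simp_all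
    show "x \<in> LC N" by (rule LC_I[OF s])
  qed
  obtain c where c: "\<And>M. set_mset M \<subseteq> {..<d} \<Longrightarrow> \<exists>M'. M' \<subseteq># M \<and> size M' \<le> c \<and> LC M \<subseteq> LC M'"
    using N.dickson_ideals[of d LC, OF LC_ideal LC_mono] by blast
  have "A.ev P \<in> ideal_prod R (ideal_power R I (n - c)) W"
    if "P \<in> carrier ?MP" "homogeneous R n P" "\<forall>M. P M \<noteq> \<zero>\<^bsub>R\<^esub> \<longrightarrow> M \<le> K" "A.ev P \<in> W" for P n K
    using that
  proof (induction K arbitrary: P rule: less_induct)
    case (less K)
    let ?J = "ideal_prod R (ideal_power R I (n - c)) W"
    interpret J: ideal ?J R by (intro R.ideal_prod_is_ideal R.ideal_power_ideal I.is_ideal W)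
    note Pc = less.prems(1)[unfolded R.mpoly_carrier_iff]
    have lower: "A.ev Q \<in> ?J" if Q: "Q \<in> carrier ?MP" "homogeneous R n Q" "\<forall>M. Q M \<noteq> \<zero>\<^bsub>R\<^esub> \<longrightarrow> M < K" "A.ev Q \<in> W" for Q
    proof (cases "Q = (\<lambda>M. \<zero>\<^bsub>R\<^esub>)")
      case True then show ?thesis by simp
    next
      case False
      let ?S = "{M. Q M \<noteq> \<zero>\<^bsub>R\<^esub>}"
      have fin: "finite ?S" using Q(1) by (simp add: R.mpoly_carrier_iff)
      have "?S \<noteq> {}" using False by auto
      then have "Max ?S < K" using fin Q(3) by auto
      then show ?thesis using Q fin by (intro less.IH[of "Max ?S"]) auto
    qed
    show ?case
    proof (cases "P K = \<zero>\<^bsub>R\<^esub>")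
      case True
      then show ?thesis using less.prems by (intro lower) (auto simp: order.strict_iff_order)
    next
      case False
      then have K: "size K = n" "set_mset K \<subseteq> {..<d}" using less.prems(2) Pc by (auto simp: homogeneous_def)
      have lP: "lead P K" using less.prems K by (simp add: lead_def)
      then have "P K \<in> LC K" by (auto simp: LC_def)
      then obtain M' P' where M': "M' \<subseteq># K" "size M' \<le> c" and P': "lead P' M'" "P' M' = P K"
        using c[OF K(2)] by (fastforce simp: LC_def)
      define L where "L = K - M'"
      have L: "set_mset L \<subseteq> {..<d}" "M' + L = K" using K(2) M'(1) by (auto simp: L_def dest: in_diffD)
      let ?Q = "monomial R \<one>\<^bsub>R\<^esub> L \<otimes>\<^bsub>power_series_ring R\<^esub> P'"
      have P'c: "P' \<in> carrier ?MP" "A.ev P' \<in> W" using P' by (auto simp: lead_def)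
      have PK: "P K \<in> carrier R" using Pc by blast
      have lQ: "lead ?Q K" "?Q K = P K" using shift[OF P'(1) L(1) R.one_closed] L(2) P'(2) PK by simp_all
      have mc: "monomial R \<one>\<^bsub>R\<^esub> L \<in> carrier ?MP" using L by (intro R.mpoly_monomial_closed) auto
      have Qc: "?Q \<in> carrier ?MP" using mc P'c by (intro R.mpoly_mult_closed)
      have evQ: "A.ev ?Q \<in> ?J"
      proof -
        have "A.ev ?Q = A.mval L \<otimes>\<^bsub>R\<^esub> A.ev P'"
          using A.ev_mult[OF mc P'c(1)] A.ev_monomial[of "\<one>\<^bsub>R\<^esub>" L] by (simp add: identity_apply)
        moreover have "A.mval L \<in> ideal_power R I (n - c)"
        proof -
          have "n - c \<le> size L" using K(1) M' by (simp add: L_def size_Diff_submset)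
          then show ?thesis using monomial_in_power[OF L(1)] R.ideal_power_antimono[OF I.is_ideal] by blast
        qed
        ultimately show ?thesis using P'c by (simp add: ideal_prod.prod)
      qed
      let ?D = "\<lambda>M. P M \<ominus>\<^bsub>R\<^esub> ?Q M"
      have Dc: "?D \<in> carrier ?MP"
        using MP.minus_closed[OF less.prems(1) Qc] R.mpoly_minus[OF less.prems(1) Qc] by simp
      have D0: "?D M = \<zero>\<^bsub>R\<^esub>" if "P M = \<zero>\<^bsub>R\<^esub>" "?Q M = \<zero>\<^bsub>R\<^esub>" for M using that by (simp add: a_minus_def)
      have evD: "A.ev ?D = A.ev P \<ominus>\<^bsub>R\<^esub> A.ev ?Q" by (rule A.ev_minus[OF less.prems(1) Qc])
      have "A.ev ?D \<in> ?J"
      proof (rule lower[OF Dc])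
        show "homogeneous R n ?D"
          unfolding homogeneous_def
        proof (intro allI impI)
          fix M assume "?D M \<noteq> \<zero>\<^bsub>R\<^esub>"
          then have "P M \<noteq> \<zero>\<^bsub>R\<^esub> \<or> ?Q M \<noteq> \<zero>\<^bsub>R\<^esub>" using D0 by blast
          then show "size M = n" using lP lQ(1) K(1) by (auto simp: lead_def homogeneous_def)
        qed
        show "\<forall>M. ?D M \<noteq> \<zero>\<^bsub>R\<^esub> \<longrightarrow> M < K"
        proof (intro allI impI)
          fix M assume D: "?D M \<noteq> \<zero>\<^bsub>R\<^esub>"
          then have "P M \<noteq> \<zero>\<^bsub>R\<^esub> \<or> ?Q M \<noteq> \<zero>\<^bsub>R\<^esub>" using D0 by blast
          then have "M \<le> K" using lP lQ(1) by (auto simp: lead_def)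
          moreover have "M \<noteq> K" using D lQ(2) PK by (auto simp: a_minus_def R.r_neg)
          ultimately show "M < K" by simp
        qed
        have "A.ev ?Q \<in> W" using lQ(1) by (simp add: lead_def)
        then have "A.ev P \<oplus>\<^bsub>R\<^esub> \<ominus>\<^bsub>R\<^esub> A.ev ?Q \<in> W" using less.prems(4) by (intro W.a_closed W.a_inv_closed)
        then show "A.ev ?D \<in> W" using evD by (simp only: a_minus_def)
      qed
      then have "A.ev ?D \<oplus>\<^bsub>R\<^esub> A.ev ?Q \<in> ?J" using evQ by (intro J.a_closed)
      moreover have "A.ev ?D \<oplus>\<^bsub>R\<^esub> A.ev ?Q = A.ev P"
        using evD A.ev_closed[OF Qc] A.ev_closed[OF less.prems(1)]
        by (simp only: a_minus_def) (simp add: R.a_assoc R.l_neg)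
      ultimately show ?thesis by simp
    qed
  qed
  note key = this
  show ?thesis
  proof (intro exI[of _ c] allI subsetI)
    fix n v assume v: "v \<in> ideal_power R I n \<inter> W"
    then obtain P where P: "P \<in> carrier ?MP" "homogeneous R n P" "A.ev P = v" using power_form by blast
    let ?S = "{M. P M \<noteq> \<zero>\<^bsub>R\<^esub>}"
    have fin: "finite ?S" using P(1) by (simp add: R.mpoly_carrier_iff)
    have "\<exists>K. \<forall>M. P M \<noteq> \<zero>\<^bsub>R\<^esub> \<longrightarrow> M \<le> K"
      using Max_ge[OF fin] by (intro exI[of _ "Max ?S"]) auto
    then show "v \<in> ideal_prod R (ideal_power R I (n - c)) W" using key[OF P(1,2)] P(3) v by blast
  qed
qed

section \<open>Consequences of the Artin-Rees lemma\<close>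

lemma add_ideals_iff: "v \<in> I <+>\<^bsub>R\<^esub> J \<longleftrightarrow> (\<exists>i\<in>I. \<exists>j\<in>J. v = i \<oplus>\<^bsub>R\<^esub> j)"
  by (auto simp: set_add_def set_mult_def)

lemma (in cring) eq_minusI:
  assumes "u \<in> carrier R" "i \<in> carrier R" "v \<in> carrier R" "u = i \<oplus> v"
  shows "v = u \<ominus> i"
  using assms by (simp add: a_minus_def a_comm[of i v] a_assoc r_neg)

text \<open>The Artin-Rees lemma for the ideal generated by \<open>I\<close> and \<open>u\<close>. Modulo \<open>I\<close>, the order of \<open>u b\<close>
  bounds the order of \<open>b\<close> up to an element that \<open>u\<close> annihilates.\<close>

lemma artin_rees_multiple:
  assumes R: "cring R" "noetherian_ring R" and m: "ideal m R" and I: "ideal I R" and u: "u \<in> carrier R"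
  shows "\<exists>c. \<forall>n b. b \<in> carrier R \<longrightarrow> u \<otimes>\<^bsub>R\<^esub> b \<in> I <+>\<^bsub>R\<^esub> ideal_power R m n \<longrightarrow>
    (\<exists>b'\<in>ideal_power R m (n - c). u \<otimes>\<^bsub>R\<^esub> (b \<ominus>\<^bsub>R\<^esub> b') \<in> I)"
proof -
  interpret R: cring R by fact
  interpret I: ideal I R by fact
  let ?W = "(PIdl\<^bsub>R\<^esub> u) <+>\<^bsub>R\<^esub> I"
  have uW: "ideal (PIdl\<^bsub>R\<^esub> u) R" by (rule R.cgenideal_ideal[OF u])
  have W: "ideal ?W R" by (rule R.add_ideals[OF uW I])
  obtain c where c: "\<And>n. ideal_power R m n \<inter> ?W \<subseteq> ideal_prod R (ideal_power R m (n - c)) ?W"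
    using artin_rees[OF R m W] by blast
  have el: "\<exists>b'\<in>ideal_power R m k. \<exists>i\<in>I. v = u \<otimes>\<^bsub>R\<^esub> b' \<oplus>\<^bsub>R\<^esub> i"
    if "v \<in> ideal_prod R (ideal_power R m k) ?W" for v k
    using that
  proof induction
    case (prod \<mu> w)
    then obtain b i where w: "b \<in> carrier R" "i \<in> I" "w = b \<otimes>\<^bsub>R\<^esub> u \<oplus>\<^bsub>R\<^esub> i"
      by (auto simp: add_ideals_iff cgenideal_def)
    have \<mu>: "\<mu> \<in> carrier R" using prod R.ideal_power_closed[OF m] by blast
    have "\<mu> \<otimes>\<^bsub>R\<^esub> b \<in> ideal_power R m k"
      using prod(1) w(1) ideal.I_r_closed[OF R.ideal_power_ideal[OF m]] by blast
    moreover have "\<mu> \<otimes>\<^bsub>R\<^esub> i \<in> I" using \<mu> w(2) by (rule I.I_l_closed[rotated])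
    moreover have "\<mu> \<otimes>\<^bsub>R\<^esub> w = u \<otimes>\<^bsub>R\<^esub> (\<mu> \<otimes>\<^bsub>R\<^esub> b) \<oplus>\<^bsub>R\<^esub> \<mu> \<otimes>\<^bsub>R\<^esub> i"
      using \<mu> w u I.Icarr[OF w(2)] by (simp add: R.r_distr R.m_ac)
    ultimately show ?case by blast
  next
    case (sum s1 s2)
    then obtain b1 i1 b2 i2 where s: "b1 \<in> ideal_power R m k" "i1 \<in> I" "s1 = u \<otimes>\<^bsub>R\<^esub> b1 \<oplus>\<^bsub>R\<^esub> i1"
      "b2 \<in> ideal_power R m k" "i2 \<in> I" "s2 = u \<otimes>\<^bsub>R\<^esub> b2 \<oplus>\<^bsub>R\<^esub> i2" by blast
    have cl: "b1 \<in> carrier R" "b2 \<in> carrier R" "i1 \<in> carrier R" "i2 \<in> carrier R"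
      using s R.ideal_power_closed[OF m] I.Icarr by blast+
    have "s1 \<oplus>\<^bsub>R\<^esub> s2 = u \<otimes>\<^bsub>R\<^esub> (b1 \<oplus>\<^bsub>R\<^esub> b2) \<oplus>\<^bsub>R\<^esub> (i1 \<oplus>\<^bsub>R\<^esub> i2)"
      using s cl u by (simp add: R.r_distr R.a_ac)
    then show ?case using R.ideal_power_plus[OF m s(1,4)] I.a_closed[OF s(2,5)] by blast
  qed
  show ?thesis
  proof (intro exI[of _ c] allI impI)
    fix n b assume b: "b \<in> carrier R" "u \<otimes>\<^bsub>R\<^esub> b \<in> I <+>\<^bsub>R\<^esub> ideal_power R m n"
    then obtain i v where iv: "i \<in> I" "v \<in> ideal_power R m n" "u \<otimes>\<^bsub>R\<^esub> b = i \<oplus>\<^bsub>R\<^esub> v"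
      by (auto simp: add_ideals_iff)
    have cl: "i \<in> carrier R" "v \<in> carrier R" using iv I.Icarr R.ideal_power_closed[OF m] by blast+
    have v: "v = b \<otimes>\<^bsub>R\<^esub> u \<oplus>\<^bsub>R\<^esub> \<ominus>\<^bsub>R\<^esub> i"
      using R.eq_minusI[of "u \<otimes>\<^bsub>R\<^esub> b" i v] iv(3) cl b(1) u by (simp add: a_minus_def R.m_comm)
    have "b \<otimes>\<^bsub>R\<^esub> u \<in> PIdl\<^bsub>R\<^esub> u" using b(1) by (auto simp: cgenideal_def)
    then have "v \<in> ?W" using v I.a_inv_closed[OF iv(1)] by (auto simp: add_ideals_iff)
    then have "v \<in> ideal_prod R (ideal_power R m (n - c)) ?W" using c iv(2) by blast
    then obtain b' i' where b': "b' \<in> ideal_power R m (n - c)" "i' \<in> I" "v = u \<otimes>\<^bsub>R\<^esub> b' \<oplus>\<^bsub>R\<^esub> i'" using el by blast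
    have cl': "b' \<in> carrier R" "i' \<in> carrier R" using b' I.Icarr R.ideal_power_closed[OF m] by blast+
    have "u \<otimes>\<^bsub>R\<^esub> (b \<ominus>\<^bsub>R\<^esub> b') = u \<otimes>\<^bsub>R\<^esub> b \<ominus>\<^bsub>R\<^esub> u \<otimes>\<^bsub>R\<^esub> b'"
      using u b(1) cl' by (simp add: a_minus_def R.r_distr R.r_minus)
    also have "\<dots> = i \<oplus>\<^bsub>R\<^esub> (u \<otimes>\<^bsub>R\<^esub> b' \<oplus>\<^bsub>R\<^esub> i') \<ominus>\<^bsub>R\<^esub> u \<otimes>\<^bsub>R\<^esub> b'" using iv(3) b'(3) by simp
    also have "\<dots> = i \<oplus>\<^bsub>R\<^esub> i'"
    proof -
      have q: "u \<otimes>\<^bsub>R\<^esub> b' \<in> carrier R" using u cl' by simp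
      show ?thesis using cl cl' q by (simp add: a_minus_def R.a_ac R.r_neg R.r_neg1 R.r_neg2)
    qed
    finally have "u \<otimes>\<^bsub>R\<^esub> (b \<ominus>\<^bsub>R\<^esub> b') \<in> I" using I.a_closed iv(1) b'(2) by simp
    then show "\<exists>b'\<in>ideal_power R m (n - c). u \<otimes>\<^bsub>R\<^esub> (b \<ominus>\<^bsub>R\<^esub> b') \<in> I" using b'(1) by blast
  qed
qed

lemma artin_rees_prime:
  assumes R: "cring R" "noetherian_ring R" and m: "ideal m R" and P: "primeideal P R"
    and f: "f \<in> carrier R" "f \<notin> P"
  shows "\<exists>c. \<forall>n b. b \<in> carrier R \<longrightarrow> f \<otimes>\<^bsub>R\<^esub> b \<in> P <+>\<^bsub>R\<^esub> ideal_power R m n \<longrightarrow>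
    b \<in> P <+>\<^bsub>R\<^esub> ideal_power R m (n - c)"
proof -
  interpret R: cring R by fact
  interpret P: primeideal P R by fact
  obtain c where c: "\<And>n b. b \<in> carrier R \<Longrightarrow> f \<otimes>\<^bsub>R\<^esub> b \<in> P <+>\<^bsub>R\<^esub> ideal_power R m n \<Longrightarrow>
    \<exists>b'\<in>ideal_power R m (n - c). f \<otimes>\<^bsub>R\<^esub> (b \<ominus>\<^bsub>R\<^esub> b') \<in> P"
    using artin_rees_multiple[OF R m P.is_ideal f(1)] by blast
  show ?thesis
  proof (intro exI[of _ c] allI impI)
    fix n b assume b: "b \<in> carrier R" "f \<otimes>\<^bsub>R\<^esub> b \<in> P <+>\<^bsub>R\<^esub> ideal_power R m n"
    then obtain b' where b': "b' \<in> ideal_power R m (n - c)" "f \<otimes>\<^bsub>R\<^esub> (b \<ominus>\<^bsub>R\<^esub> b') \<in> P" using c by blast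
    have cl: "b' \<in> carrier R" using b' R.ideal_power_closed[OF m] by blast
    then have d: "b \<ominus>\<^bsub>R\<^esub> b' \<in> P" using b' P.I_prime[of f "b \<ominus>\<^bsub>R\<^esub> b'"] f b(1) by simp
    have "b = (b \<ominus>\<^bsub>R\<^esub> b') \<oplus>\<^bsub>R\<^esub> b'" using b(1) cl by (simp add: a_minus_def R.a_assoc R.l_neg)
    then show "b \<in> P <+>\<^bsub>R\<^esub> ideal_power R m (n - c)" using d b'(1) unfolding add_ideals_iff by blast
  qed
qed

lemma (in cring) proper_ideal_in_maximal:
  assumes I: "ideal I R" "\<one> \<notin> I"
  obtains M where "maximalideal M R" "I \<subseteq> M"
proof -
  let ?A = "{J. ideal J R \<and> I \<subseteq> J \<and> \<one> \<notin> J}"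
  have "\<exists>M\<in>?A. \<forall>J\<in>?A. M \<subseteq> J \<longrightarrow> J = M"
  proof (rule subset_Zorn_nonempty)
    show "?A \<noteq> {}" using I by blast
    fix \<C> assume C: "\<C> \<noteq> {}" "subset.chain ?A \<C>"
    then have "subset.chain {I. ideal I R} \<C>" unfolding subset_chain_def by blast
    then have "ideal (\<Union>\<C>) R" using chain_Union_is_ideal[of \<C>] C(1) by simp
    moreover have "I \<subseteq> \<Union>\<C>" "\<one> \<notin> \<Union>\<C>" using C unfolding subset_chain_def by blast+
    ultimately show "\<Union>\<C> \<in> ?A" by blast
  qed
  then obtain M where M: "ideal M R" "I \<subseteq> M" "\<one> \<notin> M" "\<forall>J. ideal J R \<and> I \<subseteq> J \<and> \<one> \<notin> J \<longrightarrow> M \<subseteq> J \<longrightarrow> J = M"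
    by (auto simp del: Un_iff)
  have "maximalideal M R"
  proof (rule maximalidealI[OF M(1)])
    show "carrier R \<noteq> M" using M(3) by auto
    fix J assume J: "ideal J R" "M \<subseteq> J" "J \<subseteq> carrier R"
    show "J = M \<or> J = carrier R"
      using M(4) M(2) J ideal.one_imp_carrier[OF J(1)] by (metis subset_trans)
  qed
  then show ?thesis using that M(2) by blast
qed

context local_ring
begin

lemma maximal: "maximalideal \<mm> R" by (rule is_maximalideal)

lemma max_ideal: "ideal \<mm> R" by (rule is_ideal)

lemma one_notin: "\<one> \<notin> \<mm>"
  using I_notcarr one_imp_carrier by blast

lemma proper_ideal_le:
  assumes "ideal I R" "\<one> \<notin> I" shows "I \<subseteq> \<mm>"
  using proper_ideal_in_maximal[OF assms] maximal_unique by metis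

lemma unit_if_notin:
  assumes "r \<in> carrier R" "r \<notin> \<mm>" shows "r \<in> Units R"
proof -
  have "ideal (PIdl r) R" "r \<in> PIdl r" using assms by (simp_all add: cgenideal_ideal cgenideal_self)
  then have "\<one> \<in> PIdl r" using proper_ideal_le assms(2) by blast
  then obtain x where "x \<in> carrier R" "\<one> = x \<otimes> r" by (auto simp: cgenideal_def)
  then show ?thesis using assms(1) by (auto simp: Units_def m_comm intro!: bexI[of _ x])
qed

end

text \<open>Krull's intersection theorem for \<open>R/I\<close>: the bound for the multiples of \<open>u\<close>, applied to \<open>u\<close>
  itself, gives \<open>u (1 - b) \<in> I\<close> with \<open>b \<in> \<mm>\<close>, and \<open>1 - b\<close> is a unit.\<close>

lemma (in noetherian_local_ring) ideal_closed:
  assumes I: "ideal I R" and u: "u \<in> carrier R" and all: "\<And>n. u \<in> I <+>\<^bsub>R\<^esub> ideal_power R \<mm> n"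
  shows "u \<in> I"
proof -
  interpret I: ideal I R by fact
  obtain c where c: "\<And>n b. b \<in> carrier R \<Longrightarrow> u \<otimes> b \<in> I <+>\<^bsub>R\<^esub> ideal_power R \<mm> n \<Longrightarrow>
    \<exists>b'\<in>ideal_power R \<mm> (n - c). u \<otimes> (b \<ominus> b') \<in> I"
    using artin_rees_multiple[OF is_cring noetherian_ring_axioms max_ideal I u] by blast
  obtain b where b: "b \<in> \<mm>" "u \<otimes> (\<one> \<ominus> b) \<in> I"
    using c[of \<one> "Suc c"] all[of "Suc c"] u ideal_power_1[OF max_ideal] by auto
  have bc: "b \<in> carrier R" using b(1) by (rule Icarr)
  have "\<one> \<ominus> b \<notin> \<mm>"
  proof
    assume "\<one> \<ominus> b \<in> \<mm>"
    then have "(\<one> \<ominus> b) \<oplus> b \<in> \<mm>" using b(1) by (intro a_closed)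
    then show False using bc one_notin by (simp add: a_minus_def a_assoc l_neg)
  qed
  then have "\<one> \<ominus> b \<in> Units R" using bc by (intro unit_if_notin) auto
  then obtain v where v: "v \<in> carrier R" "(\<one> \<ominus> b) \<otimes> v = \<one>"
    by (metis Units_inv_closed Units_r_inv)
  have "u \<otimes> (\<one> \<ominus> b) \<otimes> v \<in> I" using b(2) v(1) by (rule I.I_r_closed)
  then show ?thesis using u bc v by (simp add: m_assoc)
qed

section \<open>Regular parameters are analytically independent\<close>

locale field_in_ring = cring R for R (structure) +
  fixes K
  assumes subfield: "subfield K R"
begin

lemma K_closed: "k \<in> K \<Longrightarrow> k \<in> carrier R"
  using subfieldE(3)[OF subfield] by blast

lemmas K_ring = subringE[OF subfieldE(1)[OF subfield]]

lemma K_zero [simp]: "\<zero> \<in> K" and K_one [simp]: "\<one> \<in> K" using K_ring by auto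
lemma K_add [intro]: "a \<in> K \<Longrightarrow> b \<in> K \<Longrightarrow> a \<oplus> b \<in> K" using K_ring by auto
lemma K_mult [intro]: "a \<in> K \<Longrightarrow> b \<in> K \<Longrightarrow> a \<otimes> b \<in> K" using K_ring by auto
lemma K_uminus [intro]: "a \<in> K \<Longrightarrow> \<ominus> a \<in> K" using K_ring by auto

lemma K_inv: "k \<in> K \<Longrightarrow> k \<noteq> \<zero> \<Longrightarrow> inv k \<in> K \<and> k \<otimes> inv k = \<one> \<and> inv k \<otimes> k = \<one>"
  using subfield_m_inv[OF subfield, of k] by auto

lemma one_nonzero: "\<one> \<noteq> \<zero>" by (rule subfieldE(6)[OF subfield])

text \<open>The \<open>K\<close>-span of the list together with \<open>W\<close>; in the sequel this stands for the span in the
  vector space \<open>R/W\<close>.\<close>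

primrec span :: "'a set \<Rightarrow> 'a list \<Rightarrow> 'a set" where
  "span W [] = W"
| "span W (y # ys) = {k \<otimes> y \<oplus> s | k s. k \<in> K \<and> s \<in> span W ys}"

lemma span_ConsI: "k \<in> K \<Longrightarrow> s \<in> span W ys \<Longrightarrow> v = k \<otimes> y \<oplus> s \<Longrightarrow> v \<in> span W (y # ys)"
  by auto

context
  fixes W assumes W: "ideal W R"
begin

interpretation W: ideal W R by (rule W)

lemma span_closed: "set ys \<subseteq> carrier R \<Longrightarrow> v \<in> span W ys \<Longrightarrow> v \<in> carrier R"
  by (induction ys arbitrary: v) (auto simp: W.Icarr K_closed)

lemma span_add:
  assumes "set ys \<subseteq> carrier R" "u \<in> span W ys" "v \<in> span W ys" shows "u \<oplus> v \<in> span W ys"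
  using assms
proof (induction ys arbitrary: u v)
  case Nil then show ?case by (auto intro: W.a_closed)
next
  case (Cons y ys)
  then obtain k s k' s' where 1: "u = k \<otimes> y \<oplus> s" "k \<in> K" "s \<in> span W ys" "v = k' \<otimes> y \<oplus> s'" "k' \<in> K" "s' \<in> span W ys"
    by auto
  have c: "s \<in> carrier R" "s' \<in> carrier R" using 1 Cons.prems span_closed by auto
  have "u \<oplus> v = (k \<oplus> k') \<otimes> y \<oplus> (s \<oplus> s')"
    using 1 c Cons.prems K_closed by (simp add: l_distr a_ac)
  moreover have "s \<oplus> s' \<in> span W ys" using Cons 1 by auto
  ultimately show ?case using 1 by auto
qed

lemma span_scale:
  assumes "set ys \<subseteq> carrier R" "u \<in> span W ys" "c \<in> K" shows "c \<otimes> u \<in> span W ys"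
  using assms
proof (induction ys arbitrary: u)
  case Nil then show ?case using K_closed by (auto intro: W.I_l_closed)
next
  case (Cons y ys)
  then obtain k s where 1: "u = k \<otimes> y \<oplus> s" "k \<in> K" "s \<in> span W ys" by auto
  have c: "s \<in> carrier R" using 1 Cons.prems span_closed by auto
  have "c \<otimes> u = (c \<otimes> k) \<otimes> y \<oplus> c \<otimes> s"
    using 1 c Cons.prems K_closed by (simp add: r_distr m_assoc)
  then show ?case using Cons 1 by auto
qed

lemma span_base: "set ys \<subseteq> carrier R \<Longrightarrow> W \<subseteq> span W ys"
proof (induction ys)
  case (Cons y ys)
  show ?case
  proof
    fix w assume w: "w \<in> W"
    then have "w = \<zero> \<otimes> y \<oplus> w" using Cons.prems W.Icarr by simp
    moreover have "w \<in> span W ys" using w Cons by auto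
    ultimately show "w \<in> span W (y # ys)" by (intro span_ConsI[of \<zero>]) auto
  qed
qed simp

lemma span_mem: "set ys \<subseteq> carrier R \<Longrightarrow> y \<in> set ys \<Longrightarrow> y \<in> span W ys"
proof (induction ys)
  case (Cons z ys)
  show ?case
  proof (cases "y = z")
    case True
    have "\<zero> \<in> span W ys" using span_base[of ys] Cons.prems W.zero_closed by auto
    moreover have "y = \<one> \<otimes> z \<oplus> \<zero>" using True Cons.prems by simp
    ultimately show ?thesis by (intro span_ConsI[of \<one> \<zero>]) auto
  next
    case False
    then have "y \<in> span W ys" "y = \<zero> \<otimes> z \<oplus> y" using Cons by auto
    then show ?thesis by (intro span_ConsI[of \<zero>]) auto
  qed
qed simp

text \<open>Gaussian elimination: the element \<open>y\<close> is eliminated from all vectors by means of one in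
  which it occurs.\<close>

lemma linear_dependence:
  assumes "finite E" "length ys < card E" "set ys \<subseteq> carrier R" "\<And>e. e \<in> E \<Longrightarrow> v e \<in> span W ys"
  shows "\<exists>c. (\<forall>e. c e \<in> K) \<and> (\<exists>e\<in>E. c e \<noteq> \<zero>) \<and> (\<Oplus>e\<in>E. c e \<otimes> v e) \<in> W"
  using assms
proof (induction ys arbitrary: E v)
  case Nil
  then obtain e where e: "e \<in> E" by fastforce
  have "(\<Oplus>e'\<in>E. (if e = e' then \<one> else \<zero>) \<otimes> v e') = (\<Oplus>e'\<in>E. if e = e' then v e' else \<zero>)"
    using Nil W.Icarr by (intro finsum_cong') auto
  also have "\<dots> = v e" using Nil e W.Icarr by (intro add.finprod_singleton) auto
  finally have "(\<Oplus>e'\<in>E. (if e = e' then \<one> else \<zero>) \<otimes> v e') \<in> W" using Nil e by simp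
  then show ?case using e one_nonzero by (intro exI[of _ "\<lambda>e'. if e = e' then \<one> else \<zero>"]) auto
next
  case (Cons y ys)
  have yc: "y \<in> carrier R" "set ys \<subseteq> carrier R" using Cons.prems by auto
  have "\<forall>e\<in>E. \<exists>k s. k \<in> K \<and> s \<in> span W ys \<and> v e = k \<otimes> y \<oplus> s" using Cons.prems(4) by fastforce
  then obtain k s where ks: "\<And>e. e \<in> E \<Longrightarrow> k e \<in> K" "\<And>e. e \<in> E \<Longrightarrow> s e \<in> span W ys"
    "\<And>e. e \<in> E \<Longrightarrow> v e = k e \<otimes> y \<oplus> s e" by metis
  have sc: "s e \<in> carrier R" if "e \<in> E" for e using ks that span_closed yc by blast
  have vc: "v e \<in> carrier R" if "e \<in> E" for e using ks that sc yc K_closed by simp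
  show ?case
  proof (cases "\<forall>e\<in>E. k e = \<zero>")
    case True
    then have "v e \<in> span W ys" if "e \<in> E" for e using ks that sc yc by simp
    then show ?thesis using Cons.IH[of E v] Cons.prems yc by auto
  next
    case False
    then obtain e0 where e0: "e0 \<in> E" "k e0 \<noteq> \<zero>" by blast
    let ?F = "E - {e0}"
    define l where "l e = k e \<otimes> inv (k e0)" for e
    have lK: "l e \<in> K" if "e \<in> E" for e using ks(1) e0 K_inv that by (auto simp: l_def)
    define u where "u e = s e \<oplus> \<ominus> l e \<otimes> s e0" for e
    have u: "u e \<in> span W ys" if "e \<in> E" for e
      unfolding u_def using that ks e0 lK yc by (intro span_add span_scale) auto
    have uv: "u e = v e \<oplus> \<ominus> l e \<otimes> v e0" if "e \<in> E" for e
    proof -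
      have c: "k e \<in> carrier R" "k e0 \<in> carrier R" "inv (k e0) \<in> carrier R" "inv (k e0) \<otimes> k e0 = \<one>" "l e \<in> carrier R"
        using that e0 ks K_inv K_closed lK by blast+
      have "\<ominus> l e \<otimes> (k e0 \<otimes> y) = \<ominus> (k e \<otimes> y)"
      proof -
        have "l e \<otimes> (k e0 \<otimes> y) = k e \<otimes> (inv (k e0) \<otimes> k e0) \<otimes> y"
          unfolding l_def using c(1-3) yc by (simp add: m_assoc)
        then show ?thesis using c yc by (simp add: l_minus)
      qed
      then have "\<ominus> l e \<otimes> v e0 = \<ominus> (k e \<otimes> y) \<oplus> \<ominus> l e \<otimes> s e0"
        using ks(3)[OF e0(1)] c yc sc e0 by (simp add: r_distr)
      then show ?thesis unfolding u_def
        using ks(3)[OF that] c yc sc[OF that] sc[OF e0(1)] by (simp add: a_ac r_neg1 r_neg2 r_neg)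
    qed
    have "length ys < card ?F" using Cons.prems e0 by (simp add: card_Diff_singleton)
    then obtain c where c: "\<And>e. c e \<in> K" "\<exists>e\<in>?F. c e \<noteq> \<zero>" "(\<Oplus>e\<in>?F. c e \<otimes> u e) \<in> W"
      using Cons.IH[of ?F u] Cons.prems yc u by auto
    define t where "t = (\<Oplus>e\<in>?F. c e \<otimes> \<ominus> l e)"
    have tK: "t \<in> K"
    proof -
      have "(\<Oplus>e\<in>A. c e \<otimes> \<ominus> l e) \<in> K" if "finite A" "A \<subseteq> E" for A
        using that
      proof (induction A)
        case (insert x A)
        then have "(\<Oplus>e\<in>insert x A. c e \<otimes> \<ominus> l e) = c x \<otimes> \<ominus> l x \<oplus> (\<Oplus>e\<in>A. c e \<otimes> \<ominus> l e)"
          using c(1) lK K_closed by (intro finsum_insert) auto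
        moreover have "c x \<otimes> \<ominus> l x \<in> K" using insert c(1) lK by (intro K_mult K_uminus) auto
        ultimately show ?case using insert by (simp add: K_add)
      qed simp
      then show ?thesis using Cons.prems by (auto simp: t_def)
    qed
    have cc: "c e \<in> carrier R" for e using c(1) K_closed by blast
    have lc: "l e \<in> carrier R" if "e \<in> E" for e using lK that K_closed by blast
    have "(\<Oplus>e\<in>?F. c e \<otimes> u e) = (\<Oplus>e\<in>?F. c e \<otimes> v e \<oplus> (c e \<otimes> \<ominus> l e) \<otimes> v e0)"
      using cc lc vc e0 by (intro finsum_cong') (auto simp: uv r_distr m_assoc)
    also have "\<dots> = (\<Oplus>e\<in>?F. c e \<otimes> v e) \<oplus> (\<Oplus>e\<in>?F. (c e \<otimes> \<ominus> l e) \<otimes> v e0)"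
      using cc lc vc e0 by (intro finsum_addf) auto
    also have "(\<Oplus>e\<in>?F. (c e \<otimes> \<ominus> l e) \<otimes> v e0) = t \<otimes> v e0"
      unfolding t_def using cc lc vc e0 Cons.prems by (intro finsum_ldistr[symmetric]) auto
    finally have eq: "(\<Oplus>e\<in>?F. c e \<otimes> u e) = (\<Oplus>e\<in>?F. c e \<otimes> v e) \<oplus> t \<otimes> v e0" .
    let ?c = "c(e0 := t)"
    have "(\<Oplus>e\<in>insert e0 ?F. ?c e \<otimes> v e) = t \<otimes> v e0 \<oplus> (\<Oplus>e\<in>?F. ?c e \<otimes> v e)"
      using Cons.prems vc e0 cc K_closed[OF tK] by (subst finsum_insert) auto
    also have "(\<Oplus>e\<in>?F. ?c e \<otimes> v e) = (\<Oplus>e\<in>?F. c e \<otimes> v e)"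
      using cc vc by (intro finsum_cong') auto
    finally have "(\<Oplus>e\<in>E. ?c e \<otimes> v e) = (\<Oplus>e\<in>?F. c e \<otimes> u e)"
      unfolding eq using e0 cc vc K_closed[OF tK] by (simp add: insert_absorb a_comm finsum_closed Pi_def)
    then show ?thesis using c tK by (intro exI[of _ ?c]) auto
  qed
qed

end

end

context cring
begin

primrec horner :: "'a \<Rightarrow> nat \<Rightarrow> (nat \<Rightarrow> 'a) \<Rightarrow> 'a" where
  "horner f 0 g = \<zero>"
| "horner f (Suc t) g = g 0 \<oplus> f \<otimes> horner f t (\<lambda>a. g (Suc a))"

text \<open>The sum, over all lists \<open>e\<close> of \<open>j\<close> exponents below \<open>t\<close>, of \<open>k e\<close> times the product of the
  powers of \<open>f (j - 1), \<dots>, f 0\<close> with these exponents, nested as in Horner's rule so that the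
  outermost element can be split off.\<close>

primrec power_sum :: "(nat \<Rightarrow> 'a) \<Rightarrow> nat \<Rightarrow> nat \<Rightarrow> (nat list \<Rightarrow> 'a) \<Rightarrow> 'a" where
  "power_sum f t 0 k = k []"
| "power_sum f t (Suc j) k = horner (f j) t (\<lambda>a. power_sum f t j (\<lambda>e. k (a # e)))"

lemma horner_closed: "f \<in> carrier R \<Longrightarrow> (\<And>a. a < t \<Longrightarrow> g a \<in> carrier R) \<Longrightarrow> horner f t g \<in> carrier R"
  by (induction t arbitrary: g) auto

lemma horner_cong: "(\<And>a. a < t \<Longrightarrow> g a = g' a) \<Longrightarrow> horner f t g = horner f t g'"
proof (induction t arbitrary: g g')
  case (Suc t)
  have "g 0 = g' 0" by (rule Suc.prems) simp
  moreover have "horner f t (\<lambda>a. g (Suc a)) = horner f t (\<lambda>a. g' (Suc a))"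
    by (rule Suc.IH, rule Suc.prems) simp
  ultimately show ?case by (simp only: horner.simps)
qed simp

lemma horner_add:
  assumes "f \<in> carrier R" "\<And>a. a < t \<Longrightarrow> g a \<in> carrier R" "\<And>a. a < t \<Longrightarrow> h a \<in> carrier R"
  shows "horner f t (\<lambda>a. g a \<oplus> h a) = horner f t g \<oplus> horner f t h"
  using assms(2,3)
proof (induction t arbitrary: g h)
  case (Suc t)
  have "horner f t (\<lambda>a. g (Suc a)) \<in> carrier R" "horner f t (\<lambda>a. h (Suc a)) \<in> carrier R"
    using assms(1) Suc.prems by (auto intro!: horner_closed)
  then show ?case using Suc.prems assms(1) Suc.IH[of "\<lambda>a. g (Suc a)" "\<lambda>a. h (Suc a)"] by (simp add: r_distr a_ac)
qed simp

lemma horner_zero: "f \<in> carrier R \<Longrightarrow> horner f t (\<lambda>a. \<zero>) = \<zero>"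
  by (induction t) simp_all

lemma horner_scale:
  assumes "f \<in> carrier R" "c \<in> carrier R" "\<And>a. a < t \<Longrightarrow> g a \<in> carrier R"
  shows "horner f t (\<lambda>a. c \<otimes> g a) = c \<otimes> horner f t g"
  using assms(3)
proof (induction t arbitrary: g)
  case (Suc t)
  have "horner f t (\<lambda>a. g (Suc a)) \<in> carrier R"
    using assms(1) Suc.prems by (auto intro!: horner_closed)
  then show ?case using Suc.prems assms Suc.IH[of "\<lambda>a. g (Suc a)"] by (simp add: r_distr m_lcomm)
qed (use assms in simp)

context
  fixes f :: "nat \<Rightarrow> 'a" and t :: nat
  assumes f: "\<And>j. f j \<in> carrier R"
begin

abbreviation "box j \<equiv> {e. set e \<subseteq> {..<t} \<and> length e = j}"

lemma power_sum_closed: "(\<And>e. k e \<in> carrier R) \<Longrightarrow> power_sum f t j k \<in> carrier R"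
  by (induction j arbitrary: k) (auto intro!: horner_closed f)

lemma power_sum_cong: "(\<And>e. e \<in> box j \<Longrightarrow> k e = k' e) \<Longrightarrow> power_sum f t j k = power_sum f t j k'"
proof (induction j arbitrary: k k')
  case (Suc j)
  have "power_sum f t j (\<lambda>e. k (a # e)) = power_sum f t j (\<lambda>e. k' (a # e))" if "a < t" for a
    using that by (intro Suc.IH Suc.prems) auto
  then show ?case by (auto intro!: horner_cong)
qed simp

lemma power_sum_add: "(\<And>e. k e \<in> carrier R) \<Longrightarrow> (\<And>e. k' e \<in> carrier R) \<Longrightarrow>
  power_sum f t j (\<lambda>e. k e \<oplus> k' e) = power_sum f t j k \<oplus> power_sum f t j k'"
  by (induction j arbitrary: k k') (auto simp: horner_add f power_sum_closed)

lemma power_sum_scale: "c \<in> carrier R \<Longrightarrow> (\<And>e. k e \<in> carrier R) \<Longrightarrow>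
  power_sum f t j (\<lambda>e. c \<otimes> k e) = c \<otimes> power_sum f t j k"
  by (induction j arbitrary: k) (auto simp: horner_scale f power_sum_closed)

lemma power_sum_zero: "power_sum f t j (\<lambda>e. \<zero>) = \<zero>"
  by (induction j) (simp_all add: horner_zero f)

lemma power_sum_expand:
  assumes c: "\<And>e. c e \<in> carrier R"
  shows "power_sum f t j c = (\<Oplus>e\<in>box j. c e \<otimes> power_sum f t j (\<lambda>e'. if e' = e then \<one> else \<zero>))"
proof -
  let ?v = "\<lambda>e. power_sum f t j (\<lambda>e'. if e' = e then \<one> else \<zero>)"
  have vc: "?v e \<in> carrier R" for e by (rule power_sum_closed) simp
  have "(\<Oplus>e\<in>F. c e \<otimes> ?v e) = power_sum f t j (\<lambda>e. if e \<in> F then c e else \<zero>)" if "finite F" for F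
    using that
  proof (induction F)
    case empty then show ?case by (simp add: power_sum_zero)
  next
    case (insert x F)
    have "(\<Oplus>e\<in>insert x F. c e \<otimes> ?v e) = c x \<otimes> ?v x \<oplus> power_sum f t j (\<lambda>e. if e \<in> F then c e else \<zero>)"
      using insert c vc by (subst finsum_insert) auto
    also have "c x \<otimes> ?v x = power_sum f t j (\<lambda>e'. c x \<otimes> (if e' = x then \<one> else \<zero>))"
      using c by (intro power_sum_scale[symmetric]) auto
    also have "\<dots> \<oplus> power_sum f t j (\<lambda>e. if e \<in> F then c e else \<zero>)
        = power_sum f t j (\<lambda>e'. c x \<otimes> (if e' = x then \<one> else \<zero>) \<oplus> (if e' \<in> F then c e' else \<zero>))"
      using c by (intro power_sum_add[symmetric]) auto
    also have "(\<lambda>e'. c x \<otimes> (if e' = x then \<one> else \<zero>) \<oplus> (if e' \<in> F then c e' else \<zero>)) =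
        (\<lambda>e. if e \<in> insert x F then c e else \<zero>)"
      using insert c by (auto simp: fun_eq_iff)
    finally show ?case .
  qed
  note * = this
  have fin: "finite (box j)" using finite_lists_length_eq[of "{..<t}" j] by simp
  have "power_sum f t j c = power_sum f t j (\<lambda>e. if e \<in> box j then c e else \<zero>)"
    by (rule power_sum_cong) simp
  then show ?thesis using *[OF fin] by simp
qed

end

end

locale coefficient_field = field_in_ring R K + noetherian_local_ring \<mm> R
  for \<mm> and R (structure) and K +
  assumes residues: "r \<in> carrier R \<Longrightarrow> \<exists>k\<in>K. r \<ominus> k \<in> \<mm>"
begin

lemma K_meets_m: "k \<in> K \<Longrightarrow> k \<in> \<mm> \<Longrightarrow> k = \<zero>"
  using K_inv[of k] K_closed one_notin by (metis I_r_closed)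

lemma decompose:
  assumes "r \<in> carrier R"
  obtains k \<mu> where "k \<in> K" "\<mu> \<in> \<mm>" "r = k \<oplus> \<mu>"
proof -
  obtain k where k: "k \<in> K" "r \<ominus> k \<in> \<mm>" using residues[OF assms] by blast
  have "r = k \<oplus> (r \<ominus> k)" using assms K_closed[OF k(1)] by (simp add: a_minus_def a_lcomm[of k r] r_neg)
  then show ?thesis using that k by blast
qed

text \<open>Modulo \<open>P'\<close>, which contains \<open>f\<close>, only the constant coefficient remains, so it vanishes. Then
  \<open>f\<close> can be cancelled modulo \<open>P\<close> at the cost of \<open>c\<close> in the exponent, and the remaining sum is
  shorter.\<close>

lemma horner_independent:
  assumes f: "f \<in> carrier R" "f \<in> P'" and P: "ideal P R" "ideal P' R" "P \<subseteq> P'"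
    and ar: "\<And>n b. b \<in> carrier R \<Longrightarrow> f \<otimes> b \<in> P <+>\<^bsub>R\<^esub> ideal_power R \<mm> n \<Longrightarrow> b \<in> P <+>\<^bsub>R\<^esub> ideal_power R \<mm> (n - c)"
    and g: "\<And>a. g a \<in> carrier R"
    and zero: "\<And>a. g a \<in> P' <+>\<^bsub>R\<^esub> ideal_power R \<mm> n \<Longrightarrow> g a = \<zero>"
    and mem: "horner f t g \<in> P <+>\<^bsub>R\<^esub> ideal_power R \<mm> (n + c * t)"
  shows "\<forall>a<t. g a = \<zero>"
  using g zero mem
proof (induction t arbitrary: g)
  case (Suc t)
  interpret P': ideal P' R by (rule P(2))
  let ?h = "horner f t (\<lambda>a. g (Suc a))"
  have hc: "?h \<in> carrier R" using f(1) Suc.prems(1) by (intro horner_closed)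
  obtain p v where pv: "p \<in> P" "v \<in> ideal_power R \<mm> (n + c * Suc t)" "g 0 \<oplus> f \<otimes> ?h = p \<oplus> v"
    using Suc.prems(3) by (auto simp: add_ideals_iff)
  have c: "p \<in> carrier R" "v \<in> carrier R" using pv P'.Icarr P(3) ideal_power_closed[OF max_ideal] by blast+
  have "g 0 = (p \<ominus> f \<otimes> ?h) \<oplus> v"
  proof -
    have q: "f \<otimes> ?h \<in> carrier R" using f hc by simp
    have "g 0 = (g 0 \<oplus> f \<otimes> ?h) \<ominus> f \<otimes> ?h" using q Suc.prems(1) by (simp add: a_minus_def a_assoc r_neg)
    also have "\<dots> = (p \<ominus> f \<otimes> ?h) \<oplus> v" unfolding pv(3) using q c by (simp add: a_minus_def a_ac)
    finally show ?thesis .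
  qed
  moreover have "p \<ominus> f \<otimes> ?h \<in> P'"
    unfolding a_minus_def using pv(1) P(3) f(2) hc by (intro P'.a_closed P'.a_inv_closed P'.I_r_closed) auto
  moreover have "v \<in> ideal_power R \<mm> n"
    using pv(2) ideal_power_antimono[OF max_ideal, of n "n + c * Suc t"] by auto
  ultimately have g0: "g 0 = \<zero>" using Suc.prems(2)[of 0] by (auto simp: add_ideals_iff)
  then have "f \<otimes> ?h \<in> P <+>\<^bsub>R\<^esub> ideal_power R \<mm> (n + c * Suc t)" using Suc.prems(3) f hc by simp
  then have "?h \<in> P <+>\<^bsub>R\<^esub> ideal_power R \<mm> (n + c * Suc t - c)" using ar hc by blast
  then have "\<forall>a<t. g (Suc a) = \<zero>" using Suc.prems by (intro Suc.IH) (auto simp: algebra_simps)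
  then show ?case using g0 by (metis less_Suc_eq_0_disj)
qed simp

text \<open>Take \<open>f\<^sub>i \<in> P\<^sub>i\<^sub>+\<^sub>1\<close> outside \<open>P\<^sub>i\<close>. Going up the chain, each \<open>f\<^sub>i\<close> is split off by
  \<open>horner_independent\<close>, at a total cost in the exponent that is linear in \<open>t\<close>, while the number of
  products of the \<open>f\<^sub>i\<close> with exponents below \<open>t\<close> is \<open>t\<^sup>d\<close>.\<close>

lemma prime_chain_independent:
  assumes P: "\<And>i. i \<le> d \<Longrightarrow> primeideal (P i) R" "\<And>i. i < d \<Longrightarrow> P i \<subset> P (Suc i)"
  shows "\<exists>f c. (\<forall>j. f j \<in> carrier R) \<and> (\<forall>t k. (\<forall>e. k e \<in> K) \<longrightarrow>
     power_sum f t d k \<in> ideal_power R \<mm> (1 + c * t * d) \<longrightarrow> (\<forall>e\<in>{e. set e \<subseteq> {..<t} \<and> length e = d}. k e = \<zero>))"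
proof -
  have "\<forall>i<d. \<exists>f c. f \<in> P (Suc i) \<and> f \<notin> P i \<and> f \<in> carrier R \<and> (\<forall>n b. b \<in> carrier R \<longrightarrow>
     f \<otimes> b \<in> P i <+>\<^bsub>R\<^esub> ideal_power R \<mm> n \<longrightarrow> b \<in> P i <+>\<^bsub>R\<^esub> ideal_power R \<mm> (n - c))"
  proof (intro allI impI)
    fix i assume i: "i < d"
    then obtain f where f: "f \<in> P (Suc i)" "f \<notin> P i" using P(2) by blast
    have "primeideal (P (Suc i)) R" using P(1) i by simp
    then have fc: "f \<in> carrier R" using f(1) by (metis ideal.Icarr primeideal.axioms(1))
    show "\<exists>f c. f \<in> P (Suc i) \<and> f \<notin> P i \<and> f \<in> carrier R \<and> (\<forall>n b. b \<in> carrier R \<longrightarrow>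
     f \<otimes> b \<in> P i <+>\<^bsub>R\<^esub> ideal_power R \<mm> n \<longrightarrow> b \<in> P i <+>\<^bsub>R\<^esub> ideal_power R \<mm> (n - c))"
      using artin_rees_prime[OF is_cring noetherian_ring_axioms max_ideal P(1) fc f(2)] i f fc by auto
  qed
  then obtain f0 c0 where fc: "\<And>i. i < d \<Longrightarrow> f0 i \<in> P (Suc i)" "\<And>i. i < d \<Longrightarrow> f0 i \<in> carrier R"
    "\<And>i n b. i < d \<Longrightarrow> b \<in> carrier R \<Longrightarrow>
     f0 i \<otimes> b \<in> P i <+>\<^bsub>R\<^esub> ideal_power R \<mm> n \<Longrightarrow> b \<in> P i <+>\<^bsub>R\<^esub> ideal_power R \<mm> (n - c0 i)" by metis
  define c where "c = (\<Sum>i<d. c0 i)"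
  have c0c: "c0 i \<le> c" if "i < d" for i unfolding c_def using that by (intro member_le_sum) auto
  have ar: "b \<in> P i <+>\<^bsub>R\<^esub> ideal_power R \<mm> (n - c)" if "i < d" "b \<in> carrier R"
    "f0 i \<otimes> b \<in> P i <+>\<^bsub>R\<^esub> ideal_power R \<mm> n" for i n b
    using fc(3)[OF that] ideal_power_antimono[OF max_ideal, of "n - c" "n - c0 i"] c0c[OF that(1)]
    by (fastforce simp: add_ideals_iff)
  \<comment> \<open>The outermost variable of \<open>power_sum\<close> has the largest index and has to belong to the smallest
    prime; hence the reversal.\<close>
  define f where "f j = (if j < d then f0 (d - Suc j) else \<zero>)" for j
  have f: "f j \<in> carrier R" for j using fc(2) by (auto simp: f_def)
  have "\<forall>e\<in>{e. set e \<subseteq> {..<t} \<and> length e = j}. k e = \<zero>"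
    if "j \<le> d" "\<And>e. k e \<in> K" "power_sum f t j k \<in> P (d - j) <+>\<^bsub>R\<^esub> ideal_power R \<mm> (1 + c * t * j)" for t j k
    using that
  proof (induction j arbitrary: k)
    case 0
    have "primeideal (P d) R" using P(1) by simp
    then interpret Pd: primeideal "P d" R .
    have "\<one> \<notin> P d" using Pd.I_notcarr Pd.one_imp_carrier by blast
    then have "P d \<subseteq> \<mm>" by (rule proper_ideal_le[OF Pd.is_ideal])
    then have "k [] \<in> \<mm>" using 0(3) ideal_power_1[OF max_ideal] by (auto simp: add_ideals_iff intro: a_closed)
    then show ?case using K_meets_m 0 by auto
  next
    case (Suc j)
    define i where "i = d - Suc j"
    have i: "i < d" "d - j = Suc i" using Suc.prems(1) by (auto simp: i_def)
    have fj: "f j = f0 i" using Suc.prems(1) by (simp add: f_def i_def)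
    let ?g = "\<lambda>a. power_sum f t j (\<lambda>e. k (a # e))"
    have idP: "ideal (P i) R" "ideal (P (Suc i)) R" using P(1) i by (auto simp: primeideal_def)
    have z: "?g a = \<zero>" if "?g a \<in> P (Suc i) <+>\<^bsub>R\<^esub> ideal_power R \<mm> (1 + c * t * j)" for a
    proof -
      have "\<forall>e\<in>{e. set e \<subseteq> {..<t} \<and> length e = j}. k (a # e) = \<zero>"
        using that i Suc.prems by (intro Suc.IH) auto
      then have "?g a = power_sum f t j (\<lambda>e. \<zero>)" by (intro power_sum_cong f) auto
      then show ?thesis by (simp add: power_sum_zero f)
    qed
    have "\<forall>a<t. ?g a = \<zero>"
    proof (rule horner_independent[of "f j" "P (Suc i)" "P i" c ?g "1 + c * t * j" t])
      show "?g a \<in> carrier R" for a using Suc.prems(2) K_closed by (intro power_sum_closed f) auto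
      show "b \<in> P i <+>\<^bsub>R\<^esub> ideal_power R \<mm> (n - c)" if "b \<in> carrier R" "f j \<otimes> b \<in> P i <+>\<^bsub>R\<^esub> ideal_power R \<mm> n" for n b
        using ar[OF i(1)] that unfolding fj by blast
      show "horner (f j) t ?g \<in> P i <+>\<^bsub>R\<^esub> ideal_power R \<mm> (1 + c * t * j + c * t)"
        using Suc.prems(3) by (simp add: i_def algebra_simps)
      show "f j \<in> P (Suc i)" "f j \<in> carrier R" unfolding fj by (rule fc[OF i(1)])+
      show "P i \<subseteq> P (Suc i)" using P(2)[OF i(1)] by blast
    qed (use idP z in auto)
    then have "\<forall>e\<in>{e. set e \<subseteq> {..<t} \<and> length e = j}. k (a # e) = \<zero>" if "a < t" for a
      using that i Suc.prems idP ideal_power_zero[OF max_ideal] additive_subgroup.zero_closed[OF ideal.axioms(1)[OF idP(2)]]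
      by (intro Suc.IH) (auto simp: add_ideals_iff intro!: bexI[of _ \<zero>])
    then show ?case
      by (auto simp: length_Suc_conv)
  qed
  note key = this
  have "\<forall>e\<in>{e. set e \<subseteq> {..<t} \<and> length e = d}. k e = \<zero>"
    if "\<forall>e. k e \<in> K" "power_sum f t d k \<in> ideal_power R \<mm> (1 + c * t * d)" for t k
  proof (rule key)
    have id0: "ideal (P 0) R" using P(1)[of 0] by (simp add: primeideal_def)
    have cl: "power_sum f t d k \<in> carrier R" using that K_closed by (intro power_sum_closed f) auto
    have "\<zero> \<in> P 0" using additive_subgroup.zero_closed[OF ideal.axioms(1)[OF id0]] .
    then show "power_sum f t d k \<in> P (d - d) <+>\<^bsub>R\<^esub> ideal_power R \<mm> (1 + c * t * d)"
      unfolding add_ideals_iff using that cl by (intro bexI[of _ \<zero>] bexI[of _ "power_sum f t d k"]) auto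
  qed (use that in auto)
  then show ?thesis using f by blast
qed

end

text \<open>Some exponent of such a monomial is smaller than that of \<open>L\<close>. There are \<open>size L\<close> choices of
  the place and the value of this exponent, and the other \<open>d - 1\<close> exponents are below \<open>N\<close>.\<close>

lemma card_monomials_not_divisible:
  assumes L: "set_mset L \<subseteq> {..<d}"
  shows "finite {M. set_mset M \<subseteq> {..<d} \<and> size M < N \<and> \<not> L \<subseteq># M}"
    and "card {M. set_mset M \<subseteq> {..<d} \<and> size M < N \<and> \<not> L \<subseteq># M} \<le> size L * N ^ (d - 1)"
proof -
  let ?E = "{M. set_mset M \<subseteq> {..<d} \<and> size M < N \<and> \<not> L \<subseteq># M}"
  let ?A = "\<lambda>i. PiE {..<d} (\<lambda>j. if j = i then {..<count L i} else {..<N})"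
  let ?r = "\<lambda>M. restrict (count M) {..<d}"
  have inj: "inj_on ?r {M. set_mset M \<subseteq> {..<d}}"
  proof (rule inj_onI)
    fix M M' assume M: "M \<in> {M. set_mset M \<subseteq> {..<d}}" "M' \<in> {M. set_mset M \<subseteq> {..<d}}" "?r M = ?r M'"
    show "M = M'"
    proof (rule multiset_eqI)
      fix j
      show "count M j = count M' j"
      proof (cases "j < d")
        case True then show ?thesis using M(3) by (metis lessThan_iff restrict_apply')
      next
        case False
        then have "j \<notin># M" "j \<notin># M'" using M by auto
        then show ?thesis by (simp add: not_in_iff)
      qed
    qed
  qed
  have im: "?r ` ?E \<subseteq> (\<Union>i\<in>{..<d}. ?A i)"
  proof
    fix g assume "g \<in> ?r ` ?E"
    then obtain M where M: "set_mset M \<subseteq> {..<d}" "size M < N" "\<not> L \<subseteq># M" "g = ?r M" by blast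
    then obtain i where i: "count M i < count L i" by (meson mset_subset_eqI not_less)
    then have "i \<in># L" by (simp add: count_greater_zero_iff[symmetric] del: count_greater_zero_iff)
    then have id: "i < d" using L by auto
    have "count M j < N" for j using M(2) count_le_size[of M j] by linarith
    then have "g \<in> ?A i" using i M(4) by auto
    then show "g \<in> (\<Union>i\<in>{..<d}. ?A i)" using id by blast
  qed
  have finA: "finite (?A i)" for i by (intro finite_PiE) auto
  then have finU: "finite (\<Union>i\<in>{..<d}. ?A i)" by blast
  have injE: "inj_on ?r ?E" using inj by (rule inj_on_subset) blast
  show "finite ?E" using finite_imageD[OF finite_subset[OF im finU] injE] .
  have cA: "card (?A i) = count L i * N ^ (d - 1)" if "i < d" for i
  proof -
    have "card (?A i) = (\<Prod>j<d. if j = i then count L i else N)"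
      by (simp add: card_PiE if_distrib cong: if_cong)
    also have "\<dots> = count L i * (\<Prod>j\<in>{..<d} - {i}. N)"
      using that by (subst prod.remove[of _ i]) auto
    finally show ?thesis using that by simp
  qed
  have "card ?E = card (?r ` ?E)" using card_image[OF injE] by simp
  also have "\<dots> \<le> card (\<Union>i\<in>{..<d}. ?A i)" by (rule card_mono[OF finU im])
  also have "\<dots> \<le> (\<Sum>i<d. card (?A i))" by (rule card_UN_le) simp
  also have "\<dots> = (\<Sum>i<d. count L i) * N ^ (d - 1)" using cA by (simp add: sum_distrib_right)
  also have "(\<Sum>i<d. count L i) = size L"
    unfolding size_multiset_overloaded_eq using L by (intro sum.mono_neutral_right) (auto simp: not_in_iff)
  finally show "card ?E \<le> size L * N ^ (d - 1)" .
qed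

context coefficient_field
begin

text \<open>As \<open>F L\<close> is a unit, the relation \<open>F(x) \<in> \<mm>\<^sup>s\<^sup>+\<^sup>1\<close> expresses \<open>x\<^sup>L\<close>, and with it every
  multiple of \<open>x\<^sup>L\<close>, by smaller monomials of the same degree and elements of higher order. So the
  monomials not divisible by \<open>L\<close> suffice to generate \<open>\<mm>\<^sup>n\<close> modulo \<open>\<mm>\<^sup>n\<^sup>+\<^sup>1\<close>, for all \<open>n < N\<close>.\<close>

lemma monomials_span:
  assumes x: "\<mm> = genideal R (x ` {..<d})" "\<And>i. i < d \<Longrightarrow> x i \<in> carrier R"
    and F: "F \<in> carrier (mpoly_ring R d)" "homogeneous R s F" "poly_ev R R identity d x F \<in> ideal_power R \<mm> (Suc s)"
    and L: "F L \<notin> \<mm>" "\<And>M. F M \<notin> \<mm> \<Longrightarrow> M \<le> L"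
    and ys: "set ys = (\<lambda>M. \<Otimes>i\<in>{..<d}. x i [^] count M i) ` {M. set_mset M \<subseteq> {..<d} \<and> size M < N \<and> \<not> L \<subseteq># M}"
  shows "carrier R \<subseteq> span (ideal_power R \<mm> N) ys"
proof -
  interpret presentation R R \<mm> identity identity d x by (rule trivial_presentation[OF x(2,1)])
  let ?W = "ideal_power R \<mm> N"
  have W: "ideal ?W R" by (rule ideal_power_ideal[OF max_ideal])
  define px where "px M = A.mval M" for M
  have pxc [simp]: "px M \<in> carrier R" for M unfolding px_def by (rule A.mval_closed)
  have ysc: "set ys \<subseteq> carrier R" using A.mval_closed by (auto simp: ys)
  have evm: "A.ev (monomial R k M) = k \<otimes> px M" if "k \<in> carrier R" for k M
    using A.ev_monomial[OF that] unfolding px_def by (simp add: identity_apply)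
  have xadd: "px (M + M') = px M \<otimes> px M'" if "set_mset M' \<subseteq> {..<d}" for M M'
    using that
  proof (induction M')
    case empty then show ?case using A.mval_empty by (simp add: px_def)
  next
    case (add i M')
    then have "i < d" "px (M + M') = px M \<otimes> px M'" by auto
    then show ?case using A.mval_add_mset[of i "M + M'"] A.mval_add_mset[of i M'] x(2) unfolding px_def[symmetric] by (simp add: m_assoc)
  qed
  note Fc = F(1)[unfolded mpoly_carrier_iff]
  have LF: "size L = s" "set_mset L \<subseteq> {..<d}"
  proof -
    have "F L \<noteq> \<zero>" using L(1) zero_closed by metis
    then show "size L = s" "set_mset L \<subseteq> {..<d}" using F(2) Fc by (auto simp: homogeneous_def)
  qed
  have xm: "px M \<in> ideal_power R \<mm> (size M)" if "set_mset M \<subseteq> {..<d}" for M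
    using monomial_in_power[OF that] unfolding px_def .
  have sc: "r \<otimes> v \<in> span ?W ys" if r: "r \<in> carrier R" and v: "v \<in> span ?W ys" "v \<in> ideal_power R \<mm> n"
    and up: "ideal_power R \<mm> (Suc n) \<subseteq> span ?W ys" for r v n
  proof -
    obtain k \<mu> where k: "k \<in> K" "\<mu> \<in> \<mm>" "r = k \<oplus> \<mu>" using decompose[OF r] .
    have vc: "v \<in> carrier R" using v(2) ideal_power_closed[OF max_ideal] by blast
    have "v \<otimes> \<mu> \<in> ideal_power R \<mm> (Suc n)" using v(2) k(2) by (simp add: ideal_power_Suc ideal_prod.prod)
    then have "\<mu> \<otimes> v \<in> span ?W ys" using up vc k(2) Icarr by (auto simp: m_comm)
    moreover have "k \<otimes> v \<in> span ?W ys" using span_scale[OF W ysc v(1) k(1)] .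
    moreover have "r \<otimes> v = k \<otimes> v \<oplus> \<mu> \<otimes> v" unfolding k(3) using k K_closed Icarr vc by (simp add: l_distr)
    ultimately show ?thesis using span_add[OF W ysc] by simp
  qed
  have mono: "px M \<in> span ?W ys" if "set_mset M \<subseteq> {..<d}" "size M = n" "n < N"
    "ideal_power R \<mm> (Suc n) \<subseteq> span ?W ys" for M n
    using that(1,2)
  proof (induction M rule: less_induct)
    case (less M)
    show ?case
    proof (cases "L \<subseteq># M")
      case False
      then show ?thesis using less.prems that(3) by (intro span_mem[OF W ysc]) (auto simp: ys px_def)
    next
      case True
      define D where "D = M - L"
      have D: "M = L + D" "set_mset D \<subseteq> {..<d}" using True less.prems by (auto simp: D_def dest: in_diffD)
      have n: "n = s + size D" using less.prems(2) D(1) LF(1) by simp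
      define Q where "Q = (\<lambda>M. if M \<noteq> L then F M else \<zero>)"
      have Qc: "Q \<in> carrier (mpoly_ring R d)" unfolding Q_def by (rule mpoly_restrict_closed[OF F(1)])
      have trm: "Q M' \<otimes> px (M' + D) \<in> span ?W ys" if "Q M' \<noteq> \<zero>" for M'
      proof -
        have M': "M' \<noteq> L" "F M' = Q M'" "F M' \<noteq> \<zero>" using that by (auto simp: Q_def split: if_splits)
        have "F M' \<in> carrier R" using Fc by blast
        moreover have "set_mset M' \<subseteq> {..<d}" "size M' = s" using M'(3) Fc F(2) by (auto simp: homogeneous_def)
        ultimately have M'd: "set_mset (M' + D) \<subseteq> {..<d}" "size (M' + D) = n" "F M' \<in> carrier R"
          using D(2) n by auto
        have xM': "px (M' + D) \<in> ideal_power R \<mm> n" using xm M'd by blast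
        show ?thesis
        proof (cases "F M' \<in> \<mm>")
          case True
          then have "px (M' + D) \<otimes> F M' \<in> ideal_power R \<mm> (Suc n)" using xM' by (simp only: ideal_power_Suc ideal_prod.prod)
          moreover have "px (M' + D) \<otimes> F M' = Q M' \<otimes> px (M' + D)"
            unfolding \<open>F M' = Q M'\<close>[symmetric] by (rule m_comm[OF pxc M'd(3)])
          ultimately show ?thesis using \<open>ideal_power R \<mm> (Suc n) \<subseteq> span ?W ys\<close> by (metis subsetD)
        next
          case False
          then have "M' < L" using L(2) M'(1) by (simp add: order.strict_iff_order)
          then have "M' + D < M" using D(1) by (simp add: add_strict_right_mono)
          then have "px (M' + D) \<in> span ?W ys" using less.IH M'd by blast
          then show ?thesis using sc[of "F M'" "px (M' + D)" n] M'd(3) xM' \<open>F M' = Q M'\<close> \<open>ideal_power R \<mm> (Suc n) \<subseteq> span ?W ys\<close> by simp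
        qed
      qed
      have Qs: "A.ev Q \<otimes> px D \<in> span ?W ys"
      proof -
        let ?V = "\<lambda>P. P \<in> carrier (mpoly_ring R d) \<and> A.ev P \<otimes> px D \<in> span ?W ys"
        have "?V Q"
        proof (rule support_induct[of Q ?V])
          show "?V (\<lambda>M. \<zero>)" using span_base[OF W ysc] ideal_power_zero[OF max_ideal] by auto
        next
          fix M' assume M': "Q M' \<noteq> \<zero>"
          have c: "Q M' \<in> carrier R" "set_mset M' \<subseteq> {..<d}" using Qc M' by (auto simp: mpoly_carrier_iff)
          have "A.ev (monomial R (Q M') M') \<otimes> px D = Q M' \<otimes> px (M' + D)"
            using c D(2) by (simp add: evm xadd m_assoc)
          then show "?V (monomial R (Q M') M')" using trm[OF M'] c by (auto intro!: mpoly_monomial_closed)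
        next
          fix P1 P2 assume "?V P1" "?V P2"
          then show "?V (\<lambda>M. P1 M \<oplus> P2 M)" using span_add[OF W ysc]
            by (simp add: A.ev_add mpoly_add_closed l_distr)
        qed (use Qc in \<open>auto simp: mpoly_carrier_iff\<close>)
        then show ?thesis by blast
      qed
      have FL: "F L \<in> carrier R" using Fc by blast
      have "F = (\<lambda>M. Q M \<oplus> monomial R (F L) L M)"
        using Fc by (auto simp: Q_def monomial_def fun_eq_iff)
      then have evF: "A.ev F = A.ev Q \<oplus> F L \<otimes> px L"
        using A.ev_add[OF Qc mpoly_monomial_closed[OF FL LF(2)]] evm[OF FL] by simp
      have "A.ev F \<otimes> px D \<in> ideal_power R \<mm> (Suc s + size D)"
        by (rule ideal_power_mult[OF max_ideal F(3) xm[OF D(2)]])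
      then have FD: "A.ev F \<otimes> px D \<in> span ?W ys" using n that(4) by auto
      have QcR: "A.ev Q \<otimes> px D \<in> carrier R" using Qc by simp
      have eq: "F L \<otimes> px M = A.ev F \<otimes> px D \<oplus> \<ominus> \<one> \<otimes> (A.ev Q \<otimes> px D)"
      proof -
        have "A.ev F \<otimes> px D = A.ev Q \<otimes> px D \<oplus> F L \<otimes> px M"
          unfolding evF using Qc FL D by (simp add: l_distr xadd m_assoc)
        then show ?thesis using QcR FL by (simp add: l_minus a_ac r_neg2 r_neg r_neg1)
      qed
      have FLM: "F L \<otimes> px M \<in> span ?W ys"
        unfolding eq using FD span_scale[OF W ysc Qs, of "\<ominus> \<one>"] K_uminus[of \<one>] by (intro span_add[OF W ysc]) auto
      obtain k \<mu> where k: "k \<in> K" "\<mu> \<in> \<mm>" "F L = k \<oplus> \<mu>" using decompose[OF FL] .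
      have k0: "k \<noteq> \<zero>" using k L(1) Icarr by auto
      have xM: "px M \<in> ideal_power R \<mm> n" using xm less.prems by blast
      have "px M \<otimes> (\<ominus> \<mu>) \<in> ideal_power R \<mm> (Suc n)" using xM a_inv_closed[OF k(2)] by (simp add: ideal_power_Suc ideal_prod.prod)
      then have mu: "px M \<otimes> (\<ominus> \<mu>) \<in> span ?W ys" using that(4) by blast
      have c: "k \<in> carrier R" "\<mu> \<in> carrier R" "inv k \<in> K" "inv k \<in> carrier R" "inv k \<otimes> k = \<one>"
        using k K_closed Icarr K_inv k0 by auto
      have "k \<otimes> px M = F L \<otimes> px M \<oplus> px M \<otimes> (\<ominus> \<mu>)"
        unfolding k(3) using c by (simp add: l_distr m_comm[of "px M"] l_minus a_assoc r_neg)
      then have kx: "k \<otimes> px M \<in> span ?W ys" using span_add[OF W ysc FLM mu] by simp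
      have "inv k \<otimes> (k \<otimes> px M) \<in> span ?W ys" by (rule span_scale[OF W ysc kx c(3)])
      then show ?thesis using c by (simp add: m_assoc[symmetric])
    qed
  qed
  have "ideal_power R \<mm> (N - j) \<subseteq> span ?W ys" if "j \<le> N" for j
    using that
  proof (induction j)
    case 0 then show ?case using span_base[OF W ysc] by simp
  next
    case (Suc j)
    define n where "n = N - Suc j"
    have n: "n < N" "N - j = Suc n" using Suc.prems by (auto simp: n_def)
    have up: "ideal_power R \<mm> (Suc n) \<subseteq> span ?W ys" using Suc n by simp
    show ?case
    proof
      fix b assume "b \<in> ideal_power R \<mm> (N - Suc j)"
      then obtain P where P: "P \<in> carrier (mpoly_ring R d)" "homogeneous R n P" "A.ev P = b"
        using power_form n_def by blast
      let ?V = "\<lambda>P. P \<in> carrier (mpoly_ring R d) \<and> A.ev P \<in> span ?W ys"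
      have "?V P"
      proof (rule support_induct[of P ?V])
        show "?V (\<lambda>M. \<zero>)" using span_base[OF W ysc] ideal_power_zero[OF max_ideal] by auto
      next
        fix M assume M: "P M \<noteq> \<zero>"
        have c: "P M \<in> carrier R" "set_mset M \<subseteq> {..<d}" "size M = n"
          using P M by (auto simp: mpoly_carrier_iff homogeneous_def)
        have "P M \<otimes> px M \<in> span ?W ys"
          using sc[OF c(1) mono[OF c(2,3) n(1) up] _ up] xm[OF c(2)] c(3) by simp
        then show "?V (monomial R (P M) M)" using c by (auto simp: evm intro!: mpoly_monomial_closed)
      next
        fix P1 P2 assume "?V P1" "?V P2"
        then show "?V (\<lambda>M. P1 M \<oplus> P2 M)" using span_add[OF W ysc]
          by (simp add: A.ev_add mpoly_add_closed)
      qed (use P in \<open>auto simp: mpoly_carrier_iff\<close>)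
      then show "b \<in> span ?W ys" using P by blast
    qed
  qed
  from this[of N] show ?thesis by simp
qed

text \<open>Suppose that a coefficient is a unit. Then \<open>R/\<mm>\<^sup>N\<close> is generated over the coefficient field
  by at most \<open>s N\<^sup>d\<^sup>-\<^sup>1\<close> monomials, whereas the chain of primes provides \<open>t\<^sup>d\<close> independent
  elements with \<open>N\<close> linear in \<open>t\<close>.\<close>

lemma regular_independent:
  assumes x: "\<mm> = genideal R (x ` {..<d})" "\<And>i. i < d \<Longrightarrow> x i \<in> carrier R"
    and P: "\<And>i. i \<le> d \<Longrightarrow> primeideal (P i) R" "\<And>i. i < d \<Longrightarrow> P i \<subset> P (Suc i)"
    and F: "F \<in> carrier (mpoly_ring R d)" "homogeneous R s F" "poly_ev R R identity d x F \<in> ideal_power R \<mm> (Suc s)"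
  shows "F M \<in> \<mm>"
proof (rule ccontr)
  assume "F M \<notin> \<mm>"
  interpret presentation R R \<mm> identity identity d x by (rule trivial_presentation[OF x(2,1)])
  let ?S = "{M. F M \<notin> \<mm>}"
  have "?S \<subseteq> {M. F M \<noteq> \<zero>}" using zero_closed by auto
  then have fin: "finite ?S" using F(1) finite_subset by (auto simp: mpoly_carrier_iff)
  define L where "L = Max ?S"
  have L: "F L \<notin> \<mm>" "\<And>M. F M \<notin> \<mm> \<Longrightarrow> M \<le> L"
    using Max_in[OF fin] Max_ge[OF fin] \<open>F M \<notin> \<mm>\<close> by (auto simp: L_def)
  have Ln: "F L \<noteq> \<zero>" using L(1) zero_closed by auto
  have LF: "size L = s" "set_mset L \<subseteq> {..<d}"
    using Ln F by (auto simp: homogeneous_def mpoly_carrier_iff)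
  obtain f c where f: "\<And>j. f j \<in> carrier R" and ind: "\<And>t k e. (\<And>e. k e \<in> K) \<Longrightarrow>
     power_sum f t d k \<in> ideal_power R \<mm> (1 + c * t * d) \<Longrightarrow> e \<in> {e. set e \<subseteq> {..<t} \<and> length e = d} \<Longrightarrow> k e = \<zero>"
    using prime_chain_independent[of d P, OF P] by blast
  show False
  proof (cases "s = 0")
    case True
    then have "L = {#}" using LF by simp
    then have "F = monomial R (F {#}) {#}" using F(2) True by (force simp: homogeneous_def monomial_def fun_eq_iff)
    then have "A.ev F = F {#}" using A.self_ev_const[of "F {#}"] mpoly_coeff[OF F(1)] by (metis monomial_empty)
    then show False using F(3) True ideal_power_1[OF max_ideal] L(1) \<open>L = {#}\<close> by simp
  next
    case False
    then have "L \<noteq> {#}" using LF by auto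
    then have d: "d \<ge> 1" using LF(2) by (cases d) auto
    \<comment> \<open>Large enough for \<open>s N\<^sup>d\<^sup>-\<^sup>1 < t\<^sup>d\<close>, since \<open>N \<le> t (1 + c d)\<close>.\<close>
    define t where "t = s * (1 + c * d) ^ (d - 1) + 1"
    define N where "N = 1 + c * t * d"
    have t1: "1 \<le> t" by (simp add: t_def)
    have "N \<le> t * (1 + c * d)" using t1 by (simp add: N_def algebra_simps)
    then have "N ^ (d - 1) \<le> t ^ (d - 1) * (1 + c * d) ^ (d - 1)"
      by (metis power_mono power_mult_distrib zero_le)
    then have "s * N ^ (d - 1) \<le> s * (1 + c * d) ^ (d - 1) * t ^ (d - 1)"
      by (metis mult.assoc mult.commute mult_le_mono2)
    also have "\<dots> < t * t ^ (d - 1)" using t1 by (intro mult_strict_right_mono) (auto simp: t_def)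
    also have "\<dots> = t ^ d" using d by (metis Suc_diff_1 less_eq_Suc_le One_nat_def power_Suc)
    finally have big: "s * N ^ (d - 1) < t ^ d" .
    let ?E = "{M. set_mset M \<subseteq> {..<d} \<and> size M < N \<and> \<not> L \<subseteq># M}"
    have finE: "finite ?E" "card ?E \<le> s * N ^ (d - 1)"
      using card_monomials_not_divisible[OF LF(2), of N] LF(1) by auto
    obtain Ms where Ms: "set Ms = ?E" "distinct Ms" using finite_distinct_list[OF finE(1)] by blast
    let ?ys = "map (\<lambda>M. A.mval M) Ms"
    have len: "length ?ys < t ^ d" using finE(2) big Ms by (metis distinct_card le_less_trans length_map)
    have sp: "carrier R \<subseteq> span (ideal_power R \<mm> N) ?ys"
      using Ms(1) by (intro monomials_span[OF x F L]) auto
    let ?B = "{e. set e \<subseteq> {..<t} \<and> length e = d}"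
    have cB: "finite ?B" "card ?B = t ^ d" using finite_lists_length_eq[of "{..<t}" d] card_lists_length_eq[of "{..<t}" d] by auto
    let ?v = "\<lambda>e. power_sum f t d (\<lambda>e'. if e' = e then \<one> else \<zero>)"
    have vc: "?v e \<in> carrier R" for e by (rule power_sum_closed[OF f]) simp
    obtain k where k: "\<And>e. k e \<in> K" "\<exists>e\<in>?B. k e \<noteq> \<zero>" "(\<Oplus>e\<in>?B. k e \<otimes> ?v e) \<in> ideal_power R \<mm> N"
      using linear_dependence[OF ideal_power_ideal[OF max_ideal] cB(1), of ?ys ?v N] len cB(2) sp vc A.mval_closed by auto
    have "power_sum f t d k \<in> ideal_power R \<mm> (1 + c * t * d)"
      using k(3) power_sum_expand[OF f, of k] K_closed[OF k(1)] by (simp add: N_def)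
    then show False using ind[of k t] k(1,2) by blast
  qed
qed

end

section \<open>Homomorphisms out of complete regular local rings\<close>

context ideal
begin

lemmas I_add = additive_subgroup.a_closed[OF is_additive_subgroup]
lemmas I_neg = additive_subgroup.a_inv_closed[OF is_additive_subgroup]

lemma diff_self: "a \<in> carrier R \<Longrightarrow> a \<ominus> a \<in> I"
  by (simp add: a_minus_def r_neg)

lemma diff_sym: "a \<in> carrier R \<Longrightarrow> b \<in> carrier R \<Longrightarrow> a \<ominus> b \<in> I \<Longrightarrow> b \<ominus> a \<in> I"
proof -
  assume a: "a \<in> carrier R" "b \<in> carrier R" "a \<ominus> b \<in> I"
  have "b \<ominus> a = \<ominus> (a \<ominus> b)" using a by (simp add: a_minus_def minus_add a_comm)
  then show ?thesis using I_neg[OF a(3)] by simp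
qed

lemma diff_trans: "a \<in> carrier R \<Longrightarrow> b \<in> carrier R \<Longrightarrow> c \<in> carrier R \<Longrightarrow> a \<ominus> b \<in> I \<Longrightarrow> b \<ominus> c \<in> I \<Longrightarrow> a \<ominus> c \<in> I"
proof -
  assume a: "a \<in> carrier R" "b \<in> carrier R" "c \<in> carrier R" "a \<ominus> b \<in> I" "b \<ominus> c \<in> I"
  have "a \<ominus> c = (a \<ominus> b) \<oplus> (b \<ominus> c)" using a by (simp add: a_minus_def a_assoc r_neg1)
  then show ?thesis using I_add[OF a(4,5)] by simp
qed

lemma diff_add: "a \<in> carrier R \<Longrightarrow> b \<in> carrier R \<Longrightarrow> c \<in> carrier R \<Longrightarrow> d \<in> carrier R \<Longrightarrow>
  a \<ominus> b \<in> I \<Longrightarrow> c \<ominus> d \<in> I \<Longrightarrow> (a \<oplus> c) \<ominus> (b \<oplus> d) \<in> I"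
proof -
  assume a: "a \<in> carrier R" "b \<in> carrier R" "c \<in> carrier R" "d \<in> carrier R" "a \<ominus> b \<in> I" "c \<ominus> d \<in> I"
  have "(a \<oplus> c) \<ominus> (b \<oplus> d) = (a \<ominus> b) \<oplus> (c \<ominus> d)" using a by (simp add: a_minus_def minus_add a_ac)
  then show ?thesis using I_add[OF a(5,6)] by simp
qed

lemma diff_mult: "a \<in> carrier R \<Longrightarrow> b \<in> carrier R \<Longrightarrow> c \<in> carrier R \<Longrightarrow> d \<in> carrier R \<Longrightarrow>
  a \<ominus> b \<in> I \<Longrightarrow> c \<ominus> d \<in> I \<Longrightarrow> (a \<otimes> c) \<ominus> (b \<otimes> d) \<in> I"
proof -
  assume a: "a \<in> carrier R" "b \<in> carrier R" "c \<in> carrier R" "d \<in> carrier R" "a \<ominus> b \<in> I" "c \<ominus> d \<in> I"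
  have "(a \<otimes> c) \<ominus> (b \<otimes> d) = (a \<ominus> b) \<otimes> c \<oplus> b \<otimes> (c \<ominus> d)"
    using a by (simp add: a_minus_def l_distr r_distr l_minus r_minus a_assoc r_neg1)
  then show ?thesis using I_add[OF I_r_closed[OF a(5,3)] I_l_closed[OF a(6,2)]] by simp
qed

lemma diff_mem: "a \<in> carrier R \<Longrightarrow> b \<in> I \<Longrightarrow> a \<ominus> b \<in> I \<Longrightarrow> a \<in> I"
proof -
  assume a: "a \<in> carrier R" "b \<in> I" "a \<ominus> b \<in> I"
  have "a = (a \<ominus> b) \<oplus> b" using a Icarr by (simp add: a_minus_def a_assoc l_neg)
  then show ?thesis using I_add[OF a(3,2)] by simp
qed

lemma minus_mem: "a \<in> I \<Longrightarrow> b \<in> I \<Longrightarrow> a \<ominus> b \<in> I"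
  by (simp add: a_minus_def I_add I_neg)

end

lemma poly_ev_unique:
  assumes e: "evaluation R T \<phi> m c" and h: "h \<in> ring_hom (mpoly_ring R m) T"
    and const: "\<And>k. k \<in> carrier R \<Longrightarrow> h (ring.indexed_const R k) = \<phi> k"
    and var: "\<And>i. i < m \<Longrightarrow> h (ring.indexed_var R i) = c i"
    and P: "P \<in> carrier (mpoly_ring R m)"
  shows "h P = poly_ev R T \<phi> m c P"
proof -
  interpret evaluation R T \<phi> m c by (rule e)
  have "P \<in> R.indexed_pset {..<m} (carrier R)" using P by (simp add: mpoly_ring_def)
  then show ?thesis
  proof induction
    case (indexed_const k)
    then show ?case by (simp add: const)
  next
    case (indexed_padd P Q)
    then have c: "P \<in> carrier (mpoly_ring R m)" "Q \<in> carrier (mpoly_ring R m)"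
      by (simp_all add: mpoly_ring_def)
    have "R.indexed_padd P Q = P \<oplus>\<^bsub>mpoly_ring R m\<^esub> Q" by (simp add: R.indexed_padd_def)
    then show ?case using indexed_padd.IH c ev_add[OF c] ring_hom_add[OF h c] by simp
  next
    case (indexed_pmult P i)
    then have c: "P \<in> carrier (mpoly_ring R m)" "i < m" by (simp_all add: mpoly_ring_def)
    have v: "R.indexed_var i \<in> carrier (mpoly_ring R m)" using c by (intro R.mpoly_var_closed)
    have "R.indexed_pmult P i = P \<otimes>\<^bsub>mpoly_ring R m\<^esub> R.indexed_var i"
      using c by (simp add: R.mpoly_mult_var)
    then show ?case using indexed_pmult.IH c ring_hom_mult[OF h c(1) v] var ev_pmult[OF c] by simp
  qed
qed

lemma (in evaluation) ev_comp:
  assumes "cring T" "g \<in> ring_hom S T" "P \<in> carrier (mpoly_ring R m)"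
    "\<And>k. k \<in> carrier R \<Longrightarrow> g (h k) = \<phi> k" "\<And>i. i < m \<Longrightarrow> g (c i) = c' i"
  shows "g (ev P) = poly_ev R T \<phi> m c' P"
proof -
  interpret T: cring T by fact
  have \<phi>: "\<phi> \<in> ring_hom R T"
  proof (rule ring_hom_memI)
    fix x y assume "x \<in> carrier R" "y \<in> carrier R"
    then show "\<phi> (x \<otimes> y) = \<phi> x \<otimes>\<^bsub>T\<^esub> \<phi> y" "\<phi> (x \<oplus> y) = \<phi> x \<oplus>\<^bsub>T\<^esub> \<phi> y" "\<phi> x \<in> carrier T"
      by (simp_all flip: assms(4) add: ring_hom_mult[OF assms(2)] ring_hom_add[OF assms(2)] ring_hom_closed[OF assms(2)])
  qed (simp flip: assms(4) add: ring_hom_one[OF assms(2)])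
  have e: "evaluation R T \<phi> m c'"
  proof (unfold_locales)
    fix i assume "i < m"
    then show "c' i \<in> carrier T" using assms(5)[of i] c_closed[of i] ring_hom_closed[OF assms(2)] by metis
  qed (rule \<phi>)
  have "(g \<circ> ev) P = poly_ev R T \<phi> m c' P"
    by (rule poly_ev_unique[OF e ring_hom_trans[OF ev_ring_hom assms(2)]])
      (use assms in \<open>simp_all add: ev_var\<close>)
  then show ?thesis by simp
qed

locale filtration = cring W for W (structure) +
  fixes F :: "nat \<Rightarrow> 'a set"
  assumes F_ideal: "ideal (F n) W" and F_0: "F 0 = carrier W" and F_decreasing: "F (Suc n) \<subseteq> F n"
    and F_mult: "a \<in> F i \<Longrightarrow> b \<in> F j \<Longrightarrow> a \<otimes> b \<in> F (i + j)"

lemma (in filtration) F_antimono: "i \<le> j \<Longrightarrow> F j \<subseteq> F i"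
  using F_decreasing by (rule lift_Suc_antimono_le)

locale complete_filtration = filtration +
  assumes F_separated: "u \<in> carrier W \<Longrightarrow> (\<And>n. u \<in> F n) \<Longrightarrow> u = \<zero>"
    and F_complete: "(\<And>n. x n \<in> carrier W) \<Longrightarrow> (\<And>n. x (Suc n) \<ominus> x n \<in> F n) \<Longrightarrow>
      \<exists>y\<in>carrier W. \<forall>n. y \<ominus> x n \<in> F n"

lemma (in evaluation) ev_in_filtration:
  assumes "filtration S F" and c: "\<And>i. i < m \<Longrightarrow> c i \<in> F 1"
    and P: "P \<in> carrier (mpoly_ring R m)" "\<And>M. P M \<noteq> \<zero> \<Longrightarrow> h (P M) \<in> F (n - size M)"
  shows "ev P \<in> F n"
proof -
  interpret F: filtration S F by fact
  interpret Fn: ideal "F n" S by (rule F.F_ideal)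
  have mv: "mval M \<in> F (size M)" if "set_mset M \<subseteq> {..<m}" for M
    using that
  proof (induction M)
    case empty then show ?case using F.F_0 by (simp add: mval_empty)
  next
    case (add i M)
    then have "mval M \<otimes>\<^bsub>S\<^esub> c i \<in> F (size M + 1)" using c by (intro F.F_mult) auto
    then show ?case using mval_add_mset[of i M] add.prems by simp
  qed
  let ?V = "\<lambda>P. P \<in> carrier (mpoly_ring R m) \<and> ev P \<in> F n"
  have "?V P"
  proof (rule R.support_induct[of P ?V])
    fix M assume M: "P M \<noteq> \<zero>"
    have cl: "P M \<in> carrier R" "set_mset M \<subseteq> {..<m}" using P(1) M by (auto simp: R.mpoly_carrier_iff)
    have "h (P M) \<otimes>\<^bsub>S\<^esub> mval M \<in> F (n - size M + size M)" by (rule F.F_mult[OF P(2)[OF M] mv[OF cl(2)]])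
    then have "ev (monomial R (P M) M) \<in> F n"
      using subsetD[OF F.F_antimono[of n "n - size M + size M"]] ev_monomial[OF cl(1), of M] by simp
    then show "?V (monomial R (P M) M)" using cl by (auto intro!: R.mpoly_monomial_closed)
  next
    fix P1 P2 assume "?V P1" "?V P2"
    then show "?V (\<lambda>M. P1 M \<oplus> P2 M)"
      by (simp add: ev_add R.mpoly_add_closed Fn.a_closed)
  qed (use P in \<open>auto simp: R.mpoly_carrier_iff\<close>)
  then show ?thesis by blast
qed

text \<open>An element of \<open>A\<close> is the limit of values of polynomials, and its image is the limit of the
  corresponding values in \<open>W\<close>. The bound makes these values a Cauchy sequence, and independent of
  the approximation; a limit of sums or products is the sum or product of the limits, so the map
  is a homomorphism.\<close>

lemma hom_extension:
  assumes eA: "evaluation K A i d y" and eW: "evaluation K W j d w"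
    and fA: "filtration A F" and fW: "complete_filtration W G"
    and approx: "\<And>a n. a \<in> carrier A \<Longrightarrow> \<exists>P\<in>carrier (mpoly_ring K d). a \<ominus>\<^bsub>A\<^esub> poly_ev K A i d y P \<in> F n"
    and bound: "\<And>P n. P \<in> carrier (mpoly_ring K d) \<Longrightarrow> poly_ev K A i d y P \<in> F n \<Longrightarrow> poly_ev K W j d w P \<in> G n"
  shows "\<exists>\<theta>\<in>ring_hom A W. \<forall>a\<in>carrier A. \<forall>n. \<forall>P\<in>carrier (mpoly_ring K d).
    a \<ominus>\<^bsub>A\<^esub> poly_ev K A i d y P \<in> F n \<longrightarrow> \<theta> a \<ominus>\<^bsub>W\<^esub> poly_ev K W j d w P \<in> G n"
proof -
  interpret eA: evaluation K A i d y by fact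
  interpret eW: evaluation K W j d w by fact
  interpret F: filtration A F by fact
  interpret G: complete_filtration W G by fact
  let ?MP = "carrier (mpoly_ring K d)"
  interpret MP: cring "mpoly_ring K d" by (rule eA.R.mpoly_cring)
  interpret hA: ring_hom_cring "mpoly_ring K d" A eA.ev by (rule eA.ev_ring_hom_cring)
  interpret hW: ring_hom_cring "mpoly_ring K d" W eW.ev by (rule eW.ev_ring_hom_cring)
  have agree: "eW.ev P \<ominus>\<^bsub>W\<^esub> eW.ev Q \<in> G n"
    if P: "P \<in> ?MP" and Q: "Q \<in> ?MP" and a: "a \<in> carrier A" "a \<ominus>\<^bsub>A\<^esub> eA.ev P \<in> F n" "a \<ominus>\<^bsub>A\<^esub> eA.ev Q \<in> F n" for P Q a n
  proof -
    interpret Fn: ideal "F n" A by (rule F.F_ideal)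
    have "eA.ev P \<ominus>\<^bsub>A\<^esub> eA.ev Q \<in> F n"
      using Fn.diff_trans[of "eA.ev P" a "eA.ev Q"] Fn.diff_sym[of a "eA.ev P"] P Q a by simp
    then show ?thesis
      using bound[of "\<lambda>M. P M \<ominus>\<^bsub>K\<^esub> Q M" n] eA.ev_minus[OF P Q] eW.ev_minus[OF P Q]
        MP.minus_closed[OF P Q] eA.R.mpoly_minus[OF P Q] by simp
  qed
  have "\<forall>a. \<exists>P. a \<in> carrier A \<longrightarrow> (\<forall>n. P n \<in> ?MP \<and> a \<ominus>\<^bsub>A\<^esub> eA.ev (P n) \<in> F n)"
    using approx by metis
  then obtain P where P: "\<And>a n. a \<in> carrier A \<Longrightarrow> P a n \<in> ?MP"
    "\<And>a n. a \<in> carrier A \<Longrightarrow> a \<ominus>\<^bsub>A\<^esub> eA.ev (P a n) \<in> F n" by metis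
  have "\<exists>z\<in>carrier W. \<forall>n. z \<ominus>\<^bsub>W\<^esub> eW.ev (P a n) \<in> G n" if a: "a \<in> carrier A" for a
  proof (rule G.F_complete)
    fix n
    show "eW.ev (P a n) \<in> carrier W" using P(1)[OF a] by simp
    show "eW.ev (P a (Suc n)) \<ominus>\<^bsub>W\<^esub> eW.ev (P a n) \<in> G n"
      using agree[OF P(1)[OF a] P(1)[OF a] a] P(2)[OF a] F.F_decreasing by blast
  qed
  then obtain \<theta> where \<theta>: "\<And>a. a \<in> carrier A \<Longrightarrow> \<theta> a \<in> carrier W"
    "\<And>a n. a \<in> carrier A \<Longrightarrow> \<theta> a \<ominus>\<^bsub>W\<^esub> eW.ev (P a n) \<in> G n" by metis
  have key: "\<theta> a \<ominus>\<^bsub>W\<^esub> eW.ev Q \<in> G n" if a: "a \<in> carrier A" and Q: "Q \<in> ?MP" "a \<ominus>\<^bsub>A\<^esub> eA.ev Q \<in> F n" for a Q n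
  proof -
    interpret Gn: ideal "G n" W by (rule G.F_ideal)
    show ?thesis
      using Gn.diff_trans[of "\<theta> a" "eW.ev (P a n)" "eW.ev Q"] \<theta>[OF a] agree[OF P(1)[OF a] Q(1) a P(2)[OF a] Q(2)]
        P(1)[OF a] Q(1) by simp
  qed
  have eqI: "u = v" if uv: "u \<in> carrier W" "v \<in> carrier W" "\<And>n. \<exists>Q\<in>?MP. u \<ominus>\<^bsub>W\<^esub> eW.ev Q \<in> G n \<and> v \<ominus>\<^bsub>W\<^esub> eW.ev Q \<in> G n" for u v
  proof -
    have "u \<ominus>\<^bsub>W\<^esub> v \<in> G n" for n
    proof -
      interpret Gn: ideal "G n" W by (rule G.F_ideal)
      obtain Q where "Q \<in> ?MP" "u \<ominus>\<^bsub>W\<^esub> eW.ev Q \<in> G n" "v \<ominus>\<^bsub>W\<^esub> eW.ev Q \<in> G n" using uv(3) by blast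
      then show ?thesis using Gn.diff_trans[of u "eW.ev Q" v] Gn.diff_sym[of v "eW.ev Q"] uv(1,2) by simp
    qed
    then have "u \<ominus>\<^bsub>W\<^esub> v = \<zero>\<^bsub>W\<^esub>" using that by (intro G.F_separated) auto
    then show ?thesis using that by (simp add: eW.S.r_right_minus_eq)
  qed
  have "\<theta> \<in> ring_hom A W"
  proof (rule ring_hom_memI)
    fix a b assume ab: "a \<in> carrier A" "b \<in> carrier A"
    show "\<theta> a \<in> carrier W" using \<theta> ab by blast
    show "\<theta> (a \<otimes>\<^bsub>A\<^esub> b) = \<theta> a \<otimes>\<^bsub>W\<^esub> \<theta> b"
    proof (rule eqI)
      fix n
      interpret Fn: ideal "F n" A by (rule F.F_ideal)
      interpret Gn: ideal "G n" W by (rule G.F_ideal)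
      let ?Q = "P a n \<otimes>\<^bsub>power_series_ring K\<^esub> P b n"
      have Q: "?Q \<in> ?MP" using P(1) ab by (intro eA.R.mpoly_mult_closed)
      have "a \<otimes>\<^bsub>A\<^esub> b \<ominus>\<^bsub>A\<^esub> eA.ev ?Q \<in> F n"
        using P ab by (simp add: eA.ev_mult Fn.diff_mult)
      moreover have "\<theta> a \<otimes>\<^bsub>W\<^esub> \<theta> b \<ominus>\<^bsub>W\<^esub> eW.ev ?Q \<in> G n"
        using P ab \<theta> by (simp add: eW.ev_mult Gn.diff_mult)
      ultimately show "\<exists>Q\<in>?MP. \<theta> (a \<otimes>\<^bsub>A\<^esub> b) \<ominus>\<^bsub>W\<^esub> eW.ev Q \<in> G n \<and> \<theta> a \<otimes>\<^bsub>W\<^esub> \<theta> b \<ominus>\<^bsub>W\<^esub> eW.ev Q \<in> G n"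
        using key[of "a \<otimes>\<^bsub>A\<^esub> b" ?Q n] Q ab by blast
    qed (use \<theta> ab in auto)
    show "\<theta> (a \<oplus>\<^bsub>A\<^esub> b) = \<theta> a \<oplus>\<^bsub>W\<^esub> \<theta> b"
    proof (rule eqI)
      fix n
      interpret Fn: ideal "F n" A by (rule F.F_ideal)
      interpret Gn: ideal "G n" W by (rule G.F_ideal)
      let ?Q = "\<lambda>M. P a n M \<oplus>\<^bsub>K\<^esub> P b n M"
      have Q: "?Q \<in> ?MP" using P(1) ab by (intro eA.R.mpoly_add_closed)
      have "(a \<oplus>\<^bsub>A\<^esub> b) \<ominus>\<^bsub>A\<^esub> eA.ev ?Q \<in> F n"
        using P ab by (simp add: eA.ev_add Fn.diff_add)
      moreover have "(\<theta> a \<oplus>\<^bsub>W\<^esub> \<theta> b) \<ominus>\<^bsub>W\<^esub> eW.ev ?Q \<in> G n"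
        using P ab \<theta> by (simp add: eW.ev_add Gn.diff_add)
      ultimately show "\<exists>Q\<in>?MP. \<theta> (a \<oplus>\<^bsub>A\<^esub> b) \<ominus>\<^bsub>W\<^esub> eW.ev Q \<in> G n \<and> (\<theta> a \<oplus>\<^bsub>W\<^esub> \<theta> b) \<ominus>\<^bsub>W\<^esub> eW.ev Q \<in> G n"
        using key[of "a \<oplus>\<^bsub>A\<^esub> b" ?Q n] Q ab by blast
    qed (use \<theta> ab in auto)
  next
    show "\<theta> \<one>\<^bsub>A\<^esub> = \<one>\<^bsub>W\<^esub>"
    proof (rule eqI)
      fix n
      interpret Fn: ideal "F n" A by (rule F.F_ideal)
      interpret Gn: ideal "G n" W by (rule G.F_ideal)
      let ?Q = "eA.R.indexed_const \<one>\<^bsub>K\<^esub> :: nat multiset \<Rightarrow> _"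
      have "\<one>\<^bsub>A\<^esub> \<ominus>\<^bsub>A\<^esub> eA.ev ?Q \<in> F n" using Fn.diff_self[of "\<one>\<^bsub>A\<^esub>"] by simp
      moreover have "\<one>\<^bsub>W\<^esub> \<ominus>\<^bsub>W\<^esub> eW.ev ?Q \<in> G n" using Gn.diff_self[of "\<one>\<^bsub>W\<^esub>"] by simp
      ultimately show "\<exists>Q\<in>?MP. \<theta> \<one>\<^bsub>A\<^esub> \<ominus>\<^bsub>W\<^esub> eW.ev Q \<in> G n \<and> \<one>\<^bsub>W\<^esub> \<ominus>\<^bsub>W\<^esub> eW.ev Q \<in> G n"
        using key[of "\<one>\<^bsub>A\<^esub>" ?Q n] by blast
    qed (use \<theta> in auto)
  qed
  then show ?thesis using key by blast
qed

lemma (in cring) ideal_power_filtration: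
  assumes "ideal I R" shows "filtration R (ideal_power R I)"
proof (intro filtration.intro filtration_axioms.intro is_cring)
  show "ideal (ideal_power R I n) R" for n by (rule ideal_power_ideal[OF assms])
  show "ideal_power R I (Suc n) \<subseteq> ideal_power R I n" for n by (rule ideal_power_antimono[OF assms]) simp
  show "a \<otimes> b \<in> ideal_power R I (i + j)" if "a \<in> ideal_power R I i" "b \<in> ideal_power R I j" for a b i j
    using that by (rule ideal_power_mult[OF assms])
qed simp

lemma (in complete_regular_local_ring) complete_power_filtration:
  "complete_filtration R (ideal_power R \<mm>)"
proof -
  interpret filtration R "ideal_power R \<mm>" by (rule ideal_power_filtration[OF max_ideal])
  show ?thesis
  proof unfold_locales
    fix u assume "u \<in> carrier R" "\<And>n. u \<in> ideal_power R \<mm> n"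
    then show "u = \<zero>" using separated by blast
  qed (rule complete)
qed

text \<open>Generators of the maximal ideal, as many as there are steps in some chain of primes. The
  chain is kept as a witness because the dimension is used only through it.\<close>

definition regular_system where
  "regular_system \<mm> R x d \<longleftrightarrow> \<mm> = genideal R (x ` {..<d}) \<and> (\<forall>i<d. x i \<in> carrier R) \<and>
    (\<exists>P. (\<forall>i\<le>d. primeideal (P i) R) \<and> (\<forall>i<d. P i \<subset> P (Suc i)))"

lemma (in regular_local_ring) regular_system_exists:
  "\<exists>x d. regular_system \<mm> R x d"
proof -
  obtain B where B: "B \<subseteq> carrier R" "finite B" "\<mm> = Idl B" "enat (card B) = krull_dim R" using regular by blast
  obtain x where x: "bij_betw x {..<card B} B" using ex_bij_betw_nat_finite[OF B(2)] by (auto simp: atLeast0LessThan)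
  let ?Q = "\<lambda>n P. (\<forall>i\<le>n. primeideal (P i) R) \<and> (\<forall>i<n. P i \<subset> P (Suc i))"
  let ?D = "{enat n | n. \<exists>P. ?Q n P}"
  have "\<exists>P. ?Q 0 P" by (intro exI[of _ "\<lambda>_. \<mm>"]) (use maximalideal_prime[OF maximal] in simp)
  then have "enat 0 \<in> ?D" by (intro CollectI exI[of _ 0] conjI refl)
  then have ne: "?D \<noteq> {}" by (rule ex_in_conv[THEN iffD1, OF exI])
  have S: "Sup ?D = enat (card B)" using B(4) by (simp add: krull_dim_def)
  \<comment> \<open>A finite supremum of extended naturals is attained.\<close>
  have attained: "enat n \<in> D" if "Sup D = enat n" "D \<noteq> {}" for D :: "enat set" and n
  proof -
    have fin: "finite D" using that by (metis Sup_enat_def enat.distinct(1))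
    then have "Sup D = Max D" using that by (simp add: Sup_enat_def)
    then show ?thesis using Max_in[OF fin] that by metis
  qed
  from attained[OF S ne] obtain P where "?Q (card B) P" by auto
  moreover have "x ` {..<card B} = B" using x by (simp add: bij_betw_def)
  ultimately show ?thesis using B unfolding regular_system_def by (intro exI[of _ x] exI[of _ "card B"]) auto
qed

locale coefficient_map = K: field K + noetherian_local_ring \<mm> R for K and \<mm> and R (structure) +
  fixes \<kappa>
  assumes \<kappa>: "\<kappa> \<in> ring_hom K R" and \<kappa>_residue: "r \<in> carrier R \<Longrightarrow> \<exists>k\<in>carrier K. r \<ominus> \<kappa> k \<in> \<mm>"
begin

sublocale \<kappa>: ring_hom_cring K R \<kappa> by unfold_locales (rule \<kappa>)

lemma \<kappa>_m: "k \<in> carrier K \<Longrightarrow> \<kappa> k \<in> \<mm> \<Longrightarrow> k = \<zero>\<^bsub>K\<^esub>"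
proof (rule ccontr)
  assume k: "k \<in> carrier K" "\<kappa> k \<in> \<mm>" "k \<noteq> \<zero>\<^bsub>K\<^esub>"
  then have "k \<in> Units K" using K.field_Units by blast
  then have "inv\<^bsub>K\<^esub> k \<in> carrier K" "k \<otimes>\<^bsub>K\<^esub> inv\<^bsub>K\<^esub> k = \<one>\<^bsub>K\<^esub>" by auto
  then have "\<kappa> k \<otimes> \<kappa> (inv\<^bsub>K\<^esub> k) = \<one>" using k(1) \<kappa>.hom_mult \<kappa>.hom_one by metis
  then show False using I_r_closed[OF k(2), of "\<kappa> (inv\<^bsub>K\<^esub> k)"] one_notin \<open>inv\<^bsub>K\<^esub> k \<in> carrier K\<close> by simp
qed

lemma coefficient_field_image: "coefficient_field \<mm> R (\<kappa> ` carrier K)"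
proof -
  have "ring_hom_ring K R \<kappa>" using ring_hom_ringI2[OF K.ring_axioms ring_axioms \<kappa>] .
  then have "subfield (\<kappa> ` carrier K) R"
    using ring_hom_ring.img_is_subfield(2)[OF _ K.carrier_is_subfield] one_notin zero_closed by metis
  then show ?thesis
    using noetherian_local_ring_axioms is_cring \<kappa>_residue
    by (auto simp: coefficient_field_def coefficient_field_axioms_def field_in_ring_def field_in_ring_axioms_def)
qed

text \<open>If \<open>P\<close> had a term of degree less than \<open>n\<close>, its component of lowest degree would be a form in
  the regular parameters with a unit coefficient and a value of too high an order.\<close>

lemma regular_poly_bound:
  assumes x: "regular_system \<mm> R x d" and P: "P \<in> carrier (mpoly_ring K d)"
    and mem: "poly_ev K R \<kappa> d x P \<in> ideal_power R \<mm> n" and M: "size M < n"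
  shows "P M = \<zero>\<^bsub>K\<^esub>"
proof (rule ccontr)
  assume "P M \<noteq> \<zero>\<^bsub>K\<^esub>"
  interpret C: coefficient_field \<mm> R "\<kappa> ` carrier K" by (rule coefficient_field_image)
  note x' = x[unfolded regular_system_def]
  interpret e: evaluation K R \<kappa> d x by unfold_locales (use x' in auto)
  interpret s: self_evaluation R d x by unfold_locales (use x' in auto)
  have xm: "x i \<in> ideal_power R \<mm> 1" if "i < d" for i
    using x' that genideal_self[of "x ` {..<d}"] ideal_power_1[OF max_ideal] by auto
  define s where "s = (LEAST s. \<exists>M. P M \<noteq> \<zero>\<^bsub>K\<^esub> \<and> size M = s)"
  have s1: "\<exists>M. P M \<noteq> \<zero>\<^bsub>K\<^esub> \<and> size M = s" unfolding s_def by (rule LeastI_ex) (use \<open>P M \<noteq> _\<close> in blast)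
  have s2: "s \<le> size N" if "P N \<noteq> \<zero>\<^bsub>K\<^esub>" for N unfolding s_def using that by (intro Least_le) blast
  have sn: "Suc s \<le> n" using s2[OF \<open>P M \<noteq> _\<close>] M by simp
  define H where "H = (\<lambda>M. if size M \<noteq> s then P M else \<zero>\<^bsub>K\<^esub>)"
  have Hc: "H \<in> carrier (mpoly_ring K d)" unfolding H_def by (rule K.mpoly_restrict_closed[OF P])
  have hc: "hcomp K s P \<in> carrier (mpoly_ring K d)" by (rule K.hcomp_closed[OF P])
  have "P = (\<lambda>M. H M \<oplus>\<^bsub>K\<^esub> hcomp K s P M)"
    using K.mpoly_coeff[OF P] by (auto simp: H_def hcomp_def fun_eq_iff)
  then have evP: "e.ev P = e.ev H \<oplus> e.ev (hcomp K s P)" using e.ev_add[OF Hc hc] by simp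
  have evH: "e.ev H \<in> ideal_power R \<mm> (Suc s)"
  proof (rule e.ev_in_filtration[OF ideal_power_filtration[OF max_ideal] xm Hc])
    fix N assume N: "H N \<noteq> \<zero>\<^bsub>K\<^esub>"
    then have "Suc s - size N = 0" using s2[of N] by (auto simp: H_def split: if_splits)
    then show "\<kappa> (H N) \<in> ideal_power R \<mm> (Suc s - size N)" using K.mpoly_coeff[OF Hc] by simp
  qed
  interpret I: ideal "ideal_power R \<mm> (Suc s)" R by (rule ideal_power_ideal[OF max_ideal])
  have "e.ev P \<in> ideal_power R \<mm> (Suc s)" using mem ideal_power_antimono[OF max_ideal sn] by blast
  then have "e.ev P \<oplus> \<ominus> e.ev H \<in> ideal_power R \<mm> (Suc s)" using evH I.a_closed I.a_inv_closed by blast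
  moreover have "e.ev P \<oplus> \<ominus> e.ev H = e.ev (hcomp K s P)"
    unfolding evP using e.ev_closed[OF Hc] e.ev_closed[OF hc] by (simp add: a_comm[of "e.ev H"] a_assoc r_neg)
  ultimately have ev: "e.ev (hcomp K s P) \<in> ideal_power R \<mm> (Suc s)" by simp
  let ?F = "\<lambda>M. \<kappa> (hcomp K s P M)"
  note hcc = hc[unfolded K.mpoly_carrier_iff]
  have F0: "?F N \<noteq> \<zero> \<Longrightarrow> hcomp K s P N \<noteq> \<zero>\<^bsub>K\<^esub>" for N by auto
  have "finite {N. ?F N \<noteq> \<zero>}" using hcc F0 by (intro finite_subset[of "{N. ?F N \<noteq> \<zero>}" "{N. hcomp K s P N \<noteq> \<zero>\<^bsub>K\<^esub>}"]) auto
  then have Fc: "?F \<in> carrier (mpoly_ring R d)" using hcc F0 unfolding mpoly_carrier_iff by blast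
  have Fh: "homogeneous R s ?F" using K.homogeneous_hcomp[of s P] F0 unfolding homogeneous_def by blast
  have "s.ev ?F = e.ev (hcomp K s P)"
  proof -
    have "{M. ?F M \<noteq> \<zero>} \<subseteq> {N. hcomp K s P N \<noteq> \<zero>\<^bsub>K\<^esub>}" using F0 by blast
    then have "s.ev ?F = (\<Oplus>M\<in>{N. hcomp K s P N \<noteq> \<zero>\<^bsub>K\<^esub>}. identity (?F M) \<otimes> s.mval M)"
      using hcc Fc by (intro s.ev_superset) (auto simp: mpoly_coeff)
    then show ?thesis unfolding poly_ev_def by (simp add: identity_apply)
  qed
  then have "?F N \<in> \<mm>" for N
    using C.regular_independent[OF _ _ _ _ Fc Fh, of x] x' ev by metis
  moreover obtain N where N: "P N \<noteq> \<zero>\<^bsub>K\<^esub>" "size N = s" using s1 by blast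
  ultimately have "\<kappa> (P N) \<in> \<mm>" by (simp add: hcomp_def) (metis hcomp_def)
  then show False using \<kappa>_m K.mpoly_coeff[OF P] N by blast
qed

text \<open>The error of an approximation modulo \<open>\<mm>\<^sup>n\<close> is the value of a form of degree \<open>n\<close> with
  coefficients in \<open>R\<close>. Replacing each coefficient by an element of \<open>K\<close> with the same residue
  changes it by an element of \<open>\<mm>\<^sup>n\<^sup>+\<^sup>1\<close>.\<close>

lemma regular_poly_approx:
  assumes x: "regular_system \<mm> R x d" and a: "a \<in> carrier R"
  shows "\<exists>P\<in>carrier (mpoly_ring K d). a \<ominus> poly_ev K R \<kappa> d x P \<in> ideal_power R \<mm> n"
proof (induction n)
  case 0
  have "a \<ominus> poly_ev K R \<kappa> d x (\<lambda>M. \<zero>\<^bsub>K\<^esub>) \<in> carrier R" using a by (simp add: poly_ev_def)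
  then show ?case using K.mpoly_zero_closed by (intro bexI[of _ "\<lambda>M. \<zero>\<^bsub>K\<^esub>"]) auto
next
  case (Suc n)
  note x' = x[unfolded regular_system_def]
  interpret e: evaluation K R \<kappa> d x by unfold_locales (use x' in auto)
  interpret p: presentation R R \<mm> identity identity d x by (rule trivial_presentation) (use x' in auto)
  interpret I: ideal "ideal_power R \<mm> (Suc n)" R by (rule ideal_power_ideal[OF max_ideal])
  obtain P where P: "P \<in> carrier (mpoly_ring K d)" "a \<ominus> e.ev P \<in> ideal_power R \<mm> n" using Suc by blast
  obtain Q where Q: "Q \<in> carrier (mpoly_ring R d)" "homogeneous R n Q" "p.A.ev Q = a \<ominus> e.ev P"
    using p.power_form[OF P(2)] by blast
  let ?V = "\<lambda>Q. Q \<in> carrier (mpoly_ring R d) \<and> (\<exists>P\<in>carrier (mpoly_ring K d). p.A.ev Q \<ominus> e.ev P \<in> ideal_power R \<mm> (Suc n))"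
  have "?V Q"
  proof (rule support_induct[of Q ?V])
    show "?V (\<lambda>M. \<zero>)" using K.mpoly_zero_closed I.diff_self by (auto intro!: bexI[of _ "\<lambda>M. \<zero>\<^bsub>K\<^esub>"])
  next
    fix M assume M: "Q M \<noteq> \<zero>"
    have c: "Q M \<in> carrier R" "set_mset M \<subseteq> {..<d}" "size M = n"
      using Q M by (auto simp: mpoly_carrier_iff homogeneous_def)
    obtain k where k: "k \<in> carrier K" "Q M \<ominus> \<kappa> k \<in> \<mm>" using \<kappa>_residue[OF c(1)] by blast
    have "p.A.ev (monomial R (Q M) M) \<ominus> e.ev (monomial K k M) = (Q M \<ominus> \<kappa> k) \<otimes> p.A.mval M"
      unfolding p.A.ev_monomial[OF c(1)] e.ev_monomial[OF k(1)]
      using c(1) k(1) p.A.mval_closed[of M] by (simp add: identity_apply a_minus_def l_distr l_minus)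
    moreover have "(Q M \<ominus> \<kappa> k) \<otimes> p.A.mval M \<in> ideal_power R \<mm> (1 + size M)"
      using p.monomial_in_power[OF c(2)] k(2) ideal_power_1[OF max_ideal] by (intro ideal_power_mult max_ideal) auto
    ultimately show "?V (monomial R (Q M) M)"
      using c k K.mpoly_monomial_closed[of k M d] by (auto intro!: mpoly_monomial_closed bexI[of _ "monomial K k M"])
  next
    fix Q1 Q2 assume "?V Q1" "?V Q2"
    then obtain P1 P2 where "Q1 \<in> carrier (mpoly_ring R d)" "Q2 \<in> carrier (mpoly_ring R d)"
      "P1 \<in> carrier (mpoly_ring K d)" "p.A.ev Q1 \<ominus> e.ev P1 \<in> ideal_power R \<mm> (Suc n)"
      "P2 \<in> carrier (mpoly_ring K d)" "p.A.ev Q2 \<ominus> e.ev P2 \<in> ideal_power R \<mm> (Suc n)" by blast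
    then show "?V (\<lambda>M. Q1 M \<oplus> Q2 M)"
      by (auto simp: p.A.ev_add e.ev_add I.diff_add mpoly_add_closed K.mpoly_add_closed
        intro!: bexI[of _ "\<lambda>M. P1 M \<oplus>\<^bsub>K\<^esub> P2 M"])
  qed (use Q in \<open>auto simp: mpoly_carrier_iff\<close>)
  then obtain P' where P': "P' \<in> carrier (mpoly_ring K d)" "(a \<ominus> e.ev P) \<ominus> e.ev P' \<in> ideal_power R \<mm> (Suc n)"
    using Q(3) by auto
  have "a \<ominus> e.ev (\<lambda>M. P M \<oplus>\<^bsub>K\<^esub> P' M) = (a \<ominus> e.ev P) \<ominus> e.ev P'"
    using P(1) P'(1) a e.ev_closed[OF P(1)] e.ev_closed[OF P'(1)] by (simp add: e.ev_add a_minus_def minus_add a_assoc)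
  then show ?case using P P' by (intro bexI[of _ "\<lambda>M. P M \<oplus>\<^bsub>K\<^esub> P' M"]) (auto simp: K.mpoly_add_closed)
qed

text \<open>The ring \<open>R\<close> has the mapping property of the power series ring over \<open>K\<close> in the regular
  parameters.\<close>

lemma regular_universal:
  assumes x: "regular_system \<mm> R x d" and eW: "evaluation K W j d w" and fW: "complete_filtration W G"
    and w: "\<And>i. i < d \<Longrightarrow> w i \<in> G 1"
  shows "\<exists>\<theta>\<in>ring_hom R W. \<forall>a\<in>carrier R. \<forall>n. \<forall>P\<in>carrier (mpoly_ring K d).
    a \<ominus> poly_ev K R \<kappa> d x P \<in> ideal_power R \<mm> n \<longrightarrow> \<theta> a \<ominus>\<^bsub>W\<^esub> poly_ev K W j d w P \<in> G n"
proof (rule hom_extension[OF _ eW ideal_power_filtration[OF max_ideal] fW])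
  interpret eW: evaluation K W j d w by fact
  interpret G: complete_filtration W G by fact
  note x' = x[unfolded regular_system_def]
  show "evaluation K R \<kappa> d x" by unfold_locales (use x' in auto)
  show "\<exists>P\<in>carrier (mpoly_ring K d). a \<ominus> poly_ev K R \<kappa> d x P \<in> ideal_power R \<mm> n" if "a \<in> carrier R" for a n
    by (rule regular_poly_approx[OF x that])
  fix P n assume P: "P \<in> carrier (mpoly_ring K d)" "poly_ev K R \<kappa> d x P \<in> ideal_power R \<mm> n"
  show "eW.ev P \<in> G n"
  proof (rule eW.ev_in_filtration[OF G.filtration_axioms w P(1)])
    fix M assume "P M \<noteq> \<zero>\<^bsub>K\<^esub>"
    then have "n - size M = 0" using regular_poly_bound[OF x P, of M] by fastforce
    then show "j (P M) \<in> G (n - size M)" using G.F_0 K.mpoly_coeff[OF P(1)] by simp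
  qed
qed

end

section \<open>Lifting fields along nilpotent extensions\<close>

context cring
begin

primrec natr :: "nat \<Rightarrow> 'a" where
  "natr 0 = \<zero>"
| "natr (Suc n) = natr n \<oplus> \<one>"

lemma natr_closed [simp]: "natr n \<in> carrier R" by (induction n) auto

lemma natr_add: "natr (a + b) = natr a \<oplus> natr b"
  by (induction b) (auto simp: a_assoc)

lemma natr_mult: "natr (a * b) = natr a \<otimes> natr b"
  by (induction b) (auto simp: natr_add r_distr a_comm)

lemma binomial_sum:
  assumes ab: "a \<in> carrier R" "b \<in> carrier R"
  shows "(a \<oplus> b) [^] n = (\<Oplus>i\<in>{..n}. natr (n choose i) \<otimes> (a [^] i \<otimes> b [^] (n - i)))"
proof (induction n)
  case 0
  then show ?case by simp
next
  case (Suc n)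
  define t where "t n i = natr (n choose i) \<otimes> (a [^] i \<otimes> b [^] (n - i))" for n i :: nat
  have tc [simp]: "t n i \<in> carrier R" for n i using ab by (simp add: t_def)
  have step: "t (Suc n) (Suc i) = a \<otimes> t n i \<oplus> b \<otimes> t n (Suc i)" if "i \<le> n" for i
  proof (cases "i = n")
    case True
    then show ?thesis using ab by (simp add: t_def m_ac binomial_eq_0)
  next
    case False
    then have e: "n - i = Suc (n - Suc i)" using that by simp
    have "t (Suc n) (Suc i) = (natr (n choose i) \<oplus> natr (n choose Suc i)) \<otimes> (a [^] Suc i \<otimes> b [^] (n - i))"
      by (simp add: t_def natr_add)
    then show ?thesis using ab unfolding t_def e by (simp add: l_distr r_distr m_ac)
  qed
  have S: "(\<Oplus>i\<in>{..n}. t n i) \<in> carrier R" by (intro finsum_closed) auto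
  have S1: "(\<Oplus>i\<in>{..n}. t n (Suc i)) \<in> carrier R" by (intro finsum_closed) auto
  have "(\<Oplus>i\<in>{..Suc n}. t (Suc n) i) = (\<Oplus>i\<in>{..n}. t (Suc n) (Suc i)) \<oplus> t (Suc n) 0"
    by (intro finsum_Suc2) auto
  also have "(\<Oplus>i\<in>{..n}. t (Suc n) (Suc i)) = (\<Oplus>i\<in>{..n}. a \<otimes> t n i \<oplus> b \<otimes> t n (Suc i))"
    using ab by (intro finsum_cong') (auto simp: step)
  also have "\<dots> = (\<Oplus>i\<in>{..n}. a \<otimes> t n i) \<oplus> (\<Oplus>i\<in>{..n}. b \<otimes> t n (Suc i))"
    using ab by (intro finsum_addf) auto
  also have "(\<Oplus>i\<in>{..n}. a \<otimes> t n i) = a \<otimes> (\<Oplus>i\<in>{..n}. t n i)"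
    using ab by (intro finsum_rdistr[symmetric]) auto
  also have "(\<Oplus>i\<in>{..n}. b \<otimes> t n (Suc i)) = b \<otimes> (\<Oplus>i\<in>{..n}. t n (Suc i))"
    using ab by (intro finsum_rdistr[symmetric]) auto
  also have "t (Suc n) 0 = b \<otimes> t n 0" using ab by (simp add: t_def m_ac)
  also have "a \<otimes> (\<Oplus>i\<in>{..n}. t n i) \<oplus> b \<otimes> (\<Oplus>i\<in>{..n}. t n (Suc i)) \<oplus> b \<otimes> t n 0
    = a \<otimes> (\<Oplus>i\<in>{..n}. t n i) \<oplus> b \<otimes> ((\<Oplus>i\<in>{..n}. t n (Suc i)) \<oplus> t n 0)"
    using ab S S1 by (simp add: r_distr a_assoc)
  also have "(\<Oplus>i\<in>{..n}. t n (Suc i)) \<oplus> t n 0 = (\<Oplus>i\<in>{..Suc n}. t n i)"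
    by (intro finsum_Suc2[symmetric]) auto
  also have "\<dots> = (\<Oplus>i\<in>{..n}. t n i)"
    using S by (simp add: finsum_Suc Pi_def) (use ab in \<open>simp add: t_def binomial_eq_0\<close>)
  also have "a \<otimes> (\<Oplus>i\<in>{..n}. t n i) \<oplus> b \<otimes> (\<Oplus>i\<in>{..n}. t n i) = (a \<oplus> b) \<otimes> (a \<oplus> b) [^] n"
    using ab S Suc by (simp add: l_distr t_def)
  finally show ?case using ab by (simp add: t_def m_comm)
qed

lemma frobenius_add:
  assumes ab: "a \<in> carrier R" "b \<in> carrier R" and p: "normalization_semidom_class.prime (p::nat)" "natr p = \<zero>"
  shows "(a \<oplus> b) [^] p = a [^] p \<oplus> b [^] p"
proof -
  obtain q where q: "p = Suc (Suc q)" using prime_ge_2_nat[OF p(1)] by (metis add_2_eq_Suc le_Suc_ex)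
  let ?t = "\<lambda>i. natr (p choose i) \<otimes> (a [^] i \<otimes> b [^] (p - i))"
  have t: "?t i \<in> carrier R" for i using ab by simp
  have z: "?t i = \<zero>" if "0 < i" "i < p" for i
  proof -
    have "p dvd (p choose i)" using that p(1) by (intro dvd_choose_prime) auto
    then obtain c where "p choose i = p * c" by (auto elim: dvdE)
    then show ?thesis using ab p(2) by (simp add: natr_mult)
  qed
  have "(a \<oplus> b) [^] p = ?t (Suc (Suc q)) \<oplus> (\<Oplus>i\<in>{..Suc q}. ?t i)"
    unfolding binomial_sum[OF ab] using t q by (subst q(1)) (rule finsum_Suc, auto)
  also have "(\<Oplus>i\<in>{..Suc q}. ?t i) = (\<Oplus>i\<in>{..q}. ?t (Suc i)) \<oplus> ?t 0"
    using t by (intro finsum_Suc2) auto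
  also have "(\<Oplus>i\<in>{..q}. ?t (Suc i)) = \<zero>"
    by (rule add.finprod_one_eqI, rule z) (use q in auto)
  finally show ?thesis using ab q by simp
qed

text \<open>A polynomial in one variable is the list of its coefficients, constant term first.\<close>

primrec pev :: "'a list \<Rightarrow> 'a \<Rightarrow> 'a" where
  "pev [] c = \<zero>"
| "pev (f # P) c = f \<oplus> c \<otimes> pev P c"

text \<open>The value of the derivative, by the product rule applied to Horner's scheme.\<close>

primrec pder :: "'a list \<Rightarrow> 'a \<Rightarrow> 'a" where
  "pder [] c = \<zero>"
| "pder (f # P) c = pev P c \<oplus> c \<otimes> pder P c"

fun padd :: "'a list \<Rightarrow> 'a list \<Rightarrow> 'a list" where
  "padd [] Q = Q"
| "padd (p # P) [] = p # P"
| "padd (p # P) (q # Q) = (p \<oplus> q) # padd P Q"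

lemma pev_closed [simp]: "set P \<subseteq> carrier R \<Longrightarrow> c \<in> carrier R \<Longrightarrow> pev P c \<in> carrier R"
  by (induction P) auto

lemma pder_closed [simp]: "set P \<subseteq> carrier R \<Longrightarrow> c \<in> carrier R \<Longrightarrow> pder P c \<in> carrier R"
  by (induction P) auto

lemma pev_snoc: "set P \<subseteq> carrier R \<Longrightarrow> c \<in> carrier R \<Longrightarrow> k \<in> carrier R \<Longrightarrow>
  pev (P @ [k]) c = pev P c \<oplus> c [^] length P \<otimes> k"
  by (induction P) (auto simp: r_distr a_assoc m_ac)

lemma pev_padd: "set P \<subseteq> carrier R \<Longrightarrow> set Q \<subseteq> carrier R \<Longrightarrow> c \<in> carrier R \<Longrightarrow>
  pev (padd P Q) c = pev P c \<oplus> pev Q c"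
  by (induction P Q rule: padd.induct) (auto simp: r_distr a_ac)

lemma length_padd: "length (padd P Q) = max (length P) (length Q)"
  by (induction P Q rule: padd.induct) auto

lemma pev_scale: "set P \<subseteq> carrier R \<Longrightarrow> c \<in> carrier R \<Longrightarrow> k \<in> carrier R \<Longrightarrow>
  pev (map ((\<otimes>) k) P) c = k \<otimes> pev P c"
  by (induction P) (auto simp: r_distr m_lcomm)

lemma pev_zeros: "c \<in> carrier R \<Longrightarrow> pev (replicate n \<zero>) c = \<zero>"
  by (induction n) auto

lemma pev_all_zero: "\<forall>k\<in>set P. k = \<zero> \<Longrightarrow> c \<in> carrier R \<Longrightarrow> pev P c = \<zero>"
  by (induction P) auto

lemma taylor:
  assumes "set P \<subseteq> carrier R" "c \<in> carrier R" "v \<in> carrier R" "v \<otimes> v = \<zero>"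
  shows "pev P (c \<oplus> v) = pev P c \<oplus> pder P c \<otimes> v"
  using assms(1)
proof (induction P)
  case (Cons f P)
  then have cl: "f \<in> carrier R" "pev P c \<in> carrier R" "pder P c \<in> carrier R" using assms by auto
  have z: "v \<otimes> (pder P c \<otimes> v) = \<zero>"
    unfolding m_lcomm[OF assms(3) cl(3) assms(3)] assms(4) using cl by simp
  have "pev (f # P) (c \<oplus> v) = f \<oplus> (c \<oplus> v) \<otimes> (pev P c \<oplus> pder P c \<otimes> v)" using Cons by simp
  also have "\<dots> = f \<oplus> (c \<otimes> pev P c \<oplus> c \<otimes> (pder P c \<otimes> v) \<oplus> (v \<otimes> pev P c \<oplus> v \<otimes> (pder P c \<otimes> v)))"
    using cl assms by (simp add: l_distr r_distr a_ac)
  also have "\<dots> = pev (f # P) c \<oplus> pder (f # P) c \<otimes> v"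
    unfolding z using cl assms by (simp add: l_distr r_distr m_ac a_ac)
  finally show ?case .
qed (use assms in simp)

text \<open>For a monic equation of least degree this shows that the derivative does not vanish at the
  root, provided that \<open>natr (length P)\<close> is nonzero: otherwise it would be an equation of smaller
  degree.\<close>

lemma pder_monic:
  assumes F: "subring F R" and P: "set P \<subseteq> F"
  shows "\<exists>Q. set Q \<subseteq> F \<and> length Q = length P - 1 \<and>
    (\<forall>c\<in>carrier R. pder (P @ [\<one>]) c = pev Q c \<oplus> c [^] (length P - 1) \<otimes> natr (length P))"
  using P
proof (induction P)
  case Nil
  then show ?case by (intro exI[of _ "[]"]) auto
next
  case (Cons f P)
  note Fr = subringE[OF F]
  from Cons obtain Q where Q: "set Q \<subseteq> F" "length Q = length P - 1"
    "\<And>c. c \<in> carrier R \<Longrightarrow> pder (P @ [\<one>]) c = pev Q c \<oplus> c [^] (length P - 1) \<otimes> natr (length P)" by auto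
  show ?case
  proof (cases "P = []")
    case True then show ?thesis by (intro exI[of _ "[]"]) auto
  next
    case False
    then obtain n where n: "length P = Suc n" by (cases P) auto
    let ?Q = "padd P (\<zero> # Q)"
    have cF: "set P \<subseteq> carrier R" "set Q \<subseteq> carrier R" using Cons.prems Q Fr(1) by auto
    have "set (padd A B) \<subseteq> F" if "set A \<subseteq> F" "set B \<subseteq> F" for A B
      using that by (induction A B rule: padd.induct) (auto simp: Fr(7))
    then have 1: "set ?Q \<subseteq> F" using Cons.prems Q(1) Fr(2) by simp
    have 2: "length ?Q = length P" using Q(2) n by (simp add: length_padd)
    have 3: "pder ((f # P) @ [\<one>]) c = pev ?Q c \<oplus> c [^] length P \<otimes> natr (Suc (length P))" if c: "c \<in> carrier R" for c
    proof -
      have "pder ((f # P) @ [\<one>]) c = pev P c \<oplus> c [^] length P \<oplus> c \<otimes> (pev Q c \<oplus> c [^] n \<otimes> natr (length P))"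
        using c cF by (simp add: pev_snoc Q(3) n)
      also have "\<dots> = (pev P c \<oplus> c \<otimes> pev Q c) \<oplus> c [^] length P \<otimes> (natr (length P) \<oplus> \<one>)"
        using c cF by (simp add: n r_distr m_ac a_ac)
      also have "pev P c \<oplus> c \<otimes> pev Q c = pev ?Q c" using c cF by (simp add: pev_padd)
      finally show ?thesis by simp
    qed
    then show ?thesis using 1 2 by (intro exI[of _ ?Q]) auto
  qed
qed

end

lemma (in ring_hom_cring) hom_pev:
  "set P \<subseteq> carrier R \<Longrightarrow> c \<in> carrier R \<Longrightarrow> h (R.pev P c) = S.pev (map h P) (h c)"
  by (induction P) auto

lemma (in ring_hom_cring) hom_natr: "h (R.natr n) = S.natr n"
  by (induction n) auto

text \<open>The homomorphism \<open>\<kappa>\<close> is to be lifted along \<open>\<pi>\<close>. The subring \<open>B\<close> is a part of the lift that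
  has to be fixed beforehand. In characteristic \<open>p\<close> an element may be inseparable over the image
  of a partial lift, and then its lifts cannot be corrected by a Newton step. With the \<open>p\<close>-th
  powers of all candidates in \<open>B\<close>, the equation \<open>X\<^sup>p = c\<^sup>p\<close> of a lift \<open>c\<close> has its coefficients in
  every partial lift.\<close>

locale square_zero_extension = \<pi>: ring_hom_cring C D \<pi> + \<kappa>: ring_hom_cring K D \<kappa> + K: field K
  for C (structure) and D (structure) and \<pi> and K and \<kappa> +
  fixes B
  assumes surj: "d \<in> carrier D \<Longrightarrow> \<exists>c\<in>carrier C. \<pi> c = d"
    and nontrivial: "\<one>\<^bsub>D\<^esub> \<noteq> \<zero>\<^bsub>D\<^esub>"
    and square_zero: "u \<in> carrier C \<Longrightarrow> v \<in> carrier C \<Longrightarrow> \<pi> u = \<zero>\<^bsub>D\<^esub> \<Longrightarrow> \<pi> v = \<zero>\<^bsub>D\<^esub> \<Longrightarrow> u \<otimes> v = \<zero>"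
    and B_subring: "subring B C" and B_img: "\<pi> ` B \<subseteq> \<kappa> ` carrier K"
    and B_inj: "u \<in> B \<Longrightarrow> \<pi> u = \<zero>\<^bsub>D\<^esub> \<Longrightarrow> u = \<zero>"
    and B_char: "(\<forall>n>0. \<pi>.R.natr n \<noteq> \<zero>) \<or>
      (\<exists>p::nat. normalization_semidom_class.prime p \<and> \<pi>.R.natr p = \<zero> \<and> (\<forall>c\<in>carrier C. \<pi> c \<in> \<kappa> ` carrier K \<longrightarrow> c [^] p \<in> B))"
begin

text \<open>If \<open>u v = 1 + w\<close> with \<open>w\<close> in the kernel, then \<open>v (1 - w)\<close> is an inverse of \<open>u\<close>.\<close>

lemma unit_lift:
  assumes u: "u \<in> carrier C" "\<pi> u \<in> \<kappa> ` carrier K" "\<pi> u \<noteq> \<zero>\<^bsub>D\<^esub>"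
  shows "\<exists>v\<in>carrier C. u \<otimes> v = \<one> \<and> \<pi> v \<in> \<kappa> ` carrier K"
proof -
  obtain k where k: "k \<in> carrier K" "\<pi> u = \<kappa> k" using u(2) by blast
  then have "k \<noteq> \<zero>\<^bsub>K\<^esub>" using u(3) \<kappa>.hom_zero by metis
  then have "k \<in> Units K" unfolding K.field_Units using k(1) by blast
  then have ik: "inv\<^bsub>K\<^esub> k \<in> carrier K" "k \<otimes>\<^bsub>K\<^esub> inv\<^bsub>K\<^esub> k = \<one>\<^bsub>K\<^esub>" by auto
  obtain v where v: "v \<in> carrier C" "\<pi> v = \<kappa> (inv\<^bsub>K\<^esub> k)" using surj[of "\<kappa> (inv\<^bsub>K\<^esub> k)"] ik by auto
  have "\<pi> (u \<otimes> v) = \<kappa> (k \<otimes>\<^bsub>K\<^esub> inv\<^bsub>K\<^esub> k)" by (simp only: \<pi>.hom_mult[OF u(1) v(1)] k(2) v(2) \<kappa>.hom_mult[OF k(1) ik(1)])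
  then have uv: "\<pi> (u \<otimes> v) = \<one>\<^bsub>D\<^esub>" by (simp only: ik(2) \<kappa>.hom_one)
  define w where "w = u \<otimes> v \<ominus> \<one>"
  have w: "w \<in> carrier C" "\<pi> w = \<zero>\<^bsub>D\<^esub>" using u(1) v(1) uv
    by (simp_all add: w_def a_minus_def \<pi>.S.r_neg del: \<pi>.hom_mult)
  have uvw: "u \<otimes> v = \<one> \<oplus> w" using u(1) v(1) by (simp add: w_def a_minus_def \<pi>.R.a_lcomm[of \<one> "u \<otimes> v"] \<pi>.R.r_neg)
  have "(\<one> \<oplus> w) \<otimes> (\<one> \<ominus> w) = \<one> \<ominus> w \<otimes> w"
    using w(1) by (simp add: a_minus_def \<pi>.R.l_distr \<pi>.R.r_distr \<pi>.R.r_minus \<pi>.R.a_assoc \<pi>.R.r_neg1)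
      (simp add: \<pi>.R.minus_add \<pi>.R.r_neg1 \<pi>.R.r_neg2)
  also have "\<dots> = \<one>" using square_zero[OF w(1) w(1) w(2) w(2)] by (simp add: a_minus_def)
  finally have "u \<otimes> (v \<otimes> (\<one> \<ominus> w)) = \<one>" using u(1) v(1) w(1) uvw by (simp add: \<pi>.R.m_assoc[symmetric])
  moreover have "\<pi> (v \<otimes> (\<one> \<ominus> w)) = \<kappa> (inv\<^bsub>K\<^esub> k)"
    using v w by (simp add: a_minus_def) (metis \<kappa>.hom_closed \<pi>.S.minus_zero \<pi>.S.r_one \<pi>.S.r_zero \<pi>.S.one_closed ik(1))
  ultimately show ?thesis using v(1) w(1) ik(1) by (intro bexI[of _ "v \<otimes> (\<one> \<ominus> w)"]) auto
qed

text \<open>The partial lifts, described by their images in \<open>C\<close>.\<close>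

definition good where
  "good F \<longleftrightarrow> subring F C \<and> \<pi> ` F \<subseteq> \<kappa> ` carrier K \<and> (\<forall>u\<in>F. \<pi> u = \<zero>\<^bsub>D\<^esub> \<longrightarrow> u = \<zero>) \<and> B \<subseteq> F"

lemma \<kappa>_subring: "subring (\<kappa> ` carrier K) D"
proof -
  have "ring_hom_ring K D \<kappa>"
    using ring_hom_ringI2[OF \<kappa>.R.ring_axioms \<pi>.S.ring_axioms \<kappa>.homh] .
  then show ?thesis using ring_hom_ring.img_is_subring \<kappa>.R.carrier_is_subring by blast
qed

abbreviation adjoin where "adjoin F c \<equiv> {\<pi>.R.pev P c | P. set P \<subseteq> F}"

lemma adjoin_good:
  assumes F: "good F" and c: "c \<in> carrier C" "\<pi> c \<in> \<kappa> ` carrier K"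
    and inj: "\<And>P. set P \<subseteq> F \<Longrightarrow> \<pi> (\<pi>.R.pev P c) = \<zero>\<^bsub>D\<^esub> \<Longrightarrow> \<pi>.R.pev P c = \<zero>"
  shows "good (adjoin F c)" "F \<subseteq> adjoin F c" "c \<in> adjoin F c"
proof -
  have Fs: "subring F C" using F by (simp add: good_def)
  note Fr = subringE[OF Fs]
  have Fc: "set P \<subseteq> F \<Longrightarrow> set P \<subseteq> carrier C" for P using Fr(1) by blast
  have padd_F: "set (\<pi>.R.padd P Q) \<subseteq> F" if "set P \<subseteq> F" "set Q \<subseteq> F" for P Q
    using that by (induction P Q rule: \<pi>.R.padd.induct) (auto simp: Fr(7))
  have scale_F: "set (map ((\<otimes>) k) P) \<subseteq> F" if "set P \<subseteq> F" "k \<in> F" for P k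
    using that by (auto simp: Fr(6))
  show FE: "F \<subseteq> adjoin F c"
  proof
    fix f assume f: "f \<in> F"
    then have "f = \<pi>.R.pev [f] c" using c Fr(1) by auto
    then show "f \<in> adjoin F c" using f by (intro CollectI exI[of _ "[f]"]) auto
  qed
  have "c = \<pi>.R.pev [\<zero>, \<one>] c" using c by simp
  then show "c \<in> adjoin F c" using Fr(2,3) by (intro CollectI exI[of _ "[\<zero>, \<one>]"]) auto
  have add: "u \<oplus> v \<in> adjoin F c" if uv: "u \<in> adjoin F c" "v \<in> adjoin F c" for u v
  proof -
    obtain P Q where "u = \<pi>.R.pev P c" "v = \<pi>.R.pev Q c" "set P \<subseteq> F" "set Q \<subseteq> F" using uv by blast
    then show ?thesis using padd_F Fc c(1)
      by (intro CollectI exI[of _ "\<pi>.R.padd P Q"]) (simp add: \<pi>.R.pev_padd)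
  qed
  have scale: "k \<otimes> u \<in> adjoin F c" if u: "u \<in> adjoin F c" and k: "k \<in> F" for u k
  proof -
    obtain P where P: "u = \<pi>.R.pev P c" "set P \<subseteq> F" using u by blast
    then have "k \<otimes> u = \<pi>.R.pev (map ((\<otimes>) k) P) c"
      using \<pi>.R.pev_scale[OF Fc[OF P(2)] c(1)] k Fr(1) by auto
    then show ?thesis using scale_F[OF P(2) k] by blast
  qed
  have shift: "c \<otimes> u \<in> adjoin F c" if u: "u \<in> adjoin F c" for u
  proof -
    obtain P where P: "u = \<pi>.R.pev P c" "set P \<subseteq> F" using u by blast
    then have "c \<otimes> u = \<pi>.R.pev (\<zero> # P) c" using Fc[OF P(2)] c(1) by simp
    then show ?thesis using P(2) Fr(2) by (intro CollectI exI[of _ "\<zero> # P"]) auto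
  qed
  have Ec: "adjoin F c \<subseteq> carrier C" using Fc c(1) by auto
  have mult: "\<pi>.R.pev P c \<otimes> v \<in> adjoin F c" if "set P \<subseteq> F" "v \<in> adjoin F c" for P v
    using that(1)
  proof (induction P)
    case Nil
    have "v \<in> carrier C" using that(2) Ec by blast
    then have "\<pi>.R.pev [] c \<otimes> v = \<zero>" by simp
    then show ?case using FE Fr(2) by (simp only:) blast
  next
    case (Cons f P)
    have cl: "f \<in> carrier C" "\<pi>.R.pev P c \<in> carrier C" "v \<in> carrier C" using Cons.prems Fr(1) Fc[of P] c(1) that(2) Ec by auto
    have "\<pi>.R.pev (f # P) c \<otimes> v = f \<otimes> v \<oplus> c \<otimes> (\<pi>.R.pev P c \<otimes> v)"
      using cl c(1) by (simp add: \<pi>.R.l_distr \<pi>.R.m_assoc)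
    then show ?case using add[OF scale[OF that(2), of f] shift] Cons by simp
  qed
  have "subring (adjoin F c) C"
  proof (rule \<pi>.R.subringI)
    show "adjoin F c \<subseteq> carrier C" by (rule Ec)
    show "\<one> \<in> adjoin F c" using FE Fr(3) by blast
    fix u assume u: "u \<in> adjoin F c"
    have "\<ominus> \<one> \<otimes> u = \<ominus> u" using u Ec by (simp add: \<pi>.R.l_minus subsetD)
    then show "\<ominus> u \<in> adjoin F c" using scale[OF u, of "\<ominus> \<one>"] Fr(3,5) by simp
    fix v assume v: "v \<in> adjoin F c"
    show "u \<oplus> v \<in> adjoin F c" by (rule add[OF u v])
    show "u \<otimes> v \<in> adjoin F c" using u mult[OF _ v] by blast
  qed
  moreover have "\<pi> (\<pi>.R.pev P c) \<in> \<kappa> ` carrier K" if "set P \<subseteq> F" for P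
    using that
  proof (induction P)
    case Nil
    show ?case using subringE(2)[OF \<kappa>_subring] by simp
  next
    case (Cons f P)
    have cl: "f \<in> carrier C" "\<pi>.R.pev P c \<in> carrier C" using Cons.prems Fr(1) Fc[of P] c(1) by auto
    have "\<pi> f \<in> \<kappa> ` carrier K" using F Cons.prems by (auto simp: good_def)
    then show ?case using Cons cl c subringE(6,7)[OF \<kappa>_subring] by simp
  qed
  ultimately show "good (adjoin F c)"
    using F FE inj unfolding good_def by blast
qed

lemma good_B: "good B"
  using B_subring B_img B_inj by (simp add: good_def)

lemma maximal_good: "\<exists>F. good F \<and> (\<forall>F'. good F' \<longrightarrow> F \<subseteq> F' \<longrightarrow> F' = F)"
proof -
  have "\<exists>F\<in>Collect good. \<forall>F'\<in>Collect good. F \<subseteq> F' \<longrightarrow> F' = F"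
  proof (rule subset_Zorn_nonempty)
    show "Collect good \<noteq> {}" using good_B by blast
    fix \<C> assume ne: "\<C> \<noteq> {}" and ch: "subset.chain (Collect good) \<C>"
    then have g: "\<And>F. F \<in> \<C> \<Longrightarrow> good F" and lin: "\<And>F F'. F \<in> \<C> \<Longrightarrow> F' \<in> \<C> \<Longrightarrow> F \<subseteq> F' \<or> F' \<subseteq> F"
      unfolding subset_chain_def by blast+
    have two: "\<exists>F\<in>\<C>. u \<in> F \<and> v \<in> F" if "u \<in> \<Union>\<C>" "v \<in> \<Union>\<C>" for u v using that lin by blast
    have sr: "\<And>F. F \<in> \<C> \<Longrightarrow> subring F C" using g by (simp add: good_def)
    have "subring (\<Union>\<C>) C"
    proof (rule \<pi>.R.subringI)
      show "\<Union>\<C> \<subseteq> carrier C" using subringE(1)[OF sr] by blast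
      show "\<one> \<in> \<Union>\<C>" using ne subringE(3)[OF sr] by blast
      fix u assume u: "u \<in> \<Union>\<C>"
      then show "\<ominus> u \<in> \<Union>\<C>" using subringE(5)[OF sr] by blast
      fix v assume v: "v \<in> \<Union>\<C>"
      obtain F where "F \<in> \<C>" "u \<in> F" "v \<in> F" using two[OF u v] by blast
      then show "u \<oplus> v \<in> \<Union>\<C>" "u \<otimes> v \<in> \<Union>\<C>" using subringE(6,7)[OF sr] by blast+
    qed
    moreover have "\<pi> ` \<Union>\<C> \<subseteq> \<kappa> ` carrier K" "\<forall>u\<in>\<Union>\<C>. \<pi> u = \<zero>\<^bsub>D\<^esub> \<longrightarrow> u = \<zero>" "B \<subseteq> \<Union>\<C>"
      using g ne unfolding good_def by blast+
    ultimately show "\<Union>\<C> \<in> Collect good" by (simp add: good_def)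
  qed
  then show ?thesis by blast
qed

text \<open>A maximal partial lift \<open>F\<close> is a field, since the inverse of an element can be adjoined to
  it. Let \<open>x\<close> be an element of the image of \<open>\<kappa>\<close>. If \<open>x\<close> is transcendental over \<open>\<pi> F\<close>, any lift of
  \<open>x\<close> can be adjoined. Otherwise consider a monic equation of least degree \<open>n\<close> for \<open>x\<close>. If \<open>n\<close> is
  not zero in \<open>C\<close>, the derivative is a unit at any lift, and a Newton step corrects the lift to an
  exact root. If \<open>n\<close> is zero, then \<open>n\<close> is at least the characteristic \<open>p\<close>, the equation \<open>X\<^sup>p =
  c\<^sup>p\<close> has degree at most \<open>n\<close>, and the lift \<open>c\<close> solves it exactly.\<close>

lemma good_maximal_surj:
  assumes F: "good F" and max: "\<And>F'. good F' \<Longrightarrow> F \<subseteq> F' \<Longrightarrow> F' = F"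
  shows "\<kappa> ` carrier K \<subseteq> \<pi> ` F"
proof
  fix x assume x: "x \<in> \<kappa> ` carrier K"
  have Fs: "subring F C" and F\<pi>: "\<And>u. u \<in> F \<Longrightarrow> \<pi> u \<in> \<kappa> ` carrier K" and Finj: "\<And>u. u \<in> F \<Longrightarrow> \<pi> u = \<zero>\<^bsub>D\<^esub> \<Longrightarrow> u = \<zero>"
    and BF: "B \<subseteq> F"
    using F by (auto simp: good_def)
  note Fr = subringE[OF Fs]
  have Fcar: "u \<in> F \<Longrightarrow> u \<in> carrier C" for u using Fr(1) by blast
  have Fc: "set P \<subseteq> F \<Longrightarrow> set P \<subseteq> carrier C" for P using Fr(1) by blast
  have Fpow: "u [^] (n::nat) \<in> F" if "u \<in> F" for u n using that by (induction n) (auto simp: Fr(3,6))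
  have one0: "\<one> \<noteq> \<zero>" using nontrivial \<pi>.hom_one \<pi>.hom_zero by metis
  have inverses: "\<exists>v\<in>F. u \<otimes> v = \<one>" if u: "u \<in> F" "u \<noteq> \<zero>" for u
  proof -
    have uc: "u \<in> carrier C" using u Fcar by blast
    have "\<pi> u \<noteq> \<zero>\<^bsub>D\<^esub>" using Finj u by blast
    then obtain v where v: "v \<in> carrier C" "u \<otimes> v = \<one>" "\<pi> v \<in> \<kappa> ` carrier K" using unit_lift[OF uc F\<pi>[OF u(1)]] by blast
    \<comment> \<open>A power of \<open>u\<close> clears the denominators, so that injectivity on \<open>F\<close> can be used.\<close>
    have clear: "u [^] length P \<otimes> \<pi>.R.pev P v \<in> F" if "set P \<subseteq> F" for P
      using that
    proof (induction P)
      case Nil then show ?case by (simp add: Fr(2))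
    next
      case (Cons f P)
      have cl: "f \<in> carrier C" "\<pi>.R.pev P v \<in> carrier C" using Cons.prems Fcar Fc[of P] v(1) by auto
      have "u [^] length (f # P) \<otimes> \<pi>.R.pev (f # P) v = u [^] Suc (length P) \<otimes> f \<oplus> (u [^] length P \<otimes> (u \<otimes> v)) \<otimes> \<pi>.R.pev P v"
        using cl uc v(1) by (simp add: \<pi>.R.r_distr \<pi>.R.m_assoc)
      also have "\<dots> = u [^] Suc (length P) \<otimes> f \<oplus> u [^] length P \<otimes> \<pi>.R.pev P v" using v(2) uc by simp
      finally show ?case using Cons Fpow[OF u(1), of "Suc (length P)"] by (simp add: Fr(6,7) del: \<pi>.R.nat_pow_Suc)
    qed
    have "\<pi>.R.pev P v = \<zero>" if P: "set P \<subseteq> F" "\<pi> (\<pi>.R.pev P v) = \<zero>\<^bsub>D\<^esub>" for P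
    proof -
      have cl: "\<pi>.R.pev P v \<in> carrier C" using Fc[OF P(1)] v(1) by simp
      have "\<pi> (u [^] length P \<otimes> \<pi>.R.pev P v) = \<zero>\<^bsub>D\<^esub>" using P(2) cl uc by simp
      then have z: "u [^] length P \<otimes> \<pi>.R.pev P v = \<zero>" using Finj[OF clear[OF P(1)]] by blast
      have vu: "v [^] n \<otimes> u [^] n = \<one>" for n :: nat
        using v uc by (simp add: \<pi>.R.nat_pow_distrib[symmetric] \<pi>.R.m_comm[of v u])
      have "\<pi>.R.pev P v = v [^] length P \<otimes> (u [^] length P \<otimes> \<pi>.R.pev P v)"
        using cl v(1) uc vu[of "length P"] by (simp add: \<pi>.R.m_assoc[symmetric])
      then show ?thesis unfolding z using v(1) by simp
    qed
    from adjoin_good[OF F v(1,3) this] have "v \<in> F" using max by blast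
    then show ?thesis using v(2) by blast
  qed
  define rel where "rel P \<longleftrightarrow> set P \<subseteq> F \<and> \<pi>.S.pev (map \<pi> P) x = \<zero>\<^bsub>D\<^esub>" for P
  have xc: "x \<in> carrier D" using x by auto
  have rel_snoc_zero: "rel P" if "rel (P @ [\<zero>])" for P
  proof -
    have P: "set P \<subseteq> F" "\<pi>.S.pev (map \<pi> P @ [\<zero>\<^bsub>D\<^esub>]) x = \<zero>\<^bsub>D\<^esub>" using that by (auto simp: rel_def)
    have "set (map \<pi> P) \<subseteq> carrier D" using P(1) Fcar by auto
    from \<pi>.S.pev_snoc[OF this xc, of "\<zero>\<^bsub>D\<^esub>"] P(2) \<pi>.S.pev_closed[OF this xc]
    have "\<pi>.S.pev (map \<pi> P) x = \<zero>\<^bsub>D\<^esub>" using xc by simp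
    then show ?thesis using P(1) by (simp add: rel_def)
  qed
  have lift: "\<pi> (\<pi>.R.pev P c) = \<pi>.S.pev (map \<pi> P) x" if "set P \<subseteq> F" "c \<in> carrier C" "\<pi> c = x" for P c
    using \<pi>.hom_pev[OF Fc[OF that(1)] that(2)] that(3) by simp
  have in_F: "x \<in> \<pi> ` F" if c: "c \<in> carrier C" "\<pi> c = x"
    and inj: "\<And>P. set P \<subseteq> F \<Longrightarrow> rel P \<Longrightarrow> \<pi>.R.pev P c = \<zero>" for c
  proof -
    have "\<pi>.R.pev P c = \<zero>" if "set P \<subseteq> F" "\<pi> (\<pi>.R.pev P c) = \<zero>\<^bsub>D\<^esub>" for P
      using inj[OF that(1)] that lift[OF that(1) c] by (simp add: rel_def)
    from adjoin_good[OF F c(1) _ this] have "c \<in> F" using max x c(2) by blast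
    then show ?thesis using c(2) by blast
  qed
  obtain c where c: "c \<in> carrier C" "\<pi> c = x" using surj[OF xc] by blast
  show "x \<in> \<pi> ` F"
  proof (cases "\<exists>n P. length P = Suc n \<and> last P \<noteq> \<zero> \<and> rel P")
    case False
    have "\<forall>k\<in>set P. k = \<zero>" if "rel P" for P
      using that
    proof (induction P rule: rev_induct)
      case (snoc k P)
      have k: "k = \<zero>" using False snoc.prems by (metis last_snoc length_append_singleton)
      have "rel P" using rel_snoc_zero snoc.prems unfolding k by blast
      then show ?case using snoc.IH k by auto
    qed simp
    then show ?thesis using c \<pi>.R.pev_all_zero[of _ c] by (intro in_F[OF c]) blast
  next
    case True
    define n where "n = (LEAST n. \<exists>P. length P = Suc n \<and> last P \<noteq> \<zero> \<and> rel P)"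
    have ex: "\<exists>P. length P = Suc n \<and> last P \<noteq> \<zero> \<and> rel P" unfolding n_def by (rule LeastI_ex[OF True])
    have least: "n \<le> m" if "length P = Suc m" "last P \<noteq> \<zero>" "rel P" for m P
      unfolding n_def using that by (intro Least_le) blast
    have short: "\<forall>k\<in>set P. k = \<zero>" if "rel P" "length P \<le> n" for P
      using that
    proof (induction P rule: rev_induct)
      case (snoc k P)
      have k: "k = \<zero>" using least[of "P @ [k]" "length P"] snoc.prems by (metis Suc_n_not_le_n last_snoc le_trans length_append_singleton)
      have "rel P" using rel_snoc_zero snoc.prems unfolding k by blast
      then show ?case using snoc.IH snoc.prems k by auto
    qed simp
    obtain P0 k where P0: "length P0 = n" "k \<noteq> \<zero>" "rel (P0 @ [k])"
      using ex by (metis append_butlast_last_id diff_Suc_1 length_butlast list.size(3) nat.distinct(1))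
    obtain l where l: "l \<in> F" "k \<otimes> l = \<one>" using inverses P0 by (auto simp: rel_def)
    define fs where "fs = map ((\<otimes>) l) P0"
    have P0F: "set P0 \<subseteq> F" "k \<in> F" using P0(3) by (auto simp: rel_def)
    have fsF: "set fs \<subseteq> F" "length fs = n" using P0F l(1) P0(1) by (auto simp: fs_def Fr(6))
    have fs1: "fs @ [\<one>] = map ((\<otimes>) l) (P0 @ [k])" using l(2) Fcar[OF l(1)] Fcar[OF P0F(2)] by (simp add: fs_def \<pi>.R.m_comm)
    have relfs: "rel (fs @ [\<one>])"
    proof -
      have "\<pi>.R.pev (fs @ [\<one>]) c = l \<otimes> \<pi>.R.pev (P0 @ [k]) c"
        unfolding fs1 using P0F Fc[OF P0F(1)] Fcar l(1) c(1) by (intro \<pi>.R.pev_scale) auto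
      moreover have "\<pi> (\<pi>.R.pev (P0 @ [k]) c) = \<zero>\<^bsub>D\<^esub>" using lift[OF _ c, of "P0 @ [k]"] P0(3) by (simp add: rel_def)
      moreover have "\<pi>.R.pev (P0 @ [k]) c \<in> carrier C" using P0F Fc[OF P0F(1)] Fcar c(1) by simp
      ultimately have "\<pi> (\<pi>.R.pev (fs @ [\<one>]) c) = \<zero>\<^bsub>D\<^esub>" using Fcar[OF l(1)] by simp
      then show ?thesis using lift[OF _ c, of "fs @ [\<one>]"] fsF Fr(3) by (simp add: rel_def)
    qed
    have n0: "n > 0"
    proof (rule ccontr)
      assume "\<not> n > 0"
      then have "fs = []" using fsF by simp
      then show False using relfs xc nontrivial by (simp add: rel_def)
    qed
    \<comment> \<open>An exact monic equation of degree \<open>n\<close> for a lift of \<open>x\<close> finishes the proof.\<close>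
    have reduce: "x \<in> \<pi> ` F" if c': "c' \<in> carrier C" "\<pi> c' = x" and gs: "set gs \<subseteq> F" "length gs = n"
      and eq: "\<pi>.R.pev (gs @ [\<one>]) c' = \<zero>" for c' gs
    proof (rule in_F[OF c'])
      fix P assume P: "set P \<subseteq> F" "rel P"
      \<comment> \<open>By the equation, every polynomial expression in \<open>c'\<close> is one of degree less than \<open>n\<close>; by
        minimality of \<open>n\<close> it is zero as soon as its image is.\<close>
      have eq': "c' [^] n = \<ominus> \<pi>.R.pev gs c'"
        using eq Fc[OF gs(1)] c'(1) gs(2) by (simp add: \<pi>.R.pev_snoc) (metis \<pi>.R.minus_equality \<pi>.R.nat_pow_closed \<pi>.R.pev_closed \<pi>.R.a_comm \<pi>.R.minus_minus)
      have "\<exists>Q. set Q \<subseteq> F \<and> length Q = n \<and> \<pi>.R.pev P c' = \<pi>.R.pev Q c'" using P(1)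
      proof (induction P)
        case Nil
        then show ?case using c'(1) Fr(2) by (intro exI[of _ "replicate n \<zero>"]) (auto simp: \<pi>.R.pev_zeros)
      next
        case (Cons f P)
        then obtain Q where Q: "set Q \<subseteq> F" "length Q = n" "\<pi>.R.pev P c' = \<pi>.R.pev Q c'" by auto
        have "f # Q \<noteq> []" by simp
        then obtain T t where Tt: "f # Q = T @ [t]" by (metis rev_exhaust)
        have T: "set T \<subseteq> F" "t \<in> F" "length T = n"
        proof -
          have "set (f # Q) \<subseteq> F" using Cons.prems Q(1) by auto
          then show "set T \<subseteq> F" "t \<in> F" unfolding Tt by auto
          show "length T = n" using arg_cong[OF Tt, of length] Q(2) by simp
        qed
        let ?N = "\<pi>.R.padd T (map ((\<otimes>) (\<ominus> t)) gs)"
        have tn: "\<ominus> t \<in> F" "\<ominus> t \<in> carrier C" using T(2) Fr(5) Fcar by auto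
        have gn: "set (map ((\<otimes>) (\<ominus> t)) gs) \<subseteq> F" using gs(1) tn by (auto simp: Fr(6))
        have "\<pi>.R.pev (f # P) c' = \<pi>.R.pev T c' \<oplus> c' [^] n \<otimes> t"
          using \<pi>.R.pev_snoc[OF Fc[OF T(1)] c'(1) Fcar[OF T(2)]] Q(3) T(3) Tt
          by (metis \<pi>.R.pev.simps(2))
        also have "\<dots> = \<pi>.R.pev T c' \<oplus> \<ominus> t \<otimes> \<pi>.R.pev gs c'"
          unfolding eq' using Fc[OF gs(1)] c'(1) Fcar[OF T(2)] by (simp add: \<pi>.R.l_minus \<pi>.R.r_minus \<pi>.R.m_comm)
        also have "\<dots> = \<pi>.R.pev ?N c'"
          using Fc[OF gs(1)] Fc[OF T(1)] Fc[OF gn] c'(1) tn(2) by (simp add: \<pi>.R.pev_padd \<pi>.R.pev_scale)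
        finally have "\<pi>.R.pev (f # P) c' = \<pi>.R.pev ?N c'" .
        moreover have "set (\<pi>.R.padd U V) \<subseteq> F" if "set U \<subseteq> F" "set V \<subseteq> F" for U V
          using that by (induction U V rule: \<pi>.R.padd.induct) (auto simp: Fr(7))
        ultimately show ?case using T(1,3) gn gs(2) by (intro exI[of _ ?N]) (simp add: \<pi>.R.length_padd)
      qed
      then obtain Q where Q: "set Q \<subseteq> F" "length Q = n" "\<pi>.R.pev P c' = \<pi>.R.pev Q c'" by blast
      have "rel Q" using P(2) lift[OF P(1) c'] lift[OF Q(1) c'] Q by (simp add: rel_def)
      then have "\<forall>k\<in>set Q. k = \<zero>" using short Q(2) by simp
      then show "\<pi>.R.pev P c' = \<zero>" using \<pi>.R.pev_all_zero[OF _ c'(1)] Q(3) by simp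
    qed
    show ?thesis
    proof (cases "\<pi>.R.natr n = \<zero>")
      case False
      obtain Q where Q: "set Q \<subseteq> F" "length Q = n - 1"
        "\<And>c. c \<in> carrier C \<Longrightarrow> \<pi>.R.pder (fs @ [\<one>]) c = \<pi>.R.pev Q c \<oplus> c [^] (n - 1) \<otimes> \<pi>.R.natr n"
        using \<pi>.R.pder_monic[OF Fs fsF(1)] fsF(2) by auto
      let ?g = "fs @ [\<one>]"
      have gF: "set ?g \<subseteq> F" "set ?g \<subseteq> carrier C" using fsF Fr(3) Fc[OF fsF(1)] by auto
      have natF: "\<pi>.R.natr m \<in> F" for m by (induction m) (auto simp: Fr(2,3,7))
      let ?d = "\<pi>.R.pder ?g c" and ?e = "\<pi>.R.pev ?g c"
      have d: "?d = \<pi>.R.pev (Q @ [\<pi>.R.natr n]) c"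
        using Q(3)[OF c(1)] \<pi>.R.pev_snoc[OF Fc[OF Q(1)] c(1) \<pi>.R.natr_closed] Q(2) by simp
      have QF: "set (Q @ [\<pi>.R.natr n]) \<subseteq> F" using Q(1) natF by auto
      have dc: "?d \<in> carrier C" "?e \<in> carrier C" using gF c(1) by auto
      have "\<pi> ?d \<noteq> \<zero>\<^bsub>D\<^esub>"
      proof
        assume "\<pi> ?d = \<zero>\<^bsub>D\<^esub>"
        then have "rel (Q @ [\<pi>.R.natr n])" using lift[OF QF c] d QF by (simp add: rel_def)
        then have "\<forall>k\<in>set (Q @ [\<pi>.R.natr n]). k = \<zero>" using Q(2) n0 by (intro short) auto
        then show False using False by simp
      qed
      moreover have "\<pi> ?d \<in> \<kappa> ` carrier K"
      proof -
        have "\<pi>.S.pev (map \<pi> P) x \<in> \<kappa> ` carrier K" if "set P \<subseteq> F" for P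
          using that
        proof (induction P)
          case Nil show ?case using subringE(2)[OF \<kappa>_subring] by simp
        next
          case (Cons f P)
          then show ?case using F\<pi> x subringE(6,7)[OF \<kappa>_subring] by simp
        qed
        from this[OF QF] show ?thesis unfolding d lift[OF QF c] .
      qed
      ultimately obtain v where v: "v \<in> carrier C" "?d \<otimes> v = \<one>" using unit_lift dc by blast
      \<comment> \<open>The Newton step; it is exact because the correction has square zero.\<close>
      let ?v = "\<ominus> (?e \<otimes> v)"
      have e0: "\<pi> ?e = \<zero>\<^bsub>D\<^esub>" using relfs lift[OF gF(1) c] by (simp add: rel_def)
      have vv: "?v \<in> carrier C" "\<pi> ?v = \<zero>\<^bsub>D\<^esub>" using dc v(1) e0 by simp_all
      have "\<pi>.R.pev ?g (c \<oplus> ?v) = ?e \<oplus> ?d \<otimes> ?v"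
        using gF(2) c(1) vv square_zero[OF vv(1) vv(1) vv(2) vv(2)] by (intro \<pi>.R.taylor)
      also have "?d \<otimes> ?v = \<ominus> (?e \<otimes> (?d \<otimes> v))" using dc v(1) by (simp add: \<pi>.R.r_minus \<pi>.R.m_lcomm)
      also have "?e \<oplus> \<dots> = \<zero>" using dc v(2) by (simp add: \<pi>.R.r_neg)
      finally have "\<pi>.R.pev ?g (c \<oplus> ?v) = \<zero>" .
      then show ?thesis using c vv xc by (intro reduce[of "c \<oplus> ?v" fs] fsF) auto
    next
      case True
      obtain p where p: "normalization_semidom_class.prime (p::nat)" "\<pi>.R.natr p = \<zero>" "c [^] p \<in> B" using B_char True n0 c x by auto
      have "p dvd n"
      proof (rule ccontr)
        assume "\<not> p dvd n"
        then have "coprime p n" using p(1) by (simp add: prime_imp_coprime)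
        then have "gcd p n = 1" by simp
        moreover have "p \<noteq> 0" using p(1) by auto
        ultimately obtain a b where ab: "p * a = n * b + 1" using bezout_nat[of p n] by auto
        have "\<pi>.R.natr (p * a) = \<pi>.R.natr (n * b) \<oplus> \<one>" unfolding ab by simp
        then show False using p(2) True one0 by (simp add: \<pi>.R.natr_mult)
      qed
      then have "p \<le> n" using n0 by (rule dvd_imp_le)
      obtain q where q: "p = Suc q" using p(1) by (metis not_prime_0 old.nat.exhaust)
      let ?h = "(\<ominus> (c [^] p)) # replicate q \<zero>"
      have cpF: "c [^] p \<in> F" using p(3) BF by blast
      have hF: "set ?h \<subseteq> F" "length ?h = p" using Fr(2) Fr(5)[OF cpF] q by (simp_all add: set_replicate_conv_if)
      have ev: "\<pi>.R.pev (?h @ [\<one>]) c = \<zero>"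
        unfolding \<pi>.R.pev_snoc[OF Fc[OF hF(1)] c(1) \<pi>.R.one_closed] hF(2)
        using c(1) by (simp add: \<pi>.R.pev_zeros \<pi>.R.l_neg)
      have hF': "set (?h @ [\<one>]) \<subseteq> F" using hF(1) Fr(3) by auto
      have "rel (?h @ [\<one>])" using lift[OF hF' c] hF' ev by (simp add: rel_def)
      then have "n \<le> p" using least[of "?h @ [\<one>]" p] hF(2) one0 by simp
      then show ?thesis using reduce[OF c hF(1) _ ev] hF(2) \<open>p \<le> n\<close> by simp
    qed
  qed
qed

text \<open>By injectivity on a maximal partial lift, lifts inside it are unique, so choosing them gives
  a homomorphism.\<close>

theorem field_lift: "\<exists>g\<in>ring_hom K C. \<forall>k\<in>carrier K. \<pi> (g k) = \<kappa> k"
proof -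
  obtain F where F: "good F" "\<And>F'. good F' \<Longrightarrow> F \<subseteq> F' \<Longrightarrow> F' = F" using maximal_good by blast
  have "\<forall>k\<in>carrier K. \<exists>u\<in>F. \<pi> u = \<kappa> k" using good_maximal_surj[OF F] by (metis imageE image_subset_iff)
  then obtain l where l: "\<And>k. k \<in> carrier K \<Longrightarrow> l k \<in> F" "\<And>k. k \<in> carrier K \<Longrightarrow> \<pi> (l k) = \<kappa> k" by metis
  have Fs: "subring F C" and Finj: "\<And>u. u \<in> F \<Longrightarrow> \<pi> u = \<zero>\<^bsub>D\<^esub> \<Longrightarrow> u = \<zero>" using F(1) by (auto simp: good_def)
  note Fr = subringE[OF Fs]
  have eqI: "u = v" if "u \<in> F" "v \<in> F" "\<pi> u = \<pi> v" for u v
  proof -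
    have c: "u \<in> carrier C" "v \<in> carrier C" using that Fr(1) by auto
    have "u \<oplus> \<ominus> v \<in> F" using that Fr(5,7) by simp
    moreover have "\<pi> (u \<oplus> \<ominus> v) = \<zero>\<^bsub>D\<^esub>" using c that(3) by (simp add: \<pi>.S.r_neg)
    ultimately have "u \<oplus> \<ominus> v = \<zero>" by (rule Finj)
    then show ?thesis using c \<pi>.R.r_right_minus_eq[of u v] by (simp add: a_minus_def)
  qed
  have lc: "l k \<in> carrier C" if "k \<in> carrier K" for k using l(1)[OF that] Fr(1) by blast
  have "l \<in> ring_hom K C"
  proof (rule ring_hom_memI)
    fix x y assume xy: "x \<in> carrier K" "y \<in> carrier K"
    show "l x \<in> carrier C" by (rule lc[OF xy(1)])
    show "l (x \<otimes>\<^bsub>K\<^esub> y) = l x \<otimes> l y" using xy l lc Fr(6) by (intro eqI) auto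
    show "l (x \<oplus>\<^bsub>K\<^esub> y) = l x \<oplus> l y" using xy l lc Fr(7) by (intro eqI) auto
  next
    show "l \<one>\<^bsub>K\<^esub> = \<one>" using l Fr(3) by (intro eqI) auto
  qed
  then show ?thesis using l by blast
qed

end

lemma (in cring) subfield_characteristic:
  assumes L: "subfield L R"
  shows "(\<exists>p::nat. normalization_semidom_class.prime p \<and> natr p = \<zero>) \<or> (\<forall>n>0. natr n \<in> Units R)"
proof (cases "\<exists>n>0. natr n = \<zero>")
  case True
  interpret field_in_ring R L by (intro field_in_ring.intro field_in_ring_axioms.intro is_cring L)
  define n where "n = (LEAST n. n > 0 \<and> natr n = \<zero>)"
  have n: "n > 0" "natr n = \<zero>" using LeastI_ex[OF True] by (simp_all add: n_def)
  have least: "n \<le> m" if "m > 0" "natr m = \<zero>" for m unfolding n_def using that by (intro Least_le) simp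
  have "n \<noteq> 1" using n(2) one_nonzero by auto
  then obtain q :: nat where q: "normalization_semidom_class.prime q" "q dvd n" using prime_factor_nat by blast
  obtain b where b: "n = q * b" using q(2) by (rule dvdE)
  have "natr q \<otimes> natr b = \<zero>" using n(2) b natr_mult by simp
  moreover have "natr m \<in> L" for m by (induction m) auto
  ultimately have "natr q = \<zero> \<or> natr b = \<zero>" using subfieldE(5)[OF L] by blast
  moreover have "natr b \<noteq> \<zero>"
  proof
    assume "natr b = \<zero>"
    moreover have "b > 0" using n(1) b by (cases b) auto
    ultimately have "n \<le> b" by (rule least[rotated])
    moreover have "2 * b \<le> n" unfolding b using prime_ge_2_nat[OF q(1)] by simp
    ultimately show False using \<open>b > 0\<close> by simp
  qed
  ultimately show ?thesis using q(1) by blast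
next
  case False
  interpret field_in_ring R L by (intro field_in_ring.intro field_in_ring_axioms.intro is_cring L)
  have "natr m \<in> L" for m by (induction m) auto
  then have "natr m \<in> Units R" if "m > 0" for m
    using False that K_inv[of "natr m"] K_closed unfolding Units_def by blast
  then show ?thesis by blast
qed

text \<open>The subring to start from consists of the integers in characteristic zero, and of the \<open>p\<close>-th
  powers of all lifts of elements of \<open>\<kappa> K\<close> in characteristic \<open>p\<close>. A \<open>p\<close>-th power in the kernel is
  zero: as \<open>\<kappa> K\<close> is reduced, it is the power of an element of the kernel, and that has square
  zero.\<close>

lemma square_zero_lift:
  assumes C: "cring C" and \<pi>: "ring_hom_cring C D \<pi>" and K: "field K" and \<kappa>: "\<kappa> \<in> ring_hom K D"
    and surj: "\<And>d. d \<in> carrier D \<Longrightarrow> \<exists>c\<in>carrier C. \<pi> c = d"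
    and nontrivial: "\<one>\<^bsub>D\<^esub> \<noteq> \<zero>\<^bsub>D\<^esub>"
    and square_zero: "\<And>u v. u \<in> carrier C \<Longrightarrow> v \<in> carrier C \<Longrightarrow> \<pi> u = \<zero>\<^bsub>D\<^esub> \<Longrightarrow> \<pi> v = \<zero>\<^bsub>D\<^esub> \<Longrightarrow> u \<otimes>\<^bsub>C\<^esub> v = \<zero>\<^bsub>C\<^esub>"
    and char: "(\<forall>n>0. cring.natr D n \<noteq> \<zero>\<^bsub>D\<^esub>) \<or> (\<exists>p::nat. normalization_semidom_class.prime p \<and> cring.natr C p = \<zero>\<^bsub>C\<^esub>)"
  shows "\<exists>g\<in>ring_hom K C. \<forall>k\<in>carrier K. \<pi> (g k) = \<kappa> k"
proof -
  interpret \<pi>: ring_hom_cring C D \<pi> by fact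
  interpret K: field K by fact
  interpret \<kappa>: ring_hom_cring K D \<kappa> by unfold_locales (rule \<kappa>)
  have K\<kappa>: "subring (\<kappa> ` carrier K) D"
  proof -
    have "ring_hom_ring K D \<kappa>" using ring_hom_ringI2[OF K.ring_axioms \<pi>.S.ring_axioms \<kappa>] .
    then show ?thesis using ring_hom_ring.img_is_subring K.carrier_is_subring by blast
  qed
  note Kr = subringE[OF K\<kappa>]
  have main: ?thesis
    if B: "subring B C" "\<pi> ` B \<subseteq> \<kappa> ` carrier K" "\<And>u. u \<in> B \<Longrightarrow> \<pi> u = \<zero>\<^bsub>D\<^esub> \<Longrightarrow> u = \<zero>\<^bsub>C\<^esub>"
      "(\<forall>n>0. \<pi>.R.natr n \<noteq> \<zero>\<^bsub>C\<^esub>) \<or> (\<exists>p::nat. normalization_semidom_class.prime p \<and> \<pi>.R.natr p = \<zero>\<^bsub>C\<^esub> \<and>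
        (\<forall>c\<in>carrier C. \<pi> c \<in> \<kappa> ` carrier K \<longrightarrow> c [^]\<^bsub>C\<^esub> p \<in> B))" for B
  proof -
    interpret square_zero_extension C D \<pi> K \<kappa> B
      by (intro square_zero_extension.intro square_zero_extension_axioms.intro \<pi> \<kappa>.ring_hom_cring_axioms K
        surj nontrivial square_zero B)
    show ?thesis by (rule field_lift)
  qed
  from char show ?thesis
  proof
    assume D0: "\<forall>n>0. \<pi>.S.natr n \<noteq> \<zero>\<^bsub>D\<^esub>"
    let ?B = "{\<pi>.R.natr a \<ominus>\<^bsub>C\<^esub> \<pi>.R.natr b | a b. True}"
    have nat\<kappa>: "\<pi>.S.natr a \<in> \<kappa> ` carrier K" for a by (induction a) (auto simp: Kr(2,3,7))
    show ?thesis
    proof (rule main[of ?B])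
      show "subring ?B C"
      proof (rule \<pi>.R.subringI)
        show "?B \<subseteq> carrier C" by auto
        have "\<one>\<^bsub>C\<^esub> = \<pi>.R.natr 1 \<ominus>\<^bsub>C\<^esub> \<pi>.R.natr 0" by (simp add: a_minus_def)
        then show "\<one>\<^bsub>C\<^esub> \<in> ?B" by blast
        fix u assume "u \<in> ?B"
        then obtain a b where u: "u = \<pi>.R.natr a \<ominus>\<^bsub>C\<^esub> \<pi>.R.natr b" by blast
        have "\<ominus>\<^bsub>C\<^esub> u = \<pi>.R.natr b \<ominus>\<^bsub>C\<^esub> \<pi>.R.natr a"
          unfolding u by (simp add: a_minus_def \<pi>.R.minus_add \<pi>.R.a_comm)
        then show "\<ominus>\<^bsub>C\<^esub> u \<in> ?B" by blast
        fix v assume "v \<in> ?B"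
        then obtain a' b' where v: "v = \<pi>.R.natr a' \<ominus>\<^bsub>C\<^esub> \<pi>.R.natr b'" by blast
        have "u \<oplus>\<^bsub>C\<^esub> v = \<pi>.R.natr (a + a') \<ominus>\<^bsub>C\<^esub> \<pi>.R.natr (b + b')"
          unfolding u v by (simp add: a_minus_def \<pi>.R.natr_add \<pi>.R.minus_add \<pi>.R.a_ac)
        then show "u \<oplus>\<^bsub>C\<^esub> v \<in> ?B" by blast
        have "u \<otimes>\<^bsub>C\<^esub> v = \<pi>.R.natr (a * a' + b * b') \<ominus>\<^bsub>C\<^esub> \<pi>.R.natr (a * b' + b * a')"
          unfolding u v by (simp add: a_minus_def \<pi>.R.natr_add \<pi>.R.natr_mult \<pi>.R.minus_add \<pi>.R.l_distr \<pi>.R.r_distr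
            \<pi>.R.l_minus \<pi>.R.r_minus \<pi>.R.a_ac)
        then show "u \<otimes>\<^bsub>C\<^esub> v \<in> ?B" by blast
      qed
      show "\<pi> ` ?B \<subseteq> \<kappa> ` carrier K"
        using nat\<kappa> Kr(5,7) by (auto simp: a_minus_def \<pi>.hom_natr)
      show "u = \<zero>\<^bsub>C\<^esub>" if u: "u \<in> ?B" "\<pi> u = \<zero>\<^bsub>D\<^esub>" for u
      proof -
        obtain a b where ab: "u = \<pi>.R.natr a \<ominus>\<^bsub>C\<^esub> \<pi>.R.natr b" using u(1) by blast
        have "\<pi>.S.natr a \<ominus>\<^bsub>D\<^esub> \<pi>.S.natr b = \<zero>\<^bsub>D\<^esub>" using u(2) unfolding ab by (simp add: a_minus_def \<pi>.hom_natr)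
        then have e: "\<pi>.S.natr a = \<pi>.S.natr b" by (simp add: \<pi>.S.r_right_minus_eq)
        have neq: "\<pi>.S.natr (n + d) \<noteq> \<pi>.S.natr n" if "d > 0" for n d
        proof
          assume "\<pi>.S.natr (n + d) = \<pi>.S.natr n"
          then have e: "\<pi>.S.natr n \<oplus>\<^bsub>D\<^esub> \<pi>.S.natr d = \<pi>.S.natr n" by (simp add: \<pi>.S.natr_add)
          have "\<pi>.S.natr d = \<ominus>\<^bsub>D\<^esub> \<pi>.S.natr n \<oplus>\<^bsub>D\<^esub> (\<pi>.S.natr n \<oplus>\<^bsub>D\<^esub> \<pi>.S.natr d)"
            by (rule \<pi>.S.r_neg1[symmetric]) simp_all
          also have "\<dots> = \<zero>\<^bsub>D\<^esub>" unfolding e by (simp add: \<pi>.S.l_neg)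
          finally have "\<pi>.S.natr d = \<zero>\<^bsub>D\<^esub>" .
          then show False using D0 that by blast
        qed
        have "a = b"
        proof (rule ccontr)
          assume "a \<noteq> b"
          then consider "a = b + (a - b)" "a - b > 0" | "b = a + (b - a)" "b - a > 0" by linarith
          then show False using neq e by cases metis+
        qed
        then show ?thesis unfolding ab by (simp add: a_minus_def \<pi>.R.r_neg)
      qed
      have "\<pi>.R.natr n \<noteq> \<zero>\<^bsub>C\<^esub>" if "n > 0" for n using D0 that \<pi>.hom_natr \<pi>.hom_zero by metis
      then show "(\<forall>n>0. \<pi>.R.natr n \<noteq> \<zero>\<^bsub>C\<^esub>) \<or> (\<exists>p::nat. normalization_semidom_class.prime p \<and> \<pi>.R.natr p = \<zero>\<^bsub>C\<^esub> \<and>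
        (\<forall>c\<in>carrier C. \<pi> c \<in> \<kappa> ` carrier K \<longrightarrow> c [^]\<^bsub>C\<^esub> p \<in> ?B))" by blast
    qed
  next
    assume "\<exists>p::nat. normalization_semidom_class.prime p \<and> \<pi>.R.natr p = \<zero>\<^bsub>C\<^esub>"
    then obtain p :: nat where p: "normalization_semidom_class.prime p" "\<pi>.R.natr p = \<zero>\<^bsub>C\<^esub>" by blast
    obtain q where q: "p = Suc (Suc q)" using prime_ge_2_nat[OF p(1)] by (metis add_2_eq_Suc le_Suc_ex)
    let ?B = "{c [^]\<^bsub>C\<^esub> p | c. c \<in> carrier C \<and> \<pi> c \<in> \<kappa> ` carrier K}"
    note fr = \<pi>.R.frobenius_add[OF _ _ p]
    have K\<pi>: "\<pi> c [^]\<^bsub>D\<^esub> (n::nat) \<in> \<kappa> ` carrier K" if "\<pi> c \<in> \<kappa> ` carrier K" for c n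
      using that by (induction n) (auto simp: Kr(3,6))
    show ?thesis
    proof (rule main[of ?B])
      show "subring ?B C"
      proof (rule \<pi>.R.subringI)
        show "?B \<subseteq> carrier C" by auto
        have "\<one>\<^bsub>C\<^esub> = \<one>\<^bsub>C\<^esub> [^]\<^bsub>C\<^esub> p" by simp
        then show "\<one>\<^bsub>C\<^esub> \<in> ?B" using Kr(3) \<pi>.hom_one \<pi>.R.one_closed by (intro CollectI exI[of _ "\<one>\<^bsub>C\<^esub>"]) simp
        fix u assume "u \<in> ?B"
        then obtain c where c: "u = c [^]\<^bsub>C\<^esub> p" "c \<in> carrier C" "\<pi> c \<in> \<kappa> ` carrier K" by blast
        have "c [^]\<^bsub>C\<^esub> p \<oplus>\<^bsub>C\<^esub> (\<ominus>\<^bsub>C\<^esub> c) [^]\<^bsub>C\<^esub> p = \<zero>\<^bsub>C\<^esub>"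
          using fr[of c "\<ominus>\<^bsub>C\<^esub> c"] c(2) q by (simp add: \<pi>.R.r_neg)
        then have "\<ominus>\<^bsub>C\<^esub> u = (\<ominus>\<^bsub>C\<^esub> c) [^]\<^bsub>C\<^esub> p" using c(1,2) by (metis \<pi>.R.a_comm \<pi>.R.a_inv_closed \<pi>.R.minus_equality \<pi>.R.nat_pow_closed)
        then show "\<ominus>\<^bsub>C\<^esub> u \<in> ?B" using c(2,3) Kr(5) by (intro CollectI exI[of _ "\<ominus>\<^bsub>C\<^esub> c"]) simp
        fix v assume "v \<in> ?B"
        then obtain d where d: "v = d [^]\<^bsub>C\<^esub> p" "d \<in> carrier C" "\<pi> d \<in> \<kappa> ` carrier K" by blast
        show "u \<oplus>\<^bsub>C\<^esub> v \<in> ?B" unfolding c(1) d(1) using c d Kr(7) fr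
          by (intro CollectI exI[of _ "c \<oplus>\<^bsub>C\<^esub> d"]) simp
        show "u \<otimes>\<^bsub>C\<^esub> v \<in> ?B" unfolding c(1) d(1) using c d Kr(6)
          by (intro CollectI exI[of _ "c \<otimes>\<^bsub>C\<^esub> d"]) (simp add: \<pi>.R.nat_pow_distrib)
      qed
      show "\<pi> ` ?B \<subseteq> \<kappa> ` carrier K"
      proof
        fix d assume "d \<in> \<pi> ` ?B"
        then obtain c where "c \<in> carrier C" "\<pi> c \<in> \<kappa> ` carrier K" "d = \<pi> (c [^]\<^bsub>C\<^esub> p)" by blast
        then show "d \<in> \<kappa> ` carrier K" using K\<pi>[of c p] by (simp only: \<pi>.hom_pow)
      qed
      show "u = \<zero>\<^bsub>C\<^esub>" if u: "u \<in> ?B" "\<pi> u = \<zero>\<^bsub>D\<^esub>" for u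
      proof -
        obtain c k where c: "u = c [^]\<^bsub>C\<^esub> p" "c \<in> carrier C" "\<pi> c = \<kappa> k" "k \<in> carrier K" using u(1) by blast
        have k0: "k [^]\<^bsub>K\<^esub> n = \<zero>\<^bsub>K\<^esub> \<Longrightarrow> k = \<zero>\<^bsub>K\<^esub>" for n :: nat
          using c(4) K.integral_iff by (induction n) auto
        have inj: "y = \<zero>\<^bsub>K\<^esub>" if y: "y \<in> carrier K" "\<kappa> y = \<zero>\<^bsub>D\<^esub>" for y
        proof (rule ccontr)
          assume "y \<noteq> \<zero>\<^bsub>K\<^esub>"
          then have "y \<in> Units K" unfolding K.field_Units using y(1) by blast
          then have "\<kappa> y \<otimes>\<^bsub>D\<^esub> \<kappa> (inv\<^bsub>K\<^esub> y) = \<one>\<^bsub>D\<^esub>" using \<kappa>.hom_mult[of y "inv\<^bsub>K\<^esub> y"] y(1) K.Units_r_inv K.Units_inv_closed \<kappa>.hom_one by metis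
          then show False using y(2) nontrivial \<open>y \<in> Units K\<close> by (simp add: K.Units_inv_closed)
        qed
        have "\<kappa> (k [^]\<^bsub>K\<^esub> p) = \<zero>\<^bsub>D\<^esub>" using u(2) c by (simp add: \<pi>.hom_pow \<kappa>.hom_pow)
        then have "k = \<zero>\<^bsub>K\<^esub>" using k0 inj c(4) K.nat_pow_closed by blast
        then have "\<pi> c = \<zero>\<^bsub>D\<^esub>" using c(3) by simp
        then have "c \<otimes>\<^bsub>C\<^esub> c = \<zero>\<^bsub>C\<^esub>" using square_zero c(2) by blast
        then show ?thesis unfolding c(1) q using c(2) by (simp add: \<pi>.R.m_assoc)
      qed
      show "(\<forall>n>0. \<pi>.R.natr n \<noteq> \<zero>\<^bsub>C\<^esub>) \<or> (\<exists>p::nat. normalization_semidom_class.prime p \<and> \<pi>.R.natr p = \<zero>\<^bsub>C\<^esub> \<and>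
        (\<forall>c\<in>carrier C. \<pi> c \<in> \<kappa> ` carrier K \<longrightarrow> c [^]\<^bsub>C\<^esub> p \<in> ?B))" using p by blast
    qed
  qed
qed

lemma factor_hom:
  assumes "ring S" "ring C" "ring D" and p: "p \<in> ring_hom S C" "\<And>c. c \<in> carrier C \<Longrightarrow> \<exists>s\<in>carrier S. p s = c"
    and q: "q \<in> ring_hom S D" and ker: "\<And>s. s \<in> carrier S \<Longrightarrow> p s = \<zero>\<^bsub>C\<^esub> \<Longrightarrow> q s = \<zero>\<^bsub>D\<^esub>"
  shows "\<exists>\<pi>\<in>ring_hom C D. \<forall>s\<in>carrier S. \<pi> (p s) = q s"
proof -
  interpret p: ring_hom_ring S C p using assms(1,2) p(1) by (rule ring_hom_ringI2)
  interpret q: ring_hom_ring S D q using assms(1,3) q by (rule ring_hom_ringI2)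
  have same: "q s = q t" if st: "s \<in> carrier S" "t \<in> carrier S" "p s = p t" for s t
  proof -
    have "p (s \<ominus>\<^bsub>S\<^esub> t) = \<zero>\<^bsub>C\<^esub>" using st by (simp add: a_minus_def p.S.r_neg)
    then have "q (s \<ominus>\<^bsub>S\<^esub> t) = \<zero>\<^bsub>D\<^esub>" using ker st by simp
    then have "q s \<ominus>\<^bsub>D\<^esub> q t = \<zero>\<^bsub>D\<^esub>" using st by (simp add: a_minus_def)
    then show ?thesis using st by (simp add: q.S.r_right_minus_eq)
  qed
  obtain t where t: "\<And>c. c \<in> carrier C \<Longrightarrow> t c \<in> carrier S" "\<And>c. c \<in> carrier C \<Longrightarrow> p (t c) = c" using p(2) by metis
  have eq: "q (t (p s)) = q s" if "s \<in> carrier S" for s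
    using that t by (intro same) auto
  have "(\<lambda>c. q (t c)) \<in> ring_hom C D"
  proof (rule ring_hom_memI)
    fix x y assume xy: "x \<in> carrier C" "y \<in> carrier C"
    have "q (t (x \<otimes>\<^bsub>C\<^esub> y)) = q (t x \<otimes>\<^bsub>S\<^esub> t y)" using xy t by (intro same) auto
    then show "q (t (x \<otimes>\<^bsub>C\<^esub> y)) = q (t x) \<otimes>\<^bsub>D\<^esub> q (t y)" using xy t by simp
    have "q (t (x \<oplus>\<^bsub>C\<^esub> y)) = q (t x \<oplus>\<^bsub>S\<^esub> t y)" using xy t by (intro same) auto
    then show "q (t (x \<oplus>\<^bsub>C\<^esub> y)) = q (t x) \<oplus>\<^bsub>D\<^esub> q (t y)" using xy t by simp
  next
    have "q (t \<one>\<^bsub>C\<^esub>) = q \<one>\<^bsub>S\<^esub>" using t by (intro same) auto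
    then show "q (t \<one>\<^bsub>C\<^esub>) = \<one>\<^bsub>D\<^esub>" by simp
  qed (use t in auto)
  then show ?thesis using eq by (intro bexI[of _ "\<lambda>c. q (t c)"] ballI)
qed

context ideal
begin

lemma coset_hom: "(\<lambda>x. I +> x) \<in> ring_hom R (R Quot I)"
  using rcos_ring_hom by simp

lemma coset_surj: "c \<in> carrier (R Quot I) \<Longrightarrow> \<exists>x\<in>carrier R. I +> x = c"
  by (auto simp: FactRing_def A_RCOSETS_def')

lemma coset_zero_iff: "x \<in> carrier R \<Longrightarrow> I +> x = \<zero>\<^bsub>R Quot I\<^esub> \<longleftrightarrow> x \<in> I"
  using a_rcos_const a_rcos_self by (auto simp: FactRing_def)

lemma coset_eq_iff:
  assumes "x \<in> carrier R" "y \<in> carrier R"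
  shows "I +> x = I +> y \<longleftrightarrow> x \<ominus> y \<in> I"
proof -
  interpret Q: ring "R Quot I" by (rule quotient_is_ring)
  interpret h: ring_hom_ring R "R Quot I" "\<lambda>x. I +> x"
    by (rule ring_hom_ringI2[OF ring_axioms Q.ring_axioms coset_hom])
  have "I +> (x \<ominus> y) = (I +> x) \<ominus>\<^bsub>R Quot I\<^esub> (I +> y)" using assms by (simp add: a_minus_def)
  then show ?thesis using coset_zero_iff[of "x \<ominus> y"] assms Q.r_right_minus_eq[of "I +> x" "I +> y"]
    h.hom_closed by (metis minus_closed)
qed

end

lemma (in cring) ideal_power_mono:
  assumes "I \<subseteq> J" shows "ideal_power R I n \<subseteq> ideal_power R J n"
proof (induction n)
  case (Suc n)
  show ?case
  proof
    fix v assume "v \<in> ideal_power R I (Suc n)"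
    then have "v \<in> ideal_prod R (ideal_power R I n) I" by (simp add: ideal_power_Suc)
    then have "v \<in> ideal_prod R (ideal_power R J n) J"
      by induction (use assms Suc in \<open>auto intro: ideal_prod.intros\<close>)
    then show "v \<in> ideal_power R J (Suc n)" by (simp add: ideal_power_Suc)
  qed
qed simp

text \<open>Lift successively along the quotients \<open>R/J\<^sup>n\<^sup>+\<^sup>2 \<rightarrow> R/J\<^sup>n\<^sup>+\<^sup>1\<close>, whose kernels have square
  zero. Representatives of the successive images form a Cauchy sequence, because \<open>J\<close> is contained
  in \<open>\<mm>\<close>; its limit is still a lift of \<open>\<kappa>\<close> because \<open>J\<close> is closed.\<close>

lemma (in complete_regular_local_ring) field_lift_complete:
  assumes L: "subfield L R" and J: "ideal J R" "\<one> \<notin> J" and K: "field K" and \<kappa>: "\<kappa> \<in> ring_hom K (R Quot J)"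
  shows "\<exists>g\<in>ring_hom K R. \<forall>k\<in>carrier K. J +> g k = \<kappa> k"
proof -
  interpret K: field K by fact
  define A where "A n = ideal_power R J (Suc n)" for n
  have A: "ideal (A n) R" for n unfolding A_def by (rule ideal_power_ideal[OF J(1)])
  have A0: "A 0 = J" by (simp add: A_def ideal_power_1[OF J(1)])
  have Adec: "A (Suc n) \<subseteq> A n" for n unfolding A_def by (rule ideal_power_antimono[OF J(1)]) simp
  have A1: "\<one> \<notin> A n" for n
    using ideal_power_antimono[OF J(1), of 1 "Suc n"] J(2) ideal_power_1[OF J(1)] by (auto simp: A_def)
  have Jm: "J \<subseteq> \<mm>" by (rule proper_ideal_le[OF J])
  have Am: "A n \<subseteq> ideal_power R \<mm> n" for n
    using ideal_power_mono[OF Jm, of "Suc n"] ideal_power_antimono[OF max_ideal, of n "Suc n"] by (auto simp: A_def)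
  let ?C = "\<lambda>n. R Quot A n" and ?cl = "\<lambda>n x. A n +> x"
  have Ccr: "cring (?C n)" for n by (rule ideal.quotient_is_cring[OF A is_cring])
  note coset = ideal.coset_hom[OF A] ideal.coset_surj[OF A] ideal.coset_zero_iff[OF A] ideal.coset_eq_iff[OF A]
  have clh: "ring_hom_cring R (?C n) (?cl n)" for n
    by (intro ring_hom_cring.intro ring_hom_cring_axioms.intro is_cring Ccr coset(1))
  have step: "\<exists>g'. g' \<in> ring_hom K (?C (Suc n)) \<and> (\<forall>k\<in>carrier K. \<forall>x\<in>carrier R. ?cl (Suc n) x = g' k \<longrightarrow> ?cl n x = g k)"
    if g: "g \<in> ring_hom K (?C n)" for n g
  proof -
    interpret C1: ring_hom_cring R "?C (Suc n)" "?cl (Suc n)" by (rule clh)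
    interpret C0: ring_hom_cring R "?C n" "?cl n" by (rule clh)
    have "\<exists>\<pi>\<in>ring_hom (?C (Suc n)) (?C n). \<forall>x\<in>carrier R. \<pi> (?cl (Suc n) x) = ?cl n x"
      using coset(3) Adec by (intro factor_hom ring_axioms C1.S.ring_axioms C0.S.ring_axioms coset(1,2)) (blast, blast)
    then obtain \<pi> where \<pi>: "\<pi> \<in> ring_hom (?C (Suc n)) (?C n)" "\<And>x. x \<in> carrier R \<Longrightarrow> \<pi> (?cl (Suc n) x) = ?cl n x" by blast
    have "\<exists>g'\<in>ring_hom K (?C (Suc n)). \<forall>k\<in>carrier K. \<pi> (g' k) = g k"
    proof (rule square_zero_lift[OF C1.S.is_cring _ K g])
      show "ring_hom_cring (?C (Suc n)) (?C n) \<pi>"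
        by (intro ring_hom_cring.intro ring_hom_cring_axioms.intro Ccr \<pi>(1))
      show "\<exists>c\<in>carrier (?C (Suc n)). \<pi> c = d" if "d \<in> carrier (?C n)" for d
        using coset(2)[OF that] \<pi>(2) C1.hom_closed by metis
      show "\<one>\<^bsub>?C n\<^esub> \<noteq> \<zero>\<^bsub>?C n\<^esub>" using coset(3)[OF one_closed, of n] A1[of n] C0.hom_one by simp
      show "u \<otimes>\<^bsub>?C (Suc n)\<^esub> v = \<zero>\<^bsub>?C (Suc n)\<^esub>"
        if uv: "u \<in> carrier (?C (Suc n))" "v \<in> carrier (?C (Suc n))" "\<pi> u = \<zero>\<^bsub>?C n\<^esub>" "\<pi> v = \<zero>\<^bsub>?C n\<^esub>" for u v
      proof -
        obtain x y where x: "x \<in> carrier R" "?cl (Suc n) x = u" and y: "y \<in> carrier R" "?cl (Suc n) y = v"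
          using coset(2) uv by meson
        have "x \<in> A n" "y \<in> A n" using coset(3)[OF x(1)] coset(3)[OF y(1)] uv \<pi>(2) x y by auto
        then have "x \<otimes> y \<in> ideal_power R J (Suc n + Suc n)" unfolding A_def by (rule ideal_power_mult[OF J(1)])
        then have "x \<otimes> y \<in> A (Suc n)" using ideal_power_antimono[OF J(1), of "Suc (Suc n)" "Suc n + Suc n"] by (auto simp: A_def)
        then have "?cl (Suc n) (x \<otimes> y) = \<zero>\<^bsub>?C (Suc n)\<^esub>" using coset(3)[of "x \<otimes> y" "Suc n"] x(1) y(1) by blast
        then show ?thesis unfolding C1.hom_mult[OF x(1) y(1)] x(2) y(2) .
      qed
      from subfield_characteristic[OF L]
      show "(\<forall>m>0. C0.S.natr m \<noteq> \<zero>\<^bsub>?C n\<^esub>) \<or> (\<exists>p::nat. normalization_semidom_class.prime p \<and> C1.S.natr p = \<zero>\<^bsub>?C (Suc n)\<^esub>)"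
      proof
        assume "\<exists>p::nat. normalization_semidom_class.prime p \<and> natr p = \<zero>"
        then show ?thesis using C1.hom_natr C1.hom_zero by metis
      next
        assume un: "\<forall>m>0. natr m \<in> Units R"
        have "C0.S.natr m \<noteq> \<zero>\<^bsub>?C n\<^esub>" if "m > 0" for m
        proof
          assume "C0.S.natr m = \<zero>\<^bsub>?C n\<^esub>"
          then have "natr m \<in> A n" using C0.hom_natr[of m] coset(3)[of "natr m" n] by simp
          then have "inv (natr m) \<otimes> natr m \<in> A n" using un that by (intro ideal.I_l_closed[OF A] Units_inv_closed) auto
          then show False using A1[of n] un that by simp
        qed
        then show ?thesis by blast
      qed
    qed
    then obtain g' where g': "g' \<in> ring_hom K (?C (Suc n))" "\<And>k. k \<in> carrier K \<Longrightarrow> \<pi> (g' k) = g k" by blast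
    then show ?thesis using \<pi>(2) by metis
  qed
  have "\<exists>G. \<forall>n. (G n \<in> ring_hom K (?C n) \<and> (n = 0 \<longrightarrow> G n = \<kappa>)) \<and>
    (\<forall>k\<in>carrier K. \<forall>x\<in>carrier R. ?cl (Suc n) x = G (Suc n) k \<longrightarrow> ?cl n x = G n k)"
  proof (rule dependent_nat_choice)
    show "\<exists>g. g \<in> ring_hom K (?C 0) \<and> (0 = (0::nat) \<longrightarrow> g = \<kappa>)" using \<kappa> A0 by auto
    fix g n assume "g \<in> ring_hom K (?C n) \<and> (n = 0 \<longrightarrow> g = \<kappa>)"
    then show "\<exists>g'. (g' \<in> ring_hom K (?C (Suc n)) \<and> (Suc n = 0 \<longrightarrow> g' = \<kappa>)) \<and>
      (\<forall>k\<in>carrier K. \<forall>x\<in>carrier R. ?cl (Suc n) x = g' k \<longrightarrow> ?cl n x = g k)" using step by auto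
  qed
  then obtain G where G: "\<And>n. G n \<in> ring_hom K (?C n)" "G 0 = \<kappa>"
    "\<And>n k x. k \<in> carrier K \<Longrightarrow> x \<in> carrier R \<Longrightarrow> ?cl (Suc n) x = G (Suc n) k \<Longrightarrow> ?cl n x = G n k" by blast
  have "\<forall>n k. \<exists>x. k \<in> carrier K \<longrightarrow> x \<in> carrier R \<and> ?cl n x = G n k"
    using coset(2) ring_hom_closed[OF G(1)] by metis
  then obtain x where x: "\<And>n k. k \<in> carrier K \<Longrightarrow> x n k \<in> carrier R" "\<And>n k. k \<in> carrier K \<Longrightarrow> ?cl n (x n k) = G n k" by metis
  have xdiff: "x (Suc n) k \<ominus> x n k \<in> A n" if k: "k \<in> carrier K" for n k
    using coset(4)[of "x (Suc n) k" "x n k" n] G(3)[OF k x(1)[OF k] x(2)[OF k]] x[OF k] by simp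
  have "\<forall>k. \<exists>y. k \<in> carrier K \<longrightarrow> y \<in> carrier R \<and> (\<forall>n. y \<ominus> x n k \<in> ideal_power R \<mm> n)"
  proof
    fix k show "\<exists>y. k \<in> carrier K \<longrightarrow> y \<in> carrier R \<and> (\<forall>n. y \<ominus> x n k \<in> ideal_power R \<mm> n)"
      using complete[of "\<lambda>n. x n k"] x(1) xdiff Am by blast
  qed
  then obtain y where y: "\<And>k. k \<in> carrier K \<Longrightarrow> y k \<in> carrier R"
    "\<And>k n. k \<in> carrier K \<Longrightarrow> y k \<ominus> x n k \<in> ideal_power R \<mm> n" by metis
  have mI: "ideal (ideal_power R \<mm> n) R" for n by (rule ideal_power_ideal[OF max_ideal])
  have eqI: "u = v" if uv: "u \<in> carrier R" "v \<in> carrier R"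
    "\<And>n. \<exists>s t. s \<in> carrier R \<and> t \<in> carrier R \<and> u \<ominus> s \<in> ideal_power R \<mm> n \<and> v \<ominus> t \<in> ideal_power R \<mm> n \<and> ?cl n s = ?cl n t" for u v
  proof -
    have "u \<ominus> v \<in> ideal_power R \<mm> n" for n
    proof -
      interpret M: ideal "ideal_power R \<mm> n" R by (rule mI)
      obtain s t where st: "s \<in> carrier R" "t \<in> carrier R" "u \<ominus> s \<in> ideal_power R \<mm> n"
        "v \<ominus> t \<in> ideal_power R \<mm> n" "?cl n s = ?cl n t" using uv(3) by blast
      have "s \<ominus> t \<in> ideal_power R \<mm> n" using coset(4)[OF st(1,2)] st(5) Am by blast
      then show ?thesis using M.diff_trans[of u s v] M.diff_trans[of s t v] M.diff_sym[of v t] uv(1,2) st by blast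
    qed
    then have "u \<ominus> v = \<zero>" using separated by blast
    then show ?thesis using uv by (simp add: r_right_minus_eq)
  qed
  have "y \<in> ring_hom K R"
  proof (rule ring_hom_memI)
    fix k l assume kl: "k \<in> carrier K" "l \<in> carrier K"
    show "y k \<in> carrier R" by (rule y(1)[OF kl(1)])
    show "y (k \<otimes>\<^bsub>K\<^esub> l) = y k \<otimes> y l"
    proof (rule eqI)
      fix n
      interpret M: ideal "ideal_power R \<mm> n" R by (rule mI)
      interpret C: ring_hom_cring R "?C n" "?cl n" by (rule clh)
      have "?cl n (x n (k \<otimes>\<^bsub>K\<^esub> l)) = ?cl n (x n k \<otimes> x n l)"
        using kl x ring_hom_mult[OF G(1)] by simp
      moreover have "y k \<otimes> y l \<ominus> x n k \<otimes> x n l \<in> ideal_power R \<mm> n"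
        using kl x y by (intro M.diff_mult) auto
      ultimately show "\<exists>s t. s \<in> carrier R \<and> t \<in> carrier R \<and> y (k \<otimes>\<^bsub>K\<^esub> l) \<ominus> s \<in> ideal_power R \<mm> n \<and>
        y k \<otimes> y l \<ominus> t \<in> ideal_power R \<mm> n \<and> ?cl n s = ?cl n t"
        using kl x y by (intro exI[of _ "x n (k \<otimes>\<^bsub>K\<^esub> l)"] exI[of _ "x n k \<otimes> x n l"]) auto
    qed (use kl y in auto)
    show "y (k \<oplus>\<^bsub>K\<^esub> l) = y k \<oplus> y l"
    proof (rule eqI)
      fix n
      interpret M: ideal "ideal_power R \<mm> n" R by (rule mI)
      interpret C: ring_hom_cring R "?C n" "?cl n" by (rule clh)
      have "?cl n (x n (k \<oplus>\<^bsub>K\<^esub> l)) = ?cl n (x n k \<oplus> x n l)"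
        using kl x ring_hom_add[OF G(1)] by simp
      moreover have "y k \<oplus> y l \<ominus> (x n k \<oplus> x n l) \<in> ideal_power R \<mm> n"
        using kl x y by (intro M.diff_add) auto
      ultimately show "\<exists>s t. s \<in> carrier R \<and> t \<in> carrier R \<and> y (k \<oplus>\<^bsub>K\<^esub> l) \<ominus> s \<in> ideal_power R \<mm> n \<and>
        (y k \<oplus> y l) \<ominus> t \<in> ideal_power R \<mm> n \<and> ?cl n s = ?cl n t"
        using kl x y by (intro exI[of _ "x n (k \<oplus>\<^bsub>K\<^esub> l)"] exI[of _ "x n k \<oplus> x n l"]) auto
    qed (use kl y in auto)
  next
    show "y \<one>\<^bsub>K\<^esub> = \<one>"
    proof (rule eqI)
      fix n
      interpret M: ideal "ideal_power R \<mm> n" R by (rule mI)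
      interpret C: ring_hom_cring R "?C n" "?cl n" by (rule clh)
      have "?cl n (x n \<one>\<^bsub>K\<^esub>) = ?cl n \<one>" using x(2)[of "\<one>\<^bsub>K\<^esub>"] ring_hom_one[OF G(1)] C.hom_one by simp
      then show "\<exists>s t. s \<in> carrier R \<and> t \<in> carrier R \<and> y \<one>\<^bsub>K\<^esub> \<ominus> s \<in> ideal_power R \<mm> n \<and>
        \<one> \<ominus> t \<in> ideal_power R \<mm> n \<and> ?cl n s = ?cl n t"
        using x y M.diff_self[OF one_closed] by (intro exI[of _ "x n \<one>\<^bsub>K\<^esub>"] exI[of _ "\<one>"]) auto
    qed (use y in auto)
  qed
  moreover have "J +> y k = \<kappa> k" if k: "k \<in> carrier K" for k
  proof -
    interpret J: ideal J R by fact
    have xJ: "x n k \<ominus> x 0 k \<in> J" for n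
    proof (induction n)
      case 0 show ?case using J.diff_self x(1)[OF k] by blast
    next
      case (Suc n)
      have "A n \<subseteq> J" using ideal_power_antimono[OF J(1), of 1 "Suc n"] ideal_power_1[OF J(1)] by (simp add: A_def)
      then have "x (Suc n) k \<ominus> x n k \<in> J" using xdiff[OF k, of n] by blast
      then show ?case using J.diff_trans[OF x(1)[OF k] x(1)[OF k] x(1)[OF k] _ Suc] by blast
    qed
    have "y k \<ominus> x 0 k \<in> J"
    proof (rule ideal_closed[OF J(1)])
      show "y k \<ominus> x 0 k \<in> carrier R" using x(1)[OF k] y(1)[OF k] by simp
      fix n
      have "y k \<ominus> x 0 k = (x n k \<ominus> x 0 k) \<oplus> (y k \<ominus> x n k)"
        using x(1)[OF k] y(1)[OF k] by (subst a_comm) (simp_all add: a_minus_def a_assoc r_neg1)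
      then show "y k \<ominus> x 0 k \<in> J <+>\<^bsub>R\<^esub> ideal_power R \<mm> n"
        unfolding add_ideals_iff using xJ y(2)[OF k] by blast
    qed
    then have "J +> y k = J +> x 0 k" using J.coset_eq_iff x(1)[OF k] y(1)[OF k] by blast
    then show ?thesis using x(2)[OF k, of 0] G(2) A0 by simp
  qed
  ultimately show ?thesis by blast
qed

section \<open>Power series in finitely many variables over a ring\<close>

definition ps_vars :: "('a, 'm) ring_scheme \<Rightarrow> nat \<Rightarrow> (nat multiset \<Rightarrow> 'a) ring"
  where "ps_vars R e = (power_series_ring R)\<lparr>carrier :=
    {f. (\<forall>M. f M \<in> carrier R) \<and> (\<forall>M. f M \<noteq> \<zero>\<^bsub>R\<^esub> \<longrightarrow> set_mset M \<subseteq> {..<e})}\<rparr>"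

context cring
begin

lemma ps_vars_simps [simp]:
  "P \<oplus>\<^bsub>ps_vars R e\<^esub> Q = (\<lambda>M. P M \<oplus> Q M)"
  "\<zero>\<^bsub>ps_vars R e\<^esub> = (\<lambda>M. \<zero>)"
  "(\<otimes>\<^bsub>ps_vars R e\<^esub>) = (\<otimes>\<^bsub>power_series_ring R\<^esub>)"
  by (simp_all add: ps_vars_def power_series_ring_def indexed_padd_def indexed_const_def fun_eq_iff)

lemma ps_vars_one: "\<one>\<^bsub>ps_vars R e\<^esub> = indexed_const \<one>"
  by (simp add: ps_vars_def power_series_ring_def)

lemma ps_vars_carrier: "f \<in> carrier (ps_vars R e) \<longleftrightarrow>
    (\<forall>M. f M \<in> carrier R) \<and> (\<forall>M. f M \<noteq> \<zero> \<longrightarrow> set_mset M \<subseteq> {..<e})"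
  by (simp add: ps_vars_def)

lemma ps_vars_coeff: "f \<in> carrier (ps_vars R e) \<Longrightarrow> f M \<in> carrier R"
  by (simp add: ps_vars_carrier)

lemma mpoly_in_ps_vars: "P \<in> carrier (mpoly_ring R e) \<Longrightarrow> P \<in> carrier (ps_vars R e)"
  unfolding ps_vars_carrier mpoly_carrier_iff by blast

lemma ps_vars_mult_closed:
  assumes f: "f \<in> carrier (ps_vars R e)" and g: "g \<in> carrier (ps_vars R e)"
  shows "f \<otimes>\<^bsub>power_series_ring R\<^esub> g \<in> carrier (ps_vars R e)"
  unfolding ps_vars_carrier
proof (intro conjI allI impI)
  fix M
  show "(f \<otimes>\<^bsub>power_series_ring R\<^esub> g) M \<in> carrier R"
    using ps_mult_closed[of f g] f g by (simp add: ps_vars_carrier)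
  assume "(f \<otimes>\<^bsub>power_series_ring R\<^esub> g) M \<noteq> \<zero>"
  then obtain N L where "M = N + L" "f N \<noteq> \<zero>" "g L \<noteq> \<zero>"
    using f g by (meson ps_mult_nonzero ps_vars_coeff)
  then show "set_mset M \<subseteq> {..<e}" using f g by (simp add: ps_vars_carrier)
qed

lemma ps_vars_cring: "cring (ps_vars R e)"
proof -
  interpret PS: cring "power_series_ring R" by (rule power_series_cring)
  let ?V = "carrier (ps_vars R e)"
  have sub: "?V \<subseteq> carrier (power_series_ring R)" by (auto simp: ps_vars_carrier)
  have "subcring ?V (power_series_ring R)"
  proof (rule PS.subcringI', rule PS.subringI[OF sub])
    show "\<one>\<^bsub>power_series_ring R\<^esub> \<in> ?V" by (auto simp: ps_vars_carrier)
    fix f assume f: "f \<in> ?V"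
    have "\<ominus>\<^bsub>power_series_ring R\<^esub> f = (\<lambda>M. \<ominus> f M)" using f by (intro ps_uminus) (simp add: ps_vars_carrier)
    then show "\<ominus>\<^bsub>power_series_ring R\<^esub> f \<in> ?V" using f by (auto simp: ps_vars_carrier minus_eq_zero_iff)
    fix g assume g: "g \<in> ?V"
    show "f \<otimes>\<^bsub>power_series_ring R\<^esub> g \<in> ?V" by (rule ps_vars_mult_closed[OF f g])
    have "set_mset M \<subseteq> {..<e}" if "f M \<oplus> g M \<noteq> \<zero>" for M
    proof -
      have "f M \<noteq> \<zero> \<or> g M \<noteq> \<zero>" using that by auto
      then show ?thesis using f g by (auto simp: ps_vars_carrier)
    qed
    then show "f \<oplus>\<^bsub>power_series_ring R\<^esub> g \<in> ?V" using f g by (simp add: ps_vars_carrier)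
  qed
  then have "cring ((power_series_ring R)\<lparr>carrier := ?V\<rparr>)" using PS.subcring_iff[OF sub] by simp
  moreover have "(power_series_ring R)\<lparr>carrier := ?V\<rparr> = ps_vars R e" by (simp add: ps_vars_def)
  ultimately show ?thesis by simp
qed

lemma ps_vars_minus:
  assumes "f \<in> carrier (ps_vars R e)" "g \<in> carrier (ps_vars R e)"
  shows "f \<ominus>\<^bsub>ps_vars R e\<^esub> g = (\<lambda>M. f M \<ominus> g M)"
proof -
  interpret V: cring "ps_vars R e" by (rule ps_vars_cring)
  have "(\<lambda>M. \<ominus> g M) \<in> carrier (ps_vars R e)" using assms by (auto simp: ps_vars_carrier minus_eq_zero_iff)
  then have "\<ominus>\<^bsub>ps_vars R e\<^esub> g = (\<lambda>M. \<ominus> g M)"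
    using assms by (intro V.minus_equality) (auto simp: l_neg ps_vars_coeff)
  then show ?thesis by (simp add: a_minus_def)
qed

lemma const_in_ps_vars: "k \<in> carrier R \<Longrightarrow> indexed_const k \<in> carrier (ps_vars R e)"
  by (auto simp: ps_vars_carrier indexed_const_def)

lemma var_in_ps_vars: "i < e \<Longrightarrow> indexed_var i \<in> carrier (ps_vars R e)"
  using mpoly_in_ps_vars[OF mpoly_var_closed] .

lemma ps_const_hom: "indexed_const \<in> ring_hom R (ps_vars R e)"
proof (rule ring_hom_memI)
  fix x y assume xy: "x \<in> carrier R" "y \<in> carrier R"
  show "indexed_const x \<in> carrier (ps_vars R e)" using xy(1) by (rule const_in_ps_vars)
  show "indexed_const (x \<otimes> y) = indexed_const x \<otimes>\<^bsub>ps_vars R e\<^esub> indexed_const y"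
    using mpoly_const_mult[OF xy(1) mpoly_const_closed[OF xy(2)]] xy(1)
    by (simp only: ps_vars_simps) (auto simp: indexed_const_def fun_eq_iff)
  show "indexed_const (x \<oplus> y) = indexed_const x \<oplus>\<^bsub>ps_vars R e\<^esub> indexed_const y"
    by (auto simp: indexed_const_def fun_eq_iff)
qed (simp add: ps_vars_one)

lemma ps_constant_term_mult:
  assumes "f \<in> carrier (ps_vars R e)" "g \<in> carrier (ps_vars R e)"
  shows "(f \<otimes>\<^bsub>power_series_ring R\<^esub> g) {#} = f {#} \<otimes> g {#}"
proof -
  have "{N. N \<subseteq># {#}} = {{#} :: nat multiset}" by auto
  then show ?thesis using assms ps_vars_coeff by (simp add: ps_mult)
qed

lemma ps_constant_term_hom: "(\<lambda>f. f {#}) \<in> ring_hom (ps_vars R e) R"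
  by (rule ring_hom_memI) (auto simp: ps_vars_coeff ps_constant_term_mult ps_vars_one indexed_const_def)

lemma ps_var_mult:
  assumes "f \<in> carrier (ps_vars R e)"
  shows "indexed_var i \<otimes>\<^bsub>power_series_ring R\<^esub> f = indexed_pmult f i"
proof -
  interpret PS: cring "power_series_ring R" by (rule power_series_cring)
  have "indexed_var i \<in> carrier (power_series_ring R)" by (auto simp: indexed_var_def indexed_const_def indexed_pmult_def)
  then show ?thesis
    using ps_mult_var[of f i] PS.m_comm[of f "indexed_var i"] assms by (simp add: ps_vars_coeff)
qed

definition drop_var :: "nat \<Rightarrow> (nat multiset \<Rightarrow> 'a) \<Rightarrow> nat multiset \<Rightarrow> 'a" where
  "drop_var e f = (\<lambda>M. if e \<in># M then \<zero> else f M)"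

lemma drop_var_closed:
  assumes "f \<in> carrier (ps_vars R (Suc e))" shows "drop_var e f \<in> carrier (ps_vars R e)"
proof -
  have "set_mset M \<subseteq> {..<e}" if "drop_var e f M \<noteq> \<zero>" for M
  proof -
    have "e \<notin># M" "f M \<noteq> \<zero>" using that by (auto simp: drop_var_def split: if_splits)
    then have "set_mset M \<subseteq> {..<Suc e}" using assms by (simp add: ps_vars_carrier)
    then show ?thesis using \<open>e \<notin># M\<close> by (auto simp: less_Suc_eq)
  qed
  then show ?thesis using assms by (auto simp: ps_vars_carrier drop_var_def)
qed

lemma drop_var_hom: "drop_var e \<in> ring_hom (ps_vars R (Suc e)) (ps_vars R e)"
proof (rule ring_hom_memI)
  fix f g assume fg: "f \<in> carrier (ps_vars R (Suc e))" "g \<in> carrier (ps_vars R (Suc e))"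
  show "drop_var e f \<in> carrier (ps_vars R e)" by (rule drop_var_closed[OF fg(1)])
  show "drop_var e (f \<oplus>\<^bsub>ps_vars R (Suc e)\<^esub> g) = drop_var e f \<oplus>\<^bsub>ps_vars R e\<^esub> drop_var e g"
    by (auto simp: drop_var_def)
  have c: "f M \<in> carrier R" "g M \<in> carrier R" for M using fg ps_vars_coeff by auto
  have "drop_var e (f \<otimes>\<^bsub>power_series_ring R\<^esub> g) M = (drop_var e f \<otimes>\<^bsub>power_series_ring R\<^esub> drop_var e g) M" for M
  proof (cases "e \<in># M")
    case True
    have "drop_var e f N \<otimes> drop_var e g (M - N) = \<zero>" if "N \<subseteq># M" for N
    proof -
      have "e \<in># N \<or> e \<in># M - N" using True that by (metis subset_mset.add_diff_inverse union_iff)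
      then show ?thesis using c by (auto simp: drop_var_def)
    qed
    then have "(drop_var e f \<otimes>\<^bsub>power_series_ring R\<^esub> drop_var e g) M = \<zero>"
      unfolding ps_mult by (intro add.finprod_one_eqI) auto
    then show ?thesis using True by (simp add: drop_var_def)
  next
    case False
    then have "(\<Oplus>N\<in>{N. N \<subseteq># M}. f N \<otimes> g (M - N)) = (\<Oplus>N\<in>{N. N \<subseteq># M}. drop_var e f N \<otimes> drop_var e g (M - N))"
      using c by (intro finsum_cong') (auto simp: drop_var_def dest: mset_subset_eqD in_diffD)
    then show ?thesis using False by (simp add: drop_var_def ps_mult)
  qed
  then show "drop_var e (f \<otimes>\<^bsub>ps_vars R (Suc e)\<^esub> g) = drop_var e f \<otimes>\<^bsub>ps_vars R e\<^esub> drop_var e g"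
    by (simp only: ps_vars_simps) (rule ext)
next
  show "drop_var e \<one>\<^bsub>ps_vars R (Suc e)\<^esub> = \<one>\<^bsub>ps_vars R e\<^esub>"
    by (auto simp: drop_var_def ps_vars_one indexed_const_def fun_eq_iff)
qed

text \<open>One variable at a time: dropping the last variable exhibits the ring in \<open>e + 1\<close> variables as
  an extension of the ring in \<open>e\<close> variables by a regular element.\<close>

lemma type_le_ps_vars:
  assumes I: "ideal I R" and le: "type_le TYPE('c) l R I"
  shows "ideal {f \<in> carrier (ps_vars R e). f {#} \<in> I} (ps_vars R e) \<and>
    type_le TYPE('c) l (ps_vars R e) {f \<in> carrier (ps_vars R e). f {#} \<in> I}"
proof -
  interpret I: ideal I R by (rule I)
  have idl: "ideal {f \<in> carrier (ps_vars R e). f {#} \<in> I} (ps_vars R e)" for e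
  proof -
    interpret V: cring "ps_vars R e" by (rule ps_vars_cring)
    interpret h: ring_hom_cring "ps_vars R e" R "\<lambda>f. f {#}" by unfold_locales (rule ps_constant_term_hom)
    show ?thesis
    proof (rule idealI[OF V.ring_axioms])
      show "subgroup {f \<in> carrier (ps_vars R e). f {#} \<in> I} (add_monoid (ps_vars R e))"
      proof (rule V.add.subgroupI)
        show "{f \<in> carrier (ps_vars R e). f {#} \<in> I} \<noteq> {}"
          using V.zero_closed I.zero_closed by (metis (mono_tags, lifting) empty_iff h.hom_zero mem_Collect_eq)
        fix f assume f: "f \<in> {f \<in> carrier (ps_vars R e). f {#} \<in> I}"
        then show "\<ominus>\<^bsub>ps_vars R e\<^esub> f \<in> {f \<in> carrier (ps_vars R e). f {#} \<in> I}"
          using h.hom_a_inv[of f] I.a_inv_closed by auto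
      qed (auto simp del: ps_vars_simps simp: h.hom_add I.a_closed)
    qed (auto simp del: ps_vars_simps simp: h.hom_mult I.I_l_closed I.I_r_closed)
  qed
  have "type_le TYPE('c) l (ps_vars R e) {f \<in> carrier (ps_vars R e). f {#} \<in> I}"
  proof (induction e)
    case 0
    show ?case
    proof (rule type_le_retract[OF ps_vars_cring is_cring ps_constant_term_hom ps_const_hom _ idl I _ _ le])
      fix f assume f: "f \<in> carrier (ps_vars R 0)"
      have "f M = \<zero>" if "M \<noteq> {#}" for M using f that by (auto simp: ps_vars_carrier)
      then show "indexed_const (f {#}) = f" by (auto simp: indexed_const_def fun_eq_iff)
    next
      show "(\<lambda>f. f {#}) ` {f \<in> carrier (ps_vars R 0). f {#} \<in> I} \<subseteq> I" by auto
      show "indexed_const ` I \<subseteq> {f \<in> carrier (ps_vars R 0). f {#} \<in> I}"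
      proof (rule image_subsetI)
        fix i assume i: "i \<in> I"
        then have "indexed_const i {#} \<in> I" by (simp add: indexed_const_def)
        then show "indexed_const i \<in> {f \<in> carrier (ps_vars R 0). f {#} \<in> I}" using const_in_ps_vars[OF I.Icarr[OF i]] by simp
      qed
    qed
  next
    case (Suc e)
    let ?L = "{f \<in> carrier (ps_vars R e). f {#} \<in> I}"
    interpret PS: cring "power_series_ring R" by (rule power_series_cring)
    have sub: "carrier (ps_vars R e) \<subseteq> carrier (ps_vars R (Suc e))"
      by (auto simp: ps_vars_carrier) (meson lessThan_iff less_SucI subsetD)
    have inc: "identity \<in> ring_hom (ps_vars R e) (ps_vars R (Suc e))"
      by (rule ring_hom_memI) (use sub in \<open>auto simp: identity_apply ps_vars_one\<close>)
    have "type_le TYPE('c) l (ps_vars R (Suc e)) {v \<in> carrier (ps_vars R (Suc e)). drop_var e v \<in> ?L}"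
    proof (rule type_le_extend[OF ps_vars_cring ps_vars_cring idl inc drop_var_hom _ _ _ _ _ Suc])
      fix r assume r: "r \<in> carrier (ps_vars R e)"
      have "r M = \<zero>" if "e \<in># M" for M using r that unfolding ps_vars_carrier by (metis lessThan_iff less_irrefl subsetD)
      then show "drop_var e (identity r) = r" by (auto simp: drop_var_def identity_apply fun_eq_iff)
    next
      show "indexed_var e \<in> carrier (ps_vars R (Suc e))" by (rule var_in_ps_vars) simp
      show "drop_var e (indexed_var e) = \<zero>\<^bsub>ps_vars R e\<^esub>"
        by (auto simp: drop_var_def indexed_var_def indexed_pmult_def fun_eq_iff)
    next
      fix v assume v: "v \<in> carrier (ps_vars R (Suc e))"
      let ?v = "\<lambda>M. v (add_mset e M)"
      have vc: "?v \<in> carrier (ps_vars R (Suc e))"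
        using v unfolding ps_vars_carrier by (metis insert_subset set_mset_add_mset_insert)
      have "v M = drop_var e v M \<oplus> indexed_pmult ?v e M" for M
        using ps_vars_coeff[OF v] by (auto simp: drop_var_def indexed_pmult_def)
      then have "v = identity (drop_var e v) \<oplus>\<^bsub>ps_vars R (Suc e)\<^esub> indexed_var e \<otimes>\<^bsub>ps_vars R (Suc e)\<^esub> ?v"
        unfolding ps_vars_simps ps_var_mult[OF vc] identity_apply by (rule ext)
      then show "\<exists>v'\<in>carrier (ps_vars R (Suc e)). v = identity (drop_var e v) \<oplus>\<^bsub>ps_vars R (Suc e)\<^esub> indexed_var e \<otimes>\<^bsub>ps_vars R (Suc e)\<^esub> v'"
        using vc by blast
    next
      fix v assume v: "v \<in> carrier (ps_vars R (Suc e))" "indexed_var e \<otimes>\<^bsub>ps_vars R (Suc e)\<^esub> v = \<zero>\<^bsub>ps_vars R (Suc e)\<^esub>"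
      then have z: "indexed_pmult v e = (\<lambda>M. \<zero>)" by (simp add: ps_var_mult)
      have "v M = \<zero>" for M using fun_cong[OF z, of "add_mset e M"] by (simp add: indexed_pmult_def)
      then show "v = \<zero>\<^bsub>ps_vars R (Suc e)\<^esub>" by auto
    qed
    moreover have "{v \<in> carrier (ps_vars R (Suc e)). drop_var e v \<in> ?L} = {f \<in> carrier (ps_vars R (Suc e)). f {#} \<in> I}"
    proof (intro Collect_cong conj_cong refl)
      fix v assume "v \<in> carrier (ps_vars R (Suc e))"
      moreover have "drop_var e v {#} = v {#}" by (simp add: drop_var_def)
      ultimately show "drop_var e v \<in> ?L \<longleftrightarrow> v {#} \<in> I" using drop_var_closed by simp
    qed
    ultimately show ?case by simp
  qed
  then show ?thesis using idl by blast
qed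

end

text \<open>The order of a series, counting the order of a coefficient with respect to \<open>G\<close> and each
  variable once. With the powers of the maximal ideal as \<open>G\<close> this is the filtration by powers of
  the maximal ideal of the series ring.\<close>

definition ps_filtration :: "('a, 'm) ring_scheme \<Rightarrow> (nat \<Rightarrow> 'a set) \<Rightarrow> nat \<Rightarrow> nat \<Rightarrow> (nat multiset \<Rightarrow> 'a) set" where
  "ps_filtration R G e n = {f \<in> carrier (ps_vars R e). \<forall>M. f M \<in> G (n - size M)}"

lemma ps_filtration_filtration:
  assumes G: "filtration R G"
  shows "filtration (ps_vars R e) (ps_filtration R G e)"
proof -
  interpret G: filtration R G by fact
  let ?W = "ps_filtration R G e"
  interpret V: cring "ps_vars R e" by (rule G.ps_vars_cring)
  have mult: "f \<otimes>\<^bsub>ps_vars R e\<^esub> g \<in> ?W (i + j)" if f: "f \<in> ?W i" and g: "g \<in> ?W j" for f g i j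
  proof -
    have c: "f \<in> carrier (ps_vars R e)" "g \<in> carrier (ps_vars R e)" using f g by (auto simp: ps_filtration_def)
    have "(f \<otimes>\<^bsub>power_series_ring R\<^esub> g) M \<in> G (i + j - size M)" for M
      unfolding G.ps_mult
    proof (rule G.ideal_finsum_closed[OF G.F_ideal])
      fix N assume N: "N \<in> {N. N \<subseteq># M}"
      have "f N \<otimes>\<^bsub>R\<^esub> g (M - N) \<in> G ((i - size N) + (j - size (M - N)))"
        using f g by (intro G.F_mult) (auto simp: ps_filtration_def)
      moreover have "i + j - size M \<le> (i - size N) + (j - size (M - N))"
        using N size_mset_mono[of N M] by (simp add: size_Diff_submset)
      ultimately show "f N \<otimes>\<^bsub>R\<^esub> g (M - N) \<in> G (i + j - size M)" using G.F_antimono by blast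
    qed
    then show ?thesis using G.ps_vars_mult_closed[OF c] by (simp add: ps_filtration_def)
  qed
  have W0: "?W 0 = carrier (ps_vars R e)" using G.ps_vars_coeff by (auto simp: ps_filtration_def G.F_0)
  have id: "ideal (?W n) (ps_vars R e)" for n
  proof (rule idealI[OF V.ring_axioms])
    have sc: "a \<otimes>\<^bsub>ps_vars R e\<^esub> x \<in> ?W n" if "x \<in> ?W n" "a \<in> carrier (ps_vars R e)" for a x
      using mult[of a 0 x n] that W0 by simp
    show l: "x \<otimes>\<^bsub>ps_vars R e\<^esub> a \<in> ?W n" if "a \<in> ?W n" "x \<in> carrier (ps_vars R e)" for a x using sc[OF that] .
    show "a \<otimes>\<^bsub>ps_vars R e\<^esub> x \<in> ?W n" if "a \<in> ?W n" "x \<in> carrier (ps_vars R e)" for a x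
      using mult[of a n x 0] that W0 by simp
    show "subgroup (?W n) (add_monoid (ps_vars R e))"
    proof (rule V.add.subgroupI)
      have z: "\<zero>\<^bsub>R\<^esub> \<in> G k" for k using G.F_ideal[of k] additive_subgroup.zero_closed ideal.axioms(1) by blast
      show "?W n \<subseteq> carrier (ps_vars R e)" by (auto simp: ps_filtration_def)
      have "\<zero>\<^bsub>ps_vars R e\<^esub> \<in> ?W n" using z V.zero_closed by (simp add: ps_filtration_def)
      then show "?W n \<noteq> {}" by blast
      fix f assume f: "f \<in> ?W n"
      then have fc: "f \<in> carrier (ps_vars R e)" by (simp add: ps_filtration_def)
      have "\<ominus>\<^bsub>ps_vars R e\<^esub> \<one>\<^bsub>ps_vars R e\<^esub> \<otimes>\<^bsub>ps_vars R e\<^esub> f \<in> ?W n" by (rule sc[OF f]) (rule V.a_inv_closed[OF V.one_closed])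
      moreover have "\<ominus>\<^bsub>ps_vars R e\<^esub> \<one>\<^bsub>ps_vars R e\<^esub> \<otimes>\<^bsub>ps_vars R e\<^esub> f = \<ominus>\<^bsub>ps_vars R e\<^esub> f"
        using V.l_minus[OF V.one_closed fc] V.l_one[OF fc] by metis
      ultimately show "\<ominus>\<^bsub>ps_vars R e\<^esub> f \<in> ?W n" by metis
      fix g assume g: "g \<in> ?W n"
      have "f M \<oplus>\<^bsub>R\<^esub> g M \<in> G (n - size M)" for M
        using f g additive_subgroup.a_closed[OF ideal.axioms(1)[OF G.F_ideal]] by (simp add: ps_filtration_def)
      then show "f \<oplus>\<^bsub>ps_vars R e\<^esub> g \<in> ?W n" using f g V.a_closed[of f g] by (simp add: ps_filtration_def)
    qed
  qed
  have dec: "?W (Suc n) \<subseteq> ?W n" for n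
  proof
    fix f assume f: "f \<in> ?W (Suc n)"
    have "G (Suc n - size M) \<subseteq> G (n - size M)" for M by (rule G.F_antimono) simp
    then show "f \<in> ?W n" using f by (auto simp: ps_filtration_def)
  qed
  show ?thesis
    by (intro filtration.intro filtration_axioms.intro V.is_cring id W0 dec mult)
qed

lemma ps_filtration_complete:
  assumes G: "complete_filtration R G"
  shows "complete_filtration (ps_vars R e) (ps_filtration R G e)"
proof -
  interpret G: complete_filtration R G by fact
  let ?W = "ps_filtration R G e"
  interpret W: filtration "ps_vars R e" ?W by (rule ps_filtration_filtration[OF G.filtration_axioms])
  have sep: "u = \<zero>\<^bsub>ps_vars R e\<^esub>" if u: "u \<in> carrier (ps_vars R e)" "\<And>n. u \<in> ?W n" for u
  proof -
    have "u M = \<zero>\<^bsub>R\<^esub>" for M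
    proof (rule G.F_separated)
      show "u M \<in> carrier R" using u(1) G.ps_vars_coeff by blast
      fix n show "u M \<in> G n" using u(2)[of "n + size M"] by (auto simp: ps_filtration_def dest: spec[of _ M])
    qed
    then show ?thesis by auto
  qed
  have compl: "\<exists>y\<in>carrier (ps_vars R e). \<forall>n. y \<ominus>\<^bsub>ps_vars R e\<^esub> x n \<in> ?W n"
    if x: "\<And>n. x n \<in> carrier (ps_vars R e)" "\<And>n. x (Suc n) \<ominus>\<^bsub>ps_vars R e\<^esub> x n \<in> ?W n" for x
  proof -
    have xc: "x n M \<in> carrier R" for n M using x(1) G.ps_vars_coeff by blast
    have xd: "x (Suc n) M \<ominus>\<^bsub>R\<^esub> x n M \<in> G (n - size M)" for n M
      using x(2)[of n] G.ps_vars_minus[OF x(1) x(1)] by (simp add: ps_filtration_def)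
    \<comment> \<open>The coefficients at \<open>M\<close> of the given sequence form a Cauchy sequence from the index \<open>size
      M\<close> on.\<close>
    have "\<exists>y\<in>carrier R. \<forall>n. y \<ominus>\<^bsub>R\<^esub> x (n + size M) M \<in> G n" for M
      using xc xd[of "_ + size M" M] by (intro G.F_complete) auto
    then obtain y0 where y0: "\<And>M. y0 M \<in> carrier R" "\<And>M n. y0 M \<ominus>\<^bsub>R\<^esub> x (n + size M) M \<in> G n" by metis
    define y where "y M = (if set_mset M \<subseteq> {..<e} then y0 M else \<zero>\<^bsub>R\<^esub>)" for M
    have yc: "y \<in> carrier (ps_vars R e)" using y0(1) by (auto simp: G.ps_vars_carrier y_def)
    have "y M \<ominus>\<^bsub>R\<^esub> x n M \<in> G (n - size M)" for n M
    proof (cases "set_mset M \<subseteq> {..<e}")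
      case True
      show ?thesis
      proof (cases "size M \<le> n")
        case le: True
        then show ?thesis using y0(2)[of M "n - size M"] True by (simp add: y_def)
      next
        case False
        then show ?thesis using xc y0(1) True by (simp add: y_def G.F_0)
      qed
    next
      case False
      then have "x n M = \<zero>\<^bsub>R\<^esub>" using x(1) by (auto simp: G.ps_vars_carrier)
      then show ?thesis using False additive_subgroup.zero_closed[OF ideal.axioms(1)[OF G.F_ideal]] by (simp add: y_def a_minus_def)
    qed
    then have "y \<ominus>\<^bsub>ps_vars R e\<^esub> x n \<in> ?W n" for n
      using W.minus_closed[OF yc x(1)] G.ps_vars_minus[OF yc x(1)] by (simp add: ps_filtration_def)
    then show ?thesis using yc by blast
  qed
  show ?thesis
    by (intro complete_filtration.intro complete_filtration_axioms.intro W.filtration_axioms sep compl)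
qed

text \<open>With this as \<open>G\<close>, the filtration of the series ring is the one by degree.\<close>

lemma (in cring) trivial_filtration: "filtration R (\<lambda>n. if n = 0 then carrier R else {\<zero>})"
proof (intro filtration.intro filtration_axioms.intro is_cring)
  show "ideal (if n = 0 then carrier R else {\<zero>}) R" for n :: nat by (simp add: oneideal zeroideal)
qed (auto split: if_splits)

lemma finite_monomials:
  fixes d n :: nat shows "finite {M. set_mset M \<subseteq> {..<d} \<and> size M < n}"
proof (cases d)
  case 0
  then have "{M. set_mset M \<subseteq> {..<d} \<and> size M < n} \<subseteq> {{#}}" by auto
  then show ?thesis by (rule finite_subset) simp
next
  case (Suc k)
  have "{M. set_mset M \<subseteq> {..<d} \<and> size M < n} \<subseteq> {M. set_mset M \<subseteq> {..<d} \<and> size M < n \<and> \<not> replicate_mset n 0 \<subseteq># M}"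
    using size_mset_mono by fastforce
  moreover have "finite {M. set_mset M \<subseteq> {..<d} \<and> size M < n \<and> \<not> replicate_mset n 0 \<subseteq># M}"
    by (rule card_monomials_not_divisible(1)) (use Suc in \<open>auto simp: in_replicate_mset\<close>)
  ultimately show ?thesis by (rule finite_subset)
qed

context cring
begin

lemma truncation:
  assumes f: "f \<in> carrier (ps_vars R e)"
  shows "(\<lambda>M. if size M < n then f M else \<zero>) \<in> carrier (mpoly_ring R e)"
proof -
  have "{M. (if size M < n then f M else \<zero>) \<noteq> \<zero>} \<subseteq> {M. set_mset M \<subseteq> {..<e} \<and> size M < n}"
    using f by (auto simp: ps_vars_carrier split: if_splits)
  then have "finite {M. (if size M < n then f M else \<zero>) \<noteq> \<zero>}" using finite_monomials finite_subset by blast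
  then show ?thesis using f by (auto simp: mpoly_carrier_iff ps_vars_carrier)
qed

lemma tautological_evaluation: "evaluation R (ps_vars R e) indexed_const e indexed_var"
proof -
  interpret V: cring "ps_vars R e" by (rule ps_vars_cring)
  show ?thesis by unfold_locales (use ps_const_hom var_in_ps_vars in auto)
qed

lemma tautological_ev:
  assumes "P \<in> carrier (mpoly_ring R e)"
  shows "poly_ev R (ps_vars R e) indexed_const e indexed_var P = P"
proof -
  have "identity \<in> ring_hom (mpoly_ring R e) (ps_vars R e)"
    by (rule ring_hom_memI) (auto simp: identity_apply mpoly_in_ps_vars ps_vars_one)
  from poly_ev_unique[OF tautological_evaluation this _ _ assms]
  show ?thesis by (simp add: identity_apply)
qed

end

section \<open>Two regular rings over one quotient\<close>

text \<open>Values of polynomials are approximated exactly, and the filtration of \<open>W\<close> is separated.\<close>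

lemma hom_extension_values:
  assumes eA: "evaluation K A i d y" and eW: "evaluation K W j d w" and F: "filtration A F" and G: "complete_filtration W G"
    and \<theta>: "\<theta> \<in> ring_hom A W"
    and key: "\<forall>a\<in>carrier A. \<forall>n. \<forall>P\<in>carrier (mpoly_ring K d).
      a \<ominus>\<^bsub>A\<^esub> poly_ev K A i d y P \<in> F n \<longrightarrow> \<theta> a \<ominus>\<^bsub>W\<^esub> poly_ev K W j d w P \<in> G n"
  shows "(\<forall>k\<in>carrier K. \<theta> (i k) = j k) \<and> (\<forall>l<d. \<theta> (y l) = w l) \<and> (\<forall>n. \<theta> ` F n \<subseteq> G n)"
proof -
  interpret eA: evaluation K A i d y by (rule eA)
  interpret eW: evaluation K W j d w by (rule eW)
  interpret F: filtration A F by (rule F)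
  interpret G: complete_filtration W G by (rule G)
  have exact: "\<theta> (eA.ev P) = eW.ev P" if P: "P \<in> carrier (mpoly_ring K d)" for P
  proof -
    have c: "\<theta> (eA.ev P) \<in> carrier W" using ring_hom_closed[OF \<theta>] eA.ev_closed[OF P] by blast
    have "\<theta> (eA.ev P) \<ominus>\<^bsub>W\<^esub> eW.ev P \<in> G n" for n
    proof -
      interpret Fn: ideal "F n" A by (rule F.F_ideal)
      show ?thesis using key eA.ev_closed[OF P] P Fn.diff_self by blast
    qed
    then have "\<theta> (eA.ev P) \<ominus>\<^bsub>W\<^esub> eW.ev P = \<zero>\<^bsub>W\<^esub>"
      using G.F_separated[OF eW.S.minus_closed[OF c eW.ev_closed[OF P]]] by blast
    then show ?thesis using c eW.ev_closed[OF P] by simp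
  qed
  have "\<theta> a \<in> G n" if a: "a \<in> F n" for a n
  proof -
    have ac: "a \<in> carrier A" using a F.F_antimono[of 0 n] F.F_0 by auto
    have "a \<ominus>\<^bsub>A\<^esub> eA.ev (\<lambda>M. \<zero>\<^bsub>K\<^esub>) \<in> F n" using a ac by (simp add: a_minus_def)
    then have "\<theta> a \<ominus>\<^bsub>W\<^esub> eW.ev (\<lambda>M. \<zero>\<^bsub>K\<^esub>) \<in> G n" using key ac eA.R.mpoly_zero_closed by blast
    then show ?thesis using ring_hom_closed[OF \<theta> ac] by (simp add: a_minus_def)
  qed
  moreover have "\<theta> (i k) = j k" if "k \<in> carrier K" for k
    using exact[OF eA.R.mpoly_const_closed[OF that]] that by simp
  moreover have "\<theta> (y l) = w l" if "l < d" for l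
    using exact[OF eA.R.mpoly_var_closed[OF that]] that by (simp add: eA.ev_var eW.ev_var)
  ultimately show ?thesis by blast
qed

context coefficient_map
begin

lemma regular_hom_exists:
  assumes x: "regular_system \<mm> R x d" and eW: "evaluation K W j d w" and fW: "complete_filtration W G"
    and w: "\<And>i. i < d \<Longrightarrow> w i \<in> G 1"
  shows "\<exists>\<theta>\<in>ring_hom R W. (\<forall>k\<in>carrier K. \<theta> (\<kappa> k) = j k) \<and> (\<forall>i<d. \<theta> (x i) = w i) \<and>
    (\<forall>n. \<theta> ` ideal_power R \<mm> n \<subseteq> G n)"
proof -
  note x' = x[unfolded regular_system_def]
  have e: "evaluation K R \<kappa> d x" by unfold_locales (use x' in auto)
  obtain \<theta> where \<theta>: "\<theta> \<in> ring_hom R W" "\<forall>a\<in>carrier R. \<forall>n. \<forall>P\<in>carrier (mpoly_ring K d).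
    a \<ominus> poly_ev K R \<kappa> d x P \<in> ideal_power R \<mm> n \<longrightarrow> \<theta> a \<ominus>\<^bsub>W\<^esub> poly_ev K W j d w P \<in> G n"
    using regular_universal[OF x eW fW w] by blast
  show ?thesis using hom_extension_values[OF e eW ideal_power_filtration[OF max_ideal] fW \<theta>] \<theta>(1) by blast
qed

lemma regular_hom_unique:
  assumes x: "regular_system \<mm> R x d" and G: "complete_filtration W G"
    and f: "f \<in> ring_hom R W" "\<And>n. f ` ideal_power R \<mm> n \<subseteq> G n"
    and g: "g \<in> ring_hom R W" "\<And>n. g ` ideal_power R \<mm> n \<subseteq> G n"
    and const: "\<And>k. k \<in> carrier K \<Longrightarrow> f (\<kappa> k) = g (\<kappa> k)" and var: "\<And>i. i < d \<Longrightarrow> f (x i) = g (x i)"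
    and r: "r \<in> carrier R"
  shows "f r = g r"
proof -
  note x' = x[unfolded regular_system_def]
  interpret e: evaluation K R \<kappa> d x by unfold_locales (use x' in auto)
  interpret G: complete_filtration W G by (rule G)
  interpret f: ring_hom_cring R W f by unfold_locales (rule f(1))
  interpret g: ring_hom_cring R W g by unfold_locales (rule g(1))
  have "f r \<ominus>\<^bsub>W\<^esub> g r \<in> G n" for n
  proof -
    interpret Gn: ideal "G n" W by (rule G.F_ideal)
    obtain P where P: "P \<in> carrier (mpoly_ring K d)" "r \<ominus> e.ev P \<in> ideal_power R \<mm> n"
      using regular_poly_approx[OF x r] by blast
    have c: "e.ev P \<in> carrier R" using P(1) by simp
    have "f (e.ev P) = g (e.ev P)"
      using e.ev_comp[OF G.is_cring f(1) P(1) const var] e.ev_comp[OF G.is_cring g(1) P(1) refl refl] by simp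
    moreover have "f (r \<ominus> e.ev P) = f r \<ominus>\<^bsub>W\<^esub> f (e.ev P)" "g (r \<ominus> e.ev P) = g r \<ominus>\<^bsub>W\<^esub> g (e.ev P)"
      using r c by (simp_all add: a_minus_def)
    moreover have "f (r \<ominus> e.ev P) \<in> G n" "g (r \<ominus> e.ev P) \<in> G n" using f(2) g(2) P(2) by blast+
    ultimately show ?thesis
      using Gn.diff_trans[of "f r" "f (e.ev P)" "g r"] Gn.diff_sym[of "g r" "g (e.ev P)"] r c by simp
  qed
  then have "f r \<ominus>\<^bsub>W\<^esub> g r = \<zero>\<^bsub>W\<^esub>" using G.F_separated r by simp
  then show ?thesis using r by simp
qed

end

text \<open>The ring \<open>B\<close> is the quotient of \<open>R\<close> by \<open>I\<close> and of \<open>S\<close> by \<open>J\<close>. Every statement can be applied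
  with the two rings exchanged.\<close>

locale common_quotient =
  R: complete_regular_local_ring \<mm> R + S: complete_regular_local_ring \<nn> S +
  p: ring_hom_cring R B p + q: ring_hom_cring S B q
  for \<mm> and R (structure) and \<nn> and S and B and p and q +
  fixes I J
  assumes ideals: "ideal I R" "ideal J S"
    and p_surj: "b \<in> carrier B \<Longrightarrow> \<exists>r\<in>carrier R. p r = b"
    and q_surj: "b \<in> carrier B \<Longrightarrow> \<exists>s\<in>carrier S. q s = b"
    and p_kernel: "r \<in> carrier R \<Longrightarrow> p r = \<zero>\<^bsub>B\<^esub> \<longleftrightarrow> r \<in> I"
    and q_kernel: "s \<in> carrier S \<Longrightarrow> q s = \<zero>\<^bsub>B\<^esub> \<longleftrightarrow> s \<in> J"
    and nontrivial: "\<one>\<^bsub>B\<^esub> \<noteq> \<zero>\<^bsub>B\<^esub>"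
begin

lemma swap: "common_quotient \<nn> S \<mm> R B q p J I"
  by (intro common_quotient.intro common_quotient_axioms.intro S.complete_regular_local_ring_axioms
    R.complete_regular_local_ring_axioms p.ring_hom_cring_axioms q.ring_hom_cring_axioms ideals
    p_surj q_surj p_kernel q_kernel nontrivial)

lemma I_le: "I \<subseteq> \<mm>"
  using R.proper_ideal_le[OF ideals(1)] p_kernel[of \<one>] nontrivial by simp

lemma p_diff: "r \<in> carrier R \<Longrightarrow> r' \<in> carrier R \<Longrightarrow> p (r \<ominus> r') = p r \<ominus>\<^bsub>B\<^esub> p r'"
  by (simp add: a_minus_def)

text \<open>Elements of \<open>R\<close> and \<open>S\<close> with the same image in \<open>B\<close> are both units or both nonunits, because
  the kernels lie in the maximal ideals.\<close>

lemma nonunit_transfer: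
  assumes r: "r \<in> \<mm>" and s: "s \<in> carrier S" and eq: "p r = q s"
  shows "s \<in> \<nn>"
proof (rule ccontr)
  assume "s \<notin> \<nn>"
  then have u: "s \<in> Units S" by (rule S.unit_if_notin[OF s])
  define t where "t = inv\<^bsub>S\<^esub> s"
  have t: "t \<in> carrier S" "s \<otimes>\<^bsub>S\<^esub> t = \<one>\<^bsub>S\<^esub>" using u by (auto simp: t_def)
  obtain r' where r': "r' \<in> carrier R" "p r' = q t" using p_surj[of "q t"] t(1) by auto
  have rc: "r \<in> carrier R" using r by (rule R.Icarr)
  have "p (r \<otimes> r') = q (s \<otimes>\<^bsub>S\<^esub> t)" using rc r' s t(1) eq by simp
  then have "p (\<one> \<ominus> r \<otimes> r') = \<zero>\<^bsub>B\<^esub>" using rc r' t(2) by (simp add: p_diff)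
  then have m: "\<one> \<ominus> r \<otimes> r' \<in> \<mm>" using p_kernel[of "\<one> \<ominus> r \<otimes> r'"] rc r' I_le by auto
  have "\<one> \<in> \<mm>" by (rule R.diff_mem[OF _ R.I_r_closed[OF r r'(1)] m]) simp
  then show False using R.one_notin by blast
qed

text \<open>The maximal ideals have the same image in \<open>B\<close>, hence so do their powers.\<close>

lemma power_transfer:
  "v \<in> ideal_power R \<mm> n \<Longrightarrow> \<exists>w\<in>ideal_power S \<nn> n. q w = p v"
proof (induction n arbitrary: v)
  case 0
  then show ?case using q_surj[of "p v"] by simp
next
  case (Suc n)
  interpret N: ideal "ideal_power S \<nn> (Suc n)" S by (rule S.ideal_power_ideal[OF S.max_ideal])
  have Ncarr: "ideal_power S \<nn> n \<subseteq> carrier S" by (rule subsetI) (rule ideal.Icarr[OF S.ideal_power_ideal[OF S.max_ideal]])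
  have Mcarr: "ideal_power R \<mm> n \<subseteq> carrier R" by (rule subsetI) (rule ideal.Icarr[OF R.ideal_power_ideal[OF R.max_ideal]])
  have "ideal (ideal_prod R (ideal_power R \<mm> n) \<mm>) R"
    by (rule R.ideal_prod_is_ideal[OF R.ideal_power_ideal[OF R.max_ideal] R.max_ideal])
  then have pc: "z \<in> carrier R" if "z \<in> ideal_prod R (ideal_power R \<mm> n) \<mm>" for z
    using that by (rule ideal.Icarr)
  have "v \<in> ideal_prod R (ideal_power R \<mm> n) \<mm>" using Suc.prems by (simp add: R.ideal_power_Suc)
  then show ?case
  proof induction
    case (prod a b)
    obtain w where w: "w \<in> ideal_power S \<nn> n" "q w = p a" using Suc.IH[OF prod(1)] by blast
    obtain s where s: "s \<in> carrier S" "q s = p b" using q_surj[of "p b"] R.Icarr[OF prod(2)] by auto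
    have "s \<in> \<nn>" using nonunit_transfer[OF prod(2) s(1)] s(2) by simp
    then have "w \<otimes>\<^bsub>S\<^esub> s \<in> ideal_power S \<nn> (Suc n)" unfolding S.ideal_power_Suc using w(1) by (intro ideal_prod.prod)
    moreover have "q (w \<otimes>\<^bsub>S\<^esub> s) = p (a \<otimes> b)" using w s subsetD[OF Ncarr w(1)] subsetD[OF Mcarr prod(1)] R.Icarr[OF prod(2)] by simp
    ultimately show ?case by blast
  next
    case (sum a b)
    then obtain w w' where w: "w \<in> ideal_power S \<nn> (Suc n)" "q w = p a"
      "w' \<in> ideal_power S \<nn> (Suc n)" "q w' = p b" by blast
    have "q (w \<oplus>\<^bsub>S\<^esub> w') = p (a \<oplus> b)" using w N.Icarr pc sum.hyps by simp
    then show ?case using N.a_closed[OF w(1,3)] by blast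
  qed
qed

text \<open>If \<open>r\<close> is a preimage of \<open>q s\<close> in \<open>R\<close>, then \<open>u - r\<close> lies in \<open>I\<close> up to arbitrarily high powers
  of \<open>\<mm>\<close>, hence in \<open>I\<close>.\<close>

lemma equal_by_approximation:
  assumes u: "u \<in> carrier R" and s: "s \<in> carrier S"
    and approx: "\<And>n. \<exists>u'\<in>carrier R. \<exists>s'\<in>carrier S.
      u \<ominus> u' \<in> ideal_power R \<mm> n \<and> s \<ominus>\<^bsub>S\<^esub> s' \<in> ideal_power S \<nn> n \<and> p u' = q s'"
  shows "p u = q s"
proof -
  interpret sw: common_quotient \<nn> S \<mm> R B q p J I by (rule swap)
  obtain r where r: "r \<in> carrier R" "p r = q s" using p_surj[of "q s"] s by auto
  have "u \<ominus> r \<in> I"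
  proof (rule R.ideal_closed[OF ideals(1)])
    show "u \<ominus> r \<in> carrier R" using u r by simp
    fix n
    interpret M: ideal "ideal_power R \<mm> n" R by (rule R.ideal_power_ideal[OF R.max_ideal])
    obtain u' s' where us: "u' \<in> carrier R" "s' \<in> carrier S" "u \<ominus> u' \<in> ideal_power R \<mm> n"
      "s \<ominus>\<^bsub>S\<^esub> s' \<in> ideal_power S \<nn> n" "p u' = q s'" using approx by blast
    obtain v where v: "v \<in> ideal_power R \<mm> n" "p v = q (s \<ominus>\<^bsub>S\<^esub> s')" using sw.power_transfer[OF us(4)] by blast
    \<comment> \<open>An element of high order that has the image \<open>p u - q s\<close>.\<close>
    define z where "z = (u \<ominus> u') \<ominus> v"
    have z: "z \<in> ideal_power R \<mm> n" unfolding z_def by (rule M.minus_mem[OF us(3) v(1)])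
    have zc: "z \<in> carrier R" by (rule M.Icarr[OF z])
    have q: "q s \<in> carrier B" "q s' \<in> carrier B" "p u \<in> carrier B" using s us u by auto
    have "p z = (p u \<ominus>\<^bsub>B\<^esub> q s') \<ominus>\<^bsub>B\<^esub> (q s \<ominus>\<^bsub>B\<^esub> q s')"
      using u us v M.Icarr[OF v(1)] s by (simp add: z_def p_diff sw.p_diff)
    also have "\<dots> = p u \<ominus>\<^bsub>B\<^esub> q s"
    proof -
      have "q s' \<oplus>\<^bsub>B\<^esub> (\<ominus>\<^bsub>B\<^esub> q s \<oplus>\<^bsub>B\<^esub> \<ominus>\<^bsub>B\<^esub> q s') = \<ominus>\<^bsub>B\<^esub> q s"
        using p.S.r_neg2[of "q s'" "\<ominus>\<^bsub>B\<^esub> q s"] p.S.a_comm[of "\<ominus>\<^bsub>B\<^esub> q s" "\<ominus>\<^bsub>B\<^esub> q s'"] q by simp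
      then show ?thesis using q by (simp add: a_minus_def p.S.minus_add p.S.a_ac)
    qed
    finally have "p ((u \<ominus> r) \<ominus> z) = \<zero>\<^bsub>B\<^esub>" using u r zc q by (simp add: p_diff)
    then have "(u \<ominus> r) \<ominus> z \<in> I" using p_kernel[of "(u \<ominus> r) \<ominus> z"] u r zc by simp
    moreover have "u \<ominus> r = ((u \<ominus> r) \<ominus> z) \<oplus> z" using u r zc by (simp add: a_minus_def R.a_assoc R.l_neg)
    ultimately show "u \<ominus> r \<in> I <+>\<^bsub>R\<^esub> ideal_power R \<mm> n" using z unfolding add_ideals_iff by blast
  qed
  then have "p (u \<ominus> r) = \<zero>\<^bsub>B\<^esub>" using p_kernel[of "u \<ominus> r"] u r by simp
  then show ?thesis using u r s by (simp add: p_diff)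
qed

text \<open>The two sides agree on values of polynomials over \<open>K\<close>, and these approximate \<open>r\<close>.\<close>

lemma lifts_identity:
  assumes K: "coefficient_map K \<mm> R \<kappa>" and x: "regular_system \<mm> R x d"
    and \<alpha>: "\<alpha> \<in> ring_hom R S" "\<And>n. \<alpha> ` ideal_power R \<mm> n \<subseteq> ideal_power S \<nn> n"
    and const: "\<And>k. k \<in> carrier K \<Longrightarrow> q (\<alpha> (\<kappa> k)) = p (\<kappa> k)" and var: "\<And>i. i < d \<Longrightarrow> q (\<alpha> (x i)) = p (x i)"
    and r: "r \<in> carrier R"
  shows "q (\<alpha> r) = p r"
proof -
  interpret K: coefficient_map K \<mm> R \<kappa> by (rule K)
  note x' = x[unfolded regular_system_def]
  interpret e: evaluation K R \<kappa> d x by unfold_locales (use x' in auto)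
  interpret \<alpha>: ring_hom_cring R S \<alpha> by unfold_locales (rule \<alpha>(1))
  have "p r = q (\<alpha> r)"
  proof (rule equal_by_approximation[OF r])
    show "\<alpha> r \<in> carrier S" using r by simp
    fix n
    obtain P where P: "P \<in> carrier (mpoly_ring K d)" "r \<ominus> e.ev P \<in> ideal_power R \<mm> n"
      using K.regular_poly_approx[OF x r] by blast
    have c: "e.ev P \<in> carrier R" using P(1) by simp
    have "\<alpha> (r \<ominus> e.ev P) = \<alpha> r \<ominus>\<^bsub>S\<^esub> \<alpha> (e.ev P)" using r c by (simp add: a_minus_def)
    moreover have "\<alpha> (r \<ominus> e.ev P) \<in> ideal_power S \<nn> n" using \<alpha>(2) P(2) by blast
    moreover have "(q \<circ> \<alpha>) (e.ev P) = p (e.ev P)"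
      using e.ev_comp[OF p.S.is_cring ring_hom_trans[OF \<alpha>(1) q.homh] P(1), of "\<lambda>k. p (\<kappa> k)" "\<lambda>i. p (x i)"]
        e.ev_comp[OF p.S.is_cring p.homh P(1), of "\<lambda>k. p (\<kappa> k)" "\<lambda>i. p (x i)"] const var by simp
    ultimately show "\<exists>u'\<in>carrier R. \<exists>s'\<in>carrier S.
      r \<ominus> u' \<in> ideal_power R \<mm> n \<and> \<alpha> r \<ominus>\<^bsub>S\<^esub> s' \<in> ideal_power S \<nn> n \<and> p u' = q s'"
      using P(2) c by (intro bexI[of _ "e.ev P"] bexI[of _ "\<alpha> (e.ev P)"]) auto
  qed
  then show ?thesis by simp
qed

text \<open>First lift the residue field to \<open>R\<close>. Its image in \<open>B = S/J\<close> is then lifted to \<open>S\<close>, so that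
  the two lifts agree in \<open>B\<close>. The second map also hits all residues, since these can be compared
  in \<open>B\<close>.\<close>

lemma coefficient_maps_exist:
  assumes LR: "subfield L R" and LS: "subfield L' S"
  shows "\<exists>\<kappa> \<mu>. coefficient_map (R Quot \<mm>) \<mm> R \<kappa> \<and> coefficient_map (R Quot \<mm>) \<nn> S \<mu> \<and>
    (\<forall>k\<in>carrier (R Quot \<mm>). q (\<mu> k) = p (\<kappa> k))"
proof -
  interpret sw: common_quotient \<nn> S \<mm> R B q p J I by (rule swap)
  interpret I: ideal I R by (rule ideals(1))
  interpret J: ideal J S by (rule ideals(2))
  let ?K = "R Quot \<mm>"
  interpret K: field ?K by (rule maximalideal.quotient_is_field[OF R.maximal R.is_cring])
  have "identity \<in> ring_hom ?K ?K" by (rule ring_hom_memI) (simp_all add: identity_apply)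
  from R.field_lift_complete[OF LR R.max_ideal R.one_notin K.field_axioms this]
  obtain \<kappa> where \<kappa>: "\<kappa> \<in> ring_hom ?K R" "\<And>k. k \<in> carrier ?K \<Longrightarrow> \<mm> +>\<^bsub>R\<^esub> \<kappa> k = k"
    by (auto simp: identity_apply)
  have residue: "\<exists>k\<in>carrier ?K. r \<ominus> \<kappa> k \<in> \<mm>" if r: "r \<in> carrier R" for r
  proof (intro bexI[of _ "\<mm> +>\<^bsub>R\<^esub> r"])
    show c: "\<mm> +>\<^bsub>R\<^esub> r \<in> carrier ?K" using ring_hom_closed[OF R.coset_hom r] .
    show "r \<ominus> \<kappa> (\<mm> +>\<^bsub>R\<^esub> r) \<in> \<mm>"
      using R.coset_eq_iff[OF r ring_hom_closed[OF \<kappa>(1) c]] \<kappa>(2)[OF c] by simp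
  qed
  have cR: "coefficient_map ?K \<mm> R \<kappa>"
    by (intro coefficient_map.intro coefficient_map_axioms.intro K.field_axioms R.noetherian_local_ring_axioms \<kappa>(1) residue)
  have ringJ: "ring (S Quot J)" by (rule J.quotient_is_ring)
  obtain \<pi> where \<pi>: "\<pi> \<in> ring_hom B (S Quot J)" "\<And>s. s \<in> carrier S \<Longrightarrow> \<pi> (q s) = J +>\<^bsub>S\<^esub> s"
    using factor_hom[OF S.ring_axioms p.S.ring_axioms ringJ q.homh q_surj J.coset_hom] q_kernel J.coset_zero_iff by metis
  have hom: "\<pi> \<circ> (p \<circ> \<kappa>) \<in> ring_hom ?K (S Quot J)" by (intro ring_hom_trans[OF ring_hom_trans[OF \<kappa>(1) p.homh] \<pi>(1)])
  have "\<one>\<^bsub>S\<^esub> \<notin> J" using q_kernel[of "\<one>\<^bsub>S\<^esub>"] nontrivial by simp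
  from S.field_lift_complete[OF LS ideals(2) this K.field_axioms hom]
  obtain \<mu> where \<mu>: "\<mu> \<in> ring_hom ?K S" "\<And>k. k \<in> carrier ?K \<Longrightarrow> J +>\<^bsub>S\<^esub> \<mu> k = \<pi> (p (\<kappa> k))" by auto
  have \<mu>q: "q (\<mu> k) = p (\<kappa> k)" if k: "k \<in> carrier ?K" for k
  proof -
    have \<kappa>c: "\<kappa> k \<in> carrier R" using ring_hom_closed[OF \<kappa>(1) k] .
    have \<mu>c: "\<mu> k \<in> carrier S" using ring_hom_closed[OF \<mu>(1) k] .
    obtain s where s: "s \<in> carrier S" "q s = p (\<kappa> k)" using q_surj[of "p (\<kappa> k)"] \<kappa>c by auto
    have "J +>\<^bsub>S\<^esub> \<mu> k = J +>\<^bsub>S\<^esub> s" using \<mu>(2)[OF k] \<pi>(2)[OF s(1)] s(2) by simp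
    then have "\<mu> k \<ominus>\<^bsub>S\<^esub> s \<in> J" using J.coset_eq_iff[OF \<mu>c s(1)] by simp
    then have "q (\<mu> k \<ominus>\<^bsub>S\<^esub> s) = \<zero>\<^bsub>B\<^esub>" using q_kernel[of "\<mu> k \<ominus>\<^bsub>S\<^esub> s"] \<mu>c s by simp
    then show ?thesis using \<mu>c \<kappa>c s sw.p_diff by simp
  qed
  have residue': "\<exists>k\<in>carrier ?K. s \<ominus>\<^bsub>S\<^esub> \<mu> k \<in> \<nn>" if s: "s \<in> carrier S" for s
  proof -
    obtain r where r: "r \<in> carrier R" "p r = q s" using p_surj[of "q s"] s by auto
    obtain k where k: "k \<in> carrier ?K" "r \<ominus> \<kappa> k \<in> \<mm>" using residue[OF r(1)] by blast
    have c: "\<kappa> k \<in> carrier R" "\<mu> k \<in> carrier S" using ring_hom_closed[OF \<kappa>(1) k(1)] ring_hom_closed[OF \<mu>(1) k(1)] .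
    have "s \<ominus>\<^bsub>S\<^esub> \<mu> k \<in> \<nn>"
      by (rule nonunit_transfer[OF k(2)]) (use s r c \<mu>q[OF k(1)] in \<open>simp_all add: p_diff sw.p_diff\<close>)
    then show ?thesis using k(1) by blast
  qed
  have "coefficient_map ?K \<nn> S \<mu>"
    by (intro coefficient_map.intro coefficient_map_axioms.intro K.field_axioms S.noetherian_local_ring_axioms \<mu>(1) residue')
  then show ?thesis using cR \<mu>q by blast
qed

text \<open>Send regular parameters of \<open>R\<close> to arbitrary preimages in \<open>S\<close> of their images in \<open>B\<close>.\<close>

lemma local_lift_exists:
  assumes K: "coefficient_map K \<mm> R \<kappa>" "coefficient_map K \<nn> S \<mu>"
    and comp: "\<And>k. k \<in> carrier K \<Longrightarrow> q (\<mu> k) = p (\<kappa> k)"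
  shows "\<exists>\<alpha>\<in>ring_hom R S. (\<forall>k\<in>carrier K. \<alpha> (\<kappa> k) = \<mu> k) \<and> (\<forall>r\<in>carrier R. q (\<alpha> r) = p r) \<and>
    (\<forall>n. \<alpha> ` ideal_power R \<mm> n \<subseteq> ideal_power S \<nn> n)"
proof -
  interpret K: coefficient_map K \<mm> R \<kappa> by (rule K(1))
  interpret K': coefficient_map K \<nn> S \<mu> by (rule K(2))
  obtain x d where x: "regular_system \<mm> R x d" using R.regular_system_exists by blast
  note x' = x[unfolded regular_system_def]
  have xm: "x i \<in> \<mm>" if "i < d" for i using x' that R.genideal_self[of "x ` {..<d}"] by auto
  have "\<exists>s\<in>carrier S. q s = p (x i)" if "i < d" for i using q_surj[of "p (x i)"] x' that by auto
  then obtain a where a: "\<And>i. i < d \<Longrightarrow> a i \<in> carrier S" "\<And>i. i < d \<Longrightarrow> q (a i) = p (x i)" by metis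
  have an: "a i \<in> ideal_power S \<nn> 1" if "i < d" for i
    using nonunit_transfer[OF xm[OF that] a(1)[OF that]] a(2)[OF that] S.ideal_power_1[OF S.max_ideal] by simp
  have e: "evaluation K S \<mu> d a" by unfold_locales (use a in auto)
  obtain \<alpha> where \<alpha>: "\<alpha> \<in> ring_hom R S" "\<And>k. k \<in> carrier K \<Longrightarrow> \<alpha> (\<kappa> k) = \<mu> k" "\<And>i. i < d \<Longrightarrow> \<alpha> (x i) = a i"
    "\<And>n. \<alpha> ` ideal_power R \<mm> n \<subseteq> ideal_power S \<nn> n"
    using K.regular_hom_exists[OF x e S.complete_power_filtration an] by metis
  have "q (\<alpha> r) = p r" if "r \<in> carrier R" for r
    by (rule lifts_identity[OF K(1) x \<alpha>(1,4) _ _ that]) (simp_all add: \<alpha> a comp)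
  then show ?thesis using \<alpha> by blast
qed


text \<open>The ideal \<open>J\<close> is a retract of the ideal \<open>L\<close> of those series over \<open>R\<close> whose constant term
  lies in \<open>I\<close>. The variables correspond to regular parameters \<open>y\<close> of \<open>S\<close>: the map \<open>\<sigma>\<close> sends \<open>y\<^sub>i\<close>
  to the variable plus a correction \<open>b\<^sub>i\<close> in \<open>R\<close> that has the same image in \<open>B\<close>, and \<open>\<tau>\<close> takes the
  correction back.\<close>

lemma relation_bound_transfer:
  assumes L: "subfield L R" "subfield L' S" and le: "type_le TYPE('z) l R I"
  shows "type_le TYPE('z) l S J"
proof -
  interpret sw: common_quotient \<nn> S \<mm> R B q p J I by (rule swap)
  obtain \<kappa> \<mu> where K: "coefficient_map (R Quot \<mm>) \<mm> R \<kappa>" "coefficient_map (R Quot \<mm>) \<nn> S \<mu>"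
    and comp: "\<And>k. k \<in> carrier (R Quot \<mm>) \<Longrightarrow> q (\<mu> k) = p (\<kappa> k)"
    using coefficient_maps_exist[OF L] by blast
  let ?K = "R Quot \<mm>"
  interpret K: coefficient_map ?K \<mm> R \<kappa> by (rule K(1))
  interpret K': coefficient_map ?K \<nn> S \<mu> by (rule K(2))
  obtain \<alpha> where \<alpha>: "\<alpha> \<in> ring_hom R S" "\<And>k. k \<in> carrier ?K \<Longrightarrow> \<alpha> (\<kappa> k) = \<mu> k"
    "\<And>r. r \<in> carrier R \<Longrightarrow> q (\<alpha> r) = p r" "\<And>n. \<alpha> ` ideal_power R \<mm> n \<subseteq> ideal_power S \<nn> n"
    using local_lift_exists[OF K comp] by blast
  interpret \<alpha>: ring_hom_cring R S \<alpha> by unfold_locales (rule \<alpha>(1))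
  obtain y e where y: "regular_system \<nn> S y e" using S.regular_system_exists by blast
  have yc: "y i \<in> carrier S" if "i < e" for i using y that by (simp add: regular_system_def)
  have yn: "y i \<in> \<nn>" if "i < e" for i
    using y that S.genideal_self[of "y ` {..<e}"] by (auto simp: regular_system_def)
  have "\<exists>r\<in>carrier R. p r = q (y i)" if "i < e" for i using p_surj[of "q (y i)"] yc[OF that] by auto
  then obtain b where b: "\<And>i. i < e \<Longrightarrow> b i \<in> carrier R" "\<And>i. i < e \<Longrightarrow> p (b i) = q (y i)" by metis
  have bm: "b i \<in> \<mm>" if "i < e" for i using sw.nonunit_transfer[OF yn[OF that] b(1)[OF that]] b(2)[OF that] by simp
  let ?V = "ps_vars R e" and ?G = "ideal_power R \<mm>" and ?H = "ideal_power S \<nn>"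
  let ?W = "ps_filtration R ?G e" and ?F = "ps_filtration R (\<lambda>n. if n = 0 then carrier R else {\<zero>}) e"
  interpret V: cring ?V by (rule R.ps_vars_cring)
  have G: "complete_filtration R ?G" by (rule R.complete_power_filtration)
  have H: "complete_filtration S ?H" by (rule S.complete_power_filtration)
  interpret W: complete_filtration ?V ?W by (rule ps_filtration_complete[OF G])
  interpret H: complete_filtration S ?H by (rule H)
  interpret F: filtration ?V ?F by (rule ps_filtration_filtration[OF R.trivial_filtration])
  have const_hom: "R.indexed_const \<in> ring_hom R ?V" by (rule R.ps_const_hom)
  have const_closed: "R.indexed_const r \<in> carrier ?V" if "r \<in> carrier R" for r by (rule R.const_in_ps_vars[OF that])
  have var_closed: "R.indexed_var i \<in> carrier ?V" if "i < e" for i by (rule R.var_in_ps_vars[OF that])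

  define w where "w i = R.indexed_var i \<oplus>\<^bsub>?V\<^esub> R.indexed_const (b i)" for i :: nat
  have wc: "w i \<in> carrier ?V" if "i < e" for i
    unfolding w_def using var_closed[OF that] const_closed[OF b(1)[OF that]] by (rule V.a_closed)
  have w_coeff: "w i M = (if M = {#} then b i else if M = {#i#} then \<one> else \<zero>)" if "i < e" for i M
  proof -
    have "i \<in># M \<and> M - {#i#} = {#} \<longleftrightarrow> M = {#i#}" by (metis diff_single_trivial insert_DiffM multi_member_last add_mset_remove_trivial)
    then show ?thesis using b(1)[OF that] by (auto simp: w_def R.indexed_var_def R.indexed_const_def R.indexed_pmult_def)
  qed
  have wW: "w i \<in> ?W 1" if "i < e" for i
  proof -
    have "w i M \<in> ?G (1 - size M)" for M
    proof (cases "M = {#}")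
      case True
      then show ?thesis using w_coeff[OF that] bm[OF that] R.ideal_power_1[OF R.max_ideal] by simp
    next
      case False
      then have "1 - size M = 0" by (cases M) auto
      then show ?thesis using R.ps_vars_coeff[OF wc[OF that]] by simp
    qed
    then show ?thesis using wc[OF that] by (simp add: ps_filtration_def)
  qed
  have eW: "evaluation ?K ?V (\<lambda>k. R.indexed_const (\<kappa> k)) e w"
    using ring_hom_trans[OF K.\<kappa> const_hom] wc by unfold_locales (auto simp: comp_def)
  obtain \<sigma> where \<sigma>: "\<sigma> \<in> ring_hom S ?V" "\<And>k. k \<in> carrier ?K \<Longrightarrow> \<sigma> (\<mu> k) = R.indexed_const (\<kappa> k)"
    "\<And>i. i < e \<Longrightarrow> \<sigma> (y i) = w i" "\<And>n. \<sigma> ` ?H n \<subseteq> ?W n"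
    using K'.regular_hom_exists[OF y eW W.complete_filtration_axioms wW] by metis
  \<comment> \<open>The constant term of \<open>\<sigma>\<close> is a lift of the identity of \<open>B\<close> from \<open>S\<close> to \<open>R\<close>.\<close>
  have \<sigma>0: "(\<lambda>s. \<sigma> s {#}) \<in> ring_hom S R"
    using ring_hom_trans[OF \<sigma>(1) R.ps_constant_term_hom] by (simp add: comp_def)
  have \<sigma>q: "p (\<sigma> s {#}) = q s" if s: "s \<in> carrier S" for s
  proof (rule sw.lifts_identity[OF K(2) y \<sigma>0 _ _ _ s])
    fix n
    have "f {#} \<in> ?G n" if "f \<in> ?W n" for f using that by (auto simp: ps_filtration_def dest: spec[of _ "{#}"])
    then show "(\<lambda>s. \<sigma> s {#}) ` ?H n \<subseteq> ?G n" using \<sigma>(4)[of n] by blast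
  next
    fix k assume k: "k \<in> carrier ?K"
    then show "p (\<sigma> (\<mu> k) {#}) = q (\<mu> k)" by (simp add: \<sigma>(2) comp R.indexed_const_def)
  next
    fix i assume i: "i < e"
    then show "p (\<sigma> (y i) {#}) = q (y i)" by (simp add: \<sigma>(3) w_coeff b(2))
  qed

  define u where "u i = y i \<ominus>\<^bsub>S\<^esub> \<alpha> (b i)" for i
  have uc: "u i \<in> carrier S" if "i < e" for i using yc[OF that] b(1)[OF that] by (simp add: u_def)
  have uq: "q (u i) = \<zero>\<^bsub>B\<^esub>" if "i < e" for i
    using yc[OF that] b[OF that] \<alpha>(3) by (simp add: u_def sw.p_diff)
  have un: "u i \<in> ?H 1" if "i < e" for i
    using uq[OF that] sw.p_kernel[OF uc[OF that]] sw.I_le S.ideal_power_1[OF S.max_ideal] by auto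
  have eV: "evaluation R ?V R.indexed_const e R.indexed_var" by (rule R.tautological_evaluation)
  interpret eS: evaluation R S \<alpha> e u by unfold_locales (use uc in auto)
  \<comment> \<open>Here series are approximated by polynomials with coefficients in \<open>R\<close>, so for the existence of
    \<open>\<tau>\<close> the coefficients carry the trivial filtration.\<close>
  let ?cut = "\<lambda>n f M. if size M < n then f M else \<zero>"
  have cut: "f \<ominus>\<^bsub>?V\<^esub> ?cut n f \<in> ?F n" if f: "f \<in> carrier ?V" for f n
  proof -
    have P: "?cut n f \<in> carrier ?V" by (rule R.mpoly_in_ps_vars[OF R.truncation[OF f]])
    show ?thesis unfolding R.ps_vars_minus[OF f P]
      using R.ps_vars_coeff[OF f] V.minus_closed[OF f P]
      by (auto simp: ps_filtration_def R.ps_vars_minus[OF f P])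
  qed
  have "\<exists>\<theta>\<in>ring_hom ?V S. \<forall>a\<in>carrier ?V. \<forall>n. \<forall>P\<in>carrier (mpoly_ring R e).
      a \<ominus>\<^bsub>?V\<^esub> poly_ev R ?V R.indexed_const e R.indexed_var P \<in> ?F n \<longrightarrow> \<theta> a \<ominus>\<^bsub>S\<^esub> eS.ev P \<in> ?H n"
  proof (rule hom_extension[OF eV eS.evaluation_axioms F.filtration_axioms H])
    fix f n assume f: "f \<in> carrier ?V"
    show "\<exists>P\<in>carrier (mpoly_ring R e). f \<ominus>\<^bsub>?V\<^esub> poly_ev R ?V R.indexed_const e R.indexed_var P \<in> ?F n"
      using cut[OF f] R.tautological_ev R.truncation[OF f] by (intro bexI[of _ "?cut n f"]) auto
  next
    fix P n assume P: "P \<in> carrier (mpoly_ring R e)" "poly_ev R ?V R.indexed_const e R.indexed_var P \<in> ?F n"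
    show "eS.ev P \<in> ?H n"
    proof (rule eS.ev_in_filtration[OF H.filtration_axioms un P(1)])
      fix M assume "P M \<noteq> \<zero>"
      moreover have "P M \<in> (if n - size M = 0 then carrier R else {\<zero>})"
        using P(2) by (simp add: R.tautological_ev[OF P(1)] ps_filtration_def)
      ultimately have "n - size M = 0" by (auto split: if_splits)
      then show "\<alpha> (P M) \<in> ?H (n - size M)" using R.mpoly_coeff[OF P(1)] by simp
    qed
  qed
  then obtain \<tau> where \<tau>: "\<tau> \<in> ring_hom ?V S"
    and \<tau>key: "\<forall>a\<in>carrier ?V. \<forall>n. \<forall>P\<in>carrier (mpoly_ring R e).
      a \<ominus>\<^bsub>?V\<^esub> poly_ev R ?V R.indexed_const e R.indexed_var P \<in> ?F n \<longrightarrow> \<tau> a \<ominus>\<^bsub>S\<^esub> eS.ev P \<in> ?H n" by blast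
  from hom_extension_values[OF eV eS.evaluation_axioms F.filtration_axioms H \<tau> \<tau>key]
  have \<tau>c: "\<And>r. r \<in> carrier R \<Longrightarrow> \<tau> (R.indexed_const r) = \<alpha> r" and \<tau>v: "\<And>i. i < e \<Longrightarrow> \<tau> (R.indexed_var i) = u i" by blast+
  have \<tau>closed: "\<tau> f \<in> carrier S" if "f \<in> carrier ?V" for f by (rule ring_hom_closed[OF \<tau> that])
  have \<tau>cut: "\<tau> f \<ominus>\<^bsub>S\<^esub> eS.ev (?cut n f) \<in> ?H n" if f: "f \<in> carrier ?V" for f n
    using \<tau>key f cut[OF f, of n] R.truncation[OF f, of n] R.tautological_ev[OF R.truncation[OF f]] by simp
  have evq: "q (eS.ev P) = p (P {#})" if P: "P \<in> carrier (mpoly_ring R e)" for P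
  proof -
    have inc: "identity \<in> ring_hom (mpoly_ring R e) ?V"
      by (rule ring_hom_memI) (auto simp: identity_apply R.mpoly_in_ps_vars R.ps_vars_one)
    have hp: "p \<circ> ((\<lambda>f. f {#}) \<circ> identity) \<in> ring_hom (mpoly_ring R e) B"
      by (rule ring_hom_trans[OF ring_hom_trans[OF inc R.ps_constant_term_hom] p.homh])
    have hq: "q \<circ> eS.ev \<in> ring_hom (mpoly_ring R e) B" by (rule ring_hom_trans[OF eS.ev_ring_hom q.homh])
    have eB: "evaluation R B p e (\<lambda>_. \<zero>\<^bsub>B\<^esub>)" by unfold_locales auto
    have "(q \<circ> eS.ev) P = poly_ev R B p e (\<lambda>_. \<zero>\<^bsub>B\<^esub>) P"
      by (rule poly_ev_unique[OF eB hq _ _ P]) (auto simp: \<alpha>(3) uq eS.ev_var)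
    moreover have "(p \<circ> ((\<lambda>f. f {#}) \<circ> identity)) P = poly_ev R B p e (\<lambda>_. \<zero>\<^bsub>B\<^esub>) P"
      by (rule poly_ev_unique[OF eB hp _ _ P])
        (auto simp: identity_apply R.indexed_const_def R.indexed_var_def R.indexed_pmult_def)
    ultimately show ?thesis by (simp add: identity_apply)
  qed
  have \<tau>q: "q (\<tau> f) = p (f {#})" if f: "f \<in> carrier ?V" for f
  proof -
    have f0: "f {#} \<in> carrier R" using R.ps_vars_coeff[OF f] .
    have "p (f {#}) = q (\<tau> f)"
    proof (rule equal_by_approximation[OF f0 \<tau>closed[OF f]])
      fix n
      interpret Gn: ideal "?G n" R by (rule R.ideal_power_ideal[OF R.max_ideal])
      \<comment> \<open>The cut is made at \<open>Suc n\<close> in order to keep the constant term also for \<open>n = 0\<close>.\<close>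
      have P: "?cut (Suc n) f \<in> carrier (mpoly_ring R e)" by (rule R.truncation[OF f])
      have "\<tau> f \<ominus>\<^bsub>S\<^esub> eS.ev (?cut (Suc n) f) \<in> ?H n"
        using \<tau>cut[OF f, of "Suc n"] S.ideal_power_antimono[OF S.max_ideal, of n "Suc n"] by auto
      moreover have "p (f {#}) = q (eS.ev (?cut (Suc n) f))" using evq[OF P] by simp
      ultimately show "\<exists>u'\<in>carrier R. \<exists>s'\<in>carrier S.
          f {#} \<ominus> u' \<in> ?G n \<and> \<tau> f \<ominus>\<^bsub>S\<^esub> s' \<in> ?H n \<and> p u' = q s'"
        using Gn.diff_self[OF f0] f0 eS.ev_closed[OF P] by blast
    qed
    then show ?thesis by simp
  qed
  have \<tau>W: "\<tau> f \<in> ?H n" if f: "f \<in> ?W n" for f n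
  proof -
    interpret Hn: ideal "?H n" S by (rule S.ideal_power_ideal[OF S.max_ideal])
    have fc: "f \<in> carrier ?V" using f by (simp add: ps_filtration_def)
    have "eS.ev (?cut n f) \<in> ?H n"
    proof (rule eS.ev_in_filtration[OF H.filtration_axioms un R.truncation[OF fc]])
      fix M
      have "f M \<in> ?G (n - size M)" using f by (simp add: ps_filtration_def)
      moreover assume "?cut n f M \<noteq> \<zero>"
      ultimately show "\<alpha> (?cut n f M) \<in> ?H (n - size M)" using \<alpha>(4)[of "n - size M"] by (auto split: if_splits)
    qed
    then show ?thesis by (rule Hn.diff_mem[OF \<tau>closed[OF fc] _ \<tau>cut[OF fc]])
  qed
  have retract: "\<tau> (\<sigma> s) = s" if s: "s \<in> carrier S" for s
  proof -
    have id: "identity \<in> ring_hom S S" by (rule ring_hom_memI) (simp_all add: identity_apply)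
    have "(\<tau> \<circ> \<sigma>) s = identity s"
    proof (rule K'.regular_hom_unique[OF y H ring_hom_trans[OF \<sigma>(1) \<tau>] _ id _ _ _ s])
      show "(\<tau> \<circ> \<sigma>) ` ?H n \<subseteq> ?H n" "identity ` ?H n \<subseteq> ?H n" for n
        using \<sigma>(4)[of n] \<tau>W[of _ n] by (auto simp: identity_apply)
      fix k assume k: "k \<in> carrier ?K"
      then show "(\<tau> \<circ> \<sigma>) (\<mu> k) = identity (\<mu> k)"
        using ring_hom_closed[OF K.\<kappa> k] by (simp add: identity_apply \<sigma>(2) \<tau>c \<alpha>(2))
    next
      fix i assume i: "i < e"
      have "\<tau> (w i) = u i \<oplus>\<^bsub>S\<^esub> \<alpha> (b i)"
        unfolding w_def ring_hom_add[OF \<tau> var_closed[OF i] const_closed[OF b(1)[OF i]]] by (simp add: \<tau>c \<tau>v i b(1))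
      also have "\<dots> = y i" using yc[OF i] b(1)[OF i] by (simp add: u_def a_minus_def S.a_assoc S.l_neg)
      finally show "(\<tau> \<circ> \<sigma>) (y i) = identity (y i)" using i by (simp add: identity_apply \<sigma>(3))
    qed
    then show ?thesis by (simp add: identity_apply)
  qed

  let ?L = "{f \<in> carrier ?V. f {#} \<in> I}"
  have L: "ideal ?L ?V" "type_le TYPE('z) l ?V ?L" using R.type_le_ps_vars[OF ideals(1) le] by blast+
  show ?thesis
  proof (rule type_le_retract[OF S.is_cring V.is_cring \<sigma>(1) \<tau> retract ideals(2) L(1) _ _ L(2)])
    show "\<sigma> ` J \<subseteq> ?L"
    proof (rule image_subsetI)
      fix s assume s: "s \<in> J"
      then have sc: "s \<in> carrier S" using ideal.Icarr[OF ideals(2)] by blast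
      have c: "\<sigma> s \<in> carrier ?V" by (rule ring_hom_closed[OF \<sigma>(1) sc])
      have "p (\<sigma> s {#}) = \<zero>\<^bsub>B\<^esub>" using \<sigma>q[OF sc] q_kernel[OF sc] s by simp
      then show "\<sigma> s \<in> ?L" using p_kernel[OF R.ps_vars_coeff[OF c]] c by simp
    qed
    show "\<tau> ` ?L \<subseteq> J"
    proof (rule image_subsetI)
      fix f assume f: "f \<in> ?L"
      then have "p (f {#}) = \<zero>\<^bsub>B\<^esub>" using p_kernel[OF R.ps_vars_coeff[of f]] by blast
      then have "q (\<tau> f) = \<zero>\<^bsub>B\<^esub>" using \<tau>q[of f] f by simp
      then show "\<tau> f \<in> J" using q_kernel[OF \<tau>closed] f by simp
    qed
  qed
qed

end

theorem corollary2p4: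
  fixes R :: "('a, 'm) ring_scheme" and S :: "('b, 'n) ring_scheme"
    and \<mm> I :: "'a set" and \<nn> J :: "'b set"
    and sI :: "'a set \<Rightarrow> 'a set \<Rightarrow> 'a set" and sJ :: "'a set \<Rightarrow> 'b set \<Rightarrow> 'b set"
  assumes "complete_regular_local_ring \<mm> R" and "\<exists>K. subfield K R"
    and "complete_regular_local_ring \<nn> S" and "\<exists>L. subfield L S"
    and "(R Quot \<mm>) \<simeq> (S Quot \<nn>)"
    and "ideal I R" and "ideal J S"
    and "algebra (R Quot \<mm>) (with_smult (R Quot I) sI)"
    and "algebra (R Quot \<mm>) (with_smult (S Quot J) sJ)"
    and "algebra_iso (R Quot \<mm>) (with_smult (R Quot I) sI) (with_smult (S Quot J) sJ) \<noteq> {}"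
  shows "ideal_relation_type R I = ideal_relation_type S J"
proof -
  interpret R: complete_regular_local_ring \<mm> R by fact
  interpret S: complete_regular_local_ring \<nn> S by fact
  interpret I: ideal I R by fact
  interpret J: ideal J S by fact
  interpret RI: cring "R Quot I" by (rule I.quotient_is_cring[OF R.is_cring])
  interpret SJ: cring "S Quot J" by (rule J.quotient_is_cring[OF S.is_cring])
  obtain K L where K: "subfield K R" and L: "subfield L S" using assms(2,4) by blast
  obtain h where h_iso: "h \<in> algebra_iso (R Quot \<mm>) (with_smult (R Quot I) sI) (with_smult (S Quot J) sJ)"
    using assms(10) by blast
  have h: "h \<in> ring_hom (R Quot I) (S Quot J)" "bij_betw h (carrier (R Quot I)) (carrier (S Quot J))"
    using h_iso by (auto simp: algebra_iso_def ring_iso_def with_smult_def ring_hom_def)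
  let ?B = "S Quot J" and ?q = "\<lambda>s. J +>\<^bsub>S\<^esub> s" and ?p = "h \<circ> (\<lambda>r. I +>\<^bsub>R\<^esub> r)"
  have p: "?p \<in> ring_hom R ?B" by (rule ring_hom_trans[OF I.coset_hom h(1)])
  have hzero: "h c = \<zero>\<^bsub>?B\<^esub> \<longleftrightarrow> c = \<zero>\<^bsub>R Quot I\<^esub>" if c: "c \<in> carrier (R Quot I)" for c
    using ring_hom_zero[OF h(1) RI.ring_axioms SJ.ring_axioms] inj_onD[OF bij_betw_imp_inj_on[OF h(2)] _ c RI.zero_closed] by auto
  have p_ker: "?p r = \<zero>\<^bsub>?B\<^esub> \<longleftrightarrow> r \<in> I" if r: "r \<in> carrier R" for r
    using hzero[OF ring_hom_closed[OF I.coset_hom r]] I.coset_zero_iff[OF r] by simp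
  have p_surj: "\<exists>r\<in>carrier R. ?p r = c" if c: "c \<in> carrier ?B" for c
  proof -
    have "c \<in> h ` carrier (R Quot I)" unfolding bij_betw_imp_surj_on[OF h(2)] by (rule c)
    then obtain d where d: "c = h d" "d \<in> carrier (R Quot I)" by (rule imageE)
    obtain r where r: "r \<in> carrier R" "I +>\<^bsub>R\<^esub> r = d" using I.coset_surj[OF d(2)] by (rule bexE)
    show ?thesis by (rule bexI[OF _ r(1)]) (simp only: o_apply r(2) d(1))
  qed
  show ?thesis
  proof (cases "\<one>\<^bsub>?B\<^esub> = \<zero>\<^bsub>?B\<^esub>")
    case True
    \<comment> \<open>If the quotient is the zero ring, both ideals are whole rings, and every bound on the
      relation type holds for them.\<close>
    have "\<one>\<^bsub>R\<^esub> \<in> I" by (rule iffD1[OF p_ker[OF R.one_closed] trans[OF ring_hom_one[OF p] True]])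
    then have I_eq: "I = carrier R" by (rule I.one_imp_carrier)
    have "\<one>\<^bsub>S\<^esub> \<in> J" by (rule iffD1[OF J.coset_zero_iff[OF S.one_closed] trans[OF ring_hom_one[OF J.coset_hom] True]])
    then have J_eq: "J = carrier S" by (rule J.one_imp_carrier)
    then show ?thesis
      unfolding I_eq J_eq
      by (intro ideal_relation_type_eqI type_le_unit_ideal R.oneideal S.oneideal R.is_cring S.is_cring
        R.noetherian_ring_axioms S.noetherian_ring_axioms)
  next
    case False
    have pc: "ring_hom_cring R ?B ?p" by unfold_locales (rule p)
    have qc: "ring_hom_cring S ?B ?q" by unfold_locales (rule J.coset_hom)
    interpret RS: common_quotient \<mm> R \<nn> S ?B ?p ?q I J
      by (intro common_quotient.intro common_quotient_axioms.intro assms(1,3,6,7) pc qc p_surj p_ker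
        J.coset_surj J.coset_zero_iff False)
    interpret SR: common_quotient \<nn> S \<mm> R ?B ?q ?p J I by (rule RS.swap)
    show ?thesis
      by (intro ideal_relation_type_eqI assms(6,7) R.is_cring S.is_cring R.noetherian_ring_axioms S.noetherian_ring_axioms)
        (erule RS.relation_bound_transfer[OF K L] SR.relation_bound_transfer[OF L K])+
  qed
qed

end
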